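(* Let $\Gamma$ be a Fuchsian group acting on the unit disk $\mathbb{D}$ such that $\mathbb{D}/\Gamma$ is a finite area hyperbolic surface, and let $q>0$. Then there exists a constant $C=C(\Gamma,q)>0$ depending only on $\Gamma$ and $q$ such that the following holds. Let $f:\mathbb{D}\to\Omega$ be a conformal map onto a domain $\Omega\subset\mathbb{C}$, normalized so that $f(0)=0$ and $f'(0)=1$, and suppose that $f$ conjugates $\Gamma$ to a Kleinian group, with induced homomorphism $\rho:\Gamma\to\mathrm{PSL}(2,\mathbb{C})$. Then $$\frac{1}{C}\sum_{\gamma\in\Gamma}\frac{|\gamma'(0)|^{q+2}}{|\rho(\gamma)'(0)|^{q}}\;\leq\; \int_{\mathbb{D}} \frac{1}{|f'(z)|^q}\,dx\,dy\;\leq\; C\sum_{\gamma\in\Gamma} \frac{|\gamma'(0)|^{q+2}}{|\rho(\gamma)'(0)|^q}$$ (as an inequality in $[0,\infty]$).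
   Context: "Conformal map" means a biholomorphism. "$f$ conjugates $\Gamma$ to a Kleinian group" means that for each $\gamma\in\Gamma$ the map $f\circ\gamma\circ f^{-1}:\Omega\to\Omega$ is the restriction to $\Omega$ of a Möbius transformation, denoted $\rho(\gamma)\in\mathrm{PSL}(2,\mathbb{C})$, and the image $\rho(\Gamma)$ is a Kleinian group (a discrete subgroup of $\mathrm{PSL}(2,\mathbb{C})$); thus $f\circ\gamma=\rho(\gamma)\circ f$. Here $\gamma'$ and $\rho(\gamma)'$ denote complex derivatives of Möbius transformations, and $dx\,dy$ is Lebesgue measure, $z=x+iy$. Since $\mathbb{D}/\Gamma$ is a hyperbolic surface, $\Gamma$ acts freely on $\mathbb{D}$. *)

theory Defs
  imports "HOL-Complex_Analysis.Complex_Analysis" "HOL-Algebra.Coset"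
begin

definition SL2C :: "(complex^2^2) monoid" where
  "SL2C = \<lparr>carrier = {A. det A = 1}, mult = (**), one = mat 1\<rparr>"

definition pm_one :: "(complex^2^2) set" where
  "pm_one = {mat 1, - mat 1}"

definition PSL2C :: "(complex^2^2) set monoid" where
  "PSL2C = SL2C Mod pm_one"

definition PSL2C_class :: "complex^2^2 \<Rightarrow> (complex^2^2) set" where
  "PSL2C_class A = pm_one #>\<^bsub>SL2C\<^esub> A"

definition SL2C_topology :: "(complex^2^2) topology" where
  "SL2C_topology = top_of_set (carrier SL2C)"

text \<open>The quotient topology; see \<open>quotient_map_PSL2C_class\<close> below.\<close>

definition PSL2C_topology :: "(complex^2^2) set topology" where
  "PSL2C_topology =
     topology (\<lambda>U. U \<subseteq> carrier PSL2C \<and>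
                   openin SL2C_topology {A \<in> carrier SL2C. PSL2C_class A \<in> U})"

text \<open>
  Elements of \<open>PSL2C\<close> act on the Riemann sphere by Moebius transformations. Only the values at finite
  points that are mapped to finite points are used. Since division by zero yields \<open>0\<close> in HOL,
  \<open>moebius P z\<close> is meaningful only if \<open>z\<close> is not the pole of \<open>P\<close>. Neither notion depends on
  the representing matrix; see \<open>moebius_PSL2C_class\<close> and \<open>moebius_pole_PSL2C_class\<close>.
\<close>

definition PSL2C_rep :: "(complex^2^2) set \<Rightarrow> complex^2^2" where
  "PSL2C_rep P = (SOME A. A \<in> P)"

definition moebius :: "(complex^2^2) set \<Rightarrow> complex \<Rightarrow> complex" where
  "moebius P z = (let A = PSL2C_rep P in (A$1$1 * z + A$1$2) / (A$2$1 * z + A$2$2))"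

definition moebius_pole :: "(complex^2^2) set \<Rightarrow> complex \<Rightarrow> bool" where
  "moebius_pole P z \<longleftrightarrow> (let A = PSL2C_rep P in A$2$1 * z + A$2$2 = 0)"

definition kleinian_group :: "(complex^2^2) set set \<Rightarrow> bool" where
  "kleinian_group G \<longleftrightarrow>
     subgroup G PSL2C \<and> subtopology PSL2C_topology G = discrete_topology G"

abbreviation unit_disk :: "complex set" where
  "unit_disk \<equiv> ball 0 1"

definition fuchsian_group :: "(complex^2^2) set set \<Rightarrow> bool" where
  "fuchsian_group G \<longleftrightarrow>
     kleinian_group G \<and>
     (\<forall>g\<in>G. (\<forall>z\<in>unit_disk. \<not> moebius_pole g z) \<and> moebius g ` unit_disk = unit_disk)"

definition acts_freely_on_disk :: "(complex^2^2) set set \<Rightarrow> bool" where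
  "acts_freely_on_disk G \<longleftrightarrow>
     (\<forall>g\<in>G. \<forall>z\<in>unit_disk. moebius g z = z \<longrightarrow> g = \<one>\<^bsub>PSL2C\<^esub>)"

text \<open>The area of the metric \<open>2 |dz| / (1 - |z|\<^sup>2)\<close> of curvature \<open>-1\<close>, for subsets of the unit disk.\<close>

definition hyperbolic_area :: "complex set \<Rightarrow> ennreal" where
  "hyperbolic_area A = (\<integral>\<^sup>+z\<in>A. ennreal (4 / (1 - (cmod z)\<^sup>2)\<^sup>2) \<partial>lborel)"

definition fundamental_set :: "(complex^2^2) set set \<Rightarrow> complex set \<Rightarrow> bool" where
  "fundamental_set G F \<longleftrightarrow>
     F \<in> sets borel \<and> F \<subseteq> unit_disk \<and>
     (\<forall>z\<in>unit_disk. \<exists>!w. w \<in> F \<and> (\<exists>g\<in>G. w = moebius g z))"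

text \<open>
  The hyperbolic area of the quotient of the disk by \<open>G\<close> is the area of a fundamental set; it is
  the same for every fundamental set because the elements of \<open>G\<close> are hyperbolic isometries.
\<close>

definition finite_area_hyperbolic_surface :: "(complex^2^2) set set \<Rightarrow> bool" where
  "finite_area_hyperbolic_surface G \<longleftrightarrow>
     acts_freely_on_disk G \<and> (\<exists>F. fundamental_set G F \<and> hyperbolic_area F < \<infinity>)"

definition conformal_map :: "(complex \<Rightarrow> complex) \<Rightarrow> complex set \<Rightarrow> complex set \<Rightarrow> bool" where
  "conformal_map f S T \<longleftrightarrow>
     f holomorphic_on S \<and> bij_betw f S T \<and> inv_into S f holomorphic_on T"

definition conjugates_to_kleinian ::
    "(complex \<Rightarrow> complex) \<Rightarrow> complex set \<Rightarrow> (complex^2^2) set set \<Rightarrow>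
     ((complex^2^2) set \<Rightarrow> (complex^2^2) set) \<Rightarrow> bool" where
  "conjugates_to_kleinian f \<Omega> G \<rho> \<longleftrightarrow>
     (\<forall>g\<in>G. \<rho> g \<in> carrier PSL2C \<and>
        (\<forall>w\<in>\<Omega>. \<not> moebius_pole (\<rho> g) w \<and>
                f (moebius g (inv_into unit_disk f w)) = moebius (\<rho> g) w)) \<and>
     kleinian_group (\<rho> ` G)"

lemma group_SL2C: "group SL2C"
proof (rule groupI)
  fix A assume "A \<in> carrier SL2C"
  then have d: "det A = 1" by (simp add: SL2C_def)
  then have "invertible A" by (simp add: invertible_det_nz)
  then obtain B where B: "B ** A = mat 1" unfolding invertible_def by blast
  then have "det B * det A = 1" by (metis det_I det_mul)
  then have "det B = 1" using d by simp
  then show "\<exists>B\<in>carrier SL2C. B \<otimes>\<^bsub>SL2C\<^esub> A = \<one>\<^bsub>SL2C\<^esub>"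
    using B by (auto simp: SL2C_def)
qed (auto simp: SL2C_def det_mul matrix_mul_assoc)

lemma neg_matrix_mult:
  "(- A) ** B = - (A ** B)" "A ** (- B) = - (A ** B)" for A B :: "complex^2^2"
  by (simp_all add: matrix_matrix_mult_def vec_eq_iff sum_negf)

lemma normal_pm_one: "pm_one \<lhd> SL2C"
proof -
  interpret group SL2C by (rule group_SL2C)
  have d: "det (- mat 1 :: complex^2^2) = 1"
    by (simp add: det_2 mat_def)
  have c: "pm_one \<subseteq> carrier SL2C"
    using d by (auto simp: pm_one_def SL2C_def)
  have inv: "inv\<^bsub>SL2C\<^esub> A = A" if "A \<in> pm_one" for A
    using that c by (intro inv_equality) (auto simp: pm_one_def SL2C_def neg_matrix_mult)
  have s: "subgroup pm_one SL2C"
    by (rule subgroupI[OF c]) (auto simp: inv, auto simp: pm_one_def SL2C_def neg_matrix_mult)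
  have comm: "A \<otimes>\<^bsub>SL2C\<^esub> h = h \<otimes>\<^bsub>SL2C\<^esub> A" if "h \<in> pm_one" for A h
    using that by (auto simp: pm_one_def SL2C_def neg_matrix_mult)
  have "A \<otimes>\<^bsub>SL2C\<^esub> h \<otimes>\<^bsub>SL2C\<^esub> inv\<^bsub>SL2C\<^esub> A = h" if "A \<in> carrier SL2C" "h \<in> pm_one" for A h
  proof -
    have h: "h \<in> carrier SL2C" using that c by blast
    have "A \<otimes>\<^bsub>SL2C\<^esub> h \<otimes>\<^bsub>SL2C\<^esub> inv\<^bsub>SL2C\<^esub> A = h \<otimes>\<^bsub>SL2C\<^esub> A \<otimes>\<^bsub>SL2C\<^esub> inv\<^bsub>SL2C\<^esub> A"
      by (simp only: comm[OF that(2), of A])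
    also have "\<dots> = h \<otimes>\<^bsub>SL2C\<^esub> (A \<otimes>\<^bsub>SL2C\<^esub> inv\<^bsub>SL2C\<^esub> A)"
      using that h by (intro m_assoc inv_closed)
    finally show ?thesis using that h by simp
  qed
  then show ?thesis
    using s by (simp add: normal_inv_iff)
qed

lemma group_PSL2C: "group PSL2C"
  unfolding PSL2C_def by (rule normal.factorgroup_is_group[OF normal_pm_one])

lemma PSL2C_class_eq: "PSL2C_class A = {A, - A}"
  by (auto simp: PSL2C_class_def r_coset_def pm_one_def SL2C_def neg_matrix_mult)

lemma carrier_PSL2C: "carrier PSL2C = PSL2C_class ` carrier SL2C"
  by (simp add: PSL2C_def carrier_FactGroup PSL2C_class_def)

lemma mult_PSL2C_class:
  assumes "A \<in> carrier SL2C" "B \<in> carrier SL2C"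
  shows "PSL2C_class A \<otimes>\<^bsub>PSL2C\<^esub> PSL2C_class B = PSL2C_class (A ** B)"
proof -
  have "A ** B = A \<otimes>\<^bsub>SL2C\<^esub> B" by (simp add: SL2C_def)
  then show ?thesis
    unfolding PSL2C_def PSL2C_class_def mult_FactGroup
    by (simp only: normal.rcos_sum[OF normal_pm_one assms])
qed

lemma openin_PSL2C_topology:
  "openin PSL2C_topology U \<longleftrightarrow>
     U \<subseteq> carrier PSL2C \<and> openin SL2C_topology {A \<in> carrier SL2C. PSL2C_class A \<in> U}"
proof -
  let ?pre = "\<lambda>U. {A \<in> carrier SL2C. PSL2C_class A \<in> U}"
  have "istopology (\<lambda>U. U \<subseteq> carrier PSL2C \<and> openin SL2C_topology (?pre U))"
    unfolding istopology_def
  proof (rule conjI; intro allI impI)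
    fix S T
    assume S: "S \<subseteq> carrier PSL2C \<and> openin SL2C_topology (?pre S)"
      and T: "T \<subseteq> carrier PSL2C \<and> openin SL2C_topology (?pre T)"
    have "?pre (S \<inter> T) = ?pre S \<inter> ?pre T" by auto
    then show "S \<inter> T \<subseteq> carrier PSL2C \<and> openin SL2C_topology (?pre (S \<inter> T))"
      using S T openin_Int[of SL2C_topology "?pre S" "?pre T"] by auto
  next
    fix \<K> assume K: "\<forall>K\<in>\<K>. K \<subseteq> carrier PSL2C \<and> openin SL2C_topology (?pre K)"
    have "?pre (\<Union>\<K>) = \<Union>(?pre ` \<K>)" by auto
    moreover have "openin SL2C_topology (\<Union>(?pre ` \<K>))"
      using K by (intro openin_Union) auto
    ultimately show "\<Union>\<K> \<subseteq> carrier PSL2C \<and> openin SL2C_topology (?pre (\<Union>\<K>))"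
      using K by auto
  qed
  from topology_inverse'[OF this] show ?thesis
    unfolding PSL2C_topology_def by (rule fun_cong)
qed

lemma topspace_PSL2C_topology: "topspace PSL2C_topology = carrier PSL2C"
proof
  show "topspace PSL2C_topology \<subseteq> carrier PSL2C"
    using openin_topspace[of PSL2C_topology] unfolding openin_PSL2C_topology by (rule conjunct1)
  have "{A \<in> carrier SL2C. PSL2C_class A \<in> carrier PSL2C} = topspace SL2C_topology"
    by (auto simp: carrier_PSL2C SL2C_topology_def)
  then have "openin PSL2C_topology (carrier PSL2C)"
    unfolding openin_PSL2C_topology by (simp only: openin_topspace) blast
  then show "carrier PSL2C \<subseteq> topspace PSL2C_topology"
    by (rule openin_subset)
qed

lemma quotient_map_PSL2C_class: "quotient_map SL2C_topology PSL2C_topology PSL2C_class"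
proof -
  have "topspace SL2C_topology = carrier SL2C" by (simp add: SL2C_topology_def)
  then show ?thesis
    unfolding quotient_map_def topspace_PSL2C_topology openin_PSL2C_topology carrier_PSL2C
    by simp
qed

lemma PSL2C_rep_class: "PSL2C_rep (PSL2C_class A) = A \<or> PSL2C_rep (PSL2C_class A) = - A"
proof -
  have "PSL2C_rep {A, - A} \<in> {A, - A}"
    unfolding PSL2C_rep_def by (rule someI[of _ A]) simp
  then show ?thesis by (simp add: PSL2C_class_eq)
qed

lemma moebius_PSL2C_class:
  "moebius (PSL2C_class A) z = (A$1$1 * z + A$1$2) / (A$2$1 * z + A$2$2)"
  using PSL2C_rep_class[of A]
proof
  assume rep: "PSL2C_rep (PSL2C_class A) = - A"
  have 1: "(- A)$i$1 * z + (- A)$i$2 = - (A$i$1 * z + A$i$2)" for i by simp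
  show ?thesis
    unfolding moebius_def Let_def rep 1 by (rule minus_divide_divide)
qed (simp add: moebius_def)

lemma moebius_pole_PSL2C_class:
  "moebius_pole (PSL2C_class A) z \<longleftrightarrow> A$2$1 * z + A$2$2 = 0"
  using PSL2C_rep_class[of A]
proof
  assume rep: "PSL2C_rep (PSL2C_class A) = - A"
  have 1: "(- A)$i$1 * z + (- A)$i$2 = - (A$i$1 * z + A$i$2)" for i by simp
  show ?thesis
    unfolding moebius_pole_def Let_def rep 1 by (rule neg_equal_0_iff_equal)
qed (simp add: moebius_pole_def)

end

theory Submission
  imports Defs
begin

text \<open>
  Equivariance gives \<open>f' (\<gamma> 0) * \<gamma>' 0 = \<rho>(\<gamma>)' 0\<close>, so each term of the sum is
  \<open>|\<gamma>' 0|\<^sup>2 / |f' (\<gamma> 0)| powr q\<close>, which by distortion is comparable to the integral over the image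
  under \<open>\<gamma>\<close> of any fixed compact set. Disjoint translates of a small ball give the lower bound.

  For the upper bound, finite area and discreteness (Zassenhaus) show that the disk is covered by the
  translates of a compact set and of finitely many horodisks at parabolic fixed points. On a horodisk
  the integral is controlled by a crescent next to it: normalizing the parabolic element of \<open>\<Gamma>\<close> and its
  image to the same translation, \<open>f\<close> becomes a univalent \<open>h\<close> with \<open>h (w + 1) = h w + 1\<close>, which stays
  close to a translation. Hence \<open>|f'| powr (-1/2)\<close> is comparable to \<open>|a * z + b| + c * |z - p|\<close>, a weight
  that cannot be small on the whole crescent. Powers of the parabolic element move the crescent into a
  compact set.
\<close>

section \<open>Distortion of univalent functions\<close>

text \<open>The constant has to be uniform in \<open>f\<close> and \<rho>. On compact pieces this is
  harmless: the distortion bounds hold for all univalent functions with one constant, and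
  \<open>f\<close> composed with any \<open>act x\<close> is univalent again. Any bound on second
  coefficients will do for this, so Schottky's theorem takes the place of the area theorem. The
  obstacle is the cusps: a horodisk at a parabolic fixed point is not covered by translates of a
  compact set, and the image of a parabolic element is not given to be parabolic. Univalence forces
  it to be: a multiplier other than 1 contradicts the Koebe-type estimates at great height. The
  group is handled through matrices in SU(1,1), where norms, commutators and traces are available.
  Each Moebius transformation then occurs twice, as \<open>x\<close> and \<open>- x\<close>, which
  costs a factor 2 in the constant. Horodisks are summed over distinct conjugates of a parabolic
  element rather than over group elements; the elements giving the same conjugate form a coset of
  its centralizer, and these supply the orbit terms for its crescent. So each cusp uses every orbit
  term only once.\<close>

lemma normalized_univalent_omits:
  assumes holf: "f holomorphic_on ball 0 1" and inj: "inj_on f (ball 0 1)"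
    and f0: "f 0 = (0::complex)" and f1: "deriv f 0 = 1"
  obtains b where "b \<notin> f ` ball 0 1" "cmod b < 2"
proof -
  have "\<not> ball 0 2 \<subseteq> f ` ball 0 1"
  proof
    assume sub: "ball 0 2 \<subseteq> f ` ball 0 1"
    obtain g where g: "g holomorphic_on (f ` ball 0 1)"
      "\<And>z. z \<in> ball 0 1 \<Longrightarrow> deriv f z * deriv g (f z) = 1"
      "\<And>z. z \<in> ball 0 1 \<Longrightarrow> g (f z) = z"
      using holomorphic_has_inverse[OF holf open_ball inj] by blast
    have g0: "g 0 = 0" "deriv g 0 = 1"
      using g(2)[of 0] g(3)[of 0] f0 f1 by auto
    have holg: "g holomorphic_on ball 0 2"
      using g(1) sub by (rule holomorphic_on_subset)
    \<comment> \<open>The inverse, rescaled to the unit disk, would be a self-map fixing 0 with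
      derivative 2, against the Schwarz lemma. Any radius above 1 would lead to the same
      contradiction.\<close>
    define k where "k = (\<lambda>z. g (2 * z))"
    have holk: "k holomorphic_on ball 0 1"
      unfolding k_def
      by (rule holomorphic_on_compose_gen[OF _ holg, unfolded o_def])
        (auto intro!: holomorphic_intros simp: norm_mult)
    have "(g has_field_derivative 1) (at (2 * 0))"
      using holomorphic_derivI[OF holg open_ball, of 0] g0 by simp
    then have "(k has_field_derivative 1 * 2) (at 0)"
      unfolding k_def by (intro DERIV_chain') (auto intro!: derivative_eq_intros)
    then have dk: "deriv k 0 = 2"
      by (simp add: DERIV_imp_deriv)
    have "cmod (deriv k 0) \<le> 1"
    proof (rule Schwarz_Lemma(2)[OF holk, of 0])
      show "k 0 = 0" by (simp add: k_def g0)
      fix z :: complex assume "cmod z < 1"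
      then have "2 * z \<in> f ` ball 0 1"
        using sub by (auto simp: norm_mult subset_iff)
      then show "cmod (k z) < 1"
        using g(3) by (auto simp: k_def)
    qed simp
    then show False using dk by simp
  qed
  then obtain b where "b \<in> ball 0 2" "b \<notin> f ` ball 0 1" by blast
  then show ?thesis using that by simp
qed

text \<open>If \<open>f\<close> omits \<open>b\<close>, a branch of \<open>sqrt (1 - f / b)\<close> that is \<open>1\<close> at the origin omits \<open>0\<close> and
  \<open>- 1\<close>, so Schottky's theorem applies.\<close>

lemma normalized_univalent_bounded:
  obtains K where "K > 0"
    "\<And>f z. \<lbrakk>f holomorphic_on ball 0 1; inj_on f (ball 0 1); f 0 = (0::complex); deriv f 0 = 1;
       cmod z \<le> 1/2\<rbrakk> \<Longrightarrow> cmod (f z) \<le> K"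
proof
  \<comment> \<open>Schottky's bound for a function of modulus at most 1 at the origin, evaluated at
    points of modulus at most 2/3.\<close>
  define M where "M = exp (pi * exp (pi * (2 + 2 * 1 + 12 * (2/3) / (1 - 2/3))))"
  show "2 * (1 + M^2) > 0"
    by (simp add: add_pos_nonneg)
  fix f :: "complex \<Rightarrow> complex" and z :: complex
  assume holf: "f holomorphic_on ball 0 1" and inj: "inj_on f (ball 0 1)"
    and f0: "f 0 = 0" and f1: "deriv f 0 = 1" and z: "cmod z \<le> 1/2"
  obtain b where b: "b \<notin> f ` ball 0 1" "cmod b < 2"
    using normalized_univalent_omits[OF holf inj f0 f1] .
  have "b \<noteq> 0"
    using b(1) f0 by force
  have nz: "1 - f w / b \<noteq> 0" if "w \<in> ball 0 1" for w
    using b(1) that \<open>b \<noteq> 0\<close> by auto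
  obtain l where l: "l holomorphic_on ball 0 1" "\<And>w. w \<in> ball 0 1 \<Longrightarrow> exp (l w) = 1 - f w / b"
  proof (rule holomorphic_logarithm_exists[of "ball 0 1" "\<lambda>w. 1 - f w / b" 0])
    show "(\<lambda>w. 1 - f w / b) holomorphic_on ball 0 1"
      using \<open>b \<noteq> 0\<close> by (intro holomorphic_intros holf) auto
  qed (use nz in auto)
  define s where "s = exp (l 0 / 2)"
  have s2: "s\<^sup>2 = 1"
    using l(2)[of 0] f0 by (simp add: s_def exp_double[symmetric])
  \<comment> \<open>The sign gives \<open>g 0 = -1\<close>, so that \<open>g\<close> omits 0 and 1:
    \<open>g w = 1\<close> would mean \<open>f w = 0\<close>, hence \<open>w = 0\<close>, where
    \<open>g\<close> is -1.\<close>
  define g where "g = (\<lambda>w. - s * exp (l w / 2))"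
  have g2: "(g w)\<^sup>2 = 1 - f w / b" if "w \<in> ball 0 1" for w
    using l(2)[OF that] s2 by (simp add: g_def power_mult_distrib exp_double[symmetric])
  have g0: "g 0 = -1"
    using s2 by (simp add: g_def s_def power2_eq_square)
  have holg: "g holomorphic_on ball 0 1"
    unfolding g_def by (intro holomorphic_intros l) auto
  \<comment> \<open>Shrinking by 3/4 makes the function holomorphic on the closed disk; a point of
    modulus 1/2 becomes one of modulus 2/3.\<close>
  define k where "k = (\<lambda>w. g (3/4 * w))"
  have sub: "3/4 * w \<in> ball 0 1" if "w \<in> cball 0 1" for w :: complex
    using that by (simp add: norm_mult)
  have holk: "k holomorphic_on cball 0 1"
    unfolding k_def using sub
    by (intro holomorphic_on_compose_gen[OF _ holg, unfolded o_def])
      (auto intro!: holomorphic_intros)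
  have no: "\<not> (k w = 0 \<or> k w = 1)" if "w \<in> cball 0 1" for w
  proof
    assume "k w = 0 \<or> k w = 1"
    then show False
    proof
      assume "k w = 0"
      then show False using g2[OF sub[OF that]] nz[OF sub[OF that]] by (simp add: k_def)
    next
      assume k1: "k w = 1"
      then have "f (3/4 * w) = f 0"
        using g2[OF sub[OF that]] \<open>b \<noteq> 0\<close> f0 by (simp add: k_def)
      then have "3/4 * w = 0"
        using inj_onD[OF inj, of "3/4 * w" 0] sub[OF that] by simp
      then show False using k1 g0 by (simp add: k_def)
    qed
  qed
  have "cmod (k (4/3 * z)) \<le> M"
    unfolding M_def
    by (rule Schottky[OF holk _ no]) (use z g0 in \<open>auto simp: k_def norm_mult\<close>)
  then have gz: "cmod (g z) \<le> M"
    by (simp add: k_def)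
  have "f z = b * (1 - (g z)\<^sup>2)"
    using g2[of z] z \<open>b \<noteq> 0\<close> by (simp add: field_simps)
  then have "cmod (f z) = cmod b * cmod (1 - (g z)\<^sup>2)"
    by (simp add: norm_mult)
  also have "\<dots> \<le> 2 * (1 + M\<^sup>2)"
  proof (intro mult_mono)
    have "cmod (1 - (g z)\<^sup>2) \<le> cmod 1 + cmod ((g z)\<^sup>2)"
      by (rule norm_triangle_ineq4)
    also have "\<dots> \<le> 1 + M\<^sup>2"
      using power_mono[OF gz, of 2] by (simp add: norm_power)
    finally show "cmod (1 - (g z)\<^sup>2) \<le> 1 + M\<^sup>2" .
  qed (use b in auto)
  finally show "cmod (f z) \<le> 2 * (1 + M\<^sup>2)" .
qed

lemma normalized_univalent_deriv2:
  obtains A where "A > 0"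
    "\<And>f. \<lbrakk>f holomorphic_on ball 0 1; inj_on f (ball 0 1); f 0 = (0::complex); deriv f 0 = 1\<rbrakk>
       \<Longrightarrow> cmod (deriv (deriv f) 0) \<le> A"
proof -
  obtain K where K: "K > 0"
    "\<And>f z. \<lbrakk>f holomorphic_on ball 0 1; inj_on f (ball 0 1); f 0 = (0::complex); deriv f 0 = 1;
       cmod z \<le> 1/2\<rbrakk> \<Longrightarrow> cmod (f z) \<le> K"
    using normalized_univalent_bounded by blast
  show thesis
  proof
    show "8 * K > 0" using K by simp
    fix f :: "complex \<Rightarrow> complex"
    assume f: "f holomorphic_on ball 0 1" "inj_on f (ball 0 1)" "f 0 = 0" "deriv f 0 = 1"
    have "cmod ((deriv ^^ 2) f 0) \<le> fact 2 * K / (1/2) ^ 2"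
    proof (rule Cauchy_inequality)
      show "f holomorphic_on ball 0 (1/2)"
        using f(1) by (rule holomorphic_on_subset) auto
      show "continuous_on (cball 0 (1/2)) f"
        by (rule continuous_on_subset[OF holomorphic_on_imp_continuous_on[OF f(1)]]) auto
    qed (use K(2)[OF f] in auto)
    then show "cmod (deriv (deriv f) 0) \<le> 8 * K"
      by (simp add: numeral_2_eq_2)
  qed
qed

text \<open>Bieberbach's theorem would allow \<open>A = 4\<close>. Fixing one admissible value as a
  parameter makes every constant derived from it independent of the function.\<close>

locale koebe_constant =
  fixes A :: real
  assumes A_pos: "A > 0"
    and deriv2_normalized: "\<And>f. \<lbrakk>f holomorphic_on ball 0 1; inj_on f (ball 0 1); f 0 = (0::complex);
        deriv f 0 = 1\<rbrakk> \<Longrightarrow> cmod (deriv (deriv f) 0) \<le> A"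

lemma koebe_constant_exists: "\<exists>A. koebe_constant A"
  using normalized_univalent_deriv2 unfolding koebe_constant_def by metis

lemma univalent_normalization:
  assumes holf: "f holomorphic_on ball a r" and inj: "inj_on f (ball a r)" and r: "r > 0"
  defines "F \<equiv> \<lambda>z::complex. (f (a + r * z) - f a) / (r * deriv f a)"
  shows "F holomorphic_on ball 0 1" "inj_on F (ball 0 1)" "F 0 = 0" "deriv F 0 = 1"
    "deriv (deriv F) 0 = r * deriv (deriv f) a / deriv f a"
proof -
  have d: "deriv f a \<noteq> 0"
    by (rule holomorphic_injective_imp_regular[OF holf open_ball inj]) (use r in auto)
  have sub: "a + r * z \<in> ball a r" if "z \<in> ball 0 1" for z :: complex
    using that r by (simp add: dist_norm norm_mult)
  show "F holomorphic_on ball 0 1"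
    unfolding F_def using r d sub
    by (intro holomorphic_intros holomorphic_on_compose_gen[OF _ holf, unfolded o_def]) auto
  show "inj_on F (ball 0 1)"
  proof (rule inj_onI)
    fix x y assume xy: "x \<in> ball 0 1" "y \<in> ball 0 1" "F x = F y"
    then have "f (a + r * x) = f (a + r * y)"
      using r d by (simp add: F_def)
    then show "x = y"
      using inj_onD[OF inj _ sub[OF xy(1)] sub[OF xy(2)]] r by simp
  qed
  show "F 0 = 0" by (simp add: F_def)
  have D: "(F has_field_derivative deriv f (a + r * z) / deriv f a) (at z)" if "z \<in> ball 0 1" for z :: complex
  proof -
    have 1: "(f has_field_derivative deriv f (a + r * z)) (at (a + r * z))"
      by (rule holomorphic_derivI[OF holf open_ball sub[OF that]])
    have "((\<lambda>z. f (a + r * z)) has_field_derivative deriv f (a + r * z) * r) (at z)"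
      by (rule DERIV_chain'[where f = "\<lambda>z. a + r * z" and g = f, OF _ 1]) (auto intro!: derivative_eq_intros)
    then show ?thesis
      unfolding F_def using r d by (auto intro!: derivative_eq_intros simp: field_simps)
  qed
  show "deriv F 0 = 1"
    using D[of 0] d by (auto intro!: DERIV_imp_deriv)
  have e: "eventually (\<lambda>z::complex. deriv F z = deriv f (a + r * z) / deriv f a) (nhds 0)"
    by (rule eventually_mono[OF eventually_nhds_in_open[of "ball 0 1" 0]])
       (auto intro!: DERIV_imp_deriv D)
  have 1: "(deriv f has_field_derivative deriv (deriv f) a) (at (a + of_real r * 0))"
    using holomorphic_derivI[OF holomorphic_deriv[OF holf open_ball] open_ball, of a] r by simp
  have "((\<lambda>z. deriv f (a + r * z)) has_field_derivative deriv (deriv f) a * r) (at 0)"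
    by (rule DERIV_chain'[where f = "\<lambda>z. a + r * z" and g = "deriv f", OF _ 1]) (auto intro!: derivative_eq_intros)
  then have "((\<lambda>z. deriv f (a + r * z) / deriv f a) has_field_derivative
      r * deriv (deriv f) a / deriv f a) (at 0)"
    using d by (auto intro!: derivative_eq_intros simp: field_simps)
  then show "deriv (deriv F) 0 = r * deriv (deriv f) a / deriv f a"
    using deriv_cong_ev[OF e refl] by (simp add: DERIV_imp_deriv)
qed

context koebe_constant
begin

lemma deriv2_bound:
  assumes "f holomorphic_on ball a r" "inj_on f (ball a r)" "r > 0"
  shows "r * cmod (deriv (deriv f) a) \<le> A * cmod (deriv f a)"
proof -
  have d: "deriv f a \<noteq> 0"
    by (rule holomorphic_injective_imp_regular[OF assms(1) open_ball assms(2)]) (use assms in auto)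
  have "cmod (r * deriv (deriv f) a / deriv f a) \<le> A"
    using deriv2_normalized[OF univalent_normalization(1-4)[OF assms]]
    unfolding univalent_normalization(5)[OF assms] .
  then show ?thesis
    using d assms(3) by (simp add: norm_divide norm_mult field_simps)
qed

text \<open>If \<open>F\<close> omits \<open>b\<close> then \<open>F / (1 - F / b)\<close> is again univalent, and its second coefficient differs
  from that of \<open>F\<close> by \<open>1 / b\<close>.\<close>

lemma omitted_bound:
  assumes f: "f holomorphic_on ball a r" "inj_on f (ball a r)" "r > 0"
    and w: "w \<notin> f ` ball a r"
  shows "r * cmod (deriv f a) \<le> A * cmod (w - f a)"
proof -
  define F where "F = (\<lambda>z::complex. (f (a + r * z) - f a) / (r * deriv f a))"
  note F = univalent_normalization[OF f, folded F_def]
  have d: "deriv f a \<noteq> 0"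
    by (rule holomorphic_injective_imp_regular[OF f(1) open_ball f(2)]) (use f in auto)
  define b where "b = (w - f a) / (r * deriv f a)"
  have b: "F z \<noteq> b" if "z \<in> ball 0 1" for z :: complex
  proof
    assume "F z = b"
    then have "w = f (a + r * z)"
      using f(3) d by (simp add: F_def b_def)
    moreover have "a + r * z \<in> ball a r"
      using that f(3) by (simp add: dist_norm norm_mult)
    ultimately show False using w by blast
  qed
  have F0: "F 0 = 0" by (simp add: F_def)
  have b0: "b \<noteq> 0" using b[of 0] F0 by auto
  have nz: "1 - F z / b \<noteq> 0" if "z \<in> ball 0 1" for z :: complex
    using b[OF that] b0 by auto
  define X where "X = (\<lambda>z. F z / (1 - F z / b))"
  have holX: "X holomorphic_on ball 0 1"
    unfolding X_def using nz b0 by (intro holomorphic_intros F) auto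
  have injX: "inj_on X (ball 0 1)"
  proof (rule inj_onI)
    fix x y assume xy: "x \<in> ball 0 1" "y \<in> ball 0 1" "X x = X y"
    then have "F x * (1 - F y / b) = F y * (1 - F x / b)"
      using nz[OF xy(1)] nz[OF xy(2)] unfolding X_def by (simp add: frac_eq_eq)
    then have "F x = F y" by (simp add: algebra_simps)
    then show "x = y" using inj_onD[OF F(2)] xy by blast
  qed
  have D: "(X has_field_derivative deriv F z / (1 - F z / b)^2) (at z)" if "z \<in> ball 0 1" for z :: complex
  proof -
    have 1: "(F has_field_derivative deriv F z) (at z)"
      by (rule holomorphic_derivI[OF F(1) open_ball that])
    have "(X has_field_derivative (deriv F z * (1 - F z / b) - F z * (- deriv F z / b)) /
        ((1 - F z / b) * (1 - F z / b))) (at z)"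
      unfolding X_def using nz[OF that] b0 by (auto intro!: derivative_eq_intros 1)
    moreover have "deriv F z * (1 - F z / b) - F z * (- deriv F z / b) = deriv F z"
      by (simp add: algebra_simps)
    ultimately show ?thesis by (simp add: power2_eq_square)
  qed
  have X0: "X 0 = 0" by (simp add: X_def F0)
  have X1: "deriv X 0 = 1" using D[of 0] F(4) F0 by (auto intro!: DERIV_imp_deriv)
  have e: "eventually (\<lambda>z::complex. deriv X z = deriv F z / (1 - F z / b)^2) (nhds 0)"
    by (rule eventually_mono[OF eventually_nhds_in_open[of "ball 0 1" 0]])
       (auto intro!: DERIV_imp_deriv D)
  have 1: "(F has_field_derivative 1) (at 0)"
    using holomorphic_derivI[OF F(1) open_ball, of 0] F by simp
  have 2: "(deriv F has_field_derivative deriv (deriv F) 0) (at 0)"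
    using holomorphic_derivI[OF holomorphic_deriv[OF F(1) open_ball] open_ball, of 0] by simp
  have "((\<lambda>z. deriv F z / (1 - F z / b)^2) has_field_derivative deriv (deriv F) 0 + 2 / b) (at 0)"
    using b0 by (auto intro!: derivative_eq_intros 1 2 simp: F(4) F0)
  then have X2: "deriv (deriv X) 0 = deriv (deriv F) 0 + 2 / b"
    using deriv_cong_ev[OF e refl] by (simp add: DERIV_imp_deriv)
  have "cmod (2 / b) = cmod (deriv (deriv X) 0 - deriv (deriv F) 0)"
    by (simp add: X2)
  also have "\<dots> \<le> cmod (deriv (deriv X) 0) + cmod (deriv (deriv F) 0)"
    by (rule norm_triangle_ineq4)
  also have "\<dots> \<le> A + A"
    by (intro add_mono deriv2_normalized holX injX X0 X1 F(1,2,4) F0)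
  finally have "1 \<le> A * cmod b"
    using b0 by (simp add: norm_divide field_simps)
  also have "cmod b = cmod (w - f a) / (r * cmod (deriv f a))"
    using f(3) by (simp add: b_def norm_divide norm_mult)
  finally show ?thesis
    using d f(3) by (simp add: field_simps)
qed

end

text \<open>\<open>deriv (deriv f) / deriv f\<close> is the derivative of a branch of \<open>log (deriv f)\<close>.\<close>

lemma deriv_log_lipschitz:
  assumes S: "open S" "convex S" and holf: "f holomorphic_on S" and inj: "inj_on f S"
    and T: "convex T" "T \<subseteq> S"
    and B: "\<And>z. z \<in> T \<Longrightarrow> cmod (deriv (deriv f) z) \<le> B * cmod (deriv f z)"
    and uv: "u \<in> T" "v \<in> T"
  shows "cmod (deriv f u) \<le> exp (B * cmod (u - v)) * cmod (deriv f v)"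
proof -
  have nz: "deriv f z \<noteq> 0" if "z \<in> S" for z
    by (rule holomorphic_injective_imp_regular[OF holf S(1) inj that])
  have hd: "deriv f holomorphic_on S"
    by (rule holomorphic_deriv[OF holf S(1)])
  obtain g where g: "g holomorphic_on S" "\<And>z. z \<in> S \<Longrightarrow> exp (g z) = deriv f z"
    by (rule holomorphic_logarithm_exists[OF S(2,1) hd nz, of u]) (use uv T in auto)
  have dg: "deriv (deriv f) z = deriv f z * deriv g z" if "z \<in> S" for z
  proof -
    have "((\<lambda>z. exp (g z)) has_field_derivative exp (g z) * deriv g z) (at z)"
      by (rule DERIV_chain'[OF holomorphic_derivI[OF g(1) S(1) that] DERIV_exp])
    then have "deriv (\<lambda>z. exp (g z)) z = deriv f z * deriv g z"
      using g(2)[OF that] by (auto simp: DERIV_imp_deriv)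
    moreover have "deriv (\<lambda>z. exp (g z)) z = deriv (deriv f) z"
      by (intro deriv_cong_ev refl) (use eventually_nhds_in_open[OF S(1) that] g(2) in \<open>auto elim: eventually_mono\<close>)
    ultimately show ?thesis by simp
  qed
  have "cmod (g u - g v) \<le> B * cmod (u - v)"
  proof (rule field_differentiable_bound[OF T(1) _ _ uv])
    fix z assume z: "z \<in> T"
    then show "(g has_field_derivative deriv g z) (at z within T)"
      using holomorphic_derivI[OF g(1) S(1)] T(2) by (meson has_field_derivative_at_within subsetD)
    show "cmod (deriv g z) \<le> B"
      using B[OF z] dg[of z] nz[of z] z T(2) by (auto simp: norm_mult)
  qed
  then have "Re (g u) \<le> B * cmod (u - v) + Re (g v)"
    using complex_Re_le_cmod[of "g u - g v"] by simp
  moreover have "cmod (deriv f z) = exp (Re (g z))" if "z \<in> T" for z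
    using g(2)[of z] that T(2) by (metis norm_exp_eq_Re subsetD)
  ultimately show ?thesis
    using uv by (simp add: exp_add[symmetric])
qed

context koebe_constant
begin

lemma distortion:
  assumes f: "f holomorphic_on ball 0 1" "inj_on f (ball 0 1)"
    and uv: "cmod u \<le> R" "cmod v \<le> R" "R < 1"
  shows "cmod (deriv f u) \<le> exp (2 * A / (1 - R)) * cmod (deriv f v)"
proof -
  have "cmod (deriv f u) \<le> exp (A / (1 - R) * cmod (u - v)) * cmod (deriv f v)"
  proof (rule deriv_log_lipschitz[OF open_ball convex_ball f, of "cball 0 R"])
    fix z :: complex assume z: "z \<in> cball 0 R"
    have sub: "ball z (1 - R) \<subseteq> ball 0 1"
    proof
      fix x assume "x \<in> ball z (1 - R)"
      then have "dist z x < 1 - R" by simp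
      moreover have "cmod z \<le> R" using z by simp
      moreover have "cmod x \<le> cmod z + dist z x"
        by (metis dist_0_norm dist_triangle)
      ultimately show "x \<in> ball 0 1" by simp
    qed
    have "(1 - R) * cmod (deriv (deriv f) z) \<le> A * cmod (deriv f z)"
      by (rule deriv2_bound) (use uv(3) holomorphic_on_subset[OF f(1) sub] inj_on_subset[OF f(2) sub] in auto)
    then show "cmod (deriv (deriv f) z) \<le> A / (1 - R) * cmod (deriv f z)"
      using uv(3) by (simp add: field_simps)
  qed (use uv in auto)
  also have "A / (1 - R) * cmod (u - v) \<le> A / (1 - R) * 2"
    using norm_triangle_ineq4[of u v] uv A_pos by (intro mult_left_mono) auto
  finally show ?thesis by (simp add: mult_ac mult_right_mono)
qed

end

section \<open>Univalent functions that commute with a translation\<close>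

definition upper_half_plane :: "complex set" where
  "upper_half_plane = {w. Im w > 0}"

lemma upper_half_plane:
  "open upper_half_plane" "convex upper_half_plane"
  unfolding upper_half_plane_def
  by (simp_all add: open_halfspace_Im_gt convex_halfspace_Im_gt)

lemma mem_upper_half_plane [simp]: "w \<in> upper_half_plane \<longleftrightarrow> Im w > 0"
  by (simp add: upper_half_plane_def)

lemma ball_Im_subset: "Y \<ge> r \<Longrightarrow> Im w \<ge> Y \<Longrightarrow> ball w r \<subseteq> {x. Im x > Y - r}"
proof
  fix x assume "Y \<ge> r" "Im w \<ge> Y" "x \<in> ball w r"
  moreover have "\<bar>Im (w - x)\<bar> \<le> dist w x"
    unfolding dist_norm by (rule abs_Im_le_cmod)
  ultimately show "x \<in> {x. Im x > Y - r}" by simp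
qed

context koebe_constant
begin

context
  fixes h :: "complex \<Rightarrow> complex"
  assumes holh: "h holomorphic_on upper_half_plane" and injh: "inj_on h upper_half_plane"
begin

lemma hp_has_deriv:
  "Im x > 0 \<Longrightarrow> (h has_field_derivative deriv h x) (at x within S)"
  using holomorphic_derivI[OF holh upper_half_plane(1), of x]
  by (simp add: has_field_derivative_at_within)

lemma hp_has_deriv2:
  "Im x > 0 \<Longrightarrow> (deriv h has_field_derivative deriv (deriv h) x) (at x within S)"
  using holomorphic_derivI[OF holomorphic_deriv[OF holh upper_half_plane(1)] upper_half_plane(1), of x]
  by (simp add: has_field_derivative_at_within)

lemma hp_deriv2: "Im w > 0 \<Longrightarrow> Im w * cmod (deriv (deriv h) w) \<le> A * cmod (deriv h w)"
  using ball_Im_subset[of "Im w" "Im w" w]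
  by (intro deriv2_bound holomorphic_on_subset[OF holh] inj_on_subset[OF injh])
    (auto simp: subset_iff)

lemma hp_lipschitz:
  assumes "Y > 0" "Im u \<ge> Y" "Im v \<ge> Y"
  shows "cmod (deriv h u) \<le> exp (A / Y * cmod (u - v)) * cmod (deriv h v)"
proof (rule deriv_log_lipschitz[OF upper_half_plane holh injh, of "{w. Im w \<ge> Y}"])
  fix z assume z: "z \<in> {w. Im w \<ge> Y}"
  have "Y * cmod (deriv (deriv h) z) \<le> Im z * cmod (deriv (deriv h) z)"
    using z by (intro mult_right_mono) auto
  also have "\<dots> \<le> A * cmod (deriv h z)"
    using z assms by (intro hp_deriv2) auto
  finally show "cmod (deriv (deriv h) z) \<le> A / Y * cmod (deriv h z)"
    using assms by (simp add: field_simps)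
qed (use assms in \<open>auto simp: convex_halfspace_Im_ge\<close>)

lemma hp_omitted:
  assumes "Im w > 0" "u \<notin> h ` upper_half_plane"
  shows "Im w * cmod (deriv h w) \<le> A * cmod (u - h w)"
  using ball_Im_subset[of "Im w" "Im w" w] assms
  by (intro omitted_bound holomorphic_on_subset[OF holh] inj_on_subset[OF injh])
    (auto simp: subset_iff)

lemma hp_step:
  assumes "Y > 0" "Im w \<ge> Y"
  shows "cmod (h (w + 1) - h w) \<le> exp (A / Y) * cmod (deriv h w)"
proof -
  have "cmod (h (w + 1) - h w) \<le> exp (A / Y) * cmod (deriv h w) * cmod ((w + 1) - w)"
  proof (rule field_differentiable_bound[of "closed_segment w (w + 1)" _ "deriv h"])
    fix z assume z: "z \<in> closed_segment w (w + 1)"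
    then obtain t where t: "0 \<le> t" "t \<le> 1" "z = w + of_real t"
      by (auto simp: in_segment algebra_simps scaleR_conv_of_real)
    then have I: "Im z = Im w" by simp
    then show "(h has_field_derivative deriv h z) (at z within closed_segment w (w + 1))"
      using assms by (intro hp_has_deriv) simp
    have "cmod (deriv h z) \<le> exp (A / Y * cmod (z - w)) * cmod (deriv h w)"
      by (rule hp_lipschitz) (use assms I in auto)
    also have "\<dots> \<le> exp (A / Y) * cmod (deriv h w)"
      using t A_pos assms by (intro mult_right_mono) (auto simp: mult_left_le divide_right_mono)
    finally show "cmod (deriv h z) \<le> exp (A / Y) * cmod (deriv h w)" .
  qed auto
  then show ?thesis by simp
qed

text \<open>If \<open>l\<close> were not 1, the affine map would have a finite fixed point
  \<open>u\<close>, and injectivity makes \<open>h\<close> omit it. One step from \<open>w\<close>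
  to \<open>w + 1\<close> then has length \<open>|l - 1| * |h w - u|\<close>. It is also at most a
  constant times \<open>|deriv h w|\<close>, and the omitted value bounds this by a constant times
  \<open>|h w - u| / Im w\<close>. For large \<open>Im w\<close> the two disagree.\<close>

lemma affine_multiplier_eq_1:
  assumes eq: "\<And>w. Im w > 0 \<Longrightarrow> h (w + 1) = l * h w + t"
  shows "l = 1"
proof (rule ccontr)
  assume l: "l \<noteq> 1"
  define u where "u = t / (1 - l)"
  have u: "l * u + t = u" using l by (simp add: u_def field_simps)
  have om: "u \<notin> h ` upper_half_plane"
  proof
    assume "u \<in> h ` upper_half_plane"
    then obtain w where w: "Im w > 0" "h w = u" by auto
    then have "h (w + 1) = h w" using eq[of w] u by simp
    then have "w + 1 = w" using inj_onD[OF injh, of "w + 1" w] w by auto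
    then show False by simp
  qed
  \<comment> \<open>Height at least 1 allows \<open>hp_step\<close> with \<open>Y = 1\<close>; the
    second entry makes \<open>y * |l - 1|\<close> twice the upper bound derived below.\<close>
  define y where "y = max 1 (2 * exp A * A / cmod (l - 1))"
  define w where "w = Complex 0 y"
  have y: "y \<ge> 1" "Im w = y" by (auto simp: y_def w_def)
  have hu: "h w \<noteq> u" using om y by auto
  have "h (w + 1) - h w = (l - 1) * (h w - u)"
    using eq[of w] y u by (simp add: algebra_simps)
  then have "cmod (l - 1) * cmod (h w - u) = cmod (h (w + 1) - h w)"
    by (simp add: norm_mult)
  also have "\<dots> \<le> exp A * cmod (deriv h w)"
    using hp_step[of 1 w] y by simp
  finally have "y * (cmod (l - 1) * cmod (h w - u)) \<le> exp A * (y * cmod (deriv h w))"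
    using y by (simp add: mult.left_commute mult_left_mono)
  also have "\<dots> \<le> exp A * (A * cmod (u - h w))"
    using hp_omitted[of w u] y om by (intro mult_left_mono) auto
  finally have "y * cmod (l - 1) \<le> exp A * A"
    using hu by (simp add: norm_minus_commute mult.assoc[symmetric])
  moreover have "2 * exp A * A \<le> y * cmod (l - 1)"
    using l by (simp add: y_def field_simps max_def)
  moreover have "exp A * A > 0" using A_pos by simp
  ultimately show False by linarith
qed

context
  fixes Y :: real
  assumes Y: "Y > 0" and eq: "\<And>w. Im w > 0 \<Longrightarrow> h (w + 1) = h w + 1"
begin

lemma periodic_int: "Im w > 0 \<Longrightarrow> h (w + of_int n) = h w + of_int n"
proof -
  have nat: "Im w > 0 \<Longrightarrow> h (w + of_nat m) = h w + of_nat m" for w m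
  proof (induction m)
    case (Suc m)
    then show ?case using eq[of "w + of_nat m"] by (simp add: ac_simps)
  qed simp
  assume w: "Im w > 0"
  show ?thesis
  proof (cases "n \<ge> 0")
    case True
    then show ?thesis using nat[OF w, of "nat n"] by simp
  next
    case False
    then show ?thesis using nat[of "w + of_int n" "nat (- n)"] w by simp
  qed
qed

lemma periodic_deriv_lower: "Im w \<ge> Y \<Longrightarrow> exp (- A / Y) \<le> cmod (deriv h w)"
  using hp_step[OF Y, of w] eq[of w] Y by (simp add: exp_minus field_simps)

text \<open>A ball about \<open>w\<close> of radius at most 1 does not contain \<open>w + 1\<close>.
  By injectivity its image omits \<open>h (w + 1)\<close>, which lies at distance 1 from
  \<open>h w\<close>.\<close>

lemma periodic_deriv_upper: "Im w \<ge> Y \<Longrightarrow> cmod (deriv h w) \<le> A / min Y 1"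
proof -
  assume w: "Im w \<ge> Y"
  have sub: "ball w (min Y 1) \<subseteq> upper_half_plane"
    using ball_Im_subset[of "min Y 1" Y w] w by (auto simp: subset_iff)
  have "h (w + 1) \<notin> h ` ball w (min Y 1)"
  proof
    assume "h (w + 1) \<in> h ` ball w (min Y 1)"
    then obtain x where x: "x \<in> ball w (min Y 1)" "h (w + 1) = h x" by auto
    then have "w + 1 = x"
      using inj_onD[OF injh x(2)] sub w Y by auto
    then show False using x by (auto simp: dist_norm)
  qed
  then have "min Y 1 * cmod (deriv h w) \<le> A * cmod (h (w + 1) - h w)"
    using sub Y
    by (intro omitted_bound holomorphic_on_subset[OF holh] inj_on_subset[OF injh]) auto
  then show ?thesis using eq[of w] w Y by (simp add: field_simps)
qed

text \<open>Over one period \<open>h\<close> increases by exactly 1, while \<open>deriv h\<close>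
  varies by at most \<open>E\<close> along the segment; the mean value estimate for
  \<open>h z - deriv h w * z\<close> compares the two.\<close>

lemma periodic_mean:
  assumes w: "Im w > 0" and E: "\<And>x. Im x = Im w \<Longrightarrow> cmod (deriv (deriv h) x) \<le> E"
  shows "cmod (deriv h w - 1) \<le> E"
proof -
  have cs: "\<exists>t. 0 \<le> t \<and> t \<le> 1 \<and> x = w + of_real t" if "x \<in> closed_segment w (w + 1)" for x
    using that by (auto simp: in_segment algebra_simps scaleR_conv_of_real)
  have I: "Im x = Im w" if "x \<in> closed_segment w (w + 1)" for x
    using cs[OF that] by auto
  have E0: "E \<ge> 0" using E[of w] norm_ge_zero order_trans by blast
  have 1: "cmod (deriv h x - deriv h w) \<le> E" if x: "x \<in> closed_segment w (w + 1)" for x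
  proof -
    have "cmod (deriv h x - deriv h w) \<le> E * cmod (x - w)"
    proof (rule field_differentiable_bound[of "closed_segment w (w + 1)" _ "deriv (deriv h)"])
      fix z assume z: "z \<in> closed_segment w (w + 1)"
      show "(deriv h has_field_derivative deriv (deriv h) z) (at z within closed_segment w (w + 1))"
        using I[OF z] w by (intro hp_has_deriv2) simp
      show "cmod (deriv (deriv h) z) \<le> E" using E I[OF z] by simp
    qed (use x in auto)
    also have "\<dots> \<le> E * 1"
      using cs[OF x] E0 by (intro mult_left_mono) auto
    finally show ?thesis by simp
  qed
  have "cmod ((h (w + 1) - deriv h w * (w + 1)) - (h w - deriv h w * w)) \<le> E * cmod ((w + 1) - w)"
  proof (rule field_differentiable_bound[of "closed_segment w (w + 1)" _ "\<lambda>x. deriv h x - deriv h w"])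
    fix z assume z: "z \<in> closed_segment w (w + 1)"
    have "(h has_field_derivative deriv h z) (at z within closed_segment w (w + 1))"
      using I[OF z] w by (intro hp_has_deriv) simp
    then show "((\<lambda>z. h z - deriv h w * z) has_field_derivative deriv h z - deriv h w)
        (at z within closed_segment w (w + 1))"
      by (auto intro!: derivative_eq_intros)
    show "cmod (deriv h z - deriv h w) \<le> E" by (rule 1[OF z])
  qed auto
  moreover have "(h (w + 1) - deriv h w * (w + 1)) - (h w - deriv h w * w) = 1 - deriv h w"
    using eq[OF w] by (simp add: algebra_simps)
  ultimately show ?thesis by (simp add: norm_minus_commute)
qed

text \<open>The mean over a period of \<open>deriv h - 1\<close> vanishes, so \<open>deriv h - 1\<close> is bounded by its own
  derivative; this gains one power of \<open>Im w\<close> over the distortion estimate and makes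
  \<open>deriv h - 1\<close> integrable along vertical lines.\<close>

lemma periodic_deriv_decay:
  defines "C1 \<equiv> A * (A / min Y 1)"
  assumes w: "Im w \<ge> 2 * Y"
  shows "cmod (deriv h w - 1) \<le> 4 * C1 / (Im w)\<^sup>2"
proof -
  have d2: "deriv h holomorphic_on upper_half_plane"
    by (rule holomorphic_deriv[OF holh upper_half_plane(1)])
  \<comment> \<open>First pass: the distortion bound on the second derivative gives only decay of
    order \<open>1 / Im x\<close>.\<close>
  have a: "cmod (deriv h x - 1) \<le> C1 / Im x" if x: "Im x \<ge> Y" for x
  proof (rule periodic_mean)
    fix v assume "Im v = Im x"
    then have "Im x * cmod (deriv (deriv h) v) \<le> A * cmod (deriv h v)"
      using hp_deriv2[of v] x Y by simp
    also have "\<dots> \<le> C1"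
      unfolding C1_def using periodic_deriv_upper[of v] A_pos x \<open>Im v = Im x\<close>
      by (intro mult_left_mono) auto
    finally have "Im x * cmod (deriv (deriv h) v) \<le> C1" .
    then show "cmod (deriv (deriv h) v) \<le> C1 / Im x"
      using x Y by (simp add: field_simps)
  qed (use x Y in auto)
  have C1: "C1 \<ge> 0" using A_pos Y by (simp add: C1_def)
  show ?thesis
  proof (rule periodic_mean)
    fix v assume v: "Im v = Im w"
    then have v0: "Im v > 0" using w Y by simp
    have sub: "Im x \<ge> Im v / 2" if "x \<in> cball v (Im v / 2)" for x
    proof -
      have "\<bar>Im (v - x)\<bar> \<le> dist v x" unfolding dist_norm by (rule abs_Im_le_cmod)
      then show ?thesis using that by simp
    qed
    then have sub': "cball v (Im v / 2) \<subseteq> upper_half_plane" using v0 by force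
    \<comment> \<open>Second pass: Cauchy's estimate on a disk of radius \<open>Im v / 2\<close>
      turns the first-order decay into a second derivative of order \<open>1 / (Im v)^2\<close>, to
      which \<open>periodic_mean\<close> applies once more.\<close>
    have "cmod ((deriv ^^ 1) (\<lambda>x. deriv h x - 1) v) \<le> fact 1 * (C1 / (Im v / 2)) / (Im v / 2) ^ 1"
    proof (rule Cauchy_inequality)
      have hc: "(\<lambda>x. deriv h x - 1) holomorphic_on cball v (Im v / 2)"
        by (intro holomorphic_intros holomorphic_on_subset[OF d2 sub'])
      show "continuous_on (cball v (Im v / 2)) (\<lambda>x. deriv h x - 1)"
        by (rule holomorphic_on_imp_continuous_on[OF hc])
      show "(\<lambda>x. deriv h x - 1) holomorphic_on ball v (Im v / 2)"
        using hc by (rule holomorphic_on_subset) auto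
      fix x assume "cmod (v - x) = Im v / 2"
      then have x: "Im x \<ge> Im v / 2" by (intro sub) (simp add: dist_norm)
      have "cmod (deriv h x - 1) \<le> C1 / Im x" using x v w by (intro a) auto
      also have "\<dots> \<le> C1 / (Im v / 2)"
        using x v0 C1 by (intro divide_left_mono) auto
      finally show "cmod (deriv h x - 1) \<le> C1 / (Im v / 2)" .
    qed (use v0 in auto)
    moreover have "deriv (\<lambda>x. deriv h x - 1) v = deriv (deriv h) v"
      using hp_has_deriv2[OF v0, of UNIV]
      by (intro DERIV_imp_deriv) (auto intro!: derivative_eq_intros)
    ultimately show "cmod (deriv (deriv h) v) \<le> 4 * C1 / (Im w)\<^sup>2"
      using v by (simp add: power2_eq_square)
  qed (use w Y in auto)
qed

text \<open>The function \<open>h w - w\<close> is periodic, so \<open>w\<close> may be moved into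
  the strip over \<open>[0, 1)\<close>. What remains is a horizontal move of length below 1 and a
  vertical one, along which the decay \<open>4 * C1 / t^2\<close> has a bounded integral.\<close>

lemma periodic_near_translation:
  defines "C1 \<equiv> A * (A / min Y 1)"
  defines "k \<equiv> h (Complex 0 (2 * Y)) - Complex 0 (2 * Y)"
  assumes w: "Im w \<ge> 2 * Y"
  shows "cmod (h w - w - k) \<le> 4 * C1 / (2 * Y)\<^sup>2 + 4 * C1 / (2 * Y)"
proof -
  have C1: "C1 \<ge> 0" using A_pos Y by (simp add: C1_def)
  define g where "g = (\<lambda>w. h w - w)"
  have dg: "(g has_field_derivative deriv h x - 1) (at x within S)" if "Im x > 0" for x S
    unfolding g_def using hp_has_deriv[OF that] by (auto intro!: derivative_eq_intros)
  define w0 where "w0 = w + of_int (- \<lfloor>Re w\<rfloor>)"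
  have gw: "g w = g w0"
    using periodic_int[of w "- \<lfloor>Re w\<rfloor>"] w Y by (simp add: g_def w0_def)
  define w1 where "w1 = Complex 0 (Im w)"
  have "cmod (g w0 - g w1) \<le> 4 * C1 / (2 * Y)\<^sup>2 * cmod (w0 - w1)"
  proof (rule field_differentiable_bound[of "{x. Im x \<ge> 2 * Y}"])
    fix z assume z: "z \<in> {x. Im x \<ge> 2 * Y}"
    show "(g has_field_derivative deriv h z - 1) (at z within {x. Im x \<ge> 2 * Y})"
      by (rule dg) (use z Y in auto)
    have "cmod (deriv h z - 1) \<le> 4 * C1 / (Im z)\<^sup>2"
      using periodic_deriv_decay[of z] z by (simp add: C1_def)
    also have "\<dots> \<le> 4 * C1 / (2 * Y)\<^sup>2"
      using z Y C1 power_mono[of "2 * Y" "Im z" 2] by (intro divide_left_mono) auto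
    finally show "cmod (deriv h z - 1) \<le> 4 * C1 / (2 * Y)\<^sup>2" .
  qed (use w in \<open>auto simp: w0_def w1_def convex_halfspace_Im_ge\<close>)
  also have "w0 - w1 = of_real (frac (Re w))"
    by (simp add: w0_def w1_def complex_eq_iff frac_def)
  also have "4 * C1 / (2 * Y)\<^sup>2 * cmod (of_real (frac (Re w))) \<le> 4 * C1 / (2 * Y)\<^sup>2 * 1"
    using C1 frac_lt_1[of "Re w"] frac_ge_0[of "Re w"] by (intro mult_left_mono) auto
  finally have hor: "cmod (g w0 - g w1) \<le> 4 * C1 / (2 * Y)\<^sup>2" by simp
  have ver: "cmod (g w1 - k) \<le> 4 * C1 / (2 * Y)"
  proof (cases "Im w = 2 * Y")
    case True
    then show ?thesis using C1 Y by (simp add: w1_def k_def g_def)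
  next
    case False
    define p where "p = (\<lambda>t. g (\<i> * of_real t))"
    have dp: "(p has_vector_derivative \<i> * (deriv h (\<i> * of_real t) - 1)) (at t)" if "t > 0" for t
      unfolding p_def
      by (rule has_vector_derivative_eq_rhs[OF field_vector_diff_chain_at[unfolded o_def,
            where f = "\<lambda>t. \<i> * of_real t" and f' = \<i>]])
        (use that in \<open>auto intro!: dg derivative_eq_intros\<close>)
    \<comment> \<open>\<open>- 4 * C1 / t\<close> is the primitive of the bound
      \<open>4 * C1 / t^2\<close>.\<close>
    have "norm (p (Im w) - p (2 * Y)) \<le> (- 4 * C1 / Im w) - (- 4 * C1 / (2 * Y))"
    proof (rule differentiable_bound_general[where f' = "\<lambda>t. \<i> * (deriv h (\<i> * of_real t) - 1)"
          and \<phi>' = "\<lambda>t. 4 * C1 / t\<^sup>2"])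
      show "2 * Y < Im w" using False w by simp
      show "continuous_on {2 * Y..Im w} p"
        using has_vector_derivative_continuous[OF dp] Y
        by (intro continuous_at_imp_continuous_on ballI) auto
      show "continuous_on {2 * Y..Im w} (\<lambda>t. - 4 * C1 / t)"
        using Y by (intro continuous_intros) auto
      fix t assume t: "2 * Y < t" "t < Im w"
      show "(p has_vector_derivative \<i> * (deriv h (\<i> * of_real t) - 1)) (at t)"
        by (rule dp) (use t Y in auto)
      show "((\<lambda>t. - 4 * C1 / t) has_vector_derivative 4 * C1 / t\<^sup>2) (at t)"
        unfolding has_real_derivative_iff_has_vector_derivative[symmetric]
        using t Y by (auto intro!: derivative_eq_intros simp: power2_eq_square)
      show "norm (\<i> * (deriv h (\<i> * of_real t) - 1)) \<le> 4 * C1 / t\<^sup>2"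
        using periodic_deriv_decay[of "\<i> * of_real t"] t by (simp add: norm_mult C1_def)
    qed
    moreover have "p (Im w) = g w1" "p (2 * Y) = k"
      by (auto simp: p_def w1_def k_def g_def complex_i_mult_minus Complex_eq)
    ultimately have "cmod (g w1 - k) \<le> 4 * C1 / (2 * Y) - 4 * C1 / Im w" by simp
    also have "\<dots> \<le> 4 * C1 / (2 * Y)" using C1 w Y by simp
    finally show ?thesis .
  qed
  have "h w - w - k = g w0 - k" unfolding gw[symmetric] by (simp add: g_def)
  then have "cmod (h w - w - k) = cmod ((g w0 - g w1) + (g w1 - k))" by simp
  also have "\<dots> \<le> cmod (g w0 - g w1) + cmod (g w1 - k)" by (rule norm_triangle_ineq)
  finally show ?thesis using hor ver by linarith
qed

end

end

lemma periodic_univalent_bounds: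
  assumes "Y > 0"
  obtains C where "C \<ge> 1"
    "\<And>h w. \<lbrakk>h holomorphic_on upper_half_plane; inj_on h upper_half_plane;
       \<And>w. Im w > 0 \<Longrightarrow> h (w + 1) = h w + 1; Im w \<ge> Y\<rbrakk> \<Longrightarrow>
       1 / C \<le> cmod (deriv h w) \<and> cmod (deriv h w) \<le> C"
    "\<And>h w. \<lbrakk>h holomorphic_on upper_half_plane; inj_on h upper_half_plane;
       \<And>w. Im w > 0 \<Longrightarrow> h (w + 1) = h w + 1; Im w \<ge> Y\<rbrakk> \<Longrightarrow>
       cmod (h w - w - (h (Complex 0 Y) - Complex 0 Y)) \<le> C"
    "\<And>h w u. \<lbrakk>h holomorphic_on upper_half_plane; inj_on h upper_half_plane;
       \<And>w. Im w > 0 \<Longrightarrow> h (w + 1) = h w + 1; Im w \<ge> Y; u \<notin> h ` upper_half_plane\<rbrakk> \<Longrightarrow>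
       1 \<le> C * cmod (h w - u)"
proof
  \<comment> \<open>\<open>Y / 2\<close> appears because \<open>periodic_near_translation\<close>
    holds from twice its parameter upwards.\<close>
  define C1 where "C1 = A * (A / min (Y / 2) 1)"
  define Ca where "Ca = exp (A / Y) + A / min Y 1"
  define Cb where "Cb = 4 * C1 / Y\<^sup>2 + 4 * C1 / Y"
  define C where "C = Ca + Cb + A * Ca / Y"
  have C1: "C1 > 0" using A_pos assms by (simp add: C1_def)
  have Cb: "Cb > 0" using C1 assms by (simp add: Cb_def add_pos_pos)
  have e1: "exp (A / Y) \<ge> 1" using A_pos assms by simp
  have amin: "A / min Y 1 > 0" using A_pos assms by simp
  have Ca: "Ca \<ge> 1" using e1 amin unfolding Ca_def by linarith
  have last: "A * Ca / Y > 0" using A_pos assms Ca by simp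
  show "C \<ge> 1" using Ca Cb last by (simp add: C_def)
  fix h :: "complex \<Rightarrow> complex" and w u :: complex
  assume h: "h holomorphic_on upper_half_plane" "inj_on h upper_half_plane"
    "\<And>w. Im w > 0 \<Longrightarrow> h (w + 1) = h w + 1" and w: "Im w \<ge> Y"
  have lo: "1 / Ca \<le> cmod (deriv h w)"
  proof -
    have "1 / Ca \<le> 1 / exp (A / Y)"
      using e1 amin Ca by (intro divide_left_mono) (auto simp: Ca_def)
    also have "\<dots> \<le> cmod (deriv h w)"
      using periodic_deriv_lower[OF h(1,2) assms h(3) w] by (simp add: exp_minus inverse_eq_divide)
    finally show ?thesis .
  qed
  have "1 / C \<le> 1 / Ca"
    using Ca Cb last by (intro divide_left_mono) (auto simp: C_def)
  moreover have "cmod (deriv h w) \<le> Ca"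
    using periodic_deriv_upper[OF h(1,2) assms h(3) w] by (simp add: Ca_def add_increasing)
  moreover have "Ca \<le> C" using Cb last by (simp add: C_def)
  ultimately show "1 / C \<le> cmod (deriv h w) \<and> cmod (deriv h w) \<le> C"
    using lo by linarith
  have "cmod (h w - w - (h (Complex 0 Y) - Complex 0 Y)) \<le> Cb"
    using periodic_near_translation[OF h(1,2) _ h(3), of "Y / 2" w] assms w
    by (simp add: Cb_def C1_def)
  then show "cmod (h w - w - (h (Complex 0 Y) - Complex 0 Y)) \<le> C"
    using Ca last by (simp add: C_def)
  assume u: "u \<notin> h ` upper_half_plane"
  have "Y * (1 / Ca) \<le> Im w * cmod (deriv h w)"
    using lo w assms Ca by (intro mult_mono) auto
  also have "\<dots> \<le> A * cmod (u - h w)"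
    using hp_omitted[OF h(1,2) _ u, of w] w assms by simp
  finally have "1 \<le> A * Ca / Y * cmod (u - h w)"
    using assms Ca by (simp add: field_simps)
  also have "\<dots> \<le> C * cmod (u - h w)"
    using Ca Cb by (intro mult_right_mono) (auto simp: C_def)
  also have "\<dots> = C * cmod (h w - u)"
    by (simp add: norm_minus_commute)
  finally show "1 \<le> C * cmod (h w - u)" .
qed

text \<open>The Moebius map induced by \<open>w + 1\<close> has no fixed point in the image of
  \<open>F\<close>, since \<open>F\<close> is injective. If it is affine, its multiplier is 1 by
  \<open>affine_multiplier_eq_1\<close>. Otherwise \<open>1 / (F w - u)\<close> sends a fixed point
  \<open>u\<close> to infinity and the same lemma applies. Either way the map is parabolic.\<close>

lemma conjugate_to_translation:
  assumes F: "F holomorphic_on upper_half_plane" "inj_on F upper_half_plane"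
    and det: "A' * D - B * C = 1"
    and eq: "\<And>w. Im w > 0 \<Longrightarrow> C * F w + D \<noteq> 0 \<and> F (w + 1) = (A' * F w + B) / (C * F w + D)"
  obtains \<alpha> \<beta> \<gamma> \<delta> where "\<alpha> * \<delta> - \<beta> * \<gamma> = 1" "\<And>w. Im w > 0 \<Longrightarrow> \<gamma> * F w + \<delta> \<noteq> 0"
    "\<And>w. Im w > 0 \<Longrightarrow> (\<alpha> * F (w + 1) + \<beta>) / (\<gamma> * F (w + 1) + \<delta>) =
       (\<alpha> * F w + \<beta>) / (\<gamma> * F w + \<delta>) + 1"
proof -
  have shift: "F (w + 1) \<noteq> F w" if "Im w > 0" for w
  proof
    assume "F (w + 1) = F w"
    then have "w + 1 = w" using inj_onD[OF F(2), of "w + 1" w] that by auto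
    then show False by simp
  qed
  show thesis
  proof (cases "C = 0")
    case True
    then have AD: "A' * D = 1" using det by simp
    have D0: "D \<noteq> 0" using AD by auto
    then have eq': "F (w + 1) = (A' / D) * F w + B / D" if "Im w > 0" for w
      using eq[OF that] True by (simp add: add_divide_distrib)
    have one: "A' / D = 1"
      by (rule affine_multiplier_eq_1[OF F eq'])
    define t where "t = B / D"
    have tr: "F (w + 1) = F w + t" if "Im w > 0" for w
      using eq'[OF that] one by (simp add: t_def)
    have "t \<noteq> 0" using tr[of \<i>] shift[of \<i>] by auto
    \<comment> \<open>The diagonal matrix with entries \<open>1 / s\<close> and \<open>s\<close> has
      determinant 1 and acts as division by \<open>t\<close>.\<close>
    define s where "s = csqrt t"
    have s: "s * s = t" "s \<noteq> 0" using \<open>t \<noteq> 0\<close> by (auto simp: s_def power2_eq_square[symmetric])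
    show thesis
      by (rule that[of "1 / s" s 0 0]) (use s tr \<open>t \<noteq> 0\<close> in \<open>auto simp: field_simps\<close>)
  next
    case False
    define u where "u = (A' - D + csqrt ((D - A')\<^sup>2 + 4 * B * C)) / (2 * C)"
    have "2 * C * u = A' - D + csqrt ((D - A')\<^sup>2 + 4 * B * C)"
      using False by (simp add: u_def)
    then have "(2 * C * u - (A' - D))\<^sup>2 = (D - A')\<^sup>2 + 4 * B * C" by simp
    then have "4 * C * (C * u * u + (D - A') * u - B) = 0"
      by (simp add: power2_eq_square algebra_simps)
    then have u: "C * u * u + (D - A') * u - B = 0" using False by simp
    \<comment> \<open>\<open>\<mu>\<close> is the eigenvalue of the matrix with eigenvector
      \<open>(u, 1)\<close>; the other eigenvalue is \<open>A' - C * u\<close>, hence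
      \<open>1 / \<mu>\<close>.\<close>
    define \<mu> where "\<mu> = C * u + D"
    have mu: "(A' - C * u) * \<mu> = 1"
    proof -
      have "(A' - C * u) * \<mu> = A' * D - C * (C * u * u + (D - A') * u - B) - B * C"
        by (simp add: \<mu>_def algebra_simps)
      then show ?thesis using u det by simp
    qed
    then have mu0: "\<mu> \<noteq> 0" "A' - C * u \<noteq> 0" by auto
    have inv: "A' - C * u = 1 / \<mu>" using mu mu0 by (simp add: field_simps)
    have F1: "(F (w + 1) - u) * (C * F w + D) = (A' - C * u) * (F w - u)" if "Im w > 0" for w
    proof -
      have "F (w + 1) * (C * F w + D) = A' * F w + B"
        using eq[OF that] by (simp add: nonzero_eq_divide_eq)
      then have "(F (w + 1) - u) * (C * F w + D) = A' * F w + B - u * (C * F w + D)"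
        by (simp add: left_diff_distrib)
      also have "\<dots> = (A' - C * u) * (F w - u) - (C * u * u + (D - A') * u - B)"
        by (simp add: algebra_simps)
      finally show ?thesis using u by simp
    qed
    have nu: "F w \<noteq> u" if "Im w > 0" for w
    proof
      assume "F w = u"
      then have "F (w + 1) = u" using F1[OF that] eq[OF that] by simp
      then show False using \<open>F w = u\<close> shift[OF that] by simp
    qed
    define X where "X = (\<lambda>w. 1 / (F w - u))"
    have X: "X (w + 1) = \<mu>\<^sup>2 * X w + C * \<mu>" if "Im w > 0" for w
    proof -
      have n: "F w - u \<noteq> 0" "F (w + 1) - u \<noteq> 0" using nu[OF that] nu[of "w + 1"] that by auto
      have "1 / (F (w + 1) - u) = \<mu> * (C * F w + D) / (F w - u)"
        using F1[OF that] n mu0 unfolding inv by (simp add: field_simps)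
      also have "C * F w + D = C * (F w - u) + \<mu>" by (simp add: \<mu>_def algebra_simps)
      finally show ?thesis
        using n by (simp add: X_def field_simps power2_eq_square)
    qed
    have "\<mu>\<^sup>2 = 1"
    proof (rule affine_multiplier_eq_1[where h = X and t = "C * \<mu>"])
      show "X holomorphic_on upper_half_plane"
        unfolding X_def using nu by (intro holomorphic_intros F) auto
      show "inj_on X upper_half_plane"
      proof (rule inj_onI)
        fix x y assume xy: "x \<in> upper_half_plane" "y \<in> upper_half_plane" "X x = X y"
        then have "F x = F y" using nu[of x] nu[of y] by (auto simp: X_def field_simps)
        then show "x = y" using inj_onD[OF F(2)] xy by blast
      qed
    qed (rule X)
    then have tr: "X (w + 1) = X w + C * \<mu>" if "Im w > 0" for w using X[OF that] by simp
    define t where "t = C * \<mu>"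
    have t0: "t \<noteq> 0" using False mu0 by (simp add: t_def)
    \<comment> \<open>A square root of \<open>- t\<close> is what makes the matrix with rows
      \<open>(0, - 1 / g)\<close> and \<open>(g, - g * u)\<close> represent \<open>X / t\<close>
      with determinant 1.\<close>
    define g where "g = csqrt (- t)"
    have g: "g * g = - t" "g \<noteq> 0" using t0 by (auto simp: g_def power2_eq_square[symmetric])
    have form: "(0 * F w + (- 1 / g)) / (g * F w + (- g * u)) = X w / t" for w
    proof -
      have "(0 * F w + (- 1 / g)) / (g * F w + (- g * u)) = (- 1 / g) / (g * (F w - u))"
        by (simp add: algebra_simps)
      also have "\<dots> = - 1 / ((g * g) * (F w - u))" by simp
      also have "\<dots> = X w / t" unfolding g(1) X_def by simp
      finally show ?thesis .
    qed
    show thesis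
    proof (rule that[of 0 "- g * u" "- 1 / g" g])
      show "0 * (- g * u) - - 1 / g * g = 1" using g by simp
      show "g * F w + - g * u \<noteq> 0" if "Im w > 0" for w
        using g nu[OF that] by (auto simp: algebra_simps)
      show "(0 * F (w + 1) + - 1 / g) / (g * F (w + 1) + - g * u) =
          (0 * F w + - 1 / g) / (g * F w + - g * u) + 1" if "Im w > 0" for w
        unfolding form tr[OF that] using t0 by (simp add: t_def add_divide_distrib)
    qed
  qed
qed

end

section \<open>Parabolic automorphisms and horodisks\<close>

text \<open>The right-hand side is the Poisson kernel of the disk with pole \<open>p\<close>:
  horodisks at \<open>p\<close> become half-planes under the Cayley map that sends \<open>p\<close>
  to infinity.\<close>

lemma Im_cayley:
  assumes "cmod p = 1" "z \<noteq> p"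
  shows "Im (\<i> * (p + z) / (p - z)) = (1 - (cmod z)\<^sup>2) / (cmod (p - z))\<^sup>2"
proof -
  have "Re p * Re p + Im p * Im p = 1"
    using assms(1) cmod_power2[of p] by (simp add: power2_eq_square)
  moreover have "Re ((p + z) * cnj (p - z)) = Re p * Re p + Im p * Im p - (cmod z)\<^sup>2"
    unfolding cmod_power2
    by (simp add: power2_eq_square left_diff_distrib right_diff_distrib distrib_left distrib_right)
  ultimately have 1: "Re ((p + z) * cnj (p - z)) = 1 - (cmod z)\<^sup>2" by linarith
  have 2: "(p + z) / (p - z) = (p + z) * cnj (p - z) / of_real ((cmod (p - z))\<^sup>2)"
    using complex_div_cnj[of "p + z" "p - z"] by simp
  have "Re ((p + z) / (p - z)) = (1 - (cmod z)\<^sup>2) / (cmod (p - z))\<^sup>2"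
    unfolding 2 Re_divide_of_real 1 ..
  then show ?thesis by (simp only: times_divide_eq_right[symmetric] Im_i_times)
qed

lemma cayley_inverse_in_disk:
  assumes "cmod p = 1" "Im v > 0"
  shows "cmod (p * (v - \<i>) / (v + \<i>)) < 1"
proof -
  have "(cmod (v - \<i>))\<^sup>2 < (cmod (v + \<i>))\<^sup>2"
    using assms(2) unfolding cmod_power2 by (simp add: power2_eq_square algebra_simps)
  then have "cmod (v - \<i>) < cmod (v + \<i>)" by (rule power2_less_imp_less) simp
  moreover have "cmod (v + \<i>) > 0" using \<open>cmod (v - \<i>) < cmod (v + \<i>)\<close> norm_ge_zero le_less_trans by blast
  ultimately show ?thesis using assms(1) by (simp add: norm_divide norm_mult)
qed

text \<open>The parabolic automorphism of the disk with fixed point \<open>p\<close> that becomes the translation by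
  \<open>2 * \<tau>\<close> under \<open>z \<mapsto> \<i> * (p + z) / (p - z)\<close>.\<close>

definition parabolic :: "real \<Rightarrow> complex \<Rightarrow> complex \<Rightarrow> complex" where
  "parabolic \<tau> p z = ((1 + \<i> * \<tau>) * z - \<i> * \<tau> * p) / (\<i> * \<tau> * cnj p * z + (1 - \<i> * \<tau>))"

lemma cnj_mult_unit: "cmod p = 1 \<Longrightarrow> cnj p * p = 1"
  by (metis complex_cnj_mult complex_norm_square mult.commute of_real_1 one_power2)

lemma parabolic_cayley:
  assumes p: "cmod p = 1" and v: "v + \<i> \<noteq> 0" "v + 2 * \<tau> + \<i> \<noteq> 0"
  shows "parabolic \<tau> p (p * (v - \<i>) / (v + \<i>)) = p * (v + 2 * of_real \<tau> - \<i>) / (v + 2 * of_real \<tau> + \<i>)"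
proof -
  define z where "z = p * (v - \<i>) / (v + \<i>)"
  have z: "z * (v + \<i>) = p * (v - \<i>)" using v by (simp add: z_def)
  have 1: "((1 + \<i> * \<tau>) * z - \<i> * \<tau> * p) * (v + \<i>) = p * (v + 2 * \<tau> - \<i>)"
  proof -
    have "((1 + \<i> * \<tau>) * z - \<i> * \<tau> * p) * (v + \<i>) =
        (1 + \<i> * \<tau>) * (z * (v + \<i>)) - \<i> * \<tau> * p * (v + \<i>)"
      by (simp add: algebra_simps)
    also have "\<dots> = p * (v + 2 * \<tau> - \<i>)"
      unfolding z by (simp add: algebra_simps)
    finally show ?thesis .
  qed
  have 2: "(\<i> * \<tau> * cnj p * z + (1 - \<i> * \<tau>)) * (v + \<i>) = v + 2 * \<tau> + \<i>"
  proof -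
    have "(\<i> * \<tau> * cnj p * z + (1 - \<i> * \<tau>)) * (v + \<i>) =
        \<i> * \<tau> * cnj p * (z * (v + \<i>)) + (1 - \<i> * \<tau>) * (v + \<i>)"
      by (simp add: algebra_simps)
    also have "\<dots> = \<i> * \<tau> * (cnj p * p) * (v - \<i>) + (1 - \<i> * \<tau>) * (v + \<i>)"
      unfolding z by (simp add: mult.assoc)
    also have "\<dots> = v + 2 * \<tau> + \<i>"
      unfolding cnj_mult_unit[OF p] by (simp add: algebra_simps)
    finally show ?thesis .
  qed
  have "parabolic \<tau> p z =
      (((1 + \<i> * \<tau>) * z - \<i> * \<tau> * p) * (v + \<i>)) / ((\<i> * \<tau> * cnj p * z + (1 - \<i> * \<tau>)) * (v + \<i>))"
    unfolding parabolic_def using v(1) by simp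
  then have "parabolic \<tau> p z = p * (v + 2 * \<tau> - \<i>) / (v + 2 * \<tau> + \<i>)" unfolding 1 2 .
  then show ?thesis unfolding z_def by simp
qed

context koebe_constant
begin

text \<open>In the coordinate in which the automorphism is \<open>w \<mapsto> w + 1\<close>, \<open>f\<close> is a Moebius transformation
  of a univalent \<open>h\<close> that commutes with the translation and hence is close to a translation itself.
  The term \<open>c * cmod (z - p)\<close> absorbs the error near the pole of the Moebius transformation.\<close>

lemma parabolic_comparison_pos:
  assumes "\<eta> > 0"
  obtains K where "K \<ge> 1"
    "\<And>f \<tau> p A' B C D. \<lbrakk>f holomorphic_on ball 0 1; inj_on f (ball 0 1); \<tau> > 0; cmod p = 1;
       A' * D - B * C = 1;
       \<And>z. cmod z < 1 \<Longrightarrow> C * f z + D \<noteq> 0 \<and> f (parabolic \<tau> p z) = (A' * f z + B) / (C * f z + D)\<rbrakk>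
     \<Longrightarrow> \<exists>a b c. c \<ge> 0 \<and> (\<forall>z. cmod z < 1 \<longrightarrow> \<tau> * (cmod (z - p))\<^sup>2 \<le> \<eta> * (1 - (cmod z)\<^sup>2) \<longrightarrow>
          1 \<le> K * (cmod (deriv f z) * \<tau> * (cmod (a * z + b) + c * cmod (z - p))\<^sup>2) \<and>
          cmod (deriv f z) * \<tau> * (cmod (a * z + b) + c * cmod (z - p))\<^sup>2 \<le> K)"
proof -
  \<comment> \<open>In the coordinate \<open>N\<close> below, the horodisk condition for \<eta>
    reads \<open>Im (N z) >= Y\<close>.\<close>
  define Y where "Y = 1 / (2 * \<eta>)"
  have Y: "Y > 0" using assms by (simp add: Y_def)
  obtain C0 where C0: "C0 \<ge> 1"
    "\<And>h w. \<lbrakk>h holomorphic_on upper_half_plane; inj_on h upper_half_plane;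
       \<And>w. Im w > 0 \<Longrightarrow> h (w + 1) = h w + 1; Im w \<ge> Y\<rbrakk> \<Longrightarrow>
       1 / C0 \<le> cmod (deriv h w) \<and> cmod (deriv h w) \<le> C0"
    "\<And>h w. \<lbrakk>h holomorphic_on upper_half_plane; inj_on h upper_half_plane;
       \<And>w. Im w > 0 \<Longrightarrow> h (w + 1) = h w + 1; Im w \<ge> Y\<rbrakk> \<Longrightarrow>
       cmod (h w - w - (h (Complex 0 Y) - Complex 0 Y)) \<le> C0"
    "\<And>h w u. \<lbrakk>h holomorphic_on upper_half_plane; inj_on h upper_half_plane;
       \<And>w. Im w > 0 \<Longrightarrow> h (w + 1) = h w + 1; Im w \<ge> Y; u \<notin> h ` upper_half_plane\<rbrakk> \<Longrightarrow>
       1 \<le> C0 * cmod (h w - u)"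
    using periodic_univalent_bounds[OF Y] by blast
  \<comment> \<open>Produced by the bounds \<open>cmod l + c <= Q + (C0 + 1) * c\<close> and
    \<open>c <= C0 * Q\<close> below.\<close>
  define M where "M = 1 + (C0 + 1) * C0"
  have CM: "C0 \<le> M" using C0(1) by (simp add: M_def algebra_simps)
  have M1: "M \<ge> 1" using C0(1) CM by linarith
  show thesis
  proof
    show "C0 * M\<^sup>2 \<ge> 1" using C0(1) M1 mult_mono[of 1 C0 1 "M\<^sup>2"] one_le_power[of M 2] by simp
    fix f :: "complex \<Rightarrow> complex" and \<tau> :: real and p A' B C D :: complex
    assume f: "f holomorphic_on ball 0 1" "inj_on f (ball 0 1)" and tau: "\<tau> > 0" and p: "cmod p = 1"
      and det: "A' * D - B * C = 1"
      and conj: "\<And>z. cmod z < 1 \<Longrightarrow> C * f z + D \<noteq> 0 \<and>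
        f (parabolic \<tau> p z) = (A' * f z + B) / (C * f z + D)"
    \<comment> \<open>The Cayley map divided by the translation length, so that the parabolic map
      becomes \<open>w + 1\<close>; \<open>J\<close> is its inverse.\<close>
    define N where "N = (\<lambda>z. \<i> * (p + z) / (p - z) / (2 * of_real \<tau>))"
    define J where "J = (\<lambda>w. p * (2 * of_real \<tau> * w - \<i>) / (2 * of_real \<tau> * w + \<i>))"
    define F where "F = (\<lambda>w. f (J w))"
    have Jnz: "2 * of_real \<tau> * w + \<i> \<noteq> 0" if "Im w > 0" for w
    proof
      assume "2 * of_real \<tau> * w + \<i> = 0"
      then have "Im (2 * of_real \<tau> * w + \<i>) = 0" by simp
      then have "2 * \<tau> * Im w + 1 = 0" by simp
      moreover have "\<tau> * Im w > 0" using that tau by simp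
      ultimately show False by simp
    qed
    have Jd: "cmod (J w) < 1" if "Im w > 0" for w
      unfolding J_def using that tau p by (intro cayley_inverse_in_disk) auto
    have NJ: "N (J w) = w" if "Im w > 0" for w
    proof -
      let ?v = "2 * of_real \<tau> * w"
      have n: "?v + \<i> \<noteq> 0" by (rule Jnz[OF that])
      have p0: "p \<noteq> 0" using p by auto
      have 1: "p + J w = p * (2 * ?v) / (?v + \<i>)"
        using n by (simp add: J_def field_simps)
      have 2: "p - J w = p * (2 * \<i>) / (?v + \<i>)"
        using n by (simp add: J_def field_simps)
      have 3: "\<i> * (p * X / V) / (p * (2 * \<i>) / V) = X / 2" if "V \<noteq> 0" for X V
        using that p0 by simp
      show ?thesis
        unfolding N_def 1 2 3[OF n] using tau by simp
    qed
    have JN: "J (N z) = z" if "z \<noteq> p" for z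
    proof -
      have n: "p - z \<noteq> 0" using that by simp
      have p0: "p \<noteq> 0" using p by auto
      have v: "2 * of_real \<tau> * N z = \<i> * (p + z) / (p - z)" using tau by (simp add: N_def)
      have 1: "\<i> * (p + z) / (p - z) - \<i> = \<i> * (2 * z) / (p - z)" using n by (simp add: field_simps)
      have 2: "\<i> * (p + z) / (p - z) + \<i> = \<i> * (2 * p) / (p - z)" using n by (simp add: field_simps)
      show ?thesis unfolding J_def v 1 2 using n p0 by (simp add: field_simps)
    qed
    have ne: "z \<noteq> p" if "cmod z < 1" for z using that p by auto
    have ImN: "Im (N z) = (1 - (cmod z)\<^sup>2) / (cmod (p - z))\<^sup>2 / (2 * \<tau>)" if "z \<noteq> p" for z
      using Im_cayley[OF p that] unfolding N_def
      by (metis Im_divide_of_real of_real_mult of_real_numeral)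
    have ImN0: "Im (N z) > 0" if z: "cmod z < 1" for z
      unfolding ImN[OF ne[OF z]] using z tau ne[OF z] by (simp add: power_less_one_iff)
    have FN: "F (N z) = f z" if "cmod z < 1" for z
      using JN[OF ne[OF that]] by (simp add: F_def)
    have holF: "F holomorphic_on upper_half_plane"
      unfolding F_def
    proof (rule holomorphic_on_compose_gen[OF _ f(1), unfolded o_def])
      show "J holomorphic_on upper_half_plane"
        unfolding J_def using Jnz by (intro holomorphic_intros) auto
    qed (use Jd in auto)
    have injF: "inj_on F upper_half_plane"
    proof (rule inj_onI)
      fix x y assume xy: "x \<in> upper_half_plane" "y \<in> upper_half_plane" "F x = F y"
      then have "J x = J y" using inj_onD[OF f(2), of "J x" "J y"] Jd by (auto simp: F_def)
      then show "x = y" using NJ xy by (metis mem_upper_half_plane)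
    qed
    have J1: "J (w + 1) = parabolic \<tau> p (J w)" if "Im w > 0" for w
      using parabolic_cayley[OF p, of "2 * of_real \<tau> * w" \<tau>] Jnz[OF that] Jnz[of "w + 1"] that
      by (simp add: J_def algebra_simps)
    obtain \<alpha> \<beta> \<gamma> \<delta> where M0: "\<alpha> * \<delta> - \<beta> * \<gamma> = 1" "\<And>w. Im w > 0 \<Longrightarrow> \<gamma> * F w + \<delta> \<noteq> 0"
      "\<And>w. Im w > 0 \<Longrightarrow> (\<alpha> * F (w + 1) + \<beta>) / (\<gamma> * F (w + 1) + \<delta>) =
         (\<alpha> * F w + \<beta>) / (\<gamma> * F w + \<delta>) + 1"
    proof (rule conjugate_to_translation[OF holF injF det])
      fix w :: complex assume "Im w > 0"
      then show "C * F w + D \<noteq> 0 \<and> F (w + 1) = (A' * F w + B) / (C * F w + D)"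
        using conj[of "J w"] Jd[of w] J1[of w] by (simp add: F_def)
    qed blast
    define h where "h = (\<lambda>w. (\<alpha> * F w + \<beta>) / (\<gamma> * F w + \<delta>))"
    have holh: "h holomorphic_on upper_half_plane"
      unfolding h_def using M0(2) by (intro holomorphic_intros holF) auto
    \<comment> \<open>So \<open>\<alpha> - \<gamma> * h w\<close> is the reciprocal of the
      denominator of \<open>h\<close>, and its square is the ratio of \<open>deriv h\<close> to
      \<open>deriv F\<close>.\<close>
    have inv: "(\<alpha> - \<gamma> * h w) * (\<gamma> * F w + \<delta>) = 1" if "Im w > 0" for w
    proof -
      have "h w * (\<gamma> * F w + \<delta>) = \<alpha> * F w + \<beta>" using M0(2)[OF that] by (simp add: h_def)
      then have "(\<alpha> - \<gamma> * h w) * (\<gamma> * F w + \<delta>) = \<alpha> * (\<gamma> * F w + \<delta>) - \<gamma> * (\<alpha> * F w + \<beta>)"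
        by (simp add: left_diff_distrib mult.assoc)
      also have "\<dots> = 1" using M0(1) by (simp add: algebra_simps)
      finally show ?thesis .
    qed
    have injh: "inj_on h upper_half_plane"
    proof (rule inj_onI)
      fix x y assume xy: "x \<in> upper_half_plane" "y \<in> upper_half_plane" "h x = h y"
      have "(\<alpha> * F x + \<beta>) * (\<gamma> * F y + \<delta>) = (\<alpha> * F y + \<beta>) * (\<gamma> * F x + \<delta>)"
        using xy M0(2)[of x] M0(2)[of y] by (simp add: h_def frac_eq_eq)
      then have "(\<alpha> * \<delta> - \<beta> * \<gamma>) * (F x - F y) = 0" by (simp add: algebra_simps)
      then show "x = y" using M0(1) inj_onD[OF injF] xy by auto
    qed
    have per: "h (w + 1) = h w + 1" if "Im w > 0" for w
      using M0(3)[OF that] by (simp add: h_def)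
    have dh: "cmod (deriv h w) = cmod (deriv F w) * (cmod (\<alpha> - \<gamma> * h w))\<^sup>2" if w: "Im w > 0" for w
    proof -
      have dF: "(F has_field_derivative deriv F w) (at w)"
        using holomorphic_derivI[OF holF upper_half_plane(1)] w by simp
      have "(h has_field_derivative ((\<alpha> * deriv F w) * (\<gamma> * F w + \<delta>) - (\<alpha> * F w + \<beta>) * (\<gamma> * deriv F w))
          / ((\<gamma> * F w + \<delta>) * (\<gamma> * F w + \<delta>))) (at w)"
        unfolding h_def using M0(2)[OF w] by (auto intro!: derivative_eq_intros dF)
      moreover have "(\<alpha> * deriv F w) * (\<gamma> * F w + \<delta>) - (\<alpha> * F w + \<beta>) * (\<gamma> * deriv F w) =
          (\<alpha> * \<delta> - \<beta> * \<gamma>) * deriv F w"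
        by (simp add: algebra_simps)
      moreover have "1 / (\<gamma> * F w + \<delta>) = \<alpha> - \<gamma> * h w"
        using inv[OF w] M0(2)[OF w] by (simp add: field_simps)
      ultimately have "deriv h w = deriv F w * (\<alpha> - \<gamma> * h w)\<^sup>2"
        using M0(1) by (simp add: DERIV_imp_deriv power2_eq_square flip: \<open>1 / (\<gamma> * F w + \<delta>) = \<alpha> - \<gamma> * h w\<close>)
      then show ?thesis by (simp add: norm_mult norm_power)
    qed
    have df: "cmod (deriv f z) * (\<tau> * (cmod (p - z))\<^sup>2) = cmod (deriv F (N z))" if z: "cmod z < 1" for z
    proof -
      have pz: "p - z \<noteq> 0" using ne[OF z] by simp
      have dF: "(F has_field_derivative deriv F (N z)) (at (N z))"
        using holomorphic_derivI[OF holF upper_half_plane(1)] ImN0[OF z] by simp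
      have "(N has_field_derivative (\<i> * (p - z) + \<i> * (p + z)) / ((p - z) * (p - z)) / (2 * of_real \<tau>)) (at z)"
        unfolding N_def by (intro DERIV_cdivide) (use pz in \<open>auto intro!: derivative_eq_intros\<close>)
      moreover have "\<i> * (p - z) + \<i> * (p + z) = 2 * \<i> * p" by (simp add: algebra_simps)
      ultimately have dN: "(N has_field_derivative 2 * \<i> * p / ((p - z) * (p - z)) / (2 * of_real \<tau>)) (at z)"
        by simp
      have "((\<lambda>z. F (N z)) has_field_derivative deriv F (N z) *
          (2 * \<i> * p / ((p - z) * (p - z)) / (2 * of_real \<tau>))) (at z)"
        by (rule DERIV_chain'[OF dN dF])
      then have "deriv (\<lambda>z. F (N z)) z = deriv F (N z) *
          (2 * \<i> * p / ((p - z) * (p - z)) / (2 * of_real \<tau>))"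
        by (rule DERIV_imp_deriv)
      moreover have "deriv (\<lambda>z. F (N z)) z = deriv f z"
        by (rule deriv_cong_ev[OF eventually_mono[OF eventually_nhds_in_open[of "ball 0 1" z]] refl])
          (use z FN in auto)
      ultimately have "cmod (deriv f z) = cmod (deriv F (N z)) / ((cmod (p - z))\<^sup>2 * \<tau>)"
        using p tau by (simp add: norm_mult norm_divide power2_eq_square)
      then show ?thesis using pz tau by (simp add: field_simps)
    qed
    define k where "k = h (Complex 0 Y) - Complex 0 Y"
    define c where "c = cmod \<gamma>"
    \<comment> \<open>Replacing \<open>h w\<close> by its approximation \<open>w + k\<close> turns
      \<open>\<alpha> - \<gamma> * h w\<close> into
      \<open>\<alpha> - \<gamma> * k - \<gamma> * N z\<close>. Multiplication by
      \<open>p - z\<close> clears the pole of \<open>N\<close> and leaves the affine function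
      \<open>a * z + b\<close>.\<close>
    define a where "a = - (\<alpha> - \<gamma> * k) - \<gamma> * \<i> / (2 * of_real \<tau>)"
    define b where "b = p * (\<alpha> - \<gamma> * k) - p * (\<gamma> * \<i> / (2 * of_real \<tau>))"
    show "\<exists>a b c. c \<ge> 0 \<and> (\<forall>z. cmod z < 1 \<longrightarrow> \<tau> * (cmod (z - p))\<^sup>2 \<le> \<eta> * (1 - (cmod z)\<^sup>2) \<longrightarrow>
          1 \<le> (C0 * M\<^sup>2) * (cmod (deriv f z) * \<tau> * (cmod (a * z + b) + c * cmod (z - p))\<^sup>2) \<and>
          cmod (deriv f z) * \<tau> * (cmod (a * z + b) + c * cmod (z - p))\<^sup>2 \<le> C0 * M\<^sup>2)"
    proof (rule exI[of _ a], rule exI[of _ b], rule exI[of _ c], intro conjI allI impI)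
      show "c \<ge> 0" by (simp add: c_def)
    next
      fix z assume z: "cmod z < 1" and H: "\<tau> * (cmod (z - p))\<^sup>2 \<le> \<eta> * (1 - (cmod z)\<^sup>2)"
      have pz: "p - z \<noteq> 0" using ne[OF z] by simp
      define w where "w = N z"
      define l where "l = \<alpha> - \<gamma> * k - \<gamma> * w"
      define Q where "Q = cmod (\<alpha> - \<gamma> * h w)"
      have wY: "Im w \<ge> Y"
        unfolding w_def ImN[OF ne[OF z]] Y_def using assms tau pz H
        by (simp add: field_simps norm_minus_commute)
      then have w0: "Im w > 0" using Y by linarith
      have L: "a * z + b = (p - z) * l"
      proof -
        have "(p - z) * w = \<i> * (p + z) / (2 * of_real \<tau>)" using pz by (simp add: w_def N_def)
        then have "(p - z) * l = (p - z) * (\<alpha> - \<gamma> * k) - \<gamma> * (\<i> * (p + z) / (2 * of_real \<tau>))"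
          unfolding l_def by (simp add: right_diff_distrib mult.left_commute)
        also have "\<dots> = a * z + b"
          by (simp add: a_def b_def algebra_simps add_divide_distrib)
        finally show ?thesis ..
      qed
      have P: "cmod (a * z + b) + c * cmod (z - p) = cmod (p - z) * (cmod l + c)"
        unfolding L norm_mult by (simp add: norm_minus_commute[of z p] distrib_left mult.commute[of c])
      have hw: "cmod (h w - w - k) \<le> C0"
        unfolding k_def by (rule C0(3)[OF holh injh per wY])
      have dQ: "(\<alpha> - \<gamma> * h w) = l - \<gamma> * (h w - w - k)" by (simp add: l_def algebra_simps)
      have g1: "cmod (\<gamma> * (h w - w - k)) \<le> C0 * c"
        using mult_left_mono[OF hw, of c] by (simp add: c_def norm_mult mult.commute)
      have Q1: "Q \<le> M * (cmod l + c)"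
      proof -
        have "Q \<le> cmod l + C0 * c"
          unfolding Q_def dQ using norm_triangle_ineq4[of l "\<gamma> * (h w - w - k)"] g1 by linarith
        also have "\<dots> \<le> M * cmod l + M * c"
          using M1 CM mult_right_mono[of 1 M "cmod l"] by (intro add_mono mult_right_mono) (auto simp: c_def)
        finally show ?thesis by (simp add: algebra_simps)
      qed
      have Q2: "cmod l + c \<le> M * Q"
      proof -
        \<comment> \<open>\<open>\<alpha> / \<gamma>\<close> is the image of infinity under the
          normalizing map. As \<open>F\<close> is finite, \<open>h\<close> omits this value and so
          keeps a definite distance from it.\<close>
        have cQ: "c \<le> C0 * Q"
        proof (cases "\<gamma> = 0")
          case True
          then show ?thesis using C0(1) by (simp add: c_def Q_def)
        next
          case False
          have "\<alpha> / \<gamma> \<notin> h ` upper_half_plane"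
          proof
            assume "\<alpha> / \<gamma> \<in> h ` upper_half_plane"
            then obtain x where "Im x > 0" "\<alpha> - \<gamma> * h x = 0" using False by (auto simp: field_simps)
            then show False using inv[of x] by simp
          qed
          then have "1 \<le> C0 * cmod (h w - \<alpha> / \<gamma>)" by (intro C0(4) holh injh per wY)
          then have "c * 1 \<le> c * (C0 * cmod (h w - \<alpha> / \<gamma>))" by (intro mult_left_mono) (auto simp: c_def)
          also have "\<dots> = C0 * cmod (\<gamma> * (h w - \<alpha> / \<gamma>))" by (simp add: c_def norm_mult)
          also have "\<gamma> * (h w - \<alpha> / \<gamma>) = - (\<alpha> - \<gamma> * h w)" using False by (simp add: algebra_simps)
          finally show ?thesis by (simp add: Q_def norm_minus_commute)
        qed
        have "cmod l \<le> Q + C0 * c"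
          using norm_triangle_ineq4[of "\<alpha> - \<gamma> * h w" "- (\<gamma> * (h w - w - k))"] g1
          by (simp add: dQ Q_def)
        then have "cmod l + c \<le> Q + (C0 + 1) * c" by (simp add: algebra_simps)
        also have "\<dots> \<le> Q + (C0 + 1) * (C0 * Q)" using C0(1) cQ by (intro add_left_mono mult_left_mono) auto
        also have "\<dots> = M * Q" by (simp add: M_def algebra_simps)
        finally show ?thesis .
      qed
      have c0: "c \<ge> 0" by (simp add: c_def)
      have Q0: "Q \<ge> 0" by (simp add: Q_def)
      define G where "G = cmod (deriv F w)"
      have G0: "G \<ge> 0" by (simp add: G_def)
      have main: "cmod (deriv f z) * \<tau> * (cmod (p - z) * (cmod l + c))\<^sup>2 = G * (cmod l + c)\<^sup>2"
        using df[OF z] by (simp add: G_def w_def power_mult_distrib mult_ac)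
      have GQ: "1 / C0 \<le> G * Q\<^sup>2" "G * Q\<^sup>2 \<le> C0"
        using C0(2)[OF holh injh per wY] dh[OF w0] by (auto simp: G_def Q_def)
      have "G * Q\<^sup>2 \<le> G * (M * (cmod l + c))\<^sup>2"
        using Q1 Q0 G0 by (intro mult_left_mono power_mono)
      then have "C0 * (G * Q\<^sup>2) \<le> C0 * (G * (M * (cmod l + c))\<^sup>2)"
        by (rule mult_left_mono) (use C0(1) in auto)
      moreover have "1 \<le> C0 * (G * Q\<^sup>2)" using GQ(1) C0(1) by (simp add: field_simps)
      ultimately have "1 \<le> C0 * (G * (M * (cmod l + c))\<^sup>2)" by linarith
      moreover have "G * (cmod l + c)\<^sup>2 \<le> C0 * M\<^sup>2"
      proof -
        have "G * (cmod l + c)\<^sup>2 \<le> G * (M * Q)\<^sup>2"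
          using Q2 c0 G0 by (intro mult_left_mono power_mono) auto
        also have "\<dots> = (G * Q\<^sup>2) * M\<^sup>2" by (simp add: power_mult_distrib)
        also have "\<dots> \<le> C0 * M\<^sup>2" using GQ(2) by (intro mult_right_mono) auto
        finally show ?thesis .
      qed
      ultimately show "1 \<le> (C0 * M\<^sup>2) * (cmod (deriv f z) * \<tau> * (cmod (a * z + b) + c * cmod (z - p))\<^sup>2)"
          "cmod (deriv f z) * \<tau> * (cmod (a * z + b) + c * cmod (z - p))\<^sup>2 \<le> C0 * M\<^sup>2"
        unfolding P main by (simp_all add: power_mult_distrib mult_ac)
    qed
  qed
qed

text \<open>A negative translation length is reduced to a positive one by passing to the inverses of
  the parabolic map and of the matrix that it induces.\<close>

lemma parabolic_comparison:
  assumes "\<eta> > 0"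
  obtains K where "K \<ge> 1"
    "\<And>f \<tau> p A' B C D. \<lbrakk>f holomorphic_on ball 0 1; inj_on f (ball 0 1); \<tau> \<noteq> 0; cmod p = 1;
       A' * D - B * C = 1;
       \<And>z. cmod z < 1 \<Longrightarrow> C * f z + D \<noteq> 0 \<and> f (parabolic \<tau> p z) = (A' * f z + B) / (C * f z + D)\<rbrakk>
     \<Longrightarrow> \<exists>a b c. c \<ge> 0 \<and> (\<forall>z. cmod z < 1 \<longrightarrow> \<bar>\<tau>\<bar> * (cmod (z - p))\<^sup>2 \<le> \<eta> * (1 - (cmod z)\<^sup>2) \<longrightarrow>
          1 \<le> K * (cmod (deriv f z) * \<bar>\<tau>\<bar> * (cmod (a * z + b) + c * cmod (z - p))\<^sup>2) \<and>
          cmod (deriv f z) * \<bar>\<tau>\<bar> * (cmod (a * z + b) + c * cmod (z - p))\<^sup>2 \<le> K)"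
proof -
  obtain K where K: "K \<ge> 1"
    "\<And>f \<tau> p A' B C D. \<lbrakk>f holomorphic_on ball 0 1; inj_on f (ball 0 1); \<tau> > 0; cmod p = 1;
       A' * D - B * C = 1;
       \<And>z. cmod z < 1 \<Longrightarrow> C * f z + D \<noteq> 0 \<and> f (parabolic \<tau> p z) = (A' * f z + B) / (C * f z + D)\<rbrakk>
     \<Longrightarrow> \<exists>a b c. c \<ge> 0 \<and> (\<forall>z. cmod z < 1 \<longrightarrow> \<tau> * (cmod (z - p))\<^sup>2 \<le> \<eta> * (1 - (cmod z)\<^sup>2) \<longrightarrow>
          1 \<le> K * (cmod (deriv f z) * \<tau> * (cmod (a * z + b) + c * cmod (z - p))\<^sup>2) \<and>
          cmod (deriv f z) * \<tau> * (cmod (a * z + b) + c * cmod (z - p))\<^sup>2 \<le> K)"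
    using parabolic_comparison_pos[OF assms] by blast
  show thesis
  proof (rule that[OF K(1)])
    fix f :: "complex \<Rightarrow> complex" and \<tau> :: real and p A' B C D :: complex
    assume f: "f holomorphic_on ball 0 1" "inj_on f (ball 0 1)" and tau: "\<tau> \<noteq> 0" and p: "cmod p = 1"
      and det: "A' * D - B * C = 1"
      and conj: "\<And>z. cmod z < 1 \<Longrightarrow> C * f z + D \<noteq> 0 \<and>
        f (parabolic \<tau> p z) = (A' * f z + B) / (C * f z + D)"
    show "\<exists>a b c. c \<ge> 0 \<and> (\<forall>z. cmod z < 1 \<longrightarrow> \<bar>\<tau>\<bar> * (cmod (z - p))\<^sup>2 \<le> \<eta> * (1 - (cmod z)\<^sup>2) \<longrightarrow>
          1 \<le> K * (cmod (deriv f z) * \<bar>\<tau>\<bar> * (cmod (a * z + b) + c * cmod (z - p))\<^sup>2) \<and>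
          cmod (deriv f z) * \<bar>\<tau>\<bar> * (cmod (a * z + b) + c * cmod (z - p))\<^sup>2 \<le> K)"
    proof (cases "\<tau> > 0")
      case True
      then show ?thesis using K(2)[OF f True p det conj] by simp
    next
      case False
      then have t: "- \<tau> > 0" using tau by simp
      have det': "D * A' - (- B) * (- C) = 1" using det by (simp add: algebra_simps)
      have conj': "- C * f z + A' \<noteq> 0 \<and> f (parabolic (- \<tau>) p z) = (D * f z + - B) / (- C * f z + A')"
        if z: "cmod z < 1" for z
      proof -
        have p0: "p \<noteq> 0" "p - z \<noteq> 0" using p z by auto
        define v where "v = \<i> * (p + z) / (p - z)"
        have "Im v > 0"
          unfolding v_def using Im_cayley[OF p, of z] p0 z by (simp add: power_less_one_iff)
        then have nv: "v + \<i> \<noteq> 0" "v - 2 * \<tau> + \<i> \<noteq> 0" "Im (v - 2 * \<tau>) > 0"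
          by (auto simp: complex_eq_iff)
        have zv: "z = p * (v - \<i>) / (v + \<i>)"
        proof -
          have 1: "v - \<i> = \<i> * (2 * z) / (p - z)" using p0 by (simp add: v_def field_simps)
          have 2: "v + \<i> = \<i> * (2 * p) / (p - z)" using p0 by (simp add: v_def field_simps)
          show ?thesis unfolding 1 2 using p0 by simp
        qed
        define y where "y = p * ((v - 2 * \<tau>) - \<i>) / ((v - 2 * \<tau>) + \<i>)"
        have y1: "cmod y < 1" unfolding y_def by (rule cayley_inverse_in_disk[OF p nv(3)])
        have py: "parabolic (- \<tau>) p z = y"
          unfolding zv using parabolic_cayley[OF p, of v "- \<tau>"] nv by (simp add: y_def)
        have "parabolic \<tau> p y = z"
          unfolding zv y_def using parabolic_cayley[OF p, of "v - 2 * \<tau>" \<tau>] nv by simp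
        then have c: "C * f y + D \<noteq> 0" "f z * (C * f y + D) = A' * f y + B"
          using conj[OF y1] by auto
        then have 1: "(- C * f z + A') * (C * f y + D) = 1"
        proof -
          have "(- C * f z + A') * (C * f y + D) = A' * (C * f y + D) - C * (f z * (C * f y + D))"
            by (simp add: algebra_simps)
          also have "\<dots> = A' * D - B * C" unfolding c(2) by (simp add: algebra_simps)
          finally show ?thesis using det by simp
        qed
        have nz: "- C * f z + A' \<noteq> 0" using 1 by auto
        have "f y * (- C * f z + A') = D * f z - B"
          using c(2) by (simp add: algebra_simps)
        then have "f y = (D * f z + - B) / (- C * f z + A')" using nz by (simp add: nonzero_eq_divide_eq)
        then show ?thesis using nz py by simp
      qed
      have T: "\<bar>\<tau>\<bar> = - \<tau>" using False by simp
      show ?thesis unfolding T by (rule K(2)[OF f t p det' conj'])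
    qed
  qed
qed

end

text \<open>The set where the Poisson kernel with pole \<open>p\<close> exceeds
  \<open>|\<tau>| / \<eta>\<close>. The factor \<open>|\<tau>|\<close> measures the horodisk
  relative to the translation length, and larger \<eta> gives a larger horodisk.\<close>

definition horodisk :: "real \<Rightarrow> complex \<Rightarrow> real \<Rightarrow> complex set" where
  "horodisk \<tau> p \<eta> = {z. \<bar>\<tau>\<bar> * (cmod (z - p))\<^sup>2 < \<eta> * (1 - (cmod z)\<^sup>2)}"

lemma horodisk_in_disk: "\<eta> > 0 \<Longrightarrow> z \<in> horodisk \<tau> p \<eta> \<Longrightarrow> cmod z < 1"
proof -
  assume "\<eta> > 0" "z \<in> horodisk \<tau> p \<eta>"
  then have "0 < \<eta> * (1 - (cmod z)\<^sup>2)"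
    unfolding horodisk_def by (auto intro: le_less_trans[rotated])
  then show "cmod z < 1"
    using \<open>\<eta> > 0\<close> by (simp add: zero_less_mult_iff power_less_one_iff)
qed

lemma horodisk_eq_ball:
  assumes "\<tau> \<noteq> 0" "\<eta> > 0" "cmod p = 1"
  defines "k \<equiv> \<eta> / \<bar>\<tau>\<bar>"
  shows "horodisk \<tau> p \<eta> = ball (p / (1 + k)) (k / (1 + k))"
proof (rule Set.set_eqI)
  fix z
  have k: "k > 0" using assms by (simp add: k_def)
  have p2: "(Re p)\<^sup>2 + (Im p)\<^sup>2 = 1" using assms(3) cmod_power2[of p] by simp
  have "z \<in> horodisk \<tau> p \<eta> \<longleftrightarrow> (cmod (z - p))\<^sup>2 < k * (1 - (cmod z)\<^sup>2)"
    using assms(1) by (simp add: horodisk_def k_def field_simps)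
  also have "\<dots> \<longleftrightarrow> (cmod ((1 + k) * z - p))\<^sup>2 < k\<^sup>2"
  proof -
    \<comment> \<open>Completing the square; the last term vanishes because \<open>p\<close> lies on
      the unit circle.\<close>
    have 1: "(cmod ((1 + k) * z - p))\<^sup>2 - k\<^sup>2 = (1 + k) * ((cmod (z - p))\<^sup>2 - k * (1 - (cmod z)\<^sup>2))
        - k * ((Re p)\<^sup>2 + (Im p)\<^sup>2 - 1)"
      unfolding cmod_power2 by (simp add: power2_eq_square algebra_simps)
    have "(cmod ((1 + k) * z - p))\<^sup>2 < k\<^sup>2 \<longleftrightarrow> (1 + k) * ((cmod (z - p))\<^sup>2 - k * (1 - (cmod z)\<^sup>2)) < 0"
      using 1 p2 by auto
    then show ?thesis using k by (auto simp: mult_less_0_iff)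
  qed
  also have "\<dots> \<longleftrightarrow> cmod ((1 + k) * z - p) < k"
    using k by (auto intro: power2_less_imp_less power_strict_mono)
  also have "(1 + k) * z - p = (1 + k) * (z - p / (1 + k))"
  proof -
    have "1 + complex_of_real k \<noteq> 0" using k by (simp add: complex_eq_iff)
    then show ?thesis by (simp add: right_diff_distrib)
  qed
  also have "cmod ((1 + k) * (z - p / (1 + k))) = (1 + k) * cmod (z - p / (1 + k))"
    using k norm_of_real[of "1 + k", where 'a = complex] by (simp add: norm_mult)
  also have "(1 + k) * cmod (z - p / (1 + k)) < k \<longleftrightarrow> cmod (z - p / (1 + k)) < k / (1 + k)"
    using k by (simp add: field_simps)
  finally show "z \<in> horodisk \<tau> p \<eta> \<longleftrightarrow> z \<in> ball (p / (1 + k)) (k / (1 + k))"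
    by (simp add: dist_norm norm_minus_commute)
qed

text \<open>The zero of an affine function may spoil one ball but not both: points of the two balls
  differ by at least 3/4, so small values in both would force first \<open>a\<close> and then
  \<open>b\<close> to be small. Both balls lie inside the unit disk with negative real part, away
  from the point 1 at which the cusp will sit.\<close>

lemma affine_large_on_one_of_two_balls:
  fixes a b :: complex
  obtains u where "u = Complex (-1/4) (1/2) \<or> u = Complex (-1/4) (-1/2)"
    "\<And>x. x \<in> ball u (1/8) \<Longrightarrow> cmod a + cmod b \<le> 8 * cmod (a * x + b)"
proof (cases "\<forall>x\<in>ball (Complex (-1/4) (1/2)) (1/8). cmod a + cmod b \<le> 8 * cmod (a * x + b)")
  case True
  then show ?thesis using that by blast
next
  case False
  then obtain x where x: "x \<in> ball (Complex (-1/4) (1/2)) (1/8)" "8 * cmod (a * x + b) < cmod a + cmod b"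
    by fastforce
  show ?thesis
  proof (rule that[of "Complex (-1/4) (-1/2)"])
    fix y assume y: "y \<in> ball (Complex (-1/4) (-1/2)) (1/8)"
    have "Im x \<ge> 3/8"
      using x(1) abs_Im_le_cmod[of "Complex (-1/4) (1/2) - x"] by (simp add: dist_norm)
    moreover have "Im y \<le> - 3/8"
      using y abs_Im_le_cmod[of "Complex (-1/4) (-1/2) - y"] by (simp add: dist_norm)
    ultimately have d: "cmod (x - y) \<ge> 3/4"
      using abs_Im_le_cmod[of "x - y"] by simp
    have x1: "cmod x \<le> 1"
    proof -
      have "(cmod (Complex (-1/4) (1/2)))\<^sup>2 \<le> (3/4)\<^sup>2"
        unfolding cmod_power2 by (simp add: power2_eq_square)
      then have "cmod (Complex (-1/4) (1/2)) \<le> 3/4" by (rule power2_le_imp_le) simp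
      moreover have "cmod x \<le> cmod (Complex (-1/4) (1/2)) + dist (Complex (-1/4) (1/2)) x"
        by (metis dist_0_norm dist_triangle)
      ultimately show ?thesis using x(1) by simp
    qed
    show "cmod a + cmod b \<le> 8 * cmod (a * y + b)"
    proof (rule ccontr)
      assume "\<not> ?thesis"
      then have y2: "8 * cmod (a * y + b) < cmod a + cmod b" by simp
      have "cmod a * (3/4) \<le> cmod a * cmod (x - y)" using d by (intro mult_left_mono) auto
      also have "\<dots> = cmod ((a * x + b) - (a * y + b))"
        by (simp add: norm_mult[symmetric] right_diff_distrib)
      also have "\<dots> \<le> cmod (a * x + b) + cmod (a * y + b)" by (rule norm_triangle_ineq4)
      finally have 1: "cmod a * (3/4) \<le> cmod (a * x + b) + cmod (a * y + b)" .
      have "cmod b \<le> cmod (a * x + b) + cmod (a * x)"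
        using norm_triangle_ineq4[of "a * x + b" "a * x"] by simp
      also have "cmod (a * x) \<le> cmod a" using x1 by (simp add: norm_mult mult_left_le)
      finally have "cmod b \<le> cmod (a * x + b) + cmod a" by simp
      then show False using 1 x(2) y2 norm_ge_zero[of a] by linarith
    qed
  qed simp
qed

section \<open>Integrals over horodisks and crescents\<close>

lemma emeasure_ball_complex: "r \<ge> 0 \<Longrightarrow> emeasure lborel (ball (c::complex) r) = ennreal (pi * r\<^sup>2)"
  by (simp add: emeasure_ball unit_ball_vol_2)

definition weight_integral :: "real \<Rightarrow> (complex \<Rightarrow> complex) \<Rightarrow> complex set \<Rightarrow> ennreal" where
  "weight_integral q f B = (\<integral>\<^sup>+z\<in>B. ennreal (1 / cmod (deriv f z) powr q) \<partial>lborel)"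

context koebe_constant
begin

text \<open>On the horodisk \<open>|f'| powr (- q)\<close> is comparable to
  \<open>(|\<tau>| * W^2) powr q\<close>. The weight \<open>W\<close> is at most \<open>S\<close>
  throughout and at least \<open>S / 8\<close> on a ball of one eighth of the radius, so the
  supremum times the large area is compared with the infimum times the small one.\<close>

lemma horodisk_integral_bound:
  assumes "\<eta> > 0" "\<tau>0 > 0" "q > 0"
  obtains M \<theta> where "M > 0" "\<theta> > 0"
    "\<And>f \<tau> p A' B C D. \<lbrakk>f holomorphic_on ball 0 1; inj_on f (ball 0 1); \<bar>\<tau>\<bar> \<ge> \<tau>0; cmod p = 1;
       A' * D - B * C = 1;
       \<And>z. cmod z < 1 \<Longrightarrow> C * f z + D \<noteq> 0 \<and> f (parabolic \<tau> p z) = (A' * f z + B) / (C * f z + D)\<rbrakk>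
     \<Longrightarrow> weight_integral q f (horodisk \<tau> p \<eta>)
       \<le> ennreal M * weight_integral q f (horodisk \<tau> p \<eta> - horodisk \<tau> p (\<theta> * \<eta>))"
proof -
  obtain K where K: "K \<ge> 1"
    "\<And>f \<tau> p A' B C D. \<lbrakk>f holomorphic_on ball 0 1; inj_on f (ball 0 1); \<tau> \<noteq> 0; cmod p = 1;
       A' * D - B * C = 1;
       \<And>z. cmod z < 1 \<Longrightarrow> C * f z + D \<noteq> 0 \<and> f (parabolic \<tau> p z) = (A' * f z + B) / (C * f z + D)\<rbrakk>
     \<Longrightarrow> \<exists>a b c. c \<ge> 0 \<and> (\<forall>z. cmod z < 1 \<longrightarrow> \<bar>\<tau>\<bar> * (cmod (z - p))\<^sup>2 \<le> \<eta> * (1 - (cmod z)\<^sup>2) \<longrightarrow>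
          1 \<le> K * (cmod (deriv f z) * \<bar>\<tau>\<bar> * (cmod (a * z + b) + c * cmod (z - p))\<^sup>2) \<and>
          cmod (deriv f z) * \<bar>\<tau>\<bar> * (cmod (a * z + b) + c * cmod (z - p))\<^sup>2 \<le> K)"
    using parabolic_comparison[OF assms(1)] by blast
  \<comment> \<open>Points of the chosen ball have distance at least \<open>r = k / (1 + k)\<close>
    from \<open>p\<close>, whereas the smaller horodisk lies within \<open>2 * \<theta> * k\<close>
    of \<open>p\<close>. This \<theta> makes \<open>2 * \<theta> <= 1 / (1 + k)\<close> for every
    \<open>k <= \<eta> / \<tau>0\<close>.\<close>
  define \<theta> where "\<theta> = 1 / (2 * (1 + \<eta> / \<tau>0))"
  have et: "\<eta> / \<tau>0 > 0" using assms by simp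
  then have th: "\<theta> > 0" unfolding \<theta>_def by simp
  \<comment> \<open>The first 64 is the ratio of the areas, the second the square of the loss 8 in
    \<open>W\<close>; \<open>K\<close> enters once from each side of the comparison.\<close>
  define M where "M = 64 * (64 * K\<^sup>2) powr q"
  have M0: "M > 0" using K(1) by (simp add: M_def)
  show thesis
  proof (rule that[OF M0 th])
    fix f :: "complex \<Rightarrow> complex" and \<tau> :: real and p A' B C D :: complex
    assume f: "f holomorphic_on ball 0 1" "inj_on f (ball 0 1)" and tau: "\<bar>\<tau>\<bar> \<ge> \<tau>0" and p: "cmod p = 1"
      and det: "A' * D - B * C = 1"
      and conj: "\<And>z. cmod z < 1 \<Longrightarrow> C * f z + D \<noteq> 0 \<and>
        f (parabolic \<tau> p z) = (A' * f z + B) / (C * f z + D)"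
    have t0: "\<tau> \<noteq> 0" using tau assms by auto
    define H where "H = horodisk \<tau> p \<eta>"
    define \<phi> where "\<phi> = (\<lambda>z. 1 / cmod (deriv f z) powr q)"
    have "\<exists>a b c. c \<ge> 0 \<and> (\<forall>z. cmod z < 1 \<longrightarrow> \<bar>\<tau>\<bar> * (cmod (z - p))\<^sup>2 \<le> \<eta> * (1 - (cmod z)\<^sup>2) \<longrightarrow>
          1 \<le> K * (cmod (deriv f z) * \<bar>\<tau>\<bar> * (cmod (a * z + b) + c * cmod (z - p))\<^sup>2) \<and>
          cmod (deriv f z) * \<bar>\<tau>\<bar> * (cmod (a * z + b) + c * cmod (z - p))\<^sup>2 \<le> K)"
      by (rule K(2)[OF f t0 p det conj])
    then obtain a b c where c: "c \<ge> 0" and abc0: "(\<forall>z. cmod z < 1 \<longrightarrow> \<bar>\<tau>\<bar> * (cmod (z - p))\<^sup>2 \<le> \<eta> * (1 - (cmod z)\<^sup>2) \<longrightarrow>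
          1 \<le> K * (cmod (deriv f z) * \<bar>\<tau>\<bar> * (cmod (a * z + b) + c * cmod (z - p))\<^sup>2) \<and>
          cmod (deriv f z) * \<bar>\<tau>\<bar> * (cmod (a * z + b) + c * cmod (z - p))\<^sup>2 \<le> K)"
      by blast
    have abc: "\<And>z. z \<in> H \<Longrightarrow> 1 \<le> K * (cmod (deriv f z) * \<bar>\<tau>\<bar> * (cmod (a * z + b) + c * cmod (z - p))\<^sup>2) \<and>
          cmod (deriv f z) * \<bar>\<tau>\<bar> * (cmod (a * z + b) + c * cmod (z - p))\<^sup>2 \<le> K"
      using abc0 horodisk_in_disk[OF assms(1)] unfolding H_def
      by (metis (mono_tags, lifting) horodisk_def less_imp_le mem_Collect_eq)
    define W where "W = (\<lambda>z. cmod (a * z + b) + c * cmod (z - p))"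
    have lower: "(\<bar>\<tau>\<bar> * (W z)\<^sup>2 / K) powr q \<le> \<phi> z" and upper: "\<phi> z \<le> (K * \<bar>\<tau>\<bar> * (W z)\<^sup>2) powr q"
      if z: "z \<in> H" for z
    proof -
      define d where "d = cmod (deriv f z)"
      have 1: "1 \<le> K * (d * \<bar>\<tau>\<bar> * (W z)\<^sup>2)" "d * \<bar>\<tau>\<bar> * (W z)\<^sup>2 \<le> K"
        using abc[OF z] by (auto simp: d_def W_def)
      have d0: "d > 0"
      proof (rule ccontr)
        assume "\<not> d > 0"
        then have "d = 0" by (simp add: d_def)
        then show False using 1(1) by simp
      qed
      have e: "\<phi> z = (1 / d) powr q" using d0 by (simp add: \<phi>_def d_def powr_divide)
      have "\<bar>\<tau>\<bar> * (W z)\<^sup>2 / K \<le> 1 / d" "1 / d \<le> K * \<bar>\<tau>\<bar> * (W z)\<^sup>2"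
        using 1 d0 K(1) by (auto simp: field_simps)
      then show "(\<bar>\<tau>\<bar> * (W z)\<^sup>2 / K) powr q \<le> \<phi> z" "\<phi> z \<le> (K * \<bar>\<tau>\<bar> * (W z)\<^sup>2) powr q"
        unfolding e using d0 K(1) assms(3) by (auto intro!: powr_mono2)
    qed
    define k where "k = \<eta> / \<bar>\<tau>\<bar>"
    have k: "k > 0" "k \<le> \<eta> / \<tau>0"
      using assms tau t0 by (auto simp: k_def intro!: divide_left_mono)
    define r where "r = k / (1 + k)"
    define z0 where "z0 = p / (1 + k)"
    have r: "r > 0" using k by (simp add: r_def)
    have Hball: "H = ball z0 r"
      unfolding H_def z0_def r_def k_def by (rule horodisk_eq_ball[OF t0 assms(1) p])
    have z0p: "z0 - p = - (r * p)"
    proof -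
      have n: "1 + complex_of_real k \<noteq> 0" using k by (simp add: complex_eq_iff)
      show ?thesis unfolding z0_def r_def using n by (simp add: field_simps)
    qed
    define S where "S = cmod (a * (r * p)) + cmod (a * z0 + b) + 2 * c * r"
    have S0: "S \<ge> 0" using c r by (simp add: S_def)
    \<comment> \<open>Rescales the horodisk to the unit disk, with the cusp \<open>p\<close> at
      1.\<close>
    define u where "u = (\<lambda>z. (z - z0) / (r * p))"
    have p0: "p \<noteq> 0" using p by auto
    have zu: "z = z0 + r * p * u z" for z using r p0 by (simp add: u_def)
    have au: "a * z + b = (a * (r * p)) * u z + (a * z0 + b)" for z
      by (subst zu[of z]) (simp add: algebra_simps)
    have pu: "z - p = r * p * (u z - 1)" for z
    proof -
      have "z - p = (z0 - p) + r * p * u z" by (subst zu[of z]) simp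
      then show ?thesis unfolding z0p by (simp add: algebra_simps)
    qed
    have pu': "cmod (z - p) = r * cmod (u z - 1)" for z
      unfolding pu[of z] using r p by (simp add: norm_mult)
    have W1: "W z \<le> S" if z: "z \<in> H" for z
    proof -
      have u1: "cmod (u z) \<le> 1"
        using z r p by (simp add: Hball u_def norm_divide norm_mult dist_norm norm_minus_commute)
      have "cmod (a * z + b) \<le> cmod (a * (r * p)) * cmod (u z) + cmod (a * z0 + b)"
        unfolding au[of z] norm_mult[symmetric] by (rule norm_triangle_ineq)
      also have "\<dots> \<le> cmod (a * (r * p)) + cmod (a * z0 + b)"
        using u1 by (intro add_right_mono mult_left_le) auto
      finally have 1: "cmod (a * z + b) \<le> cmod (a * (r * p)) + cmod (a * z0 + b)" .
      have "cmod (u z - 1) \<le> 2" using norm_triangle_ineq4[of "u z" 1] u1 by simp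
      then have "c * cmod (z - p) \<le> c * (r * 2)"
        unfolding pu' using c r by (intro mult_left_mono) auto
      then show ?thesis using 1 by (simp add: W_def S_def)
    qed
    obtain u0 where u0: "u0 = Complex (-1/4) (1/2) \<or> u0 = Complex (-1/4) (-1/2)"
      "\<And>x. x \<in> ball u0 (1/8) \<Longrightarrow> cmod (a * (r * p)) + cmod (a * z0 + b) \<le> 8 * cmod ((a * (r * p)) * x + (a * z0 + b))"
      using affine_large_on_one_of_two_balls by blast
    define \<Delta> where "\<Delta> = ball (z0 + r * p * u0) (r / 8)"
    have uD: "u z \<in> ball u0 (1/8)" if "z \<in> \<Delta>" for z
    proof -
      have "z0 + r * p * u0 - z = r * p * (u0 - u z)"
        by (subst zu[of z]) (simp add: algebra_simps)
      then have "r * cmod (u0 - u z) < r / 8"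
        using that r p by (simp add: \<Delta>_def dist_norm norm_mult)
      then show ?thesis using r by (simp add: dist_norm field_simps)
    qed
    have u0n: "cmod u0 \<le> 3/4"
    proof -
      have "(cmod u0)\<^sup>2 \<le> (3/4)\<^sup>2"
        using u0(1) unfolding cmod_power2 by (auto simp: power2_eq_square)
      then show ?thesis by (rule power2_le_imp_le) simp
    qed
    have DH: "z \<in> H" if "z \<in> \<Delta>" for z
    proof -
      have "cmod (u z) \<le> cmod u0 + dist u0 (u z)" by (metis dist_0_norm dist_triangle)
      then have "cmod (u z) < 1" using uD[OF that] u0n by simp
      then show ?thesis
        using r p by (simp add: Hball u_def norm_divide norm_mult dist_norm norm_minus_commute)
    qed
    have pD: "cmod (u z - 1) \<ge> 1" if "z \<in> \<Delta>" for z
    proof -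
      have "Re (u z) \<le> 0"
        using uD[OF that] u0(1) abs_Re_le_cmod[of "u0 - u z"] by (auto simp: dist_norm)
      then show ?thesis using abs_Re_le_cmod[of "u z - 1"] by simp
    qed
    have W2: "S \<le> 8 * W z" if z: "z \<in> \<Delta>" for z
    proof -
      have "c * r \<le> c * cmod (z - p)"
        unfolding pu' using pD[OF z] c r by (intro mult_left_mono) auto
      moreover have "c * cmod (z - p) \<ge> 0" using c by simp
      ultimately show ?thesis using u0(2)[OF uD[OF z]] unfolding W_def S_def au[of z] by simp
    qed
    have Dsub: "\<Delta> \<subseteq> H - horodisk \<tau> p (\<theta> * \<eta>)"
    proof
      fix z assume z: "z \<in> \<Delta>"
      have "z \<notin> horodisk \<tau> p (\<theta> * \<eta>)"
      proof
        assume "z \<in> horodisk \<tau> p (\<theta> * \<eta>)"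
        then have 1: "(cmod (z - p))\<^sup>2 < \<theta> * k * (1 - (cmod z)\<^sup>2)"
          using t0 by (simp add: horodisk_def k_def field_simps)
        have z1: "cmod z < 1" using horodisk_in_disk[OF assms(1)] DH[OF z] by (simp add: H_def)
        have rz: "r \<le> cmod (z - p)" unfolding pu' using pD[OF z] r by simp
        have "1 - (cmod z)\<^sup>2 = (1 - cmod z) * (1 + cmod z)" by (simp add: power2_eq_square algebra_simps)
        also have "\<dots> \<le> cmod (z - p) * 2"
          using z1 norm_triangle_sub[of p z] p by (intro mult_mono) (auto simp: norm_minus_commute)
        finally have "\<theta> * k * (1 - (cmod z)\<^sup>2) \<le> \<theta> * k * (cmod (z - p) * 2)"
          using th k by (intro mult_left_mono) auto
        then have "cmod (z - p) * cmod (z - p) < cmod (z - p) * (2 * \<theta> * k)"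
          using 1 by (simp add: power2_eq_square mult_ac)
        then have "cmod (z - p) < 2 * \<theta> * k"
          by (rule mult_left_less_imp_less) simp
        then have "r < 2 * \<theta> * k" using rz by linarith
        then have "k * (1 / (1 + k)) < k * (2 * \<theta>)" by (simp add: r_def mult_ac)
        then have "1 / (1 + k) < 2 * \<theta>"
          by (rule mult_left_less_imp_less) (use k in simp)
        also have "2 * \<theta> = 1 / (1 + \<eta> / \<tau>0)"
          unfolding \<theta>_def by (simp only: times_divide_eq_right mult_divide_mult_cancel_left_if) simp
        also have "\<dots> \<le> 1 / (1 + k)" using k by (intro divide_left_mono) (auto simp: add_pos_pos)
        finally show False by simp
      qed
      then show "z \<in> H - horodisk \<tau> p (\<theta> * \<eta>)" using DH[OF z] by simp
    qed
    define U where "U = (K * \<bar>\<tau>\<bar> * S\<^sup>2) powr q"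
    define L where "L = (\<bar>\<tau>\<bar> * (S / 8)\<^sup>2 / K) powr q"
    have UL: "U = (64 * K\<^sup>2) powr q * L"
    proof -
      have e: "K * \<bar>\<tau>\<bar> * S\<^sup>2 = (64 * K\<^sup>2) * (\<bar>\<tau>\<bar> * (S / 8)\<^sup>2 / K)"
        using K(1) by (simp add: power2_eq_square)
      show ?thesis unfolding U_def L_def e by (rule powr_mult)
    qed
    have "(\<integral>\<^sup>+z\<in>H. ennreal (\<phi> z) \<partial>lborel) \<le> (\<integral>\<^sup>+z. ennreal U * indicator H z \<partial>lborel)"
    proof (rule nn_integral_mono)
      fix z show "ennreal (\<phi> z) * indicator H z \<le> ennreal U * indicator H z"
      proof (cases "z \<in> H")
        case True
        have "(K * \<bar>\<tau>\<bar> * (W z)\<^sup>2) powr q \<le> U"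
          unfolding U_def using K(1) W1[OF True] assms(3) c
          by (intro powr_mono2 mult_left_mono power_mono) (auto simp: W_def)
        then show ?thesis using upper[OF True] True by (auto intro!: ennreal_leI)
      qed simp
    qed
    also have "\<dots> = ennreal U * ennreal (pi * r\<^sup>2)"
      using r by (simp add: nn_integral_cmult_indicator Hball emeasure_ball_complex)
    also have "\<dots> = ennreal M * (ennreal L * ennreal (pi * (r / 8)\<^sup>2))"
      unfolding UL M_def by (simp add: ennreal_mult'[symmetric] power2_eq_square L_def)
    finally have 1: "(\<integral>\<^sup>+z\<in>H. ennreal (\<phi> z) \<partial>lborel) \<le>
      ennreal M * (ennreal L * ennreal (pi * (r / 8)\<^sup>2))" .
    have "ennreal L * ennreal (pi * (r / 8)\<^sup>2) = (\<integral>\<^sup>+z. ennreal L * indicator \<Delta> z \<partial>lborel)"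
      using r by (simp add: nn_integral_cmult_indicator \<Delta>_def emeasure_ball_complex)
    also have "\<dots> \<le> (\<integral>\<^sup>+z\<in>H - horodisk \<tau> p (\<theta> * \<eta>). ennreal (\<phi> z) \<partial>lborel)"
    proof (rule nn_integral_mono)
      fix z show "ennreal L * indicator \<Delta> z \<le> ennreal (\<phi> z) * indicator (H - horodisk \<tau> p (\<theta> * \<eta>)) z"
      proof (cases "z \<in> \<Delta>")
        case True
        have "L \<le> (\<bar>\<tau>\<bar> * (W z)\<^sup>2 / K) powr q"
          unfolding L_def using K(1) W2[OF True] assms(3) S0
          by (intro powr_mono2 divide_right_mono mult_left_mono power_mono) auto
        then have "L \<le> \<phi> z" using lower[OF DH[OF True]] by simp
        then show ?thesis using True Dsub by (auto intro!: ennreal_leI simp: indicator_def)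
      qed simp
    qed
    finally have 2: "ennreal L * ennreal (pi * (r / 8)\<^sup>2) \<le>
      (\<integral>\<^sup>+z\<in>H - horodisk \<tau> p (\<theta> * \<eta>). ennreal (\<phi> z) \<partial>lborel)" .
    show "weight_integral q f (horodisk \<tau> p \<eta>)
       \<le> ennreal M * weight_integral q f (horodisk \<tau> p \<eta> - horodisk \<tau> p (\<theta> * \<eta>))"
      using order_trans[OF 1 mult_left_mono[OF 2, of "ennreal M"]] unfolding H_def \<phi>_def weight_integral_def by simp
  qed
qed

end

section \<open>The group SU(1,1)\<close>

text \<open>\<open>Sq a b\<close> stands for the matrix with rows \<open>(a, b)\<close> and \<open>(cnj b, cnj a)\<close>; these matrices form
  a real algebra, and those of determinant \<open>1\<close> are the group \<open>SU(1,1)\<close>.\<close>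

datatype sq = Sq (sa: complex) (sb: complex)

lemma sq_eq_iff: "x = y \<longleftrightarrow> sa x = sa y \<and> sb x = sb y"
  by (metis sq.collapse)

instantiation sq :: ring_1
begin

definition "0 = Sq 0 0"
definition "1 = Sq 1 0"
definition "x + y = Sq (sa x + sa y) (sb x + sb y)"
definition "x - y = Sq (sa x - sa y) (sb x - sb y)"
definition "- x = Sq (- sa x) (- sb x)"
definition "x * y = Sq (sa x * sa y + sb x * cnj (sb y)) (sa x * sb y + sb x * cnj (sa y))"

instance
  by standard (auto simp: sq_eq_iff zero_sq_def one_sq_def plus_sq_def minus_sq_def uminus_sq_def
      times_sq_def algebra_simps)

end

lemma sq_sel [simp]:
  "sa 0 = 0" "sb 0 = 0" "sa 1 = 1" "sb 1 = 0"
  "sa (x + y) = sa x + sa y" "sb (x + y) = sb x + sb y"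
  "sa (x - y) = sa x - sa y" "sb (x - y) = sb x - sb y"
  "sa (- x) = - sa x" "sb (- x) = - sb x"
  "sa (x * y) = sa x * sa y + sb x * cnj (sb y)"
  "sb (x * y) = sa x * sb y + sb x * cnj (sa y)"
  by (simp_all add: zero_sq_def one_sq_def plus_sq_def minus_sq_def uminus_sq_def times_sq_def)

text \<open>\<open>Sq a b\<close> can be read as the real-linear map taking \<open>z\<close> to
  \<open>a * z + b * cnj z\<close>; the product is composition, \<open>sqn\<close> the operator
  norm, \<open>sqdet\<close> the determinant and \<open>adj\<close> the adjugate, which is the
  inverse for determinant 1.\<close>

definition sqn :: "sq \<Rightarrow> real" where "sqn x = cmod (sa x) + cmod (sb x)"
definition sqdet :: "sq \<Rightarrow> real" where "sqdet x = (cmod (sa x))\<^sup>2 - (cmod (sb x))\<^sup>2"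
definition adj :: "sq \<Rightarrow> sq" where "adj x = Sq (cnj (sa x)) (- sb x)"
definition sreal :: "real \<Rightarrow> sq" where "sreal r = Sq (of_real r) 0"

lemma adj_sel [simp]: "sa (adj x) = cnj (sa x)" "sb (adj x) = - sb x"
  by (simp_all add: adj_def)

lemma sreal_sel [simp]: "sa (sreal r) = of_real r" "sb (sreal r) = 0"
  by (simp_all add: sreal_def)

lemma sreal_commute: "x * sreal r = sreal r * x"
  by (simp add: sq_eq_iff)

lemma sqn_nonneg [simp]: "sqn x \<ge> 0"
  by (simp add: sqn_def)

lemma sqn_eq_0 [simp]: "sqn x = 0 \<longleftrightarrow> x = 0"
  by (auto simp: sqn_def sq_eq_iff add_nonneg_eq_0_iff)

lemma sqn_1 [simp]: "sqn 1 = 1"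
  by (simp add: sqn_def)

lemma sqn_adj [simp]: "sqn (adj x) = sqn x"
  by (simp add: sqn_def)

lemma sqn_sreal [simp]: "sqn (sreal r) = \<bar>r\<bar>"
  by (simp add: sqn_def)

lemma sqn_sreal_mult: "sqn (sreal r * x) = \<bar>r\<bar> * sqn x"
  by (simp add: sqn_def norm_mult algebra_simps)

lemma sqn_triangle: "sqn (x + y) \<le> sqn x + sqn y"
  using norm_triangle_ineq[of "sa x" "sa y"] norm_triangle_ineq[of "sb x" "sb y"]
  by (simp add: sqn_def)

lemma sqn_triangle4: "sqn (x - y) \<le> sqn x + sqn y"
  using norm_triangle_ineq4[of "sa x" "sa y"] norm_triangle_ineq4[of "sb x" "sb y"]
  by (simp add: sqn_def)

lemma sqn_mult: "sqn (x * y) \<le> sqn x * sqn y"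
  using norm_triangle_ineq[of "sa x * sa y" "sb x * cnj (sb y)"]
    norm_triangle_ineq[of "sa x * sb y" "sb x * cnj (sa y)"]
  by (simp add: sqn_def norm_mult algebra_simps)

lemma sqdet_mult: "sqdet (x * y) = sqdet x * sqdet y"
  unfolding sqdet_def cmod_power2 by (simp add: power2_eq_square algebra_simps)

lemma sqdet_simps [simp]:
  "sqdet 1 = 1" "sqdet 0 = 0" "sqdet (- x) = sqdet x" "sqdet (adj x) = sqdet x"
  "sqdet (sreal r) = r\<^sup>2"
  by (simp_all add: sqdet_def)

lemma adj_adj [simp]: "adj (adj x) = x"
  by (simp add: sq_eq_iff)

lemma adj_mult: "adj (x * y) = adj y * adj x"
  by (simp add: sq_eq_iff algebra_simps)

lemma mult_adj: "x * adj x = sreal (sqdet x)" "adj x * x = sreal (sqdet x)"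
  by (simp_all add: sq_eq_iff sqdet_def complex_norm_square[symmetric] mult.commute flip: of_real_mult of_real_diff)
     (simp_all add: complex_norm_square)

lemma sreal_1 [simp]: "sreal 1 = 1" "sreal 0 = 0"
  by (simp_all add: sq_eq_iff)

lemma su_inverse: "sqdet x = 1 \<Longrightarrow> x * adj x = 1" "sqdet x = 1 \<Longrightarrow> adj x * x = 1"
  by (simp_all add: mult_adj)

lemma su_norms:
  assumes "sqdet x = 1"
  shows "cmod (sa x) \<ge> 1" "cmod (sb x) < cmod (sa x)" "(cmod (sa x))\<^sup>2 = 1 + (cmod (sb x))\<^sup>2"
proof -
  show e: "(cmod (sa x))\<^sup>2 = 1 + (cmod (sb x))\<^sup>2" using assms by (simp add: sqdet_def)
  show "cmod (sa x) \<ge> 1" by (rule power2_le_imp_le) (use e in auto)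
  show "cmod (sb x) < cmod (sa x)" by (rule power2_less_imp_less) (use e in auto)
qed

text \<open>The factor of automorphy: for determinant 1 the derivative of \<open>act x\<close> at
  \<open>z\<close> is the inverse square of \<open>autom x z\<close>.\<close>

definition autom :: "sq \<Rightarrow> complex \<Rightarrow> complex" where
  "autom x z = cnj (sb x) * z + cnj (sa x)"

definition act :: "sq \<Rightarrow> complex \<Rightarrow> complex" where
  "act x z = (sa x * z + sb x) / autom x z"

lemma autom_bounds:
  assumes "cmod z \<le> 1"
  shows "cmod (sa x) - cmod (sb x) * cmod z \<le> cmod (autom x z)"
    "cmod (autom x z) \<le> cmod (sa x) + cmod (sb x) * cmod z"
    "cmod (autom x z) \<le> sqn x"
proof -
  show "cmod (sa x) - cmod (sb x) * cmod z \<le> cmod (autom x z)"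
    using norm_diff_ineq[of "cnj (sa x)" "cnj (sb x) * z"]
    by (simp add: autom_def norm_mult add.commute)
  show 1: "cmod (autom x z) \<le> cmod (sa x) + cmod (sb x) * cmod z"
    using norm_triangle_ineq[of "cnj (sb x) * z" "cnj (sa x)"]
    by (simp add: autom_def norm_mult add.commute)
  show "cmod (autom x z) \<le> sqn x"
    using 1 mult_left_le[OF assms norm_ge_zero[of "sb x"]] by (simp add: sqn_def)
qed

lemma autom_nonzero:
  assumes "sqdet x = 1" "cmod z \<le> 1"
  shows "autom x z \<noteq> 0"
  using autom_bounds(1)[OF assms(2), of x] su_norms(2)[OF assms(1)]
    mult_left_le[OF assms(2) norm_ge_zero[of "sb x"]] by auto

lemma one_minus_act:
  assumes "sqdet x = 1" "cmod z \<le> 1"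
  shows "1 - (cmod (act x z))\<^sup>2 = (1 - (cmod z)\<^sup>2) / (cmod (autom x z))\<^sup>2"
proof -
  have nz: "(cmod (autom x z))\<^sup>2 \<noteq> 0" using autom_nonzero[OF assms] by simp
  have "(cmod (autom x z))\<^sup>2 - (cmod (sa x * z + sb x))\<^sup>2 = sqdet x * (1 - (cmod z)\<^sup>2)"
    unfolding autom_def sqdet_def cmod_power2 by (simp add: power2_eq_square algebra_simps)
  then have "(cmod (autom x z))\<^sup>2 - (cmod (sa x * z + sb x))\<^sup>2 = 1 - (cmod z)\<^sup>2"
    using assms by simp
  moreover have "(cmod (act x z))\<^sup>2 = (cmod (sa x * z + sb x))\<^sup>2 / (cmod (autom x z))\<^sup>2"
    by (simp add: act_def norm_divide power_divide)
  ultimately show ?thesis using nz by (simp add: field_simps)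
qed

lemma act_in_disk:
  assumes "sqdet x = 1" "cmod z < 1"
  shows "cmod (act x z) < 1"
proof -
  have "0 < (1 - (cmod z)\<^sup>2) / (cmod (autom x z))\<^sup>2"
    using assms autom_nonzero[OF assms(1), of z] by (simp add: power_less_one_iff)
  then have "(cmod (act x z))\<^sup>2 < 1"
    using one_minus_act[OF assms(1), of z] assms by simp
  then show ?thesis by (simp add: power_less_one_iff)
qed

lemma act_mult:
  assumes "sqdet y = 1" "cmod z < 1"
  shows "act (x * y) z = act x (act y z)" "autom (x * y) z = autom x (act y z) * autom y z"
proof -
  have nz: "autom y z \<noteq> 0" using autom_nonzero assms by auto
  have e: "act y z * autom y z = sa y * z + sb y" using nz by (simp add: act_def)
  have "autom x (act y z) * autom y z = cnj (sb x) * (act y z * autom y z) + cnj (sa x) * autom y z"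
    by (simp add: autom_def algebra_simps)
  also have "\<dots> = autom (x * y) z" unfolding e by (simp add: autom_def algebra_simps)
  finally show 1: "autom (x * y) z = autom x (act y z) * autom y z" ..
  have "(sa x * act y z + sb x) * autom y z = sa x * (act y z * autom y z) + sb x * autom y z"
    by (simp add: algebra_simps)
  also have "\<dots> = sa (x * y) * z + sb (x * y)" unfolding e by (simp add: autom_def algebra_simps)
  finally have 2: "sa (x * y) * z + sb (x * y) = (sa x * act y z + sb x) * autom y z" ..
  show "act (x * y) z = act x (act y z)"
    using nz unfolding act_def[of "x * y"] 1 2 unfolding act_def[of x] by simp
qed

lemma act_1 [simp]: "act 1 z = z"
  by (simp add: act_def autom_def)

lemma act_adj:
  assumes "sqdet x = 1" "cmod z < 1"
  shows "act (adj x) (act x z) = z" "act x (act (adj x) z) = z"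
  using act_mult(1)[OF assms, of "adj x"] act_mult(1)[of "adj x" z x] su_inverse[OF assms(1)] assms
  by simp_all

lemma act_diff:
  assumes "sqdet x = 1" "cmod z < 1" "cmod w < 1"
  shows "act x z - act x w = (z - w) / (autom x z * autom x w)"
proof -
  have nz: "autom x z \<noteq> 0" "autom x w \<noteq> 0" using autom_nonzero assms by auto
  have "complex_of_real (sqdet x) = sa x * cnj (sa x) - sb x * cnj (sb x)"
    by (simp add: sqdet_def complex_norm_square of_real_diff del: of_real_power)
  then have d: "sa x * cnj (sa x) - sb x * cnj (sb x) = 1" using assms by simp
  have "(sa x * z + sb x) * autom x w - (sa x * w + sb x) * autom x z =
      (sa x * cnj (sa x) - sb x * cnj (sb x)) * (z - w)"
    by (simp add: autom_def algebra_simps)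
  then show ?thesis
    unfolding act_def d using nz by (simp add: diff_frac_eq)
qed

lemma act_has_derivative:
  assumes "sqdet x = 1" "cmod z < 1"
  shows "(act x has_field_derivative 1 / (autom x z)\<^sup>2) (at z)"
proof -
  have nz: "autom x z \<noteq> 0" using autom_nonzero assms by auto
  have "complex_of_real (sqdet x) = sa x * cnj (sa x) - sb x * cnj (sb x)"
    by (simp add: sqdet_def complex_norm_square of_real_diff del: of_real_power)
  then have d: "sa x * cnj (sa x) - sb x * cnj (sb x) = 1" using assms by simp
  have "((\<lambda>z. (sa x * z + sb x) / (cnj (sb x) * z + cnj (sa x))) has_field_derivative
      (sa x * (cnj (sb x) * z + cnj (sa x)) - (sa x * z + sb x) * cnj (sb x)) /
      ((cnj (sb x) * z + cnj (sa x)) * (cnj (sb x) * z + cnj (sa x)))) (at z)"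
    using nz by (auto intro!: derivative_eq_intros simp: autom_def)
  also have "sa x * (cnj (sb x) * z + cnj (sa x)) - (sa x * z + sb x) * cnj (sb x) =
      sa x * cnj (sa x) - sb x * cnj (sb x)"
    by (simp add: algebra_simps)
  finally show ?thesis
    unfolding d by (simp add: act_def[abs_def] autom_def power2_eq_square)
qed

section \<open>Recentring at a point of the disk\<close>

definition to_zero :: "complex \<Rightarrow> sq" where
  "to_zero z = (let s = 1 / sqrt (1 - (cmod z)\<^sup>2) in Sq (of_real s) (- (of_real s * z)))"

lemma to_zero:
  assumes "cmod z < 1"
  shows "sqdet (to_zero z) = 1" "act (to_zero z) z = 0" "act (adj (to_zero z)) 0 = z"
proof -
  define s where "s = 1 / sqrt (1 - (cmod z)\<^sup>2)"
  have p: "1 - (cmod z)\<^sup>2 > 0" using assms by (simp add: power_less_one_iff)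
  have s: "s > 0" "s\<^sup>2 * (1 - (cmod z)\<^sup>2) = 1" using p by (simp_all add: s_def power_divide)
  have t: "to_zero z = Sq (of_real s) (- (of_real s * z))" by (simp add: to_zero_def s_def Let_def)
  show "sqdet (to_zero z) = 1"
    using s by (simp add: t sqdet_def norm_mult power_mult_distrib algebra_simps)
  show "act (to_zero z) z = 0" by (simp add: t act_def)
  show "act (adj (to_zero z)) 0 = z" using s by (simp add: t act_def autom_def)
qed

text \<open>The element \<open>x\<close> as seen from \<open>z\<close>: conjugation brings
  \<open>z\<close> to the origin, so closeness of \<open>based z x\<close> to 1 says that
  \<open>x\<close> hardly moves the surroundings of \<open>z\<close>.\<close>

definition based :: "complex \<Rightarrow> sq \<Rightarrow> sq" where
  "based z x = to_zero z * x * adj (to_zero z)"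

text \<open>The numerator is the quadratic polynomial of the fixed-point equation of
  \<open>act x\<close>.\<close>

lemma sb_based:
  assumes "cmod z < 1"
  shows "sb (based z x) = (sb x + (sa x - cnj (sa x)) * z - cnj (sb x) * z\<^sup>2) / of_real (1 - (cmod z)\<^sup>2)"
proof -
  define s where "s = 1 / sqrt (1 - (cmod z)\<^sup>2)"
  have p: "1 - (cmod z)\<^sup>2 > 0" using assms by (simp add: power_less_one_iff)
  have s: "s * s = 1 / (1 - (cmod z)\<^sup>2)" using p by (simp add: s_def)
  have t: "to_zero z = Sq (of_real s) (- (of_real s * z))" by (simp add: to_zero_def s_def Let_def)
  have "sb (based z x) = of_real (s * s) * (sb x + (sa x - cnj (sa x)) * z - cnj (sb x) * z\<^sup>2)"
    by (simp add: based_def t algebra_simps power2_eq_square)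
  then show ?thesis unfolding s by simp
qed

lemma based_simps:
  assumes "cmod z < 1"
  shows "based z (x * y) = based z x * based z y" "based z (x - y) = based z x - based z y"
    "based z (x + y) = based z x + based z y" "based z (- x) = - based z x"
    "based z (sreal r * x) = sreal r * based z x"
    "based z 1 = 1" "based z (adj x) = adj (based z x)" "sqdet (based z x) = sqdet x"
    "based z (sreal r) = sreal r"
proof -
  note i = su_inverse[OF to_zero(1)[OF assms]]
  show "based z (x * y) = based z x * based z y"
    unfolding based_def by (metis i(2) mult.assoc mult.left_neutral)
  show 1: "based z (sreal r * x) = sreal r * based z x" for x
    unfolding based_def by (metis mult.assoc sreal_commute)
  show b1: "based z 1 = 1" by (simp add: based_def i)
  show "based z (sreal r) = sreal r" using 1[of 1] b1 by simp
qed (simp_all add: based_def algebra_simps adj_mult sqdet_mult to_zero[OF assms] mult.assoc)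

text \<open>\<open>Re (sa x)\<close> is half the trace: \<open>x + adj x\<close> is a scalar and
  hence unchanged by conjugation.\<close>

lemma Re_sa_based:
  assumes "cmod z < 1"
  shows "Re (sa (based z x)) = Re (sa x)"
proof -
  have "x + adj x = sreal (2 * Re (sa x))" for x by (simp add: sq_eq_iff complex_add_cnj)
  then have "based z x + adj (based z x) = sreal (2 * Re (sa x))"
    using based_simps(3,7,9)[OF assms] by metis
  then have "sa (based z x + adj (based z x)) = of_real (2 * Re (sa x))" by simp
  then show ?thesis by (simp add: complex_eq_iff)
qed

lemma based_eq_1_iff: "cmod z < 1 \<Longrightarrow> based z x = 1 \<longleftrightarrow> x = 1"
proof
  assume z: "cmod z < 1" and "based z x = 1"
  note i = su_inverse[OF to_zero(1)[OF z]]
  have "adj (to_zero z) * based z x * to_zero z = x"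
    unfolding based_def by (metis i(2) mult.assoc mult.left_neutral mult.right_neutral)
  then show "x = 1" using \<open>based z x = 1\<close> i by simp
qed (simp add: based_simps)

text \<open>Pigeonhole: finitely many balls of radius \<open>s / 4\<close> cover the bounded region,
  and each contains at most one point of a separated set. The number \<open>N\<close> is chosen
  before \<open>X\<close> because the count will be applied at varying base points.\<close>

lemma separated_bounded_finite:
  assumes "s > 0"
  shows "\<exists>N::nat. \<forall>X. (\<forall>x\<in>X. sqn x \<le> r) \<and> (\<forall>x\<in>X. \<forall>y\<in>X. x \<noteq> y \<longrightarrow> sqn (x - y) \<ge> s)
      \<longrightarrow> finite X \<and> card X \<le> N"
proof -
  define pr where "pr = (\<lambda>x. (sa x, sb x))"
  have n1: "norm (pr x) \<le> sqn x" for x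
    unfolding pr_def sqn_def by (rule norm_Pair_le)
  have n2: "sqn (x - y) \<le> 2 * dist (pr x) (pr y)" for x y
  proof -
    have "cmod (sa x - sa y) \<le> dist (pr x) (pr y)"
      using dist_fst_le[of "pr x" "pr y"] by (simp add: pr_def dist_norm)
    moreover have "cmod (sb x - sb y) \<le> dist (pr x) (pr y)"
      using dist_snd_le[of "pr x" "pr y"] by (simp add: pr_def dist_norm)
    ultimately show ?thesis by (simp add: sqn_def)
  qed
  obtain T where T: "finite T" "cball (0::complex \<times> complex) r \<subseteq> (\<Union>t\<in>T. ball t (s / 4))"
  proof (rule compactE_image[of "cball (0::complex \<times> complex) r" UNIV "\<lambda>t. ball t (s / 4)"])
    show "cball (0::complex \<times> complex) r \<subseteq> (\<Union>t\<in>UNIV. ball t (s / 4))"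
    proof
      fix v assume "v \<in> cball (0::complex \<times> complex) r"
      have "v \<in> ball v (s / 4)" using assms by simp
      then show "v \<in> (\<Union>t\<in>UNIV. ball t (s / 4))" by blast
    qed
  qed auto
  show ?thesis
  proof (intro exI[of _ "card T"] allI impI)
    fix X assume "(\<forall>x\<in>X. sqn x \<le> r) \<and> (\<forall>x\<in>X. \<forall>y\<in>X. x \<noteq> y \<longrightarrow> sqn (x - y) \<ge> s)"
    then have X: "\<And>x. x \<in> X \<Longrightarrow> sqn x \<le> r"
      "\<And>x y. \<lbrakk>x \<in> X; y \<in> X; x \<noteq> y\<rbrakk> \<Longrightarrow> sqn (x - y) \<ge> s" by auto
    have "\<exists>t\<in>T. pr x \<in> ball t (s / 4)" if "x \<in> X" for x
    proof -
      have "pr x \<in> cball 0 r" using X(1)[OF that] n1[of x] by simp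
      then show ?thesis using T(2) by blast
    qed
    then obtain c where c: "\<And>x. x \<in> X \<Longrightarrow> c x \<in> T" "\<And>x. x \<in> X \<Longrightarrow> pr x \<in> ball (c x) (s / 4)"
      by metis
    have "inj_on c X"
    proof (rule inj_onI, rule ccontr)
      fix x y assume xy: "x \<in> X" "y \<in> X" "c x = c y" "x \<noteq> y"
      have "dist (pr x) (pr y) \<le> dist (c x) (pr x) + dist (c x) (pr y)"
        by (metis dist_commute dist_triangle)
      then have "dist (pr x) (pr y) < s / 2" using c(2)[OF xy(1)] c(2)[OF xy(2)] xy(3) by simp
      then show False using X(2)[OF xy(1,2,4)] n2[of x y] by simp
    qed
    moreover have "c ` X \<subseteq> T" using c(1) by auto
    ultimately show "finite X \<and> card X \<le> card T"
      using T(1) card_inj_on_le inj_on_finite by blast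
  qed
qed

section \<open>Discrete groups\<close>

text \<open>The traceless part. Scalars are central, so commutation depends on traceless parts only,
  and for elements other than scalars it means that these are real multiples of each other.\<close>

definition tless :: "sq \<Rightarrow> sq" where
  "tless x = x - sreal (Re (sa x))"

lemma tless_decomp: "x = sreal (Re (sa x)) + tless x"
  by (simp add: tless_def)

lemma Re_sa_tless [simp]: "Re (sa (tless x)) = 0"
  by (simp add: tless_def)

lemma Re_sa_mult_commute: "Re (sa (x * y)) = Re (sa (y * x))"
  by (simp add: algebra_simps)

lemma Re_sa_conj: "sqdet y = 1 \<Longrightarrow> Re (sa (y * x * adj y)) = Re (sa x)"
  by (metis Re_sa_mult_commute mult.assoc mult.left_neutral su_inverse(2))

lemma sreal_mult: "sreal a * sreal b = sreal (a * b)"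
  by (simp add: sq_eq_iff)

lemma sreal_diff: "sreal a - sreal b = sreal (a - b)"
  by (simp add: sq_eq_iff)

lemma sqdet_tless: "sqdet x = (Re (sa x))\<^sup>2 + sqdet (tless x)"
  by (simp add: sqdet_def tless_def cmod_power2)

lemma sqdet_sreal_mult: "sqdet (sreal r * x) = r\<^sup>2 * sqdet x"
  by (simp add: sqdet_mult)

lemma sreal_mult_eq_iff: "sreal a * x = sreal b * x \<longleftrightarrow> a = b \<or> x = 0"
  by (auto simp: sq_eq_iff)

lemma sreal_mult_eq_0: "sreal a * x = 0 \<longleftrightarrow> a = 0 \<or> x = 0"
  using sreal_mult_eq_iff[of a x 0] by simp

text \<open>The traceless elements form the Lie algebra of SU(1,1), of real dimension 3, in which
  the bracket vanishes only for parallel vectors. If the diagonal of \<open>x\<close> is zero, the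
  real ratio has to be read off from the diagonal entry of the commutation relation.\<close>

lemma commuting_tless_parallel:
  assumes "Re (sa x) = 0" "Re (sa y) = 0" "x * y = y * x" "x \<noteq> 0"
  obtains r where "y = sreal r * x"
proof -
  define t where "t = Im (sa x)"
  define u where "u = Im (sa y)"
  have s: "sa x = \<i> * t" "sa y = \<i> * u" using assms by (simp_all add: t_def u_def complex_eq_iff)
  have "sb (x * y) = sb (y * x)" using assms by simp
  then have "2 * \<i> * (t * sb y) = 2 * \<i> * (u * sb x)" by (simp add: s algebra_simps)
  then have 1: "t * sb y = u * sb x" by simp
  show ?thesis
  proof (cases "t = 0")
    case False
    then have "sb y = (u / t) * sb x" using 1 by (simp add: field_simps)
    then have "y = sreal (u / t) * x" using False by (simp add: sq_eq_iff s)
    then show ?thesis by (rule that)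
  next
    case True
    then have b: "sb x \<noteq> 0" using assms(4) s by (auto simp: sq_eq_iff)
    then have u0: "u = 0" using 1 True by simp
    have "sa (x * y) = sa (y * x)" using assms by simp
    then have c: "sb x * cnj (sb y) = sb y * cnj (sb x)" using True u0 s by simp
    have "Im (sb y * cnj (sb x)) = 0"
      using arg_cong[OF c, of Im] by (simp add: algebra_simps)
    then obtain R where R: "sb y * cnj (sb x) = of_real R"
      by (metis complex_is_Real_iff Reals_cases)
    define r where "r = R / (cmod (sb x))\<^sup>2"
    have "sb y * (cnj (sb x) * sb x) = of_real R * sb x"
      unfolding mult.assoc[symmetric] R ..
    moreover have "cnj (sb x) * sb x = of_real ((cmod (sb x))\<^sup>2)"
      by (metis complex_norm_square mult.commute of_real_power)
    ultimately have "sb y * of_real ((cmod (sb x))\<^sup>2) = of_real R * sb x" by metis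
    then have "sb y = of_real r * sb x"
      using b by (simp add: r_def field_simps)
    then have "y = sreal r * x" using True u0 s by (simp add: sq_eq_iff)
    then show ?thesis by (rule that)
  qed
qed

lemma commute_tless_iff: "x * y = y * x \<longleftrightarrow> tless x * y = y * tless x"
  unfolding tless_def left_diff_distrib right_diff_distrib sreal_commute by auto

text \<open>Everything that commutes with a non-scalar \<open>a\<close> has its traceless part on
  one real line.\<close>

lemma commute_trans:
  assumes "tless a \<noteq> 0" "x * a = a * x" "y * a = a * y"
  shows "x * y = y * x"
proof -
  have "tless a * tless x = tless x * tless a" "tless a * tless y = tless y * tless a"
    using assms(2,3) commute_tless_iff by metis+
  then obtain r s where "tless x = sreal r * tless a" "tless y = sreal s * tless a"
    using commuting_tless_parallel[of "tless a"] assms(1) by (metis Re_sa_tless)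
  then have "tless x * tless y = tless y * tless x"
    by (metis mult.assoc sreal_commute sreal_mult mult.commute)
  then show ?thesis using commute_tless_iff by metis
qed

lemma sqn_0 [simp]: "sqn 0 = 0"
  by simp

section \<open>Commutators near the identity\<close>

definition commutator :: "sq \<Rightarrow> sq \<Rightarrow> sq" where
  "commutator x y = x * y * adj x * adj y"

lemma sqn_le_near_1: "sqn (x - 1) \<le> d \<Longrightarrow> sqn x \<le> 1 + d"
  using sqn_triangle[of 1 "x - 1"] by simp

lemma sqn_bracket: "sqn (x * y - y * x) \<le> 2 * sqn (x - 1) * sqn y"
proof -
  have "x * y - y * x = (x - 1) * y - y * (x - 1)" by (simp add: algebra_simps)
  then have "sqn (x * y - y * x) \<le> sqn ((x - 1) * y) + sqn (y * (x - 1))"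
    using sqn_triangle4 by metis
  also have "\<dots> \<le> sqn (x - 1) * sqn y + sqn y * sqn (x - 1)"
    by (intro add_mono sqn_mult)
  finally show ?thesis by (simp add: mult_ac)
qed

text \<open>The bracket of \<open>x\<close> and \<open>y\<close> equals that of \<open>x\<close> and
  \<open>y - 1\<close> and is also controlled by \<open>x - 1\<close>, so it is a product of two
  small quantities. The threshold 1/32 gives the factor \<open>2 * (1/32)\<close>, and the remaining
  inverses contribute less than 4.\<close>

lemma sqn_commutator:
  assumes "sqdet x = 1" "sqdet y = 1" "sqn (x - 1) \<le> 1/32" "sqn (y - 1) \<le> 1/32"
  shows "sqn (commutator x y - 1) \<le> sqn (y - 1) / 4"
proof -
  have "(x * y - y * x) * (adj x * adj y) = commutator x y - y * (x * adj x) * adj y"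
    unfolding commutator_def left_diff_distrib by (simp only: mult.assoc)
  then have e: "commutator x y - 1 = (x * y - y * x) * (adj x * adj y)"
    using su_inverse(1)[OF assms(1)] su_inverse(1)[OF assms(2)] by simp
  have b: "x * y - y * x = x * (y - 1) - (y - 1) * x" by (simp add: algebra_simps)
  have "sqn (x * y - y * x) \<le> 2 * sqn (x - 1) * sqn (y - 1)"
    unfolding b by (rule sqn_bracket)
  also have "\<dots> \<le> 2 * (1/32) * sqn (y - 1)"
    using assms by (intro mult_right_mono) auto
  finally have 1: "sqn (x * y - y * x) \<le> sqn (y - 1) / 16" by simp
  have nx: "sqn x \<le> 33/32" "sqn y \<le> 33/32"
    using sqn_le_near_1[OF assms(3)] sqn_le_near_1[OF assms(4)] by simp_all
  have "sqn (adj x * adj y) \<le> sqn x * sqn y" using sqn_mult[of "adj x" "adj y"] by simp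
  also have "\<dots> \<le> (33/32) * (33/32)" using nx by (intro mult_mono) auto
  finally have 2: "sqn (adj x * adj y) \<le> 4" by simp
  have "sqn (commutator x y - 1) \<le> sqn (x * y - y * x) * sqn (adj x * adj y)"
    unfolding e by (rule sqn_mult)
  also have "\<dots> \<le> sqn (y - 1) / 16 * 4" using 1 2 by (intro mult_mono) auto
  finally show ?thesis by simp
qed

text \<open>The full preimage in SU(1,1) of a freely acting discrete group. Closure under negation
  is the reason why freeness ends in two alternatives.\<close>

locale discrete_disk_group =
  fixes G :: "sq set"
  assumes det: "x \<in> G \<Longrightarrow> sqdet x = 1"
    and one: "1 \<in> G"
    and mult: "x \<in> G \<Longrightarrow> y \<in> G \<Longrightarrow> x * y \<in> G"
    and inv: "x \<in> G \<Longrightarrow> adj x \<in> G"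
    and uminus: "x \<in> G \<Longrightarrow> - x \<in> G"
    and discrete: "\<exists>e>0. \<forall>x\<in>G. sqn (x - 1) < e \<longrightarrow> x = 1"
    and free: "x \<in> G \<Longrightarrow> cmod z < 1 \<Longrightarrow> act x z = z \<Longrightarrow> x = 1 \<or> x = - 1"
begin

text \<open>Isolation of 1 spreads to uniform separation on bounded sets through
  \<open>x * adj y - 1 = (x - y) * adj y\<close>.\<close>

lemma finite_bounded: "finite {x \<in> G. sqn x \<le> r}"
proof -
  obtain e where e: "e > 0" "\<And>x. x \<in> G \<Longrightarrow> sqn (x - 1) < e \<Longrightarrow> x = 1"
    using discrete by blast
  define s where "s = e / (\<bar>r\<bar> + 1)"
  have s: "s > 0" using e by (simp add: s_def add_nonneg_pos)
  obtain N :: nat where N: "\<forall>X. (\<forall>x\<in>X. sqn x \<le> r) \<and> (\<forall>x\<in>X. \<forall>y\<in>X. x \<noteq> y \<longrightarrow> sqn (x - y) \<ge> s)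
      \<longrightarrow> finite X \<and> card X \<le> N"
    using separated_bounded_finite[OF s, of r] by (elim exE)
  have sep: "sqn (x - y) \<ge> s" if xy: "x \<in> G" "y \<in> G" "sqn y \<le> r" "x \<noteq> y" for x y
  proof -
    have "x * adj y \<noteq> 1"
    proof
      assume "x * adj y = 1"
      then have "x * (adj y * y) = y" by (metis mult.assoc mult.left_neutral)
      then show False using xy su_inverse[OF det[OF xy(2)]] by simp
    qed
    then have "e \<le> sqn (x * adj y - 1)" using e(2) mult inv xy by force
    also have "x * adj y - 1 = (x - y) * adj y"
      using su_inverse[OF det[OF xy(2)]] by (simp add: left_diff_distrib)
    also have "sqn ((x - y) * adj y) \<le> sqn (x - y) * sqn (adj y)" by (rule sqn_mult)
    also have "\<dots> \<le> sqn (x - y) * (\<bar>r\<bar> + 1)" using xy by (intro mult_left_mono) auto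
    finally show ?thesis by (simp add: s_def field_simps)
  qed
  define X where "X = {x \<in> G. sqn x \<le> r}"
  have "(\<forall>x\<in>X. sqn x \<le> r) \<and> (\<forall>x\<in>X. \<forall>y\<in>X. x \<noteq> y \<longrightarrow> sqn (x - y) \<ge> s)"
    using sep by (auto simp: X_def)
  from mp[OF spec[OF N] this] show ?thesis by (simp add: X_def)
qed

lemma countable_group: "countable G"
proof -
  have "G = (\<Union>n::nat. {x \<in> G. sqn x \<le> real n})"
    using real_arch_simple by auto
  moreover have "countable (\<Union>n::nat. {x \<in> G. sqn x \<le> real n})"
    by (intro countable_UN countableI_type countable_finite finite_bounded)
  ultimately show ?thesis by simp
qed

lemma discrete_based:
  assumes "cmod z < 1"
  obtains e where "e > 0" "\<And>x. x \<in> G \<Longrightarrow> sqn (based z x - 1) < e \<Longrightarrow> x = 1"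
proof -
  obtain e where e: "e > 0" "\<And>x. x \<in> G \<Longrightarrow> sqn (x - 1) < e \<Longrightarrow> x = 1"
    using discrete by blast
  define t where "t = to_zero z"
  have i: "t * adj t = 1" "adj t * t = 1" using su_inverse[OF to_zero(1)[OF assms]] by (simp_all add: t_def)
  have t0: "sqn t > 0" using i sqn_eq_0[of t] sqn_nonneg[of t] by (metis less_eq_real_def mult_zero_left zero_neq_one)
  show thesis
  proof (rule that)
    show "e / (sqn t * sqn t) > 0" using e t0 by simp
    fix x assume x: "x \<in> G" "sqn (based z x - 1) < e / (sqn t * sqn t)"
    have "x - 1 = adj t * (t * (x - 1) * adj t) * t"
      by (metis i(2) mult.assoc mult.left_neutral mult.right_neutral)
    also have "t * (x - 1) * adj t = based z x - 1"
      using i by (simp add: based_def t_def algebra_simps)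
    finally have "sqn (x - 1) \<le> sqn (adj t * (based z x - 1)) * sqn t"
      by (metis sqn_mult)
    also have "\<dots> \<le> (sqn t * sqn (based z x - 1)) * sqn t"
      using sqn_mult[of "adj t" "based z x - 1"] by (intro mult_right_mono) auto
    also have "\<dots> < e"
      using x(2) t0 by (simp add: field_simps)
    finally show "x = 1" by (rule e(2)[OF x(1)])
  qed
qed

lemma tless_nonzero:
  assumes "x \<in> G" "x \<noteq> 1" "x \<noteq> - 1"
  shows "tless x \<noteq> 0"
proof
  assume t: "tless x = 0"
  then have "(Re (sa x))\<^sup>2 = 1" using sqdet_tless[of x] det[OF assms(1)] by simp
  then have "Re (sa x) = 1 \<or> Re (sa x) = - 1" by (simp add: power2_eq_1_iff)
  moreover have "x = sreal (Re (sa x))" using tless_decomp[of x] t by simp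
  moreover have "sreal (- 1) = - 1" by (simp add: sq_eq_iff)
  ultimately show False using assms by (metis sreal_1(1))
qed

text \<open>A sequence of conjugates of a parabolic element by powers of an element that scales its
  nilpotent part would converge to the identity.\<close>

lemma parabolic_not_contracted:
  assumes A: "A \<in> G" "tless A \<noteq> 0" "sqdet (tless A) = 0" and B: "B \<in> G"
    and eq: "B * tless A * adj B = sreal y * tless A" and y: "0 < y" "y < 1"
  shows False
proof -
  define N where "N = tless A"
  define a where "a = Re (sa A)"
  have "a\<^sup>2 = 1" using sqdet_tless[of A] det[OF A(1)] A(3) by (simp add: a_def)
  then have a: "a = 1 \<or> a = - 1" by (simp add: power2_eq_1_iff)
  \<comment> \<open>Conjugating \<open>n\<close> times by \<open>B\<close> keeps the scalar part
    \<open>a\<close> and multiplies the nilpotent part by \<open>y ^ n\<close>.\<close>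
  have "\<exists>X\<in>G. X = sreal a + sreal (y ^ n) * N" for n
  proof (induction n)
    case 0
    then show ?case using A(1) tless_decomp[of A] by (auto simp: a_def N_def)
  next
    case (Suc n)
    then obtain X where X: "X \<in> G" "X = sreal a + sreal (y ^ n) * N" by blast
    have i: "B * adj B = 1" by (rule su_inverse(1)[OF det[OF B]])
    have "B * (sreal a * adj B) = sreal a"
      by (metis i mult.assoc mult.right_neutral sreal_commute)
    moreover have "B * (sreal (y ^ n) * (N * adj B)) = sreal (y ^ n) * (B * N * adj B)"
      by (metis mult.assoc sreal_commute)
    ultimately have "B * X * adj B = sreal a + sreal (y ^ n) * (B * N * adj B)"
      unfolding X(2) by (simp add: distrib_left distrib_right mult.assoc)
    also have "\<dots> = sreal a + sreal (y ^ Suc n) * N"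
      using eq unfolding N_def by (metis mult.assoc mult.commute power_Suc sreal_mult)
    finally show ?case using mult inv B X(1) by metis
  qed
  then have X: "\<exists>X\<in>G. X - 1 = sreal (a * y ^ n) * N" for n
  proof -
    obtain X where X: "X \<in> G" "X = sreal a + sreal (y ^ n) * N"
      using \<open>\<And>n. \<exists>X\<in>G. X = sreal a + sreal (y ^ n) * N\<close> by blast
    show ?thesis
    proof (cases "a = 1")
      case True
      then show ?thesis using X by (intro bexI[of _ X]) auto
    next
      case False
      then have "a = - 1" using a by simp
      then have "- X - 1 = sreal (a * y ^ n) * N" unfolding X(2) by (simp add: sq_eq_iff)
      then show ?thesis using uminus[OF X(1)] by blast
    qed
  qed
  obtain e where e: "e > 0" "\<And>x. x \<in> G \<Longrightarrow> sqn (x - 1) < e \<Longrightarrow> x = 1"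
    using discrete by blast
  have N0: "sqn N > 0" using A(2) sqn_nonneg[of N] sqn_eq_0[of N] by (simp add: N_def less_eq_real_def)
  obtain n where n: "y ^ n < e / sqn N"
    using real_arch_pow_inv[of "e / sqn N" y] e N0 y by auto
  obtain Z where Z: "Z \<in> G" "Z - 1 = sreal (a * y ^ n) * N" using X by blast
  have "sqn (Z - 1) = y ^ n * sqn N"
    unfolding Z(2) sqn_sreal_mult using a y by (auto simp: abs_mult)
  also have "\<dots> < e" using n N0 by (simp add: field_simps)
  finally have "Z = 1" using e(2)[OF Z(1)] by simp
  then have "sreal (a * y ^ n) * N = 0" using Z by simp
  then show False using N0 a y by (auto simp: sreal_mult_eq_0)
qed

text \<open>The traceless parts of \<open>A\<close> and of its conjugate by \<open>B\<close> are
  parallel, so \<open>B\<close> multiplies that of \<open>A\<close> by a real \<open>y\<close>. As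
  \<open>B\<close> is near 1, \<open>y\<close> is positive. Invariance of the determinant gives
  \<open>y = 1\<close> unless the traceless part is nilpotent, and in that case
  \<open>parabolic_not_contracted\<close> for \<open>B\<close> or its inverse excludes every other
  value.\<close>

lemma commute_of_conjugate_commutes:
  assumes z: "cmod z < 1" and A: "A \<in> G" and B: "B \<in> G" "sqn (based z B - 1) \<le> 1/32"
    and comm: "A * (B * A * adj B) = (B * A * adj B) * A"
  shows "A * B = B * A"
proof (cases "tless A = 0")
  case True
  then show ?thesis using commute_tless_iff[of A B] by simp
next
  case False
  define N where "N = tless A"
  define N' where "N' = B * N * adj B"
  have i: "B * adj B = 1" "adj B * B = 1" using su_inverse[OF det[OF B(1)]] by auto
  have "B * (sreal (Re (sa A)) * adj B) = sreal (Re (sa A))"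
    by (metis i(1) mult.assoc mult.right_neutral sreal_commute)
  then have N': "N' = tless (B * A * adj B)"
    unfolding N'_def N_def tless_def Re_sa_conj[OF det[OF B(1)]]
    by (simp add: right_diff_distrib left_diff_distrib mult.assoc)
  have "N * N' = N' * N"
    using comm commute_tless_iff unfolding N' N_def by metis
  then obtain y where y: "N' = sreal y * N"
    using commuting_tless_parallel[of N N'] False by (auto simp: N_def N')
  have BN: "B * N = N' * B" unfolding N'_def using i by (simp add: mult.assoc)
  have "\<bar>y - 1\<bar> \<le> 1/8"
  proof -
    define b where "b = based z B"
    define n where "n = based z N"
    have "n \<noteq> 0"
    proof
      assume "n = 0"
      then have "based z (1 + N) = 1" using based_simps(3,6)[OF z] by (simp add: n_def)
      then have "N = 0" using based_eq_1_iff[OF z] by simp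
      then show False using False by (simp add: N_def)
    qed
    then have n0: "sqn n > 0" using sqn_nonneg[of n] sqn_eq_0[of n] by (simp add: less_eq_real_def)
    have ib: "b * adj b = 1" using su_inverse(1)[of b] based_simps(8)[OF z] det[OF B(1)] by (simp add: b_def)
    have "b * n * adj b = sreal y * n"
      using y based_simps[OF z] unfolding N'_def b_def n_def by metis
    then have "sreal (y - 1) * n = b * n * adj b - n"
      by (simp add: left_diff_distrib flip: sreal_diff)
    also have "\<dots> = (b * n - n * b) * adj b"
      using ib by (simp add: left_diff_distrib mult.assoc)
    finally have "\<bar>y - 1\<bar> * sqn n \<le> sqn (b * n - n * b) * sqn b"
      using sqn_mult[of "b * n - n * b" "adj b"] by (metis sqn_adj sqn_sreal_mult)
    also have "\<dots> \<le> (2 * (1/32) * sqn n) * (33/32)"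
    proof (intro mult_mono)
      have "sqn (b * n - n * b) \<le> 2 * sqn (b - 1) * sqn n" by (rule sqn_bracket)
      also have "\<dots> \<le> 2 * (1/32) * sqn n" using B(2) by (intro mult_right_mono) (auto simp: b_def)
      finally show "sqn (b * n - n * b) \<le> 2 * (1/32) * sqn n" .
      show "sqn b \<le> 33/32" using sqn_le_near_1[of b "1/32"] B(2) by (simp add: b_def)
    qed auto
    also have "\<dots> \<le> 1/8 * sqn n" using n0 by simp
    finally show ?thesis using n0 by simp
  qed
  then have y0: "y > 0" by linarith
  have "sqdet N' = sqdet N" unfolding N'_def using det[OF B(1)] by (simp add: sqdet_mult)
  then have yd: "(y\<^sup>2 - 1) * sqdet N = 0" unfolding y sqdet_sreal_mult by (simp add: algebra_simps)
  have "y = 1"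
  proof (cases "sqdet N = 0")
    case False
    then have "y\<^sup>2 = 1" using yd by simp
    then show ?thesis using y0 by (simp add: power2_eq_1_iff)
  next
    case True
    consider "y < 1" | "y = 1" | "y > 1" by linarith
    then show ?thesis
    proof cases
      case 1
      then show ?thesis
        using parabolic_not_contracted[OF A False _ B(1), of y] True y y0 by (simp add: N_def N'_def)
    next
      case 3
      have "sreal (1 / y) * N' = N"
        unfolding y using y0 by (simp add: sreal_mult mult.assoc[symmetric])
      then have "adj B * N * adj (adj B) = sreal (1 / y) * N"
        by (metis BN N'_def adj_adj i(2) mult.assoc mult.left_neutral sreal_commute)
      then show ?thesis
        using parabolic_not_contracted[OF A False _ inv[OF B(1)], of "1 / y"] True 3 by (simp add: N_def)
    qed simp
  qed
  then have "tless A * B = B * tless A" using y BN by (simp add: N_def)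
  then show ?thesis using commute_tless_iff by metis
qed

text \<open>Zassenhaus: iterated commutators with \<open>A\<close> contract towards the identity and hence reach it.\<close>

lemma near_identity_commute:
  assumes z: "cmod z < 1" and A: "A \<in> G" "sqn (based z A - 1) \<le> 1/32"
    and B: "B \<in> G" "sqn (based z B - 1) \<le> 1/32"
  shows "A * B = B * A"
proof -
  define b where "b = (\<lambda>n. (commutator A ^^ n) B)"
  have bS: "b (Suc n) = commutator A (b n)" for n by (simp add: b_def)
  have bG: "b n \<in> G" for n
    by (induction n) (use A B mult inv in \<open>auto simp: b_def commutator_def\<close>)
  have bc: "based z (commutator A x) = commutator (based z A) (based z x)" for x
    unfolding commutator_def by (simp only: based_simps[OF z])
  have bn: "sqn (based z (b n) - 1) \<le> (1/4) ^ n * (1/32)" for n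
  proof (induction n)
    case 0
    then show ?case using B by (simp add: b_def)
  next
    case (Suc n)
    have "(1/4::real) ^ n * (1/32) \<le> 1 * (1/32)" by (intro mult_right_mono power_le_one) auto
    then have "sqn (based z (b n) - 1) \<le> 1/32" using Suc by linarith
    then have "sqn (based z (b (Suc n)) - 1) \<le> sqn (based z (b n) - 1) / 4"
      unfolding bS bc using A B bG det based_simps(8)[OF z] by (intro sqn_commutator) auto
    then show ?case using Suc by simp
  qed
  obtain e where e: "e > 0" "\<And>x. x \<in> G \<Longrightarrow> sqn (based z x - 1) < e \<Longrightarrow> x = 1"
    using discrete_based[OF z] by blast
  obtain n where n: "(1/4::real) ^ n < e" using real_arch_pow_inv[of e "1/4"] e by auto
  have "(1/4::real) ^ n * (1/32) \<le> (1/4) ^ n" by (rule mult_right_le_one_le) auto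
  then have "b n = 1" using e(2)[OF bG, of n] bn[of n] n by linarith
  then have "A * b n = b n * A" by simp
  \<comment> \<open>Descending step: if \<open>A\<close> commutes with its commutator with
    \<open>b k\<close>, it also commutes with the conjugate of \<open>A\<close> by
    \<open>b k\<close>, and then with \<open>b k\<close> itself.\<close>
  moreover have "A * b k = b k * A" if "A * b (Suc k) = b (Suc k) * A" for k
  proof (rule commute_of_conjugate_commutes[OF z A(1) bG])
    have "(1/4::real) ^ k * (1/32) \<le> 1 * (1/32)" by (intro mult_right_mono power_le_one) auto
    then show "sqn (based z (b k) - 1) \<le> 1/32" using bn[of k] by linarith
    define Q where "Q = b k * adj A * adj (b k)"
    have i: "adj A * A = 1" by (rule su_inverse(2)[OF det[OF A(1)]])
    have "A * (A * Q) = (A * Q) * A"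
      using that unfolding bS commutator_def Q_def by (simp add: mult.assoc)
    then have "A * Q = Q * A" by (metis i mult.assoc mult.left_neutral)
    then have "adj Q * adj A = adj A * adj Q" by (metis adj_mult)
    moreover have "adj Q = b k * A * adj (b k)" by (simp add: Q_def adj_mult mult.assoc)
    ultimately have "(b k * A * adj (b k)) * adj A = adj A * (b k * A * adj (b k))" by simp
    then show "A * (b k * A * adj (b k)) = (b k * A * adj (b k)) * A"
      by (metis su_inverse[OF det[OF A(1)]] mult.assoc mult.left_neutral mult.right_neutral)
  qed
  ultimately have "A * b 0 = b 0 * A" by (induction n) auto
  then show ?thesis by (simp add: b_def)
qed

text \<open>A half-trace of modulus below 1 means an elliptic element, which has a fixed point in
  the disk.\<close>

lemma Re_sa_ge_1:
  assumes "x \<in> G" "x \<noteq> 1" "x \<noteq> - 1"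
  shows "\<bar>Re (sa x)\<bar> \<ge> 1"
proof (rule ccontr)
  assume "\<not> ?thesis"
  then have r: "(Re (sa x))\<^sup>2 < 1" by (simp add: abs_square_less_1)
  define t where "t = Im (sa x)"
  define b where "b = sb x"
  have "(Re (sa x))\<^sup>2 + t\<^sup>2 - (cmod b)\<^sup>2 = 1"
    using det[OF assms(1)] by (simp add: sqdet_def cmod_power2 t_def b_def)
  then have tb: "(cmod b)\<^sup>2 < t\<^sup>2" using r by linarith
  define s where "s = sgn t * sqrt (t\<^sup>2 - (cmod b)\<^sup>2)"
  have t0: "t \<noteq> 0" using tb by auto
  have s2: "s\<^sup>2 = t\<^sup>2 - (cmod b)\<^sup>2"
    using tb t0 by (simp add: s_def power_mult_distrib sgn_if)
  have ts: "\<bar>t\<bar> \<le> \<bar>t + s\<bar>"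
  proof -
    define R where "R = sqrt (t\<^sup>2 - (cmod b)\<^sup>2)"
    have "R \<ge> 0" using tb by (simp add: R_def)
    then show ?thesis by (auto simp: s_def sgn_if abs_if simp flip: R_def)
  qed
  have "cmod b < \<bar>t\<bar>" using tb by (metis abs_ge_zero power2_abs power2_less_imp_less)
  then have bt: "cmod b < \<bar>t + s\<bar>" using ts by linarith
  then have ts0: "t + s \<noteq> 0" by auto
  \<comment> \<open>The root of smaller modulus of the fixed-point equation, written so that
    \<open>b = 0\<close> is allowed. The sign of \<open>s\<close> agrees with that of
    \<open>t\<close>, which makes the denominator large.\<close>
  define w where "w = \<i> * b / of_real (t + s)"
  have w1: "cmod w < 1"
    using bt ts0 unfolding w_def norm_divide norm_mult norm_of_real by simp
  have wts: "w * of_real (t + s) = \<i> * b" using ts0 by (simp add: w_def del: of_real_add)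
  have "(cnj b * w\<^sup>2 - 2 * \<i> * t * w - b) * (of_real (t + s))\<^sup>2 =
      cnj b * (w * of_real (t + s))\<^sup>2 - 2 * \<i> * t * (w * of_real (t + s)) * of_real (t + s)
        - b * (of_real (t + s))\<^sup>2"
    by (simp add: power2_eq_square algebra_simps del: of_real_add)
  also have "\<dots> = b * (- (b * cnj b) + of_real (2 * t * (t + s)) - of_real ((t + s)\<^sup>2))"
    unfolding wts by (simp add: power2_eq_square algebra_simps)
  also have "b * cnj b = of_real ((cmod b)\<^sup>2)" by (rule complex_norm_square[symmetric, unfolded of_real_power[symmetric]])
  also have "- complex_of_real ((cmod b)\<^sup>2) + of_real (2 * t * (t + s)) - of_real ((t + s)\<^sup>2) =
      of_real (- (cmod b)\<^sup>2 + 2 * t * (t + s) - (t + s)\<^sup>2)" by simp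
  also have "- (cmod b)\<^sup>2 + 2 * t * (t + s) - (t + s)\<^sup>2 = 0"
    using s2 by (simp add: power2_eq_square algebra_simps)
  finally have q: "cnj b * w\<^sup>2 - 2 * \<i> * t * w - b = 0" using ts0 by (simp del: of_real_add)
  have nz: "autom x w \<noteq> 0" using autom_nonzero det assms w1 by auto
  have "sa x = cnj (sa x) + 2 * \<i> * t" by (simp add: complex_eq_iff t_def)
  then have "sa x * w = cnj (sa x) * w + 2 * \<i> * t * w" by (metis distrib_right)
  then have "sa x * w + sb x - w * autom x w = - (cnj b * w\<^sup>2 - 2 * \<i> * t * w - b)"
    by (simp add: autom_def b_def power2_eq_square algebra_simps)
  then have "act x w = w" using q nz by (simp add: act_def)
  then show False using free[OF assms(1) w1] assms by auto
qed

end

section \<open>Change of base point and displacement\<close>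

lemma sqn_to_zero: "cmod z < 1 \<Longrightarrow> sqn (to_zero z) = (1 + cmod z) / sqrt (1 - (cmod z)\<^sup>2)"
proof -
  assume "cmod z < 1"
  then have "1 - (cmod z)\<^sup>2 > 0" by (simp add: power_less_one_iff)
  then show ?thesis
    by (simp add: to_zero_def Let_def sqn_def norm_mult norm_divide add_divide_distrib)
qed

lemma based_conj:
  assumes "cmod z < 1"
  shows "adj (to_zero z) * based z x * to_zero z = x"
  using su_inverse(2)[OF to_zero(1)[OF assms]]
  unfolding based_def by (metis mult.assoc mult.left_neutral mult.right_neutral)

lemma based_change:
  assumes "cmod z < 1" "cmod w < 1"
  shows "sqn (based w x - 1) \<le> (sqn (to_zero w * adj (to_zero z)))\<^sup>2 * sqn (based z x - 1)"
proof -
  define P where "P = to_zero w * adj (to_zero z)"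
  have P: "P * adj P = 1"
    by (rule su_inverse(1)) (simp add: P_def sqdet_mult to_zero assms)
  have "based w x = P * based z x * adj P"
    unfolding P_def by (subst based_conj[OF assms(1), of x, symmetric])
      (simp add: based_def adj_mult mult.assoc)
  then have "based w x - 1 = P * (based z x - 1) * adj P"
    using P by (simp add: left_diff_distrib right_diff_distrib)
  then have "sqn (based w x - 1) \<le> sqn (P * (based z x - 1)) * sqn P"
    using sqn_mult[of "P * (based z x - 1)" "adj P"] by simp
  also have "\<dots> \<le> (sqn P * sqn (based z x - 1)) * sqn P"
    by (intro mult_right_mono sqn_mult) simp
  finally show ?thesis by (simp add: P_def power2_eq_square mult_ac)
qed

text \<open>The change of base point is a conjugation by an element that tends to 1 as
  \<open>w\<close> tends to \<open>z\<close>. A loss of 2 is affordable because smallness will be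
  measured by 1/64, while commutation only requires 1/32.\<close>

lemma based_nearby:
  assumes z: "cmod z < 1"
  obtains e where "e > 0"
    "\<And>w x. cmod w < 1 \<Longrightarrow> dist w z < e \<Longrightarrow>
      sqn (based w x - 1) \<le> 2 * sqn (based z x - 1) \<and> sqn (based z x - 1) \<le> 2 * sqn (based w x - 1)"
proof -
  define F where "F = (\<lambda>w. sqn (to_zero w * adj (to_zero z)))"
  have p: "1 - (cmod z)\<^sup>2 > 0" using z by (simp add: power_less_one_iff)
  have "isCont F z"
    unfolding F_def sqn_def to_zero_def Let_def using p by (simp) (intro continuous_intros, auto)
  moreover have "F z = 1" using su_inverse(1)[OF to_zero(1)[OF z]] by (simp add: F_def)
  ultimately obtain e where e: "e > 0" "\<And>w. dist w z < e \<Longrightarrow> dist (F w) 1 < 1/4"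
    by (metis continuous_at zero_less_divide_1_iff zero_less_numeral continuous_at_eps_delta)
  show thesis
  proof (rule that[OF e(1)])
    fix w x assume w: "cmod w < 1" "dist w z < e"
    have "F w \<ge> 0" by (simp add: F_def)
    then have "(F w)\<^sup>2 \<le> (5/4)\<^sup>2"
      using e(2)[OF w(2)] by (intro power_mono) (auto simp: dist_real_def abs_if split: if_splits)
    then have F2: "(F w)\<^sup>2 \<le> 2" by (simp add: power2_eq_square)
    have "sqn (to_zero z * adj (to_zero w)) = F w"
      unfolding F_def by (metis adj_adj adj_mult sqn_adj)
    then have 1: "sqn (based z x - 1) \<le> (F w)\<^sup>2 * sqn (based w x - 1)"
      using based_change[OF w(1) z, of x] by simp
    have 2: "sqn (based w x - 1) \<le> (F w)\<^sup>2 * sqn (based z x - 1)"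
      using based_change[OF z w(1), of x] by (simp add: F_def)
    show "sqn (based w x - 1) \<le> 2 * sqn (based z x - 1) \<and> sqn (based z x - 1) \<le> 2 * sqn (based w x - 1)"
      using 1 2 F2 by (meson mult_right_mono order_trans sqn_nonneg)
  qed
qed

text \<open>For determinant 1 this is \<open>sinh (d / 2)\<close>, where \<open>d\<close> is the
  hyperbolic distance from \<open>z\<close> to \<open>act x z\<close>.\<close>

definition disp :: "sq \<Rightarrow> complex \<Rightarrow> real" where
  "disp x z = cmod (sb (based z x))"

text \<open>The two base points are related by an element \<open>k\<close> that fixes 0. It is a
  rotation, and conjugation by a rotation preserves the modulus of the off-diagonal entry.\<close>

lemma disp_conj:
  assumes "sqdet x = 1" "cmod z < 1"
  shows "disp (x * g * adj x) (act x z) = disp g z"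
proof -
  define k where "k = to_zero (act x z) * x * adj (to_zero z)"
  have az: "cmod (act x z) < 1" by (rule act_in_disk[OF assms])
  have dk: "sqdet k = 1" by (simp add: k_def sqdet_mult to_zero assms az)
  have "act k 0 = act (to_zero (act x z)) (act x (act (adj (to_zero z)) 0))"
    unfolding k_def using assms to_zero[OF assms(2)] act_in_disk[OF assms]
    by (simp add: act_mult(1) act_in_disk)
  also have "\<dots> = 0" using to_zero[OF assms(2)] to_zero[OF az] by simp
  finally have "sb k = 0" using autom_nonzero[OF dk, of 0] by (simp add: act_def)
  moreover have "cmod (sa k) = 1"
  proof -
    have "(cmod (sa k))\<^sup>2 = 1" using dk \<open>sb k = 0\<close> by (simp add: sqdet_def)
    then show ?thesis by (simp add: power2_eq_1_iff) (smt (verit) norm_ge_zero)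
  qed
  moreover have "based (act x z) (x * g * adj x) = k * based z g * adj k"
    unfolding k_def by (subst based_conj[OF assms(2), of g, symmetric])
      (simp add: based_def adj_mult mult.assoc)
  ultimately show ?thesis by (simp add: disp_def norm_mult)
qed

lemma disp_eq:
  assumes "cmod z < 1"
  shows "disp x z = cmod (sb x + 2 * \<i> * Im (sa x) * z - cnj (sb x) * z\<^sup>2) / (1 - (cmod z)\<^sup>2)"
proof -
  have p: "1 - (cmod z)\<^sup>2 > 0" using assms by (simp add: power_less_one_iff)
  have "sa x - cnj (sa x) = 2 * \<i> * Im (sa x)" by (simp add: complex_eq_iff)
  then show ?thesis
    unfolding disp_def sb_based[OF assms] norm_divide norm_of_real using p by simp
qed

text \<open>The half-trace \<open>+ 1\<close> also selects the sign of the matrix;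
  \<open>- x\<close> represents the same transformation.\<close>

definition is_parabolic :: "sq \<Rightarrow> bool" where
  "is_parabolic x \<longleftrightarrow> sqdet x = 1 \<and> Re (sa x) = 1 \<and> x \<noteq> 1"

definition fixpoint :: "sq \<Rightarrow> complex" where
  "fixpoint x = \<i> * Im (sa x) / cnj (sb x)"

lemma parabolic_form:
  assumes "is_parabolic x"
  shows "Im (sa x) \<noteq> 0" "cmod (fixpoint x) = 1" "sa x = 1 + \<i> * Im (sa x)"
    "sb x = - \<i> * Im (sa x) * fixpoint x" "act x z = parabolic (Im (sa x)) (fixpoint x) z"
proof -
  define t where "t = Im (sa x)"
  define p where "p = fixpoint x"
  have d: "sqdet x = 1" "Re (sa x) = 1" "x \<noteq> 1" using assms by (auto simp: is_parabolic_def)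
  have "t\<^sup>2 = (cmod (sb x))\<^sup>2" using d by (simp add: sqdet_def cmod_power2[of "sa x"] t_def)
  then have tb: "\<bar>t\<bar> = cmod (sb x)" by (metis abs_norm_cancel power2_eq_iff_nonneg abs_ge_zero norm_ge_zero power2_abs)
  show sa: "sa x = 1 + \<i> * Im (sa x)" using d by (simp add: complex_eq_iff)
  show t0: "Im (sa x) \<noteq> 0"
  proof
    assume "Im (sa x) = 0"
    then have "x = 1" using tb sa by (simp add: sq_eq_iff t_def)
    then show False using d by simp
  qed
  then have b0: "sb x \<noteq> 0" using tb by (auto simp: t_def)
  show p1: "cmod (fixpoint x) = 1"
    using tb b0 by (simp add: fixpoint_def norm_divide norm_mult t_def)
  have pb: "p * cnj (sb x) = \<i> * t" using b0 by (simp add: p_def fixpoint_def t_def)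
  have "cnj p * p = 1" using cnj_mult_unit p1 by (simp add: p_def)
  then have cb: "cnj (sb x) = \<i> * t * cnj p" using pb by (metis mult.assoc mult.commute mult.left_neutral)
  then have "cnj (cnj (sb x)) = cnj (\<i> * t * cnj p)" by simp
  then show sb: "sb x = - \<i> * Im (sa x) * fixpoint x" by (simp add: t_def p_def)
  have "sa x * z + sb x = (1 + \<i> * t) * z - \<i> * t * p"
    by (subst sa, subst sb) (simp add: t_def p_def)
  moreover have "autom x z = \<i> * t * cnj p * z + (1 - \<i> * t)"
    unfolding autom_def cb by (subst sa) (simp add: t_def)
  ultimately show "act x z = parabolic (Im (sa x)) (fixpoint x) z"
    by (simp add: act_def parabolic_def t_def p_def)
qed

lemma disp_parabolic:
  assumes "is_parabolic x" "cmod z < 1"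
  shows "disp x z = \<bar>Im (sa x)\<bar> * (cmod (z - fixpoint x))\<^sup>2 / (1 - (cmod z)\<^sup>2)"
proof -
  define t where "t = Im (sa x)"
  define p where "p = fixpoint x"
  have cp: "cnj p * p = 1" using cnj_mult_unit parabolic_form[OF assms(1)] by (simp add: p_def)
  have b: "sb x = - \<i> * t * p" using parabolic_form[OF assms(1)] by (simp add: t_def p_def)
  have "(sb x + 2 * \<i> * t * z - cnj (sb x) * z\<^sup>2) * p = - \<i> * t * (p * p - 2 * p * z + (cnj p * p) * z\<^sup>2)"
    unfolding b by (simp add: algebra_simps power2_eq_square)
  also have "\<dots> = - \<i> * t * (z - p)\<^sup>2" unfolding cp by (simp add: power2_eq_square algebra_simps)
  finally have "cmod ((sb x + 2 * \<i> * t * z - cnj (sb x) * z\<^sup>2) * p) = \<bar>t\<bar> * (cmod (z - p))\<^sup>2"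
    by (simp add: norm_mult norm_power)
  moreover have "cmod p = 1" using parabolic_form[OF assms(1)] by (simp add: p_def)
  ultimately show ?thesis unfolding disp_eq[OF assms(2)] by (simp add: norm_mult t_def p_def)
qed

text \<open>Describing a horodisk by displacement makes its images under the group accessible to
  \<open>disp_conj\<close>.\<close>

lemma horodisk_disp:
  assumes "is_parabolic x" "\<eta> > 0"
  shows "horodisk (Im (sa x)) (fixpoint x) \<eta> = {z. cmod z < 1 \<and> disp x z < \<eta>}"
proof (intro Set.set_eqI iffI)
  fix z assume z: "z \<in> horodisk (Im (sa x)) (fixpoint x) \<eta>"
  then have z1: "cmod z < 1" by (rule horodisk_in_disk[OF assms(2)])
  then have "1 - (cmod z)\<^sup>2 > 0" by (simp add: power_less_one_iff)
  then show "z \<in> {z. cmod z < 1 \<and> disp x z < \<eta>}"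
    using z z1 by (simp add: horodisk_def disp_parabolic[OF assms(1) z1] pos_divide_less_eq)
next
  fix z assume z: "z \<in> {z. cmod z < 1 \<and> disp x z < \<eta>}"
  then have z1: "cmod z < 1" by simp
  then have "1 - (cmod z)\<^sup>2 > 0" by (simp add: power_less_one_iff)
  then show "z \<in> horodisk (Im (sa x)) (fixpoint x) \<eta>"
    using z z1 by (simp add: horodisk_def disp_parabolic[OF assms(1) z1] pos_divide_less_eq)
qed

section \<open>The Dirichlet domain and its thin part\<close>

context discrete_disk_group
begin

lemma adj_cancel:
  assumes "x \<in> G"
  shows "x * adj x = 1" "adj x * x = 1"
  using su_inverse[OF det[OF assms]] by auto

definition dirichlet :: "complex set" where
  "dirichlet = {z. cmod z < 1 \<and> (\<forall>x\<in>G. cmod z \<le> cmod (act x z))}"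

text \<open>By \<open>one_minus_act\<close>, an image that stays away from the circle bounds
  \<open>autom x z\<close>, and this bounds the matrix since \<open>z\<close> is an interior
  point.\<close>

lemma finite_decreasing:
  assumes "cmod z < 1" "r < 1"
  shows "finite {x \<in> G. cmod (act x z) \<le> r}"
proof (rule finite_subset[OF _ finite_bounded])
  define m where "m = sqrt ((1 - (cmod z)\<^sup>2) / (1 - r\<^sup>2))"
  show "{x \<in> G. cmod (act x z) \<le> r} \<subseteq> {x \<in> G. sqn x \<le> 2 * (m / (1 - cmod z))}"
  proof clarify
    fix x assume x: "x \<in> G" "cmod (act x z) \<le> r"
    have r0: "0 \<le> r" using x(2) norm_ge_zero order_trans by blast
    then have r1: "1 - r\<^sup>2 > 0" using assms(2) by (simp add: power_less_one_iff)
    have nz: "cmod (autom x z) > 0" using autom_nonzero det[OF x(1)] assms(1) by simp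
    have "1 - r\<^sup>2 \<le> 1 - (cmod (act x z))\<^sup>2" using x(2) by (simp add: power_mono)
    also have "\<dots> = (1 - (cmod z)\<^sup>2) / (cmod (autom x z))\<^sup>2"
      using one_minus_act det[OF x(1)] assms(1) by simp
    finally have "(cmod (autom x z))\<^sup>2 \<le> (1 - (cmod z)\<^sup>2) / (1 - r\<^sup>2)"
      using nz r1 by (simp add: field_simps)
    then have "cmod (autom x z) \<le> m" unfolding m_def by (rule real_le_rsqrt)
    moreover have "cmod (sa x) - cmod (sb x) * cmod z \<le> cmod (autom x z)"
      using autom_bounds(1) assms(1) by simp
    moreover have "cmod (sb x) * cmod z \<le> cmod (sa x) * cmod z"
      using su_norms(2)[OF det[OF x(1)]] by (intro mult_right_mono) auto
    ultimately have "cmod (sa x) * (1 - cmod z) \<le> m" by (simp add: algebra_simps)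
    then have "cmod (sa x) \<le> m / (1 - cmod z)" using assms(1) by (simp add: field_simps)
    then show "sqn x \<le> 2 * (m / (1 - cmod z))"
      using su_norms(2)[OF det[OF x(1)]] by (simp add: sqn_def)
  qed
qed

lemma exists_dirichlet:
  assumes z: "cmod z < 1"
  shows "\<exists>x\<in>G. act x z \<in> dirichlet"
proof -
  define S where "S = {x \<in> G. cmod (act x z) \<le> cmod z}"
  have S: "finite S" "1 \<in> S" using finite_decreasing[OF z z] one by (auto simp: S_def)
  obtain x where x: "x \<in> S" "\<And>y. y \<in> S \<Longrightarrow> cmod (act x z) \<le> cmod (act y z)"
    using arg_min_if_finite(1)[of S "\<lambda>x. cmod (act x z)"] arg_min_least[of S _ "\<lambda>x. cmod (act x z)"] S
    by (metis empty_iff)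
  have xG: "x \<in> G" using x by (simp add: S_def)
  have "cmod (act x z) \<le> cmod (act y (act x z))" if y: "y \<in> G" for y
  proof -
    have e: "act y (act x z) = act (y * x) z" using act_mult(1)[OF det[OF xG] z] by simp
    show ?thesis
    proof (cases "y * x \<in> S")
      case True
      then show ?thesis using x(2) e by simp
    next
      case False
      then have "cmod z < cmod (act (y * x) z)" using mult[OF y xG] by (simp add: S_def)
      then show ?thesis using x(1) e by (simp add: S_def)
    qed
  qed
  then show ?thesis using xG act_in_disk[OF det[OF xG] z] by (auto simp: dirichlet_def)
qed

text \<open>With centre 0 the Dirichlet domain is the part of the disk outside all isometric
  circles, a condition on the affine function \<open>autom x\<close>.\<close>

lemma dirichlet_iff: "z \<in> dirichlet \<longleftrightarrow> cmod z < 1 \<and> (\<forall>x\<in>G. cmod (autom x z) \<ge> 1)"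
proof -
  have "cmod z \<le> cmod (act x z) \<longleftrightarrow> cmod (autom x z) \<ge> 1" if z: "cmod z < 1" and x: "x \<in> G" for x
  proof -
    have p: "1 - (cmod z)\<^sup>2 > 0" using z by (simp add: power_less_one_iff)
    have n: "(cmod (autom x z))\<^sup>2 > 0" using autom_nonzero det[OF x] z by simp
    have "cmod z \<le> cmod (act x z) \<longleftrightarrow> 1 - (cmod (act x z))\<^sup>2 \<le> 1 - (cmod z)\<^sup>2"
      by (simp add: abs_le_square_iff[symmetric])
    also have "\<dots> \<longleftrightarrow> (1 - (cmod z)\<^sup>2) / (cmod (autom x z))\<^sup>2 \<le> 1 - (cmod z)\<^sup>2"
      using one_minus_act[OF det[OF x], of z] z by simp
    also have "\<dots> \<longleftrightarrow> 1 \<le> (cmod (autom x z))\<^sup>2"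
      using p n by (simp add: pos_divide_le_eq)
    also have "\<dots> \<longleftrightarrow> 1 \<le> cmod (autom x z)"
      using abs_le_square_iff[of 1 "cmod (autom x z)"] by simp
    finally show ?thesis .
  qed
  then show ?thesis by (auto simp: dirichlet_def)
qed

text \<open>Along the ray \<open>|autom x (t * z)|^2\<close> is a quadratic polynomial in
  \<open>t\<close>. Its value at 1 bounds the linear coefficient from below, and then its excess
  over 1 is at least \<open>(1 - t) * (|sb x|^2 - t * |u|^2)\<close>, a product of nonnegative
  factors.\<close>

lemma dirichlet_star:
  assumes z: "z \<in> dirichlet" and t: "0 \<le> t" "t \<le> 1"
  shows "of_real t * z \<in> dirichlet"
proof -
  have z1: "cmod z < 1" using z by (simp add: dirichlet_iff)
  have "cmod (of_real t * z) \<le> cmod z" using t by (simp add: norm_mult mult_left_le_one_le)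
  moreover have "cmod (autom x (of_real t * z)) \<ge> 1" if x: "x \<in> G" for x
  proof -
    define u where "u = cnj (sb x) * z"
    define v where "v = cnj (sa x)"
    define B where "B = Re (u * cnj v)"
    have ex: "(cmod (of_real s * u + v))\<^sup>2 = s\<^sup>2 * (cmod u)\<^sup>2 + 2 * s * B + (cmod v)\<^sup>2" for s
      unfolding cmod_power2 B_def by (simp add: power2_eq_square algebra_simps)
    have v2: "(cmod v)\<^sup>2 = 1 + (cmod (sb x))\<^sup>2" using su_norms(3)[OF det[OF x]] by (simp add: v_def)
    have "cmod u \<le> cmod (sb x)" using z1 by (simp add: u_def norm_mult mult_left_le)
    then have ub: "(cmod u)\<^sup>2 \<le> (cmod (sb x))\<^sup>2" by (rule power_mono) simp
    have "1 \<le> (cmod (autom x z))\<^sup>2" using z x by (simp add: dirichlet_iff)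
    then have q: "2 * B \<ge> - (cmod u)\<^sup>2 - (cmod (sb x))\<^sup>2"
      using ex[of 1] v2 by (simp add: autom_def u_def v_def)
    have "t * (cmod u)\<^sup>2 \<le> (cmod (sb x))\<^sup>2"
      by (rule order_trans[OF mult_left_le_one_le ub]) (use t in auto)
    then have "0 \<le> (1 - t) * ((cmod (sb x))\<^sup>2 - t * (cmod u)\<^sup>2)"
      using t by (intro mult_nonneg_nonneg) auto
    also have "\<dots> = t\<^sup>2 * (cmod u)\<^sup>2 + t * (- (cmod u)\<^sup>2 - (cmod (sb x))\<^sup>2) + (cmod (sb x))\<^sup>2"
      by (simp add: power2_eq_square algebra_simps)
    also have "\<dots> \<le> t\<^sup>2 * (cmod u)\<^sup>2 + t * (2 * B) + (cmod (sb x))\<^sup>2"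
      using q t by (intro add_mono mult_left_mono) auto
    also have "\<dots> = (cmod (autom x (of_real t * z)))\<^sup>2 - 1"
      using ex[of t] v2 by (simp add: autom_def u_def v_def mult_ac)
    finally have "1\<^sup>2 \<le> (cmod (autom x (of_real t * z)))\<^sup>2" by simp
    then show ?thesis by (rule power2_le_imp_le) simp
  qed
  ultimately show ?thesis using z1 by (simp add: dirichlet_iff)
qed

text \<open>The witnesses that \<open>z\<close> is a thin point. The bound 1/64 is half of what
  \<open>near_identity_commute\<close> tolerates, so elements small at two nearby points can be
  compared at a third.\<close>

definition small_elements :: "complex \<Rightarrow> sq set" where
  "small_elements z = {x \<in> G. x \<noteq> 1 \<and> x \<noteq> - 1 \<and> sqn (based z x - 1) < 1/64}"

text \<open>Elements that are small at nearby points commute. Since commuting is transitive through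
  elements other than plus or minus 1, and every point of \<open>S\<close> has a small element, the
  relation spreads along the connected set.\<close>

lemma small_elements_commute_along:
  assumes S: "connected S" "S \<subseteq> ball 0 1" "\<And>z. z \<in> S \<Longrightarrow> small_elements z \<noteq> {}"
    and ab: "a \<in> S" "b \<in> S" and x: "x \<in> small_elements a" and y: "y \<in> small_elements b"
  shows "y * x = x * y"
proof -
  define P where "P = (\<lambda>z. \<forall>y\<in>small_elements z. y * x = x * y)"
  have "P b"
  proof (rule connected_induction_simple[OF S(1) ab])
    show "P a"
      unfolding P_def
    proof
      fix y assume y: "y \<in> small_elements a"
      show "y * x = x * y"
        by (rule near_identity_commute[of a]) (use ab(1) S(2) x y in \<open>auto simp: small_elements_def\<close>)
    qed
    fix z assume z: "z \<in> S"
    then have z1: "cmod z < 1" using S(2) by auto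
    obtain e where e: "e > 0"
      "\<And>w x. cmod w < 1 \<Longrightarrow> dist w z < e \<Longrightarrow>
        sqn (based w x - 1) \<le> 2 * sqn (based z x - 1) \<and> sqn (based z x - 1) \<le> 2 * sqn (based w x - 1)"
      using based_nearby[OF z1] by blast
    have near: "sqn (based z v - 1) \<le> 1/32" if "v \<in> small_elements w" "w \<in> S" "dist w z < e" for v w
      using e(2)[of w v] that S(2) by (auto simp: small_elements_def)
    have c: "v * v' = v' * v" if "v \<in> small_elements w" "v' \<in> small_elements w'" "w \<in> S" "w' \<in> S"
      "dist w z < e" "dist w' z < e" for v v' w w'
      by (rule near_identity_commute[OF z1]) (use that near in \<open>auto simp: small_elements_def\<close>)
    show "\<exists>T. openin (top_of_set S) T \<and> z \<in> T \<and> (\<forall>u\<in>T. \<forall>v\<in>T. P u \<longrightarrow> P v)"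
    proof (intro exI[of _ "S \<inter> ball z e"] conjI ballI impI)
      show "openin (top_of_set S) (S \<inter> ball z e)" by (simp add: openin_open_Int)
      show "z \<in> S \<inter> ball z e" using z e by simp
      fix u v assume uv: "u \<in> S \<inter> ball z e" "v \<in> S \<inter> ball z e" "P u"
      \<comment> \<open>The bridge: \<open>k\<close> commutes with \<open>x\<close> because of
        \<open>P u\<close>, and with \<open>y\<close> because \<open>u\<close> and \<open>v\<close>
        are close.\<close>
      obtain k where k: "k \<in> small_elements u" using S(3) uv by blast
      have kn: "tless k \<noteq> 0" by (rule tless_nonzero) (use k in \<open>auto simp: small_elements_def\<close>)
      show "P v"
        unfolding P_def
      proof
        fix y assume y: "y \<in> small_elements v"
        show "y * x = x * y"
          by (rule commute_trans[OF kn])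
            (use c[of y v k u] k y uv in \<open>auto simp: P_def dist_commute\<close>)
      qed
    qed
  qed
  then show ?thesis using y by (simp add: P_def)
qed

text \<open>At all points of one circle the recentring elements have the same norm, so smallness
  after conjugation bounds \<open>x\<close> itself.\<close>

lemma finite_small_elements_circle:
  assumes "R < 1"
  shows "finite (\<Union>z\<in>{z. cmod z = R}. small_elements z)"
proof (rule finite_subset[OF _ finite_bounded])
  define m where "m = (1 + R) / sqrt (1 - R\<^sup>2)"
  show "(\<Union>z\<in>{z. cmod z = R}. small_elements z) \<subseteq> {x \<in> G. sqn x \<le> m * 2 * m}"
  proof clarify
    fix z x assume z: "R = cmod z" and x: "x \<in> small_elements z"
    have z1: "cmod z < 1" using assms z by simp
    have m: "sqn (to_zero z) = m" using sqn_to_zero[OF z1] z by (simp add: m_def)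
    have "sqn (based z x - 1) \<le> 1" using x by (simp add: small_elements_def)
    then have b: "sqn (based z x) \<le> 2" using sqn_le_near_1 by fastforce
    have "sqn x \<le> sqn (adj (to_zero z) * based z x) * sqn (to_zero z)"
      by (metis based_conj[OF z1] sqn_mult)
    also have "\<dots> \<le> (sqn (adj (to_zero z)) * sqn (based z x)) * sqn (to_zero z)"
      by (intro mult_right_mono sqn_mult) simp
    also have "\<dots> \<le> (m * 2) * m"
      using b m sqn_nonneg[of "to_zero z"] by (intro mult_right_mono mult_mono) auto
    finally show "x \<in> G \<and> sqn x \<le> m * 2 * m" using x by (simp add: small_elements_def)
  qed
qed

text \<open>Closeness to 1 excludes the representative with negative trace.\<close>

lemma small_elements_Re:
  assumes "cmod z < 1" "x \<in> small_elements z"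
  shows "Re (sa x) \<ge> 1"
proof -
  have "cmod (sa (based z x) - 1) \<le> sqn (based z x - 1)" by (simp add: sqn_def)
  then have "\<bar>Re (sa (based z x) - 1)\<bar> < 1"
    using abs_Re_le_cmod[of "sa (based z x) - 1"] assms(2) by (simp add: small_elements_def)
  then have "Re (sa x) > 0" using Re_sa_based[OF assms(1), of x] by simp
  then show ?thesis using Re_sa_ge_1[of x] assms(2) by (simp add: small_elements_def)
qed

lemma tless_based: "cmod z < 1 \<Longrightarrow> tless (based z x) = based z (tless x)"
  by (simp add: tless_def based_simps Re_sa_based)

text \<open>The determinant ties the half-trace to \<open>y\<close>: it exceeds 1 by at most
  \<open>y^2 * |sqdet N|\<close>. A small \<open>y\<close> would therefore bring \<open>h\<close>
  close to 1, against discreteness.\<close>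

lemma centralizer_gap:
  assumes g: "g \<in> G" "tless g \<noteq> 0"
  obtains y0 where "y0 > 0"
    "\<And>h y. \<lbrakk>h \<in> G; h \<noteq> 1; Re (sa h) \<ge> 1; tless h = sreal y * tless g\<rbrakk> \<Longrightarrow> \<bar>y\<bar> \<ge> y0"
proof -
  obtain e where e: "e > 0" "\<And>x. x \<in> G \<Longrightarrow> sqn (x - 1) < e \<Longrightarrow> x = 1"
    using discrete by blast
  define N where "N = tless g"
  define c where "c = \<bar>sqdet N\<bar> + sqn N"
  have "sqn N > 0" using g(2) sqn_eq_0[of N] sqn_nonneg[of N] by (simp add: N_def less_eq_real_def)
  then have c: "c > 0" by (simp add: c_def)
  show thesis
  proof (rule that)
    show "min 1 (e / c) > 0" using e c by simp
    fix h y assume h: "h \<in> G" "h \<noteq> 1" "Re (sa h) \<ge> 1" "tless h = sreal y * tless g"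
    show "\<bar>y\<bar> \<ge> min 1 (e / c)"
    proof (rule ccontr)
      assume "\<not> ?thesis"
      then have y: "\<bar>y\<bar> < 1" "\<bar>y\<bar> < e / c" by auto
      define x where "x = Re (sa h)"
      have "x\<^sup>2 + y\<^sup>2 * sqdet N = 1"
        using sqdet_tless[of h] det[OF h(1)] h(4) sqdet_sreal_mult by (simp add: x_def N_def)
      then have x2: "x\<^sup>2 - 1 \<le> y\<^sup>2 * \<bar>sqdet N\<bar>"
        using mult_left_mono[OF abs_ge_minus_self[of "sqdet N"] zero_le_power2[of y]] by simp
      have x1: "x \<ge> 1" using h(3) by (simp add: x_def)
      then have "x * 1 \<le> x * x" by (intro mult_left_mono) auto
      then have xx: "\<bar>x - 1\<bar> \<le> x\<^sup>2 - 1" using x1 by (simp add: power2_eq_square)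
      have y2: "y\<^sup>2 \<le> \<bar>y\<bar>"
        using y(1) mult_left_le[of "\<bar>y\<bar>" "\<bar>y\<bar>"] by (simp add: power2_eq_square)
      have "h - 1 = sreal (x - 1) + sreal y * N"
        using tless_decomp[of h] h(4) by (simp add: x_def N_def sq_eq_iff)
      then have "sqn (h - 1) \<le> \<bar>x - 1\<bar> + \<bar>y\<bar> * sqn N"
        using sqn_triangle[of "sreal (x - 1)" "sreal y * N"] by (simp add: sqn_sreal_mult)
      also have "\<dots> \<le> \<bar>y\<bar> * \<bar>sqdet N\<bar> + \<bar>y\<bar> * sqn N"
        using xx x2 mult_right_mono[OF y2, of "\<bar>sqdet N\<bar>"] by simp
      also have "\<dots> = \<bar>y\<bar> * c" by (simp add: c_def algebra_simps)
      also have "\<dots> < e" using y(2) c by (simp add: field_simps)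
      finally show False using e(2)[OF h(1)] h(2) by simp
    qed
  qed
qed

text \<open>Displacement depends only on the traceless part and scales with it, so
  \<open>disp h z = |y| * disp g z\<close>. With \<open>y\<close> bounded below, thinness caused by
  any element commuting with \<open>g\<close> bounds the displacement under \<open>g\<close>
  itself.\<close>

lemma centralizer_region:
  assumes g: "g \<in> G" "tless g \<noteq> 0"
  obtains \<rho> where "\<rho> > 0"
    "\<And>z h. \<lbrakk>cmod z < 1; h \<in> small_elements z; h * g = g * h\<rbrakk> \<Longrightarrow> disp g z \<le> \<rho>"
proof -
  obtain y0 where y0: "y0 > 0"
    "\<And>h y. \<lbrakk>h \<in> G; h \<noteq> 1; Re (sa h) \<ge> 1; tless h = sreal y * tless g\<rbrakk> \<Longrightarrow> \<bar>y\<bar> \<ge> y0"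
    using centralizer_gap[OF g] by blast
  show thesis
  proof (rule that)
    show "1 / y0 > 0" using y0 by simp
    fix z h assume z: "cmod z < 1" and h: "h \<in> small_elements z" "h * g = g * h"
    have hG: "h \<in> G" "h \<noteq> 1" using h by (auto simp: small_elements_def)
    have "tless g * tless h = tless h * tless g"
      using h(2) commute_tless_iff by metis
    then obtain y where y: "tless h = sreal y * tless g"
      using commuting_tless_parallel[of "tless g" "tless h"] g(2) by (metis Re_sa_tless)
    have yy: "\<bar>y\<bar> \<ge> y0" by (rule y0(2)[OF hG small_elements_Re[OF z h(1)] y])
    have "tless (based z h) = sreal y * based z (tless g)"
      unfolding tless_based[OF z] y based_simps[OF z] ..
    then have "sb (based z h) = of_real y * sb (based z g)"
      using tless_based[OF z, of g] by (simp add: tless_def sq_eq_iff)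
    then have "\<bar>y\<bar> * disp g z = cmod (sb (based z h))" by (simp add: disp_def norm_mult)
    also have "\<dots> \<le> sqn (based z h - 1)" by (simp add: sqn_def)
    also have "\<dots> \<le> 1" using h(1) by (simp add: small_elements_def)
    finally have "\<bar>y\<bar> * disp g z \<le> 1" .
    moreover have "y0 * disp g z \<le> \<bar>y\<bar> * disp g z"
      using yy by (intro mult_right_mono) (auto simp: disp_def)
    ultimately show "disp g z \<le> 1 / y0" using y0(1) by (simp add: field_simps)
  qed
qed

text \<open>The closure of a tube around the axis of \<open>g\<close> meets the circle only at fixed
  points of \<open>g\<close>. There \<open>autom g z\<close> and \<open>autom (adj g) z\<close> have
  product 1 and sum \<open>2 * Re (sa g) > 2\<close>, so they cannot both have modulus at least 1,
  as the Dirichlet condition requires. Compactness then keeps the region away from the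
  circle.\<close>

lemma hyperbolic_region_bounded:
  assumes g: "g \<in> G" "Re (sa g) > 1"
  obtains r where "r < 1" "\<And>z. z \<in> dirichlet \<Longrightarrow> disp g z \<le> \<rho> \<Longrightarrow> cmod z \<le> r"
proof -
  define q where "q = (\<lambda>z. sb g + 2 * \<i> * Im (sa g) * z - cnj (sb g) * z\<^sup>2)"
  define K where "K = {z \<in> cball 0 1. cmod (q z) \<le> \<rho> * (1 - (cmod z)\<^sup>2) \<and>
    1 \<le> cmod (autom g z) \<and> 1 \<le> cmod (autom (adj g) z)}"
  have "closed {z. cmod (q z) \<le> \<rho> * (1 - (cmod z)\<^sup>2)}"
    unfolding q_def by (intro closed_Collect_le continuous_intros)
  moreover have "closed {z. 1 \<le> cmod (autom x z)}" for x
    unfolding autom_def by (intro closed_Collect_le continuous_intros)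
  moreover have "K = cball 0 1 \<inter> ({z. cmod (q z) \<le> \<rho> * (1 - (cmod z)\<^sup>2)} \<inter>
      ({z. 1 \<le> cmod (autom g z)} \<inter> {z. 1 \<le> cmod (autom (adj g) z)}))"
    by (auto simp: K_def)
  ultimately have K: "compact K" by (simp only:) (intro compact_Int_closed compact_cball closed_Int)
  have int: "cmod z < 1" if z: "z \<in> K" for z
  proof (rule ccontr)
    assume "\<not> cmod z < 1"
    then have z1: "cmod z = 1" using z by (simp add: K_def)
    then have q0: "q z = 0" using z by (simp add: K_def)
    define m where "m = autom g z"
    define n where "n = autom (adj g) z"
    have mn: "m + n = of_real (2 * Re (sa g))"
      by (simp add: m_def n_def autom_def complex_eq_iff)
    have "sa g = cnj (sa g) + 2 * \<i> * Im (sa g)" by (simp add: complex_eq_iff)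
    then have s: "sa g * w = cnj (sa g) * w + 2 * \<i> * Im (sa g) * w" for w by (metis distrib_right)
    have "m * n = sa g * cnj (sa g) - sb g * cnj (sb g) + cnj (sb g) * q z"
      using s[of "cnj (sb g) * z"] unfolding q_def
      by (simp add: m_def n_def autom_def algebra_simps power2_eq_square)
    also have "\<dots> = sa g * cnj (sa g) - sb g * cnj (sb g)" using q0 by simp
    also have "\<dots> = of_real (sqdet g)"
      by (simp add: sqdet_def complex_norm_square of_real_diff del: of_real_power)
    finally have 1: "m * n = 1" using det[OF g(1)] by simp
    have ge: "1 \<le> cmod m" "1 \<le> cmod n" using z by (auto simp: K_def m_def n_def)
    have "cmod m * cmod n = 1" using 1 by (metis norm_mult norm_one)
    then have "cmod m * 1 \<le> 1" "1 * cmod n \<le> 1"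
      using ge mult_left_mono[OF ge(2), of "cmod m"] mult_right_mono[OF ge(1), of "cmod n"] by auto
    then have "cmod (m + n) \<le> 2" using norm_triangle_ineq[of m n] by simp
    then show False using g(2) unfolding mn norm_of_real by simp
  qed
  obtain r where r: "r < 1" "\<And>z. z \<in> K \<Longrightarrow> cmod z \<le> r"
  proof (cases "K = {}")
    case True
    then show ?thesis using that[of 0] by simp
  next
    case False
    then obtain z0 where "z0 \<in> K" "\<And>z. z \<in> K \<Longrightarrow> cmod z \<le> cmod z0"
      using continuous_attains_sup[OF K False, of cmod] by (metis continuous_on_norm_id)
    then show ?thesis using that[of "cmod z0"] int by blast
  qed
  show thesis
  proof (rule that[OF r(1)])
    fix z assume z: "z \<in> dirichlet" "disp g z \<le> \<rho>"
    then have z1: "cmod z < 1" by (simp add: dirichlet_iff)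
    then have p: "1 - (cmod z)\<^sup>2 > 0" by (simp add: power_less_one_iff)
    have "cmod (q z) \<le> \<rho> * (1 - (cmod z)\<^sup>2)"
      using z(2) p unfolding disp_eq[OF z1] q_def by (simp add: pos_divide_le_eq)
    then have "z \<in> K" using z(1) z1 g(1) inv[OF g(1)] by (simp add: K_def dirichlet_iff)
    then show "cmod z \<le> r" by (rule r(2))
  qed
qed

text \<open>Along a ray of the Dirichlet domain all small elements commute, so the far part of the domain
  is covered by the thin parts of finitely many centralizers.\<close>

lemma dirichlet_cover:
  assumes R: "0 \<le> R" "R < 1" "\<And>z. z \<in> dirichlet \<Longrightarrow> cmod z \<ge> R \<Longrightarrow> small_elements z \<noteq> {}"
  obtains r P \<eta> where "r < 1" "\<eta> > 0" "finite P" "\<And>g. g \<in> P \<Longrightarrow> g \<in> G \<and> is_parabolic g"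
    "\<And>z. z \<in> dirichlet \<Longrightarrow> cmod z \<le> r \<or> (\<exists>g\<in>P. disp g z < \<eta>)"
proof -
  \<comment> \<open>Every ray to a point beyond radius \<open>R\<close> crosses this circle, so the
    finitely many small elements on it account for all far points.\<close>
  define B where "B = (\<Union>z\<in>{z. cmod z = R}. small_elements z)"
  have fB: "finite B" unfolding B_def by (rule finite_small_elements_circle[OF R(2)])
  have BG: "g \<in> G" "tless g \<noteq> 0" "Re (sa g) \<ge> 1" "g \<noteq> 1" if "g \<in> B" for g
  proof -
    obtain z where z: "cmod z = R" "g \<in> small_elements z"
      using \<open>g \<in> B\<close> by (auto simp: B_def)
    show "g \<in> G" "g \<noteq> 1" using z by (auto simp: small_elements_def)
    show "tless g \<noteq> 0" by (rule tless_nonzero) (use z in \<open>auto simp: small_elements_def\<close>)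
    show "Re (sa g) \<ge> 1" using small_elements_Re z R by auto
  qed
  have "\<forall>g\<in>B. \<exists>\<rho>>0. \<forall>z h. cmod z < 1 \<longrightarrow> h \<in> small_elements z \<longrightarrow> h * g = g * h \<longrightarrow> disp g z \<le> \<rho>"
  proof
    fix g assume "g \<in> B"
    from centralizer_region[OF BG(1,2)[OF this]] show
      "\<exists>\<rho>>0. \<forall>z h. cmod z < 1 \<longrightarrow> h \<in> small_elements z \<longrightarrow> h * g = g * h \<longrightarrow> disp g z \<le> \<rho>"
      by metis
  qed
  then obtain \<rho> where \<rho>: "\<And>g. g \<in> B \<Longrightarrow> \<rho> g > 0"
    "\<And>g z h. \<lbrakk>g \<in> B; cmod z < 1; h \<in> small_elements z; h * g = g * h\<rbrakk> \<Longrightarrow> disp g z \<le> \<rho> g"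
    by metis
  have "\<forall>g\<in>B. Re (sa g) > 1 \<longrightarrow> (\<exists>r<1. \<forall>z. z \<in> dirichlet \<longrightarrow> disp g z \<le> \<rho> g \<longrightarrow> cmod z \<le> r)"
  proof (intro ballI impI)
    fix g assume "g \<in> B" "Re (sa g) > 1"
    from hyperbolic_region_bounded[OF BG(1)[OF this(1)] this(2), of "\<rho> g"]
    show "\<exists>r<1. \<forall>z. z \<in> dirichlet \<longrightarrow> disp g z \<le> \<rho> g \<longrightarrow> cmod z \<le> r" by metis
  qed
  then obtain r0 where r0: "\<And>g. g \<in> B \<Longrightarrow> Re (sa g) > 1 \<Longrightarrow> r0 g < 1"
    "\<And>g z. \<lbrakk>g \<in> B; Re (sa g) > 1; z \<in> dirichlet; disp g z \<le> \<rho> g\<rbrakk> \<Longrightarrow> cmod z \<le> r0 g"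
    by metis
  define H where "H = {g \<in> B. Re (sa g) > 1}"
  define P where "P = {g \<in> B. Re (sa g) = 1}"
  define r where "r = Max (insert R (r0 ` H))"
  define \<eta> where "\<eta> = 1 + Max (insert 0 (\<rho> ` P))"
  have fin: "finite (insert R (r0 ` H))" "finite (insert 0 (\<rho> ` P))" using fB by (auto simp: H_def P_def)
  have "r < 1" unfolding r_def using fin R r0 by (subst Max_less_iff) (auto simp: H_def)
  moreover have "\<eta> > 0"
    using Max_ge[OF fin(2), of 0] by (simp add: \<eta>_def)
  moreover have "finite P" using fB by (simp add: P_def)
  moreover have "\<And>g. g \<in> P \<Longrightarrow> g \<in> G \<and> is_parabolic g"
    using BG det by (auto simp: P_def is_parabolic_def)
  moreover have "cmod z \<le> r \<or> (\<exists>g\<in>P. disp g z < \<eta>)" if z: "z \<in> dirichlet" for z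
  proof (cases "cmod z \<le> R")
    case True
    then show ?thesis using Max_ge[OF fin(1), of R] by (simp add: r_def)
  next
    case False
    then have zR: "cmod z > R" by simp
    then have z0: "cmod z > 0" using R by linarith
    have z1: "cmod z < 1" using z by (simp add: dirichlet_iff)
    define t0 where "t0 = R / cmod z"
    have t0: "0 \<le> t0" "t0 \<le> 1" using R zR z0 by (auto simp: t0_def)
    \<comment> \<open>The part of the ray from radius \<open>R\<close> out to \<open>z\<close>; it
      stays in the Dirichlet domain by star-shapedness, and all its points are thin.\<close>
    define S where "S = (\<lambda>t. of_real t * z) ` {t0..1}"
    have Sd: "w \<in> dirichlet \<and> R \<le> cmod w" if "w \<in> S" for w
    proof -
      obtain t where t: "t0 \<le> t" "t \<le> 1" "w = of_real t * z" using \<open>w \<in> S\<close> by (auto simp: S_def)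
      have "R = t0 * cmod z" using z0 by (simp add: t0_def)
      also have "\<dots> \<le> t * cmod z" using t by (intro mult_right_mono) auto
      also have "\<dots> = cmod w" using t t0 by (simp add: norm_mult)
      finally show ?thesis using dirichlet_star[OF z] t t0 by simp
    qed
    have 1: "connected S" unfolding S_def by (intro connected_continuous_image continuous_intros) simp
    have 2: "S \<subseteq> ball 0 1" using Sd by (auto simp: dirichlet_iff)
    have 3: "\<And>w. w \<in> S \<Longrightarrow> small_elements w \<noteq> {}" using R(3) Sd by blast
    have a: "of_real t0 * z \<in> S" "z \<in> S" using t0 by (auto simp: S_def image_iff intro: bexI[of _ 1])
    obtain g where g: "g \<in> small_elements (of_real t0 * z)" using 3 a by blast
    have "cmod (of_real t0 * z) = R"
      unfolding norm_mult norm_of_real using z0 R t0(1) by (simp add: t0_def)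
    then have gB: "g \<in> B" using g by (auto simp: B_def)
    obtain h where h: "h \<in> small_elements z" using 3 a by blast
    have "h * g = g * h" by (rule small_elements_commute_along[OF 1 2 3 a g h])
    then have d: "disp g z \<le> \<rho> g" by (rule \<rho>(2)[OF gB z1 h])
    show ?thesis
    proof (cases "Re (sa g) > 1")
      case True
      then have "cmod z \<le> r0 g" using r0(2) gB z d by simp
      also have "\<dots> \<le> r" unfolding r_def using fin gB True by (intro Max_ge) (auto simp: H_def)
      finally show ?thesis by simp
    next
      case False
      then have gP: "g \<in> P" using BG(3)[OF gB] gB by (simp add: P_def)
      then have "\<rho> g \<le> Max (insert 0 (\<rho> ` P))" using fin by (intro Max_ge) auto
      then have "disp g z < \<eta>" using d by (simp add: \<eta>_def)
      then show ?thesis using gP by blast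
    qed
  qed
  ultimately show ?thesis by (rule that)
qed

end

section \<open>Hyperbolic area\<close>

text \<open>Areas of images are estimated by the change of variables for maps of
  \<open>real^2\<close>; \<open>cvec\<close> and \<open>ivec\<close> identify that space with the
  complex plane.\<close>

definition cvec :: "complex \<Rightarrow> real^2" where
  "cvec z = (\<chi> i. if i = 1 then Re z else Im z)"

definition ivec :: "real^2 \<Rightarrow> complex" where
  "ivec v = Complex (v $ 1) (v $ 2)"

lemma cvec_nth [simp]: "cvec z $ 1 = Re z" "cvec z $ 2 = Im z"
  by (simp_all add: cvec_def)

lemma ivec_cvec [simp]: "ivec (cvec z) = z"
  by (simp add: ivec_def)

lemma cvec_ivec [simp]: "cvec (ivec v) = v"
  by (simp add: ivec_def vec_eq_iff forall_2)

lemma linear_cvec: "linear cvec"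
  by (rule linearI) (simp_all add: vec_eq_iff forall_2)

lemma linear_ivec: "linear ivec"
  by (rule linearI) (simp_all add: ivec_def complex_eq_iff)

lemma borel_measurable_cvec [measurable]: "cvec \<in> borel_measurable borel"
  using linear_cvec by (intro borel_measurable_continuous_onI linear_continuous_on) (simp add: linear_conv_bounded_linear)

lemma borel_measurable_ivec [measurable]: "ivec \<in> borel_measurable borel"
  using linear_ivec by (intro borel_measurable_continuous_onI linear_continuous_on) (simp add: linear_conv_bounded_linear)

lemma distr_cvec: "distr lborel borel cvec = (lborel :: (real^2) measure)"
proof (rule lborel_eqI[symmetric])
  fix l u :: "real^2" assume le: "\<And>b. b \<in> Basis \<Longrightarrow> l \<bullet> b \<le> u \<bullet> b"
  have le': "l $ i \<le> u $ i" for i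
    using le[of "axis i 1"] by (simp add: inner_axis)
  have "cvec -` box l u = box (ivec l) (ivec u)"
    by (auto simp: mem_box_cart forall_2 in_box_complex_iff ivec_def)
  then have "emeasure (distr lborel borel cvec) (box l u) = emeasure lborel (box (ivec l) (ivec u))"
    by (subst emeasure_distr) auto
  also have "\<dots> = ennreal (\<Prod>b\<in>Basis. (ivec u - ivec l) \<bullet> b)"
    using le' by (intro emeasure_lborel_box) (auto simp: Basis_complex_def ivec_def)
  also have "(\<Prod>b\<in>Basis. (ivec u - ivec l) \<bullet> b) = (u $ 1 - l $ 1) * (u $ 2 - l $ 2)"
    by (simp add: Basis_complex_def ivec_def)
  also have "\<dots> = (\<Prod>i\<in>UNIV. u $ i - l $ i)"
    by (simp add: UNIV_2)
  also have "\<dots> = (\<Prod>b\<in>Basis. (u - l) \<bullet> b)"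
  proof -
    have B: "(Basis :: (real^2) set) = (\<lambda>i. axis i 1) ` UNIV" by (auto simp: Basis_vec_def)
    have "inj (\<lambda>i::2. axis i (1::real))" by (auto simp: inj_def axis_eq_axis)
    then show ?thesis unfolding B by (subst prod.reindex) (auto simp: inner_axis)
  qed
  finally show "emeasure (distr lborel borel cvec) (box l u) = ennreal (\<Prod>b\<in>Basis. (u - l) \<bullet> b)" .
qed simp

lemma emeasure_ivec_vimage: "E \<in> sets borel \<Longrightarrow> emeasure lborel (ivec -` E) = emeasure lborel E"
proof -
  assume E: "E \<in> sets borel"
  have m: "ivec -` E \<in> sets borel" using measurable_sets[OF borel_measurable_ivec E] by simp
  have "emeasure lborel (ivec -` E) = emeasure (distr lborel borel cvec) (ivec -` E)"
    unfolding distr_cvec ..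
  also have "\<dots> = emeasure lborel (cvec -` (ivec -` E))"
    using m by (subst emeasure_distr) auto
  also have "cvec -` (ivec -` E) = E" by auto
  finally show ?thesis .
qed

lemma det_complex_derivative:
  "det (matrix (\<lambda>h. cvec (c * ivec h))) = (cmod c)\<^sup>2"
  unfolding cmod_power2 by (simp add: det_2 matrix_def axis_def ivec_def power2_eq_square)

lemma emeasure_holomorphic_image_le:
  assumes E: "E \<in> sets borel" "emeasure lborel E < \<infinity>"
    and g: "\<And>z. z \<in> E \<Longrightarrow> (g has_field_derivative g' z) (at z)" "continuous_on E g'"
    and B: "\<And>z. z \<in> E \<Longrightarrow> (cmod (g' z))\<^sup>2 \<le> B"
    and gE: "g ` E \<in> sets borel" and B0: "B \<ge> 0"
  shows "emeasure lborel (g ` E) \<le> ennreal B * emeasure lborel E"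
proof -
  define S where "S = ivec -` E"
  define f where "f = (\<lambda>v. cvec (g (ivec v)))"
  define f' where "f' = (\<lambda>v h. cvec (g' (ivec v) * ivec h))"
  have Sb: "S \<in> sets borel" unfolding S_def using measurable_sets[OF borel_measurable_ivec E(1)] by simp
  have eS: "emeasure lborel S = emeasure lborel E" unfolding S_def by (rule emeasure_ivec_vimage[OF E(1)])
  have Sm: "S \<in> lmeasurable"
    using Sb eS E(2) by (intro fmeasurableI) (auto simp: emeasure_completion)
  have D: "(f has_derivative f' v) (at v within S)" if "v \<in> S" for v
  proof -
    have "(g has_derivative (*) (g' (ivec v))) (at (ivec v))"
      using g(1)[of "ivec v"] that by (simp add: S_def has_field_derivative_def)
    from has_derivative_compose[OF linear_imp_has_derivative[OF linear_ivec] this]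
    have 1: "((\<lambda>v. g (ivec v)) has_derivative (\<lambda>h. g' (ivec v) * ivec h)) (at v within S)" .
    from has_derivative_compose[OF 1 linear_imp_has_derivative[OF linear_cvec]]
    show ?thesis unfolding f_def f'_def .
  qed
  have dt: "\<bar>det (matrix (f' v))\<bar> = (cmod (g' (ivec v)))\<^sup>2" for v
    unfolding f'_def det_complex_derivative by simp
  have int: "(\<lambda>v. \<bar>det (matrix (f' v))\<bar>) integrable_on S"
  proof -
    have ci: "continuous_on S ivec"
      using linear_ivec by (intro linear_continuous_on) (simp add: linear_conv_bounded_linear)
    have "continuous_on S (\<lambda>v. (cmod (g' (ivec v)))\<^sup>2)"
      by (intro continuous_intros continuous_on_compose2[OF g(2) ci]) (auto simp: S_def)
    then have "(\<lambda>v. (cmod (g' (ivec v)))\<^sup>2) \<in> borel_measurable (lebesgue_on S)"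
      using Sb by (intro continuous_imp_measurable_on_sets_lebesgue) auto
    then have "(\<lambda>v. (cmod (g' (ivec v)))\<^sup>2) absolutely_integrable_on S"
    proof (rule measurable_bounded_by_integrable_imp_absolutely_integrable)
      show "(\<lambda>v. B) integrable_on S" using Sm by (intro integrable_on_const)
      show "norm ((cmod (g' (ivec v)))\<^sup>2) \<le> B" if "v \<in> S" for v using B that by (simp add: S_def)
    qed (use Sb in auto)
    then show ?thesis unfolding dt absolutely_integrable_on_def by blast
  qed
  have bd: "\<bar>det (matrix (f' v))\<bar> \<le> B" if "v \<in> S" for v
    unfolding dt using B that by (simp add: S_def)
  have 1: "f ` S \<in> lmeasurable" by (rule measurable_bounded_differentiable_image[OF Sm D int bd])
  have 2: "measure lebesgue (f ` S) \<le> B * measure lebesgue S"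
    by (rule measure_bounded_differentiable_image[OF Sm D int bd])
  have fS: "f ` S = ivec -` (g ` E)"
  proof
    show "f ` S \<subseteq> ivec -` g ` E" by (auto simp: f_def S_def)
    show "ivec -` g ` E \<subseteq> f ` S"
    proof
      fix v assume "v \<in> ivec -` g ` E"
      then obtain z where "z \<in> E" "ivec v = g z" by auto
      then have "v = f (cvec z)" "cvec z \<in> S" by (auto simp: f_def S_def) (metis cvec_ivec)
      then show "v \<in> f ` S" by blast
    qed
  qed
  have fSb: "f ` S \<in> sets borel" unfolding fS using measurable_sets[OF borel_measurable_ivec gE] by simp
  have "emeasure lborel (g ` E) = emeasure lborel (f ` S)"
    unfolding fS by (rule emeasure_ivec_vimage[OF gE, symmetric])
  also have "\<dots> = emeasure lebesgue (f ` S)" using fSb by (simp add: emeasure_completion)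
  also have "\<dots> = ennreal (measure lebesgue (f ` S))" using 1 by (simp add: emeasure_eq_measure2)
  also have "\<dots> \<le> ennreal (B * measure lebesgue S)" using 2 by (rule ennreal_leI)
  also have "\<dots> = ennreal B * ennreal (measure lebesgue S)" using B0 by (simp add: ennreal_mult)
  also have "ennreal (measure lebesgue S) = emeasure lebesgue S" using Sm by (simp add: emeasure_eq_measure2)
  also have "\<dots> = emeasure lborel E" using Sb eS by (simp add: emeasure_completion)
  finally show ?thesis .
qed

section \<open>Pseudo-hyperbolic balls and their area\<close>

definition hyp :: "complex measure" where
  "hyp = density lborel (\<lambda>z. ennreal (4 / (1 - (cmod z)\<^sup>2)\<^sup>2))"

lemma sets_hyp [simp, measurable_cong]: "sets hyp = sets borel"
  by (simp add: hyp_def)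

lemma emeasure_hyp: "A \<in> sets borel \<Longrightarrow> emeasure hyp A = hyperbolic_area A"
  unfolding hyp_def hyperbolic_area_def by (subst emeasure_density) auto

text \<open>The pseudo-hyperbolic distance, \<open>tanh (d / 2)\<close> for hyperbolic distance
  \<open>d\<close> between points of the disk.\<close>

definition pdist :: "complex \<Rightarrow> complex \<Rightarrow> real" where
  "pdist z w = cmod (act (to_zero z) w)"

lemma pdist_eq:
  assumes "cmod z < 1"
  shows "pdist z w = cmod (w - z) / cmod (1 - cnj z * w)"
proof -
  define s where "s = 1 / sqrt (1 - (cmod z)\<^sup>2)"
  have "1 - (cmod z)\<^sup>2 > 0" using assms by (simp add: power_less_one_iff)
  then have s: "s > 0" by (simp add: s_def)
  have t: "to_zero z = Sq (of_real s) (- (of_real s * z))" by (simp add: to_zero_def s_def Let_def)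
  have "act (to_zero z) w = (of_real s * (w - z)) / (of_real s * (1 - cnj z * w))"
    by (simp add: t act_def autom_def algebra_simps)
  also have "\<dots> = (w - z) / (1 - cnj z * w)" using s by simp
  finally show ?thesis by (simp add: pdist_def norm_divide)
qed

lemma pdist_act:
  assumes "sqdet x = 1" "cmod z < 1" "cmod w < 1"
  shows "pdist (act x z) (act x w) = pdist z w"
proof -
  define k where "k = to_zero (act x z) * x * adj (to_zero z)"
  have az: "cmod (act x z) < 1" by (rule act_in_disk[OF assms(1,2)])
  have dk: "sqdet k = 1" by (simp add: k_def sqdet_mult to_zero assms az)
  have ku: "act k u = act (to_zero (act x z)) (act x (act (adj (to_zero z)) u))" if "cmod u < 1" for u
    unfolding k_def using assms to_zero[OF assms(2)] that
    by (simp add: act_mult(1) act_in_disk)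
  have "act k 0 = 0" using ku[of 0] to_zero[OF assms(2)] to_zero[OF az] by simp
  then have b: "sb k = 0" using autom_nonzero[OF dk, of 0] by (simp add: act_def)
  then have a: "(cmod (sa k))\<^sup>2 = 1" using dk by (simp add: sqdet_def)
  then have a': "cmod (sa k) = 1" by (simp add: power2_eq_1_iff) (smt (verit) norm_ge_zero)
  define u where "u = act (to_zero z) w"
  have u: "cmod u < 1" unfolding u_def using assms to_zero[OF assms(2)] by (simp add: act_in_disk)
  have "act (adj (to_zero z)) u = w"
    unfolding u_def using act_adj(1)[OF to_zero(1)[OF assms(2)] assms(3)] .
  then have "act k u = act (to_zero (act x z)) (act x w)" using ku[OF u] by simp
  moreover have "cmod (act k u) = cmod u" using a' by (simp add: act_def autom_def b norm_divide norm_mult)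
  ultimately show ?thesis by (simp add: pdist_def u_def)
qed

text \<open>Both points are images of points near 0 under the same \<open>k\<close>, and on the disk
  of radius 1/4 \<open>autom k\<close> stays between 3/4 and 5/4 of its modulus at 0.\<close>

lemma pdist_comparable:
  assumes "cmod z < 1" "cmod w < 1" "pdist z w < 1/4"
  shows "1 - (cmod w)\<^sup>2 \<le> 2 * (1 - (cmod z)\<^sup>2)" "1 - (cmod z)\<^sup>2 \<le> 2 * (1 - (cmod w)\<^sup>2)"
proof -
  define k where "k = adj (to_zero z)"
  define u where "u = act (to_zero z) w"
  have dk: "sqdet k = 1" by (simp add: k_def to_zero assms)
  have u: "cmod u < 1/4" using assms by (simp add: u_def pdist_def)
  have w: "w = act k u" unfolding k_def u_def using act_adj(1)[OF to_zero(1)[OF assms(1)] assms(2)] by simp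
  have z: "z = act k 0" unfolding k_def using to_zero(3)[OF assms(1)] by simp
  define a where "a = cmod (sa k)"
  have a1: "a \<ge> 1" using su_norms(1)[OF dk] by (simp add: a_def)
  have zz: "1 - (cmod z)\<^sup>2 = 1 / a\<^sup>2"
    unfolding z using one_minus_act[OF dk, of 0] by (simp add: a_def autom_def)
  define j where "j = cmod (autom k u)"
  have ww: "1 - (cmod w)\<^sup>2 = (1 - (cmod u)\<^sup>2) / j\<^sup>2"
    unfolding w using one_minus_act[OF dk, of u] u by (simp add: j_def)
  have ab: "cmod (sb k) * cmod u \<le> a * (1/4)"
    using su_norms(2)[OF dk] u by (intro mult_mono) (auto simp: a_def)
  have j1: "3/4 * a \<le> j" "j \<le> 5/4 * a"
    using autom_bounds(1,2)[of u k] ab u by (auto simp: j_def a_def)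
  have j2: "(3/4 * a)\<^sup>2 \<le> j\<^sup>2" "j\<^sup>2 \<le> (5/4 * a)\<^sup>2" using j1 a1 by (auto intro!: power_mono)
  have u2: "(cmod u)\<^sup>2 \<le> (1/4)\<^sup>2" using u by (intro power_mono) auto
  have a2: "a\<^sup>2 > 0" "j\<^sup>2 > 0" using a1 j1 by auto
  have "(1 - (cmod u)\<^sup>2) * a\<^sup>2 \<le> 1 * a\<^sup>2" by (intro mult_right_mono) auto
  also have "\<dots> \<le> 2 * j\<^sup>2" using j2(1) a2 by (simp add: power2_eq_square)
  finally show "1 - (cmod w)\<^sup>2 \<le> 2 * (1 - (cmod z)\<^sup>2)"
    unfolding ww zz using a2 by (simp add: field_simps)
  have "j\<^sup>2 \<le> 25/16 * a\<^sup>2" using j2(2) by (simp add: power2_eq_square)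
  also have "\<dots> \<le> 2 * (15/16) * a\<^sup>2" using a2 by simp
  also have "\<dots> \<le> 2 * (1 - (cmod u)\<^sup>2) * a\<^sup>2"
    using u2 by (intro mult_right_mono) (auto simp: power2_eq_square)
  finally show "1 - (cmod z)\<^sup>2 \<le> 2 * (1 - (cmod w)\<^sup>2)"
    unfolding ww zz using a2 by (simp add: field_simps)
qed

lemma ball_in_pdist_ball:
  assumes z: "cmod z < 1" and w: "cmod (w - z) < (1 - (cmod z)\<^sup>2) / 8"
  shows "cmod w < 1" "pdist z w < 1/4"
proof -
  define d where "d = 1 - (cmod z)\<^sup>2"
  have d: "d > 0" using z by (simp add: d_def power_less_one_iff)
  have "d = (1 - cmod z) * (1 + cmod z)" by (simp add: d_def power2_eq_square algebra_simps)
  also have "\<dots> \<le> (1 - cmod z) * 2" using z by (intro mult_left_mono) auto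
  finally have "cmod (w - z) < 1 - cmod z" using w z by (simp add: d_def[symmetric])
  then show "cmod w < 1" using norm_triangle_sub[of w z] by linarith
  have "complex_of_real d = 1 - cnj z * z"
    by (simp add: d_def complex_norm_square mult.commute del: of_real_power)
  then have "1 - cnj z * w = of_real d - cnj z * (w - z)" by (simp add: algebra_simps)
  then have "cmod (1 - cnj z * w) \<ge> d - cmod (cnj z * (w - z))"
    using norm_triangle_ineq2[of "complex_of_real d" "cnj z * (w - z)"] d by simp
  moreover have "cmod (cnj z * (w - z)) \<le> 1 * (d / 8)"
    unfolding norm_mult using z w by (intro mult_mono) (auto simp: d_def)
  ultimately have 1: "cmod (1 - cnj z * w) \<ge> 7/8 * d" by simp
  then have "cmod (1 - cnj z * w) > 0" using d by linarith
  then show "pdist z w < 1/4"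
    unfolding pdist_eq[OF z] using w 1 d by (simp add: d_def[symmetric] field_simps)
qed

lemma borel_pdist_ball [measurable]:
  assumes "cmod z < 1"
  shows "{w. cmod w < 1 \<and> pdist z w < 1/4} \<in> sets borel"
  unfolding pdist_eq[OF assms] by measurable

lemma hyp_pdist_ball_ge:
  assumes z: "cmod z < 1"
  shows "emeasure hyp {w. cmod w < 1 \<and> pdist z w < 1/4} \<ge> ennreal (pi / 64)"
proof -
  define d where "d = 1 - (cmod z)\<^sup>2"
  have d: "d > 0" using z by (simp add: d_def power_less_one_iff)
  let ?B = "{w. cmod w < 1 \<and> pdist z w < 1/4}"
  \<comment> \<open>The Euclidean ball of radius \<open>d / 8\<close> lies in the set, and its
    points have \<open>1 - |w|^2 <= 2 * d\<close>, so the density there is at least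
    \<open>1 / d^2\<close>.\<close>
  have "ennreal (pi / 64) = ennreal (1 / d\<^sup>2) * emeasure lborel (ball z (d / 8))"
    using d by (simp add: emeasure_ball_complex ennreal_mult'[symmetric] power_divide)
  also have "\<dots> = (\<integral>\<^sup>+w. ennreal (1 / d\<^sup>2) * indicator (ball z (d / 8)) w \<partial>lborel)"
    by (simp add: nn_integral_cmult_indicator)
  also have "\<dots> \<le> (\<integral>\<^sup>+w\<in>?B. ennreal (4 / (1 - (cmod w)\<^sup>2)\<^sup>2) \<partial>lborel)"
  proof (rule nn_integral_mono)
    fix w
    show "ennreal (1 / d\<^sup>2) * indicator (ball z (d / 8)) w
        \<le> ennreal (4 / (1 - (cmod w)\<^sup>2)\<^sup>2) * indicator ?B w"
    proof (cases "w \<in> ball z (d / 8)")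
      case True
      then have w: "cmod w < 1" "pdist z w < 1/4"
        using ball_in_pdist_ball[OF z, of w] by (auto simp: d_def dist_norm norm_minus_commute)
      have wp: "1 - (cmod w)\<^sup>2 > 0" using w by (simp add: power_less_one_iff)
      have "(1 - (cmod w)\<^sup>2)\<^sup>2 \<le> (2 * d)\<^sup>2"
        using pdist_comparable(1)[OF z w] wp by (intro power_mono) (auto simp: d_def)
      then have "1 / d\<^sup>2 \<le> 4 / (1 - (cmod w)\<^sup>2)\<^sup>2"
        using d wp by (simp add: field_simps power_mult_distrib)
      then show ?thesis using True w by (auto intro!: ennreal_leI)
    qed simp
  qed
  also have "\<dots> = emeasure hyp ?B"
    using emeasure_hyp[OF borel_pdist_ball[OF z]] by (simp add: hyperbolic_area_def)
  finally show ?thesis .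
qed

lemma act_continuous_on: "sqdet x = 1 \<Longrightarrow> continuous_on (ball 0 1) (act x)"
  by (intro continuous_at_imp_continuous_on ballI DERIV_isCont[OF act_has_derivative]) auto

lemma borel_act_preimage:
  assumes "sqdet x = 1" "E \<in> sets borel" "F \<in> sets borel" "F \<subseteq> ball 0 1"
  shows "{v \<in> F. act x v \<in> E} \<in> sets borel"
proof -
  have m: "act x \<in> borel_measurable borel"
    unfolding act_def[abs_def] autom_def by measurable
  then have "act x -` E \<in> sets borel" using measurable_sets[OF m assms(2)] by simp
  moreover have "{v \<in> F. act x v \<in> E} = F \<inter> act x -` E" by auto
  ultimately show ?thesis using assms(3) by simp
qed

text \<open>The hyperbolic area is invariant, but a bounded distortion on small pieces is all that is needed.\<close>

lemma hyp_piece_le: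
  assumes x: "sqdet x = 1" and z: "cmod z < 1" and F: "F \<in> sets borel" "F \<subseteq> ball 0 1"
  shows "emeasure hyp {w. cmod w < 1 \<and> pdist z w < 1/4 \<and> act x w \<in> F}
    \<le> 256 * emeasure hyp {v \<in> F. pdist z (act (adj x) v) < 1/4}"
proof -
  define Q where "Q = {v \<in> F. pdist z (act (adj x) v) < 1/4}"
  define P where "P = {w. cmod w < 1 \<and> pdist z w < 1/4 \<and> act x w \<in> F}"
  have dx: "sqdet (adj x) = 1" using x by simp
  have PQ: "P = act (adj x) ` Q"
  proof
    show "P \<subseteq> act (adj x) ` Q"
    proof
      fix w assume w: "w \<in> P"
      then have e: "act (adj x) (act x w) = w" using act_adj(1)[OF x] by (simp add: P_def)
      then have "act x w \<in> Q" using w by (simp add: P_def Q_def)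
      then show "w \<in> act (adj x) ` Q" using e by (metis image_eqI)
    qed
    show "act (adj x) ` Q \<subseteq> P"
      using F(2) act_adj(2)[OF x] act_in_disk[OF dx] by (auto simp: P_def Q_def)
  qed
  have Qb: "Q \<in> sets borel"
  proof -
    have "Q = {v \<in> F. act (adj x) v \<in> {w. cmod w < 1 \<and> pdist z w < 1/4}}"
      using F(2) act_in_disk[OF dx] by (auto simp: Q_def)
    then show ?thesis using borel_act_preimage[OF dx borel_pdist_ball[OF z] F] by simp
  qed
  have Pb: "P \<in> sets borel"
  proof -
    have "P = {w \<in> {w. cmod w < 1 \<and> pdist z w < 1/4}. act x w \<in> F}" by (auto simp: P_def)
    moreover have "{w. cmod w < 1 \<and> pdist z w < 1/4} \<subseteq> ball 0 1" by auto
    ultimately show ?thesis using borel_act_preimage[OF x F(1) borel_pdist_ball[OF z]] by simp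
  qed
  define z' where "z' = act x z"
  have z': "cmod z' < 1" unfolding z'_def by (rule act_in_disk[OF x z])
  define d where "d = 1 - (cmod z)\<^sup>2"
  define d' where "d' = 1 - (cmod z')\<^sup>2"
  have d: "d > 0" "d' > 0" using z z' by (auto simp: d_def d'_def power_less_one_iff)
  have Qd: "cmod v < 1" "1 - (cmod v)\<^sup>2 \<le> 2 * d'" "d' \<le> 2 * (1 - (cmod v)\<^sup>2)"
    "1 - (cmod (act (adj x) v))\<^sup>2 \<le> 2 * d" if v: "v \<in> Q" for v
  proof -
    show v1: "cmod v < 1" using v F(2) by (auto simp: Q_def)
    have w1: "cmod (act (adj x) v) < 1" by (rule act_in_disk[OF dx v1])
    have "pdist z' v = pdist z (act (adj x) v)"
      using pdist_act[OF x z w1] act_adj(2)[OF x v1] by (simp add: z'_def)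
    then have "pdist z' v < 1/4" using v by (simp add: Q_def)
    then show "1 - (cmod v)\<^sup>2 \<le> 2 * d'" "d' \<le> 2 * (1 - (cmod v)\<^sup>2)"
      using pdist_comparable[OF z' v1] by (auto simp: d'_def)
    show "1 - (cmod (act (adj x) v))\<^sup>2 \<le> 2 * d"
      using pdist_comparable(1)[OF z w1] v by (simp add: Q_def d_def)
  qed
  have fin: "emeasure lborel Q < \<infinity>"
  proof -
    have "emeasure lborel Q \<le> emeasure lborel (ball (0::complex) 1)"
      using Qd(1) by (intro emeasure_mono) auto
    also have "\<dots> < \<infinity>" by (simp add: emeasure_ball_complex)
    finally show ?thesis .
  qed
  \<comment> \<open>By \<open>one_minus_act\<close> the modulus of the derivative is a ratio of the
    values of \<open>1 - |v|^2\<close> after and before the map. These are comparable to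
    \<open>d\<close> and \<open>d'\<close> on the piece.\<close>
  have m: "emeasure lborel P \<le> ennreal ((4 * d / d')\<^sup>2) * emeasure lborel Q"
    unfolding PQ
  proof (rule emeasure_holomorphic_image_le[OF Qb fin])
    show "(act (adj x) has_field_derivative 1 / (autom (adj x) v)\<^sup>2) (at v)" if "v \<in> Q" for v
      by (rule act_has_derivative[OF dx Qd(1)[OF that]])
    show "continuous_on Q (\<lambda>v. 1 / (autom (adj x) v)\<^sup>2)"
      using autom_nonzero[OF dx] Qd(1) unfolding autom_def
      by (intro continuous_intros) (auto simp: less_imp_le)
    show "act (adj x) ` Q \<in> sets borel" using Pb PQ by simp
    fix v assume v: "v \<in> Q"
    have nz: "cmod (autom (adj x) v) > 0" using autom_nonzero[OF dx, of v] Qd(1)[OF v] by simp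
    have vp: "1 - (cmod v)\<^sup>2 > 0" using Qd(3)[OF v] d by simp
    have "1 / (cmod (autom (adj x) v))\<^sup>2 = (1 - (cmod (act (adj x) v))\<^sup>2) / (1 - (cmod v)\<^sup>2)"
      using one_minus_act[OF dx, of v] Qd(1)[OF v] vp nz by simp
    also have "\<dots> \<le> (2 * d) / (1 - (cmod v)\<^sup>2)" using Qd(4)[OF v] vp by (intro divide_right_mono) auto
    also have "\<dots> \<le> (2 * d) / (d' / 2)" using Qd(3)[OF v] d vp by (intro divide_left_mono) auto
    finally have "cmod (1 / (autom (adj x) v)\<^sup>2) \<le> 4 * d / d'" by (simp add: norm_divide norm_power)
    then show "(cmod (1 / (autom (adj x) v)\<^sup>2))\<^sup>2 \<le> (4 * d / d')\<^sup>2" by (intro power_mono) auto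
  qed simp
  have "emeasure hyp P = (\<integral>\<^sup>+w\<in>P. ennreal (4 / (1 - (cmod w)\<^sup>2)\<^sup>2) \<partial>lborel)"
    using emeasure_hyp[OF Pb] by (simp add: hyperbolic_area_def)
  also have "\<dots> \<le> (\<integral>\<^sup>+w. ennreal (16 / d\<^sup>2) * indicator P w \<partial>lborel)"
  proof (rule nn_integral_mono)
    fix w show "ennreal (4 / (1 - (cmod w)\<^sup>2)\<^sup>2) * indicator P w \<le> ennreal (16 / d\<^sup>2) * indicator P w"
    proof (cases "w \<in> P")
      case True
      define e where "e = 1 - (cmod w)\<^sup>2"
      have de: "d \<le> 2 * e" using pdist_comparable(2)[OF z] True by (simp add: P_def d_def e_def)
      then have "d\<^sup>2 \<le> (2 * e)\<^sup>2" using d by (intro power_mono) auto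
      moreover have "e > 0" using de d by simp
      ultimately have "4 / e\<^sup>2 \<le> 16 / d\<^sup>2"
        using d by (simp add: field_simps power_mult_distrib)
      then have "4 / (1 - (cmod w)\<^sup>2)\<^sup>2 \<le> 16 / d\<^sup>2" by (simp add: e_def)
      then show ?thesis using True by (auto intro!: ennreal_leI)
    qed simp
  qed
  also have "\<dots> = ennreal (16 / d\<^sup>2) * emeasure lborel P" using Pb by (simp add: nn_integral_cmult_indicator)
  also have "\<dots> \<le> ennreal (16 / d\<^sup>2) * (ennreal ((4 * d / d')\<^sup>2) * emeasure lborel Q)"
    using m by (rule mult_left_mono) simp
  also have "\<dots> = 256 * (ennreal (1 / d'\<^sup>2) * emeasure lborel Q)"
  proof -
    have "ennreal (16 / d\<^sup>2) * ennreal ((4 * d / d')\<^sup>2) = ennreal (256 * (1 / d'\<^sup>2))"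
      using d by (simp add: ennreal_mult'[symmetric] power_divide power_mult_distrib)
    also have "\<dots> = 256 * ennreal (1 / d'\<^sup>2)" using d by (subst ennreal_mult') auto
    finally show ?thesis by (simp add: mult.assoc[symmetric])
  qed
  also have "ennreal (1 / d'\<^sup>2) * emeasure lborel Q = (\<integral>\<^sup>+v. ennreal (1 / d'\<^sup>2) * indicator Q v \<partial>lborel)"
    using Qb by (simp add: nn_integral_cmult_indicator)
  finally have 1: "emeasure hyp P \<le> 256 * (\<integral>\<^sup>+v. ennreal (1 / d'\<^sup>2) * indicator Q v \<partial>lborel)" .
  have "(\<integral>\<^sup>+v. ennreal (1 / d'\<^sup>2) * indicator Q v \<partial>lborel) \<le> (\<integral>\<^sup>+v\<in>Q. ennreal (4 / (1 - (cmod v)\<^sup>2)\<^sup>2) \<partial>lborel)"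
  proof (rule nn_integral_mono)
    fix v show "ennreal (1 / d'\<^sup>2) * indicator Q v \<le> ennreal (4 / (1 - (cmod v)\<^sup>2)\<^sup>2) * indicator Q v"
    proof (cases "v \<in> Q")
      case True
      have vp: "1 - (cmod v)\<^sup>2 > 0" using Qd(3)[OF True] d by simp
      have "(1 - (cmod v)\<^sup>2)\<^sup>2 \<le> (2 * d')\<^sup>2" using Qd(2)[OF True] vp by (intro power_mono) auto
      then have "1 / d'\<^sup>2 \<le> 4 / (1 - (cmod v)\<^sup>2)\<^sup>2"
        using d vp by (simp add: field_simps power_mult_distrib)
      then show ?thesis using True by (auto intro!: ennreal_leI)
    qed simp
  qed
  also have "\<dots> = emeasure hyp Q" using emeasure_hyp[OF Qb] by (simp add: hyperbolic_area_def)
  finally show ?thesis using order_trans[OF 1 mult_left_mono] unfolding P_def Q_def by simp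
qed

lemma borel_measurable_nn_integral_count_space:
  fixes f :: "'i \<Rightarrow> 'a \<Rightarrow> ennreal"
  assumes I: "countable I" and f: "\<And>i. i \<in> I \<Longrightarrow> f i \<in> borel_measurable M"
  shows "(\<lambda>x. \<integral>\<^sup>+i. f i x \<partial>count_space I) \<in> borel_measurable M"
proof (cases "finite I")
  case True
  then show ?thesis using f by (simp add: nn_integral_count_space_finite)
next
  case False
  have "(\<integral>\<^sup>+i. f i x \<partial>count_space I) = (\<Sum>n. f (from_nat_into I n) x)" for x
    by (simp add: nn_integral_bij_count_space[symmetric, OF bij_betw_from_nat_into[OF I False]]
        nn_integral_count_space_nat)
  moreover have "from_nat_into I n \<in> I" for n using False by (intro from_nat_into) auto
  ultimately show ?thesis using f by simp
qed

section \<open>Finite area and the thick part\<close>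

context discrete_disk_group
begin

text \<open>Seen from \<open>z\<close>, some point of the disk of radius 1/4 is carried back into
  it, which bounds the automorphy factor there and thereby the matrix.\<close>

lemma based_ball_bound:
  assumes x: "x \<in> G" and z: "cmod z < 1" and w: "cmod w < 1" "pdist z w < 1/4" "pdist z (act x w) < 1/4"
  shows "sqn (based z x) \<le> 3"
proof -
  define b where "b = based z x"
  define u where "u = act (to_zero z) w"
  note t = to_zero(1)[OF z]
  have db: "sqdet b = 1" using det[OF x] based_simps(8)[OF z] by (simp add: b_def)
  have u: "cmod u < 1/4" using w by (simp add: u_def pdist_def)
  have "act b u = act (to_zero z) (act x (act (adj (to_zero z)) u))"
    unfolding b_def based_def using u t det[OF x] by (simp add: act_mult(1) act_in_disk)
  also have "act (adj (to_zero z)) u = w" unfolding u_def by (rule act_adj(1)[OF t w(1)])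
  finally have bu: "cmod (act b u) < 1/4" using w(3) by (simp add: pdist_def)
  define j where "j = cmod (autom b u)"
  define a where "a = cmod (sa b)"
  have j0: "j > 0" using autom_nonzero[OF db, of u] u by (simp add: j_def)
  have "(cmod (act b u))\<^sup>2 \<le> (1/4)\<^sup>2" using bu by (intro power_mono) auto
  then have "15/16 \<le> 1 - (cmod (act b u))\<^sup>2" by (simp add: power2_eq_square)
  also have "\<dots> = (1 - (cmod u)\<^sup>2) / j\<^sup>2" using one_minus_act[OF db, of u] u by (simp add: j_def)
  also have "\<dots> \<le> 1 / j\<^sup>2" by (intro divide_right_mono) auto
  finally have "j\<^sup>2 \<le> 16/15" using j0 by (simp add: field_simps)
  also have "\<dots> \<le> (9/8)\<^sup>2" by (simp add: power2_eq_square)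
  finally have j1: "j \<le> 9/8" by (rule power2_le_imp_le) simp
  have "cmod (sb b) * cmod u \<le> a * (1/4)"
    using su_norms(2)[OF db] u by (intro mult_mono) (auto simp: a_def)
  then have "3/4 * a \<le> j" using autom_bounds(1)[of u b] u by (simp add: a_def j_def)
  then have "a \<le> 3/2" using j1 by simp
  then show ?thesis using su_norms(2)[OF db] by (simp add: sqn_def a_def b_def)
qed

text \<open>The elements in question are bounded as seen from \<open>z\<close>. If two of them were
  too close, their quotient would be a small element at \<open>z\<close>. The bound \<open>N\<close>
  is the same for all thick points.\<close>

lemma thick_multiplicity:
  obtains N :: nat where "\<And>z u. \<lbrakk>cmod z < 1; small_elements z = {}; cmod u < 1; pdist z u < 1/4\<rbrakk> \<Longrightarrow>
      finite {x \<in> G. pdist z (act x u) < 1/4} \<and> card {x \<in> G. pdist z (act x u) < 1/4} \<le> N"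
proof -
  \<comment> \<open>1/192 is the thickness 1/64 divided by the norm bound 3.\<close>
  obtain N :: nat where N: "\<forall>X. (\<forall>x\<in>X. sqn x \<le> 3) \<and> (\<forall>x\<in>X. \<forall>y\<in>X. x \<noteq> y \<longrightarrow> sqn (x - y) \<ge> 1/192)
      \<longrightarrow> finite X \<and> card X \<le> N"
    using separated_bounded_finite[of "1/192" 3] by (auto elim!: exE)
  show thesis
  proof (rule that)
    fix z u assume z: "cmod z < 1" "small_elements z = {}" and u: "cmod u < 1" "pdist z u < 1/4"
    define S where "S = {x \<in> G. pdist z (act x u) < 1/4}"
    define X where "X = based z ` S"
    have b3: "sqn (based z x) \<le> 3" if "x \<in> S" for x
      using based_ball_bound[of x z u] that z u by (simp add: S_def)
    have sep: "sqn (based z x - based z y) \<ge> 1/192" if xy: "x \<in> S" "y \<in> S" "x \<noteq> y" for x y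
    proof -
      have G: "x \<in> G" "y \<in> G" using xy by (auto simp: S_def)
      define v where "v = x * adj y"
      have vG: "v \<in> G" using G mult inv by (simp add: v_def)
      have v1: "v \<noteq> 1"
      proof
        assume "v = 1"
        then have "x * (adj y * y) = y" unfolding v_def by (metis mult.assoc mult.left_neutral)
        then show False using xy(3) adj_cancel[OF G(2)] by simp
      qed
      have far: "sqn (based z v - 1) \<ge> 1/64"
      proof (cases "v = - 1")
        case True
        then have "based z v = - 1" using based_simps(4,6)[OF z(1)] by simp
        then have "based z v - 1 = sreal (- 2)" by (simp add: sq_eq_iff)
        then show ?thesis by simp
      next
        case False
        then show ?thesis using z(2) vG v1 by (force simp: small_elements_def)
      qed
      have i: "based z y * adj (based z y) = 1"
        using su_inverse(1)[of "based z y"] based_simps(8)[OF z(1)] det[OF G(2)] by simp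
      have "based z v - 1 = (based z x - based z y) * adj (based z y)"
        unfolding v_def based_simps[OF z(1)] using i by (simp add: left_diff_distrib)
      then have "sqn (based z v - 1) \<le> sqn (based z x - based z y) * sqn (adj (based z y))"
        by (metis sqn_mult)
      also have "\<dots> \<le> sqn (based z x - based z y) * 3"
        using b3[OF xy(2)] by (intro mult_left_mono) auto
      finally show ?thesis using far by simp
    qed
    have inj: "inj_on (based z) S"
    proof (rule inj_onI, rule ccontr)
      fix x y assume "x \<in> S" "y \<in> S" "based z x = based z y" "x \<noteq> y"
      then show False using sep[of x y] by simp
    qed
    have "(\<forall>x\<in>X. sqn x \<le> 3) \<and> (\<forall>x\<in>X. \<forall>y\<in>X. x \<noteq> y \<longrightarrow> sqn (x - y) \<ge> 1/192)"
      using b3 sep unfolding X_def by blast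
    from mp[OF spec[OF N] this] have "finite X \<and> card X \<le> N" .
    then show "finite {x \<in> G. pdist z (act x u) < 1/4} \<and> card {x \<in> G. pdist z (act x u) < 1/4} \<le> N"
      unfolding X_def S_def[symmetric] using finite_imageD[OF _ inj] card_image[OF inj] by auto
  qed
qed

text \<open>Each ball costs a factor 2 in \<open>1 - |z|^2\<close>, and moving a Dirichlet point by
  the group cannot increase this quantity. Consequently balls about Dirichlet points of very
  different heights have disjoint orbits.\<close>

lemma dirichlet_ball_heights:
  assumes z: "z \<in> dirichlet" "z' \<in> dirichlet" and x: "x \<in> G"
    and w: "cmod w < 1" "pdist z w < 1/4" "pdist z' (act x w) < 1/4"
  shows "1 - (cmod z')\<^sup>2 \<le> 4 * (1 - (cmod z)\<^sup>2)"
proof -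
  have z1: "cmod z < 1" "cmod z' < 1" using z by (auto simp: dirichlet_iff)
  have aw: "cmod (act x w) < 1" "cmod (act x z) < 1" using act_in_disk[OF det[OF x]] w z1 by auto
  have "1 - (cmod z')\<^sup>2 \<le> 2 * (1 - (cmod (act x w))\<^sup>2)"
    by (rule pdist_comparable(2)[OF z1(2) aw(1) w(3)])
  also have "1 - (cmod (act x w))\<^sup>2 \<le> 2 * (1 - (cmod (act x z))\<^sup>2)"
    using pdist_comparable(1)[OF aw(2,1)] pdist_act[OF det[OF x] z1(1) w(1)] w(2) by simp
  also have "1 - (cmod (act x z))\<^sup>2 \<le> 1 - (cmod z)\<^sup>2"
    using z(1) x by (auto simp: dirichlet_def intro: power_mono)
  finally show ?thesis by simp
qed

text \<open>Thick points of the Dirichlet domain at geometrically decreasing distances from the circle carry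
  balls that project with bounded multiplicity to the quotient, so finite area allows only finitely many.\<close>

lemma far_points_thin:
  assumes F: "F \<in> sets borel" "F \<subseteq> ball 0 1" "\<And>z. cmod z < 1 \<Longrightarrow> \<exists>x\<in>G. act x z \<in> F"
    and area: "hyperbolic_area F < \<infinity>"
  obtains R where "0 \<le> R" "R < 1" "\<And>z. z \<in> dirichlet \<Longrightarrow> cmod z \<ge> R \<Longrightarrow> small_elements z \<noteq> {}"
proof (rule ccontr)
  note obt = that
  assume nt: "\<not> thesis"
  have ex: "\<exists>z. z \<in> dirichlet \<and> cmod z \<ge> R \<and> small_elements z = {}" if R: "0 \<le> R" "R < 1" for R
    using obt[OF R] nt by blast
  define thick where "thick = {z \<in> dirichlet. small_elements z = {}}"
  have th1: "cmod z < 1" if "z \<in> thick" for z using that by (simp add: thick_def dirichlet_iff)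
  \<comment> \<open>The ratio 4 matches the loss in \<open>dirichlet_ball_heights\<close>, so the
    orbits of the balls about different \<open>zs n\<close> are disjoint.\<close>
  have "\<exists>zs. \<forall>n. zs n \<in> thick \<and> 4 * (1 - (cmod (zs (Suc n)))\<^sup>2) < 1 - (cmod (zs n))\<^sup>2"
  proof (rule dependent_nat_choice)
    show "\<exists>z. z \<in> thick" using ex[of 0] by (auto simp: thick_def)
    fix z and n :: nat assume z: "z \<in> thick"
    define d where "d = 1 - (cmod z)\<^sup>2"
    have d: "d > 0" "d \<le> 1" using th1[OF z] by (auto simp: d_def power_less_one_iff)
    \<comment> \<open>This radius makes \<open>1 - |y|^2\<close> at most \<open>d / 8\<close>, so
      even four times it is below \<open>d\<close>.\<close>
    obtain y where y: "y \<in> dirichlet" "cmod y \<ge> 1 - d / 16" "small_elements y = {}"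
      using ex[of "1 - d / 16"] d by auto
    have y1: "cmod y < 1" using y by (simp add: dirichlet_iff)
    have "1 - (cmod y)\<^sup>2 = (1 - cmod y) * (1 + cmod y)" by (simp add: power2_eq_square algebra_simps)
    also have "\<dots> \<le> (d / 16) * 2" using y y1 d by (intro mult_mono) auto
    finally show "\<exists>y. y \<in> thick \<and> 4 * (1 - (cmod y)\<^sup>2) < 1 - (cmod z)\<^sup>2"
      using y d by (intro exI[of _ y]) (auto simp: thick_def d_def)
  qed
  then obtain zs where zs: "\<And>n. zs n \<in> thick"
    "\<And>n. 4 * (1 - (cmod (zs (Suc n)))\<^sup>2) < 1 - (cmod (zs n))\<^sup>2" by blast
  have zd: "zs n \<in> dirichlet" "small_elements (zs n) = {}" for n using zs(1)[of n] by (auto simp: thick_def)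
  have z1: "cmod (zs n) < 1" for n by (rule th1[OF zs(1)])
  have pos: "1 - (cmod (zs n))\<^sup>2 > 0" for n using z1 by (simp add: power_less_one_iff)
  have dec: "4 * (1 - (cmod (zs n))\<^sup>2) < 1 - (cmod (zs m))\<^sup>2" if "m < n" for m n
    using that
  proof (induction rule: less_Suc_induct)
    case (1 i)
    then show ?case using zs(2) by simp
  next
    case (2 i j k)
    have "4 * (1 - (cmod (zs k))\<^sup>2) < 1 - (cmod (zs j))\<^sup>2" by (rule 2)
    also have "\<dots> \<le> 4 * (1 - (cmod (zs j))\<^sup>2)" using pos[of j] by simp
    also have "\<dots> < 1 - (cmod (zs i))\<^sup>2" by (rule 2)
    finally show ?case .
  qed
  have same: "m = n" if "x \<in> G" "cmod w < 1" "pdist (zs m) w < 1/4" "pdist (zs n) (act x w) < 1/4" for m n x w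
  proof -
    have 1: "1 - (cmod (zs n))\<^sup>2 \<le> 4 * (1 - (cmod (zs m))\<^sup>2)"
      by (rule dirichlet_ball_heights[OF zd(1) zd(1) that])
    have "act (adj x) (act x w) = w" by (rule act_adj(1)[OF det[OF that(1)] that(2)])
    then have 2: "1 - (cmod (zs m))\<^sup>2 \<le> 4 * (1 - (cmod (zs n))\<^sup>2)"
      using dirichlet_ball_heights[OF zd(1) zd(1) inv[OF that(1)] act_in_disk[OF det[OF that(1)] that(2)] that(4)]
        that(3) by simp
    show ?thesis using dec[of m n] dec[of n m] 1 2 by (cases m n rule: linorder_cases) auto
  qed
  obtain N :: nat where N: "\<And>z u. \<lbrakk>cmod z < 1; small_elements z = {}; cmod u < 1; pdist z u < 1/4\<rbrakk> \<Longrightarrow>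
      finite {x \<in> G. pdist z (act x u) < 1/4} \<and> card {x \<in> G. pdist z (act x u) < 1/4} \<le> N"
    using thick_multiplicity by blast
  define B where "B = (\<lambda>n. {w. cmod w < 1 \<and> pdist (zs n) w < 1/4})"
  \<comment> \<open>\<open>P n x\<close> is the part of the \<open>n\<close>-th ball that
    \<open>x\<close> carries into \<open>F\<close>, and \<open>Q n x\<close> is its image inside
    \<open>F\<close>.\<close>
  define Q where "Q = (\<lambda>n x. {v \<in> F. pdist (zs n) (act (adj x) v) < 1/4})"
  define P where "P = (\<lambda>n x. {w. cmod w < 1 \<and> pdist (zs n) w < 1/4 \<and> act x w \<in> F})"
  have Bb: "B n \<in> sets borel" for n unfolding B_def by (rule borel_pdist_ball[OF z1])
  have Qb: "Q n x \<in> sets borel" if "x \<in> G" for n x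
  proof -
    have "sqdet (adj x) = 1" using det[OF that] by simp
    moreover have "Q n x = {v \<in> F. act (adj x) v \<in> B n}"
      using F(2) act_in_disk[OF det[OF inv[OF that]]] by (auto simp: Q_def B_def)
    ultimately show ?thesis using borel_act_preimage[OF _ Bb F(1,2)] by simp
  qed
  have Pb: "P n x \<in> sets borel" if "x \<in> G" for n x
  proof -
    have "P n x = {w \<in> B n. act x w \<in> F}" by (auto simp: P_def B_def)
    moreover have "B n \<subseteq> ball 0 1" by (auto simp: B_def)
    ultimately show ?thesis using borel_act_preimage[OF det[OF that] F(1) Bb] by simp
  qed
  \<comment> \<open>A second piece containing \<open>v\<close> yields a group element that carries
    \<open>u\<close> from the \<open>m\<close>-th ball to the \<open>n\<close>-th. By
    \<open>same\<close> the indices agree, and by thickness at most \<open>N\<close> elements are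
    possible.\<close>
  have count: "(\<Sum>n<M. \<integral>\<^sup>+x. indicator (Q n x) v \<partial>count_space G) \<le> of_nat N * indicator F v" for M v
  proof (cases "\<exists>n x. n < M \<and> x \<in> G \<and> v \<in> Q n x")
    case False
    then have "(\<integral>\<^sup>+x. indicator (Q n x) v \<partial>count_space G) = 0" if "n < M" for n
      using that by (subst nn_integral_0_iff_AE) (auto simp: AE_count_space)
    then show ?thesis by simp
  next
    case True
    then obtain m y where my: "m < M" "y \<in> G" "v \<in> Q m y" by blast
    have vF: "v \<in> F" using my by (simp add: Q_def)
    then have v1: "cmod v < 1" using F(2) by auto
    define u where "u = act (adj y) v"
    have u: "cmod u < 1" "pdist (zs m) u < 1/4"
      using my act_in_disk[OF det[OF inv[OF my(2)]] v1] by (auto simp: u_def Q_def)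
    have vu: "v = act y u" unfolding u_def using act_adj(2)[OF det[OF my(2)] v1] by simp
    have conv: "act (adj x) v = act (adj x * y) u" for x
      unfolding vu using act_mult(1)[OF det[OF my(2)] u(1)] by simp
    have zero: "(\<integral>\<^sup>+x. indicator (Q n x) v \<partial>count_space G) = 0" if "n \<noteq> m" for n
    proof -
      have "v \<notin> Q n x" if "x \<in> G" for x
      proof
        assume "v \<in> Q n x"
        then have "pdist (zs n) (act (adj x * y) u) < 1/4" by (simp add: Q_def conv)
        then have "m = n" using same[OF mult[OF inv[OF that] my(2)] u] by simp
        then show False using \<open>n \<noteq> m\<close> by simp
      qed
      then show ?thesis by (subst nn_integral_0_iff_AE) (auto simp: AE_count_space)
    qed
    define S where "S = {x \<in> G. v \<in> Q m x}"
    define T where "T = {x \<in> G. pdist (zs m) (act x u) < 1/4}"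
    have T: "finite T" "card T \<le> N" using N[OF z1 zd(2) u] by (auto simp: T_def)
    have ST: "(\<lambda>x. adj x * y) ` S \<subseteq> T"
      using mult inv my(2) by (auto simp: S_def T_def Q_def conv)
    have inj: "inj_on (\<lambda>x. adj x * y) S"
    proof (rule inj_onI)
      fix a b assume "adj a * y = adj b * y"
      then have "adj a * (y * adj y) = adj b * (y * adj y)" by (metis mult.assoc)
      then show "a = b" using adj_cancel[OF my(2)] by (metis adj_adj mult.right_neutral)
    qed
    have S: "finite S" "card S \<le> N"
      using T inj_on_finite[OF inj ST] card_inj_on_le[OF inj ST] by auto
    have "(\<integral>\<^sup>+x. indicator (Q m x) v \<partial>count_space G) = (\<integral>\<^sup>+x. indicator S x \<partial>count_space G)"
      by (intro nn_integral_cong) (auto simp: S_def indicator_def)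
    also have "\<dots> = of_nat (card S)"
      using S(1) by (simp add: nn_integral_indicator emeasure_count_space S_def)
    also have "\<dots> \<le> of_nat N" using S(2) by simp
    finally have c: "(\<integral>\<^sup>+x. indicator (Q m x) v \<partial>count_space G) \<le> of_nat N" .
    have "(\<Sum>n<M. \<integral>\<^sup>+x. indicator (Q n x) v \<partial>count_space G) =
        (\<Sum>n\<in>{m}. \<integral>\<^sup>+x. indicator (Q n x) v \<partial>count_space G)"
      using my(1) zero by (intro sum.mono_neutral_right) auto
    then show ?thesis using c vF by simp
  qed
  have lower: "ennreal (pi / 64) \<le> (\<integral>\<^sup>+x. emeasure hyp (P n x) \<partial>count_space G)" for n
  proof -
    have "ennreal (pi / 64) \<le> emeasure hyp (B n)" unfolding B_def by (rule hyp_pdist_ball_ge[OF z1])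
    also have "\<dots> = (\<integral>\<^sup>+w. indicator (B n) w \<partial>hyp)" using Bb by simp
    also have "\<dots> \<le> (\<integral>\<^sup>+w. (\<integral>\<^sup>+x. indicator (P n x) w \<partial>count_space G) \<partial>hyp)"
    proof (rule nn_integral_mono)
      fix w show "indicator (B n) w \<le> (\<integral>\<^sup>+x. indicator (P n x) w \<partial>count_space G)"
      proof (cases "w \<in> B n")
        case True
        then obtain x where x: "x \<in> G" "act x w \<in> F" using F(3) by (auto simp: B_def)
        then have "w \<in> P n x" using True by (simp add: P_def B_def)
        then have "1 \<le> (\<integral>\<^sup>+y. indicator {x} y \<partial>count_space G)"
          using x by (simp add: nn_integral_indicator emeasure_count_space)
        also have "\<dots> \<le> (\<integral>\<^sup>+x. indicator (P n x) w \<partial>count_space G)"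
          using \<open>w \<in> P n x\<close> by (intro nn_integral_mono) (auto simp: indicator_def)
        finally show ?thesis using True by simp
      qed simp
    qed
    also have "\<dots> = (\<integral>\<^sup>+x. (\<integral>\<^sup>+w. indicator (P n x) w \<partial>hyp) \<partial>count_space G)"
      using Pb by (intro nn_integral_count_space_nn_integral countable_group) auto
    also have "\<dots> = (\<integral>\<^sup>+x. emeasure hyp (P n x) \<partial>count_space G)"
      using Pb by (intro nn_integral_cong) auto
    finally show ?thesis .
  qed
  have bound: "of_nat M * ennreal (pi / 64) \<le> 256 * (of_nat N * hyperbolic_area F)" for M
  proof -
    have e: "(\<integral>\<^sup>+x. emeasure hyp (Q n x) \<partial>count_space G) =
        (\<integral>\<^sup>+x. (\<integral>\<^sup>+v. indicator (Q n x) v \<partial>hyp) \<partial>count_space G)" for n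
      using Qb by (intro nn_integral_cong) simp
    have "of_nat M * ennreal (pi / 64) = (\<Sum>n<M. ennreal (pi / 64))" by simp
    also have "\<dots> \<le> (\<Sum>n<M. \<integral>\<^sup>+x. emeasure hyp (P n x) \<partial>count_space G)"
      by (intro sum_mono lower)
    also have "\<dots> \<le> (\<Sum>n<M. \<integral>\<^sup>+x. 256 * emeasure hyp (Q n x) \<partial>count_space G)"
      unfolding P_def Q_def
      by (intro sum_mono nn_integral_mono hyp_piece_le z1 F(1,2)) (use det in auto)
    also have "\<dots> = (\<Sum>n<M. 256 * (\<integral>\<^sup>+x. (\<integral>\<^sup>+v. indicator (Q n x) v \<partial>hyp) \<partial>count_space G))"
      unfolding e[symmetric] by (simp add: nn_integral_cmult)
    also have "\<dots> = 256 * (\<Sum>n<M. \<integral>\<^sup>+v. (\<integral>\<^sup>+x. indicator (Q n x) v \<partial>count_space G) \<partial>hyp)"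
      unfolding sum_distrib_left[symmetric] using Qb
      by (intro arg_cong2[where f = "(*)"] sum.cong refl nn_integral_count_space_nn_integral[symmetric] countable_group) auto
    also have "(\<Sum>n<M. \<integral>\<^sup>+v. (\<integral>\<^sup>+x. indicator (Q n x) v \<partial>count_space G) \<partial>hyp) =
        (\<integral>\<^sup>+v. (\<Sum>n<M. \<integral>\<^sup>+x. indicator (Q n x) v \<partial>count_space G) \<partial>hyp)"
      using Qb countable_group
      by (intro nn_integral_sum[symmetric] borel_measurable_nn_integral_count_space) auto
    also have "\<dots> \<le> (\<integral>\<^sup>+v. of_nat N * indicator F v \<partial>hyp)"
      by (intro nn_integral_mono count)
    also have "\<dots> = of_nat N * hyperbolic_area F"
      using F(1) by (simp add: nn_integral_cmult_indicator emeasure_hyp)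
    finally show ?thesis by (simp add: mult_left_mono)
  qed
  have "256 * (of_nat N * hyperbolic_area F) < \<infinity>"
    using area by (simp add: ennreal_mult_less_top ennreal_of_nat_eq_real_of_nat)
  then obtain c where c: "256 * (of_nat N * hyperbolic_area F) = ennreal c" "c \<ge> 0"
    by (metis ennreal_cases infinity_ennreal_def less_irrefl)
  \<comment> \<open>\<open>M\<close> balls need area at least proportional to \<open>M\<close> in
    \<open>F\<close>, up to the fixed multiplicity, so a large \<open>M\<close> contradicts finite
    area.\<close>
  obtain M :: nat where M: "c / (pi / 64) < real M" using reals_Archimedean2 by blast
  have "of_nat M * ennreal (pi / 64) = ennreal (real M * (pi / 64))"
    unfolding ennreal_of_nat_eq_real_of_nat by (rule ennreal_mult[symmetric]) auto
  then have "ennreal (real M * (pi / 64)) \<le> ennreal c" using bound[of M] c by simp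
  then have "real M * (pi / 64) \<le> c" using c(2) by simp
  then show False using M by (simp add: field_simps)
qed

end

section \<open>The integral over orbits\<close>

lemma act_zero: "act x 0 = sb x / cnj (sa x)" "autom x 0 = cnj (sa x)"
  by (simp_all add: act_def autom_def)

lemma height_act_zero: "sqdet x = 1 \<Longrightarrow> 1 - (cmod (act x 0))\<^sup>2 = 1 / (cmod (sa x))\<^sup>2"
  using one_minus_act[of x 0] by (simp add: autom_def)

lemma pdist_zero [simp]: "pdist 0 u = cmod u"
  by (simp add: pdist_eq)

lemma autom_lower:
  assumes "sqdet x = 1" "cmod u \<le> 1"
  shows "cmod (sa x) * (1 - cmod u) \<le> cmod (autom x u)"
proof -
  have "cmod (sb x) * cmod u \<le> cmod (sa x) * cmod u"
    using su_norms(2)[OF assms(1)] by (intro mult_right_mono) auto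
  then show ?thesis using autom_bounds(1)[OF assms(2), of x] by (simp add: algebra_simps)
qed

lemma autom_upper:
  assumes "sqdet x = 1" "cmod u \<le> 1"
  shows "cmod (autom x u) \<le> 2 * cmod (sa x)"
  using autom_bounds(3)[OF assms(2), of x] su_norms(2)[OF assms(1)] by (simp add: sqn_def)

lemma near_pdist:
  assumes z: "cmod z < 1" and e: "e \<le> 1/8" and w: "cmod (w - z) < e * (1 - (cmod z)\<^sup>2)"
  shows "cmod w < 1" "pdist z w < 2 * e"
proof -
  define d where "d = 1 - (cmod z)\<^sup>2"
  have d: "d > 0" using z by (simp add: d_def power_less_one_iff)
  have "0 < e * d" unfolding d_def by (rule le_less_trans[OF norm_ge_zero w])
  then have e0: "e > 0" using d by (simp add: zero_less_mult_iff)
  have "e * d \<le> 1/8 * d" using e d by (intro mult_right_mono) auto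
  then have w8: "cmod (w - z) < d / 8" using w by (simp add: d_def[symmetric])
  show "cmod w < 1" using ball_in_pdist_ball(1)[OF z] w8 by (simp add: d_def)
  have "complex_of_real d = 1 - cnj z * z"
    by (simp add: d_def complex_norm_square mult.commute del: of_real_power)
  then have "1 - cnj z * w = of_real d - cnj z * (w - z)" by (simp add: algebra_simps)
  then have "cmod (1 - cnj z * w) \<ge> d - cmod (cnj z * (w - z))"
    using norm_triangle_ineq2[of "complex_of_real d" "cnj z * (w - z)"] d by simp
  moreover have "cmod (cnj z * (w - z)) \<le> 1 * (d / 8)"
    unfolding norm_mult using z w8 by (intro mult_mono) auto
  ultimately have 1: "cmod (1 - cnj z * w) \<ge> 7/8 * d" by simp
  then have p: "cmod (1 - cnj z * w) > 0" using d by linarith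
  have "cmod (w - z) < e * d" using w by (simp add: d_def)
  also have "\<dots> \<le> e * (2 * cmod (1 - cnj z * w))" using e0 1 d by (intro mult_left_mono) auto
  finally show "pdist z w < 2 * e"
    unfolding pdist_eq[OF z] using p by (simp add: field_simps)
qed

text \<open>The factor \<open>1 / (cmod (sa x)) ^ 4\<close> is the squared modulus of the derivative
  of \<open>act x\<close> at 0.\<close>

definition orbit_term :: "real \<Rightarrow> (complex \<Rightarrow> complex) \<Rightarrow> sq \<Rightarrow> real" where
  "orbit_term q f x = 1 / (cmod (sa x)) ^ 4 / cmod (deriv f (act x 0)) powr q"

section \<open>Integrals over images of a fixed piece of the disk\<close>

locale univalent_map =
  fixes f :: "complex \<Rightarrow> complex"
  assumes holo: "f holomorphic_on ball 0 1" and inj: "inj_on f (ball 0 1)"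
begin

lemma deriv_nonzero: "cmod z < 1 \<Longrightarrow> deriv f z \<noteq> 0"
  by (rule holomorphic_injective_imp_regular[OF holo open_ball inj]) simp

lemma deriv_comp_act:
  assumes "sqdet x = 1" "cmod u < 1"
  shows "deriv (\<lambda>z. f (act x z)) u = deriv f (act x u) / (autom x u)\<^sup>2"
proof -
  have "(f has_field_derivative deriv f (act x u)) (at (act x u))"
    using holomorphic_derivI[OF holo open_ball] act_in_disk[OF assms] by simp
  from DERIV_chain'[OF act_has_derivative[OF assms] this]
  show ?thesis by (simp add: DERIV_imp_deriv)
qed

lemma comp_act_univalent:
  assumes "sqdet x = 1"
  shows "(\<lambda>z. f (act x z)) holomorphic_on ball 0 1" "inj_on (\<lambda>z. f (act x z)) (ball 0 1)"
proof -
  have "act x holomorphic_on ball 0 1"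
    unfolding holomorphic_on_open[OF open_ball] using act_has_derivative[OF assms] mem_ball_0 by metis
  then show "(\<lambda>z. f (act x z)) holomorphic_on ball 0 1"
    by (rule holomorphic_on_compose_gen[OF _ holo, unfolded o_def]) (use act_in_disk[OF assms] in auto)
  show "inj_on (\<lambda>z. f (act x z)) (ball 0 1)"
  proof (rule inj_onI)
    fix u v assume uv: "u \<in> ball 0 1" "v \<in> ball 0 1" "f (act x u) = f (act x v)"
    then have "act x u = act x v"
      using inj_onD[OF inj, of "act x u" "act x v"] act_in_disk[OF assms] by auto
    then show "u = v" using act_adj(1)[OF assms] uv by (metis mem_ball_0)
  qed
qed

end

context koebe_constant
begin

text \<open>The distortion theorem is applied to \<open>f\<close> composed with
  \<open>act x\<close>, so the constants do not depend on how close the orbit point is to the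
  circle. The automorphy factor relating the two derivatives lies between
  \<open>(1 - R) * |sa x|\<close> and \<open>2 * |sa x|\<close>.\<close>

lemma distortion_orbit:
  assumes "univalent_map f" and x: "sqdet x = 1" and u: "cmod u \<le> R" "R < 1"
  defines "E \<equiv> exp (2 * A / (1 - R))"
  shows "(1 - R)\<^sup>2 * cmod (deriv f (act x 0)) \<le> E * cmod (deriv f (act x u))"
    "cmod (deriv f (act x u)) \<le> 4 * E * cmod (deriv f (act x 0))"
proof -
  interpret univalent_map f by fact
  define F where "F = (\<lambda>z. f (act x z))"
  have u1: "cmod u < 1" "R \<ge> 0" using u norm_ge_zero[of u] by linarith+
  define a where "a = cmod (sa x)"
  have a: "a \<ge> 1" using su_norms(1)[OF x] by (simp add: a_def)
  then have a0: "sa x \<noteq> 0" by (auto simp: a_def)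
  define j where "j = cmod (autom x u)"
  have "a * (1 - R) \<le> a * (1 - cmod u)" using u a by (intro mult_left_mono) auto
  then have j1: "a * (1 - R) \<le> j" using autom_lower[OF x, of u] u1 by (simp add: a_def j_def)
  have j2: "j \<le> 2 * a" using autom_upper[OF x, of u] u1 by (simp add: a_def j_def)
  have p: "a * (1 - R) > 0" using a u by simp
  have j0: "j > 0" using j1 p by linarith
  have d0: "cmod (deriv F 0) * a\<^sup>2 = cmod (deriv f (act x 0))"
    using deriv_comp_act[OF x, of 0] a0
    by (simp add: F_def norm_divide norm_power act_zero(2) a_def)
  have du: "cmod (deriv F u) * j\<^sup>2 = cmod (deriv f (act x u))"
    using deriv_comp_act[OF x u1(1)] j0 by (simp add: F_def norm_divide norm_power j_def)
  have E: "E > 0" by (simp add: E_def)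
  have 1: "cmod (deriv F 0) \<le> E * cmod (deriv F u)" and 2: "cmod (deriv F u) \<le> E * cmod (deriv F 0)"
    unfolding E_def F_def
    by (rule distortion[OF comp_act_univalent[OF x]]; use u u1 in simp)+
  have "(1 - R)\<^sup>2 * cmod (deriv f (act x 0)) = cmod (deriv F 0) * (a * (1 - R))\<^sup>2"
    unfolding d0[symmetric] by (simp add: power_mult_distrib)
  also have "\<dots> \<le> (E * cmod (deriv F u)) * j\<^sup>2"
    using 1 j1 p E by (intro mult_mono power_mono) auto
  also have "\<dots> = E * cmod (deriv f (act x u))" unfolding du[symmetric] by simp
  finally show "(1 - R)\<^sup>2 * cmod (deriv f (act x 0)) \<le> E * cmod (deriv f (act x u))" .
  have "cmod (deriv f (act x u)) \<le> (E * cmod (deriv F 0)) * (2 * a)\<^sup>2"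
    unfolding du[symmetric] using 2 j2 j0 E by (intro mult_mono power_mono) auto
  also have "\<dots> = 4 * E * cmod (deriv f (act x 0))"
    unfolding d0[symmetric] by (simp add: power_mult_distrib)
  finally show "cmod (deriv f (act x u)) \<le> 4 * E * cmod (deriv f (act x 0))" .
qed

lemma integral_compact_piece:
  assumes R: "0 \<le> R" "R < 1" and q: "q > 0"
  obtains K where "K > 0"
    "\<And>f x. \<lbrakk>univalent_map f; sqdet x = 1\<rbrakk> \<Longrightarrow>
      weight_integral q f (act x ` cball 0 R) \<le> ennreal (K * orbit_term q f x)"
proof -
  define E where "E = exp (2 * A / (1 - R))"
  define c where "c = E / (1 - R)\<^sup>2"
  have c: "c > 0" using R by (simp add: c_def E_def)
  define K where "K = c powr q * (pi * (2 / (1 - R))\<^sup>2)"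
  show thesis
  proof (rule that)
    show "K > 0" using c R by (simp add: K_def)
    fix f x assume f: "univalent_map f" and x: "sqdet x = 1"
    interpret univalent_map f by fact
    define a where "a = cmod (sa x)"
    have a: "a \<ge> 1" using su_norms(1)[OF x] by (simp add: a_def)
    define d where "d = cmod (deriv f (act x 0))"
    have d: "d > 0" using deriv_nonzero[OF act_in_disk[OF x]] by (simp add: d_def)
    \<comment> \<open>By \<open>act_diff\<close> the image lies within
      \<open>1 / (a^2 * (1 - R))\<close> of \<open>act x 0\<close>; the factor 2 places it in an
      open ball.\<close>
    define r where "r = 2 / (a\<^sup>2 * (1 - R))"
    have r: "r > 0" using a R by (simp add: r_def)
    have pt: "1 / cmod (deriv f z) powr q \<le> c powr q / d powr q \<and> z \<in> ball (act x 0) r"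
      if z: "z \<in> act x ` cball 0 R" for z
    proof -
      obtain u where u: "z = act x u" "cmod u \<le> R" using z by auto
      have u1: "cmod u < 1" using u R by simp
      define e where "e = cmod (deriv f z)"
      have e: "e > 0" using deriv_nonzero[OF act_in_disk[OF x u1]] by (simp add: e_def u)
      have "(1 - R)\<^sup>2 * d \<le> E * e"
        using distortion_orbit(1)[OF f x u(2) R(2)] by (simp add: d_def e_def u E_def)
      then have "1 / e \<le> c / d" using e d R by (simp add: c_def field_simps)
      then have "(1 / e) powr q \<le> (c / d) powr q" using e q by (intro powr_mono2) auto
      then have 1: "1 / e powr q \<le> c powr q / d powr q" using e d c by (simp add: powr_divide)
      have "a * (1 - R) \<le> a * (1 - cmod u)" using u a by (intro mult_left_mono) auto
      then have j: "a * (1 - R) \<le> cmod (autom x u)"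
        using autom_lower[OF x, of u] u1 by (simp add: a_def)
      have "cmod (z - act x 0) = cmod u / (cmod (autom x u) * a)"
        using act_diff[OF x u1, of 0] by (simp add: u norm_divide norm_mult act_zero(2) a_def)
      also have "\<dots> \<le> 1 / ((a * (1 - R)) * a)"
        using u1 j a R by (intro frac_le mult_right_mono) auto
      also have "\<dots> < r" using a R by (simp add: r_def power2_eq_square divide_strict_right_mono mult_ac)
      finally show ?thesis using 1 by (simp add: dist_norm norm_minus_commute e_def)
    qed
    have "(\<integral>\<^sup>+z\<in>act x ` cball 0 R. ennreal (1 / cmod (deriv f z) powr q) \<partial>lborel) \<le>
        (\<integral>\<^sup>+z. ennreal (c powr q / d powr q) * indicator (ball (act x 0) r) z \<partial>lborel)"
      by (rule nn_integral_mono) (use pt in \<open>auto simp: indicator_def intro!: ennreal_leI\<close>)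
    also have "\<dots> = ennreal (c powr q / d powr q) * ennreal (pi * r\<^sup>2)"
      using r by (simp add: nn_integral_cmult_indicator emeasure_ball_complex)
    also have "\<dots> = ennreal (K * orbit_term q f x)"
      unfolding K_def orbit_term_def a_def[symmetric] d_def[symmetric] r_def
      by (simp add: ennreal_mult'[symmetric] power_mult_distrib power_divide eval_nat_numeral mult_ac)
    finally show "weight_integral q f (act x ` cball 0 R) \<le> ennreal (K * orbit_term q f x)"
      unfolding weight_integral_def .
  qed
qed

lemma integral_small_ball:
  assumes e: "0 < e" "e \<le> 1/8" and q: "q > 0"
  obtains K where "K > 0"
    "\<And>f x. \<lbrakk>univalent_map f; sqdet x = 1\<rbrakk> \<Longrightarrow>
      ennreal (K * orbit_term q f x) \<le>
        weight_integral q f (ball (act x 0) (e / (cmod (sa x))\<^sup>2))"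
proof -
  \<comment> \<open>Radius 1/4 in the distortion constant, since the small ball pulls back into the
    disk of radius \<open>2 * e <= 1/4\<close>.\<close>
  define E where "E = exp (2 * A / (1 - 1/4))"
  have E: "E > 0" by (simp add: E_def)
  define K where "K = 1 / (4 * E) powr q * (pi * e\<^sup>2)"
  show thesis
  proof (rule that)
    show "K > 0" using E e by (simp add: K_def)
    fix f x assume f: "univalent_map f" and x: "sqdet x = 1"
    interpret univalent_map f by fact
    define a where "a = cmod (sa x)"
    have a: "a \<ge> 1" using su_norms(1)[OF x] by (simp add: a_def)
    define d where "d = cmod (deriv f (act x 0))"
    have d: "d > 0" using deriv_nonzero[OF act_in_disk[OF x]] by (simp add: d_def)
    define r where "r = e / a\<^sup>2"
    have r: "r > 0" using a e by (simp add: r_def)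
    have pt: "1 / (4 * E) powr q / d powr q \<le> 1 / cmod (deriv f z) powr q"
      if z: "z \<in> ball (act x 0) r" for z
    proof -
      have x0: "cmod (act x 0) < 1" using act_in_disk[OF x] by simp
      have "cmod (z - act x 0) < e * (1 - (cmod (act x 0))\<^sup>2)"
        using z height_act_zero[OF x] by (simp add: r_def a_def dist_norm norm_minus_commute)
      note near = near_pdist[OF x0 e(2) this]
      define u where "u = act (adj x) z"
      have dx: "sqdet (adj x) = 1" using x by simp
      have u1: "cmod u < 1" unfolding u_def by (rule act_in_disk[OF dx near(1)])
      have zu: "z = act x u" unfolding u_def using act_adj(2)[OF x near(1)] by simp
      have "cmod u < 2 * e" using near(2) pdist_act[OF x, of 0 u] u1 by (simp add: zu)
      then have u4: "cmod u \<le> 1/4" using e by simp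
      define w where "w = cmod (deriv f z)"
      have w: "w > 0" using deriv_nonzero[OF near(1)] by (simp add: w_def)
      have "w \<le> 4 * E * d"
        using distortion_orbit(2)[OF f x u4] by (simp add: w_def d_def zu E_def)
      then have "w powr q \<le> (4 * E * d) powr q" using w q by (intro powr_mono2) auto
      also have "\<dots> = (4 * E) powr q * d powr q" using E d by (simp add: powr_mult)
      finally have "1 / ((4 * E) powr q * d powr q) \<le> 1 / w powr q"
        using w E d by (intro divide_left_mono) auto
      then show ?thesis by (simp add: w_def)
    qed
    have "K * orbit_term q f x = 1 / (4 * E) powr q / d powr q * (pi * r\<^sup>2)"
      unfolding K_def orbit_term_def a_def[symmetric] d_def[symmetric] r_def
      by (simp add: power_mult_distrib power_divide eval_nat_numeral mult_ac)
    then have "ennreal (K * orbit_term q f x) = ennreal (1 / (4 * E) powr q / d powr q) * ennreal (pi * r\<^sup>2)"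
      by (simp only:) (rule ennreal_mult, auto)
    also have "\<dots> = (\<integral>\<^sup>+z. ennreal (1 / (4 * E) powr q / d powr q) * indicator (ball (act x 0) r) z \<partial>lborel)"
      using r by (simp add: nn_integral_cmult_indicator emeasure_ball_complex)
    also have "\<dots> \<le> (\<integral>\<^sup>+z\<in>ball (act x 0) r. ennreal (1 / cmod (deriv f z) powr q) \<partial>lborel)"
      by (rule nn_integral_mono) (use pt in \<open>auto simp: indicator_def intro!: ennreal_leI\<close>)
    finally show "ennreal (K * orbit_term q f x) \<le>
        weight_integral q f (ball (act x 0) (e / (cmod (sa x))\<^sup>2))"
      by (simp add: r_def a_def weight_integral_def)
  qed
qed

end

lemma (in univalent_map) borel_measurable_weight:
  assumes "B \<in> sets borel" "B \<subseteq> ball 0 1"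
  shows "(\<lambda>z. ennreal (1 / cmod (deriv f z) powr q) * indicator B z) \<in> borel_measurable lborel"
proof -
  have "continuous_on (ball 0 1) (\<lambda>z. 1 / cmod (deriv f z) powr q)"
    using deriv_nonzero
    by (intro continuous_intros holomorphic_on_imp_continuous_on[OF holomorphic_deriv[OF holo]]) auto
  then have c: "continuous_on B (\<lambda>z. 1 / cmod (deriv f z) powr q)"
    using assms(2) by (rule continuous_on_subset)
  have "(\<lambda>z. indicator B z *\<^sub>R (1 / cmod (deriv f z) powr q)) \<in> borel_measurable borel"
    by (rule borel_measurable_continuous_on_indicator[OF assms(1) c])
  then have m: "(\<lambda>z. ennreal (indicator B z *\<^sub>R (1 / cmod (deriv f z) powr q))) \<in> borel_measurable lborel"
    by simp
  have e: "ennreal (indicator B z *\<^sub>R (1 / cmod (deriv f z) powr q)) =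
      ennreal (1 / cmod (deriv f z) powr q) * indicator B z" for z
    by (simp add: indicator_def)
  show ?thesis using m unfolding e .
qed

section \<open>Disjoint balls along the orbit and reduction of crescents\<close>

context discrete_disk_group
begin

text \<open>An overlap produces \<open>g = adj y * x\<close>, different from plus or minus 1, that
  maps a point near 0 to another one. Such a \<open>g\<close> is bounded, and the finitely many
  bounded elements all move 0 by at least \<beta>, by freeness.\<close>

lemma orbit_balls_disjoint:
  obtains e where "0 < e" "e \<le> 1/8"
    "\<And>x y. \<lbrakk>x \<in> G; y \<in> G; x \<noteq> y; x \<noteq> - y\<rbrakk> \<Longrightarrow>
      ball (act x 0) (e / (cmod (sa x))\<^sup>2) \<inter> ball (act y 0) (e / (cmod (sa y))\<^sup>2) = {}"
proof -
  define X where "X = {x \<in> G. sqn x \<le> 3 \<and> x \<noteq> 1 \<and> x \<noteq> - 1}"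
  have fX: "finite X" by (rule finite_subset[OF _ finite_bounded[of 3]]) (auto simp: X_def)
  define \<beta> where "\<beta> = Min (insert 1 ((\<lambda>x. cmod (act x 0)) ` X))"
  have b0: "\<beta> > 0"
    unfolding \<beta>_def using fX free[of _ 0] by (subst Min_gr_iff) (auto simp: X_def)
  have b1: "\<beta> \<le> 1" unfolding \<beta>_def using fX by (intro Min_le) auto
  have bX: "\<beta> \<le> cmod (act x 0)" if "x \<in> X" for x unfolding \<beta>_def using fX that by (intro Min_le) auto
  \<comment> \<open>An overlap would give \<open>\<beta> < 2 * e + 8/3 * e\<close>, which is below
    \<open>8 * e\<close>.\<close>
  define e where "e = \<beta> / 8"
  show thesis
  proof (rule that)
    show e: "0 < e" "e \<le> 1/8" using b0 b1 by (auto simp: e_def)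
    fix x y assume xy: "x \<in> G" "y \<in> G" "x \<noteq> y" "x \<noteq> - y"
    show "ball (act x 0) (e / (cmod (sa x))\<^sup>2) \<inter> ball (act y 0) (e / (cmod (sa y))\<^sup>2) = {}"
    proof (rule ccontr)
      assume "\<not> ?thesis"
      then obtain w where w: "w \<in> ball (act x 0) (e / (cmod (sa x))\<^sup>2)"
        "w \<in> ball (act y 0) (e / (cmod (sa y))\<^sup>2)" by blast
      have pre: "cmod w < 1 \<and> cmod (act (adj v) w) < 2 * e \<and> act v (act (adj v) w) = w"
        if v: "v \<in> G" "w \<in> ball (act v 0) (e / (cmod (sa v))\<^sup>2)" for v
      proof -
        have v0: "cmod (act v 0) < 1" using act_in_disk[OF det[OF v(1)]] by simp
        have "cmod (w - act v 0) < e * (1 - (cmod (act v 0))\<^sup>2)"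
          using v(2) height_act_zero[OF det[OF v(1)]] by (simp add: dist_norm norm_minus_commute)
        note near = near_pdist[OF v0 e(2) this]
        have a: "act v (act (adj v) w) = w" by (rule act_adj(2)[OF det[OF v(1)] near(1)])
        have "cmod (act (adj v) w) < 1" by (rule act_in_disk[OF det[OF inv[OF v(1)]] near(1)])
        then show ?thesis using near pdist_act[OF det[OF v(1)], of 0 "act (adj v) w"] a by simp
      qed
      define u where "u = act (adj x) w"
      define v where "v = act (adj y) w"
      have u: "cmod u < 2 * e" "act x u = w" and v: "cmod v < 2 * e" and w1: "cmod w < 1"
        using pre[OF xy(1) w(1)] pre[OF xy(2) w(2)] by (auto simp: u_def v_def)
      have u1: "cmod u < 1/4" "cmod v < 1/4" using u v e b1 by (auto simp: e_def)
      define g where "g = adj y * x"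
      have gG: "g \<in> G" using mult inv xy by (simp add: g_def)
      have gv: "act g u = v"
        unfolding g_def v_def using act_mult(1)[OF det[OF xy(1)], of u "adj y"] u1 u by simp
      have yg: "y * g = x" unfolding g_def using adj_cancel[OF xy(2)] by (simp add: mult.assoc[symmetric])
      have g1: "g \<noteq> 1" "g \<noteq> - 1" using yg xy by auto
      have "based 0 g = g" by (simp add: based_def to_zero_def sq_eq_iff)
      then have "sqn g \<le> 3" using based_ball_bound[OF gG, of 0 u] u1 gv by simp
      then have "g \<in> X" using gG g1 by (simp add: X_def)
      then have b: "\<beta> \<le> cmod (act g 0)" by (rule bX)
      have a1: "cmod (sa g) \<ge> 1" using su_norms(1)[OF det[OF gG]] .
      have "1 * (3/4) \<le> cmod (sa g) * (1 - cmod u)" using a1 u1 by (intro mult_mono) auto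
      also have "\<dots> \<le> cmod (autom g u)" using autom_lower[OF det[OF gG], of u] u1 by simp
      finally have j: "3/4 \<le> cmod (autom g u)" by simp
      have "3/4 * 1 \<le> cmod (autom g u) * cmod (sa g)" using j a1 by (intro mult_mono) auto
      then have "cmod u / (cmod (autom g u) * cmod (sa g)) \<le> cmod u / (3/4)"
        by (intro divide_left_mono) auto
      also have "cmod u / (cmod (autom g u) * cmod (sa g)) = cmod (v - act g 0)"
        using act_diff[OF det[OF gG], of u 0] u1 gv by (simp add: norm_divide norm_mult act_zero(2))
      finally have "cmod (v - act g 0) \<le> 4/3 * cmod u" by simp
      moreover have "cmod (act g 0) \<le> cmod v + cmod (v - act g 0)"
        using norm_triangle_ineq4[of v "v - act g 0"] by simp
      ultimately have "\<beta> < 2 * e + 4/3 * (2 * e)" using b u(1) v by linarith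
      then show False using b0 by (simp add: e_def)
    qed
  qed
qed

text \<open>The witness is the \<open>n\<close>-th power of \<open>g\<close>, obtained by induction
  over the integers; it acts as the translation by \<open>2 * \<tau> * n\<close> in the Cayley
  coordinate.\<close>

lemma parabolic_powers:
  assumes g: "g \<in> G" "is_parabolic g"
  defines "p \<equiv> fixpoint g" and "\<tau> \<equiv> Im (sa g)"
  shows "\<exists>k\<in>G. k * g = g * k \<and> (\<forall>v. Im v > 0 \<longrightarrow>
    act k (p * (v - \<i>) / (v + \<i>)) = p * (v + of_real (2 * \<tau> * of_int n) - \<i>) / (v + of_real (2 * \<tau> * of_int n) + \<i>))"
proof -
  have p: "cmod p = 1" using parabolic_form(2)[OF g(2)] by (simp add: p_def)
  have nz: "v + \<i> \<noteq> 0" if "Im v > 0" for v using that by (auto simp: complex_eq_iff)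
  have stepg: "act g (p * (v - \<i>) / (v + \<i>)) = p * (v + of_real (2 * \<tau>) - \<i>) / (v + of_real (2 * \<tau>) + \<i>)"
    if "Im v > 0" for v
    unfolding parabolic_form(5)[OF g(2)] p_def[symmetric] \<tau>_def[symmetric]
    using parabolic_cayley[OF p nz[OF that], of \<tau>] nz[of "v + 2 * \<tau>"] that by simp
  have stepi: "act (adj g) (p * (v - \<i>) / (v + \<i>)) = p * (v - of_real (2 * \<tau>) - \<i>) / (v - of_real (2 * \<tau>) + \<i>)"
    if "Im v > 0" for v
  proof -
    define w where "w = p * (v - of_real (2 * \<tau>) - \<i>) / (v - of_real (2 * \<tau>) + \<i>)"
    have "cmod w < 1" unfolding w_def by (rule cayley_inverse_in_disk[OF p]) (use that in simp)
    then have "act (adj g) (act g w) = w" by (rule act_adj(1)[OF det[OF g(1)]])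
    moreover have "act g w = p * (v - \<i>) / (v + \<i>)"
      unfolding w_def using stepg[of "v - of_real (2 * \<tau>)"] that by simp
    ultimately show ?thesis by (simp add: w_def)
  qed
  show ?thesis
  proof (induction n rule: int_induct[where k = 0])
    case base
    then show ?case by (intro bexI[of _ 1]) (auto simp: one)
  next
    case (step1 i)
    then obtain k where k: "k \<in> G" "k * g = g * k" and kv: "\<And>v. Im v > 0 \<Longrightarrow>
      act k (p * (v - \<i>) / (v + \<i>)) = p * (v + of_real (2 * \<tau> * of_int i) - \<i>) / (v + of_real (2 * \<tau> * of_int i) + \<i>)"
      by blast
    show ?case
    proof (intro bexI[of _ "g * k"] conjI allI impI)
      fix v :: complex assume v: "Im v > 0"
      have c: "cmod (p * (v - \<i>) / (v + \<i>)) < 1" by (rule cayley_inverse_in_disk[OF p v])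
      show "act (g * k) (p * (v - \<i>) / (v + \<i>)) =
          p * (v + of_real (2 * \<tau> * of_int (i + 1)) - \<i>) / (v + of_real (2 * \<tau> * of_int (i + 1)) + \<i>)"
        unfolding act_mult(1)[OF det[OF k(1)] c] kv[OF v]
        using stepg[of "v + of_real (2 * \<tau> * of_int i)"] v by (simp add: algebra_simps)
    qed (use k g mult in \<open>auto simp: mult.assoc\<close>)
  next
    case (step2 i)
    then obtain k where k: "k \<in> G" "k * g = g * k" and kv: "\<And>v. Im v > 0 \<Longrightarrow>
      act k (p * (v - \<i>) / (v + \<i>)) = p * (v + of_real (2 * \<tau> * of_int i) - \<i>) / (v + of_real (2 * \<tau> * of_int i) + \<i>)"
      by blast
    show ?case
    proof (intro bexI[of _ "adj g * k"] conjI allI impI)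
      have "adj g * k * g = adj g * g * k" using k(2) by (simp add: mult.assoc)
      also have "\<dots> = g * adj g * k" using adj_cancel[OF g(1)] by simp
      finally show "adj g * k * g = g * (adj g * k)" by (simp add: mult.assoc)
      fix v :: complex assume v: "Im v > 0"
      have c: "cmod (p * (v - \<i>) / (v + \<i>)) < 1" by (rule cayley_inverse_in_disk[OF p v])
      show "act (adj g * k) (p * (v - \<i>) / (v + \<i>)) =
          p * (v + of_real (2 * \<tau> * of_int (i - 1)) - \<i>) / (v + of_real (2 * \<tau> * of_int (i - 1)) + \<i>)"
        unfolding act_mult(1)[OF det[OF k(1)] c] kv[OF v]
        using stepi[of "v + of_real (2 * \<tau> * of_int i)"] v by (simp add: algebra_simps)
    qed (use k g mult inv in auto)
  qed
qed

text \<open>Since \<open>Im v * disp g w = |\<tau>|\<close>, the region between the two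
  displacements is the strip \<open>lo <= Im v <= hi\<close>. A power of \<open>g\<close> brings
  \<open>Re v\<close> to at most \<open>2 * |\<tau>|\<close>, leaving a compact rectangle.\<close>

lemma crescent_cover:
  assumes g: "g \<in> G" "is_parabolic g" and e: "0 < e1" "0 < e2"
  obtains R where "0 \<le> R" "R < 1"
    "\<And>w. \<lbrakk>cmod w < 1; e1 \<le> disp g w; disp g w < e2\<rbrakk> \<Longrightarrow> \<exists>k\<in>G. k * g = g * k \<and> cmod (act k w) \<le> R"
proof -
  define p where "p = fixpoint g"
  define \<tau> where "\<tau> = Im (sa g)"
  have p: "cmod p = 1" and t0: "\<tau> \<noteq> 0"
    using parabolic_form(1,2)[OF g(2)] by (auto simp: p_def \<tau>_def)
  define lo where "lo = \<bar>\<tau>\<bar> / e2"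
  define hi where "hi = \<bar>\<tau>\<bar> / e1"
  have lo: "lo > 0" using t0 e by (simp add: lo_def)
  \<comment> \<open>A lower bound on the rectangle for \<open>4 * Im v' / |v' + \<i>|^2\<close>,
    which equals \<open>1 - |act k w|^2\<close>.\<close>
  define \<kappa> where "\<kappa> = 4 * lo / (2 * \<bar>\<tau>\<bar> + hi + 1)\<^sup>2"
  have hi0: "hi > 0" using t0 e by (simp add: hi_def)
  then have den: "2 * \<bar>\<tau>\<bar> + hi + 1 > 0" by (simp add: add_nonneg_pos)
  have kp: "\<kappa> > 0" using lo den by (simp add: \<kappa>_def)
  define R where "R = sqrt (max 0 (1 - \<kappa>))"
  show thesis
  proof (rule that)
    show "0 \<le> R" "R < 1" using kp by (auto simp: R_def)
    fix w assume w: "cmod w < 1" "e1 \<le> disp g w" "disp g w < e2"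
    have wp: "w \<noteq> p" using w p by auto
    define v where "v = \<i> * (p + w) / (p - w)"
    have h: "1 - (cmod w)\<^sup>2 > 0" using w by (simp add: power_less_one_iff)
    have pw: "(cmod (p - w))\<^sup>2 > 0" using wp by simp
    have "Im v = (1 - (cmod w)\<^sup>2) / (cmod (p - w))\<^sup>2" unfolding v_def by (rule Im_cayley[OF p wp])
    moreover have "disp g w = \<bar>\<tau>\<bar> * (cmod (p - w))\<^sup>2 / (1 - (cmod w)\<^sup>2)"
      using disp_parabolic[OF g(2) w(1)] by (simp add: p_def \<tau>_def norm_minus_commute)
    ultimately have Imv: "Im v * disp g w = \<bar>\<tau>\<bar>" using h pw by simp
    have dg: "disp g w > 0" using w e by linarith
    then have Imv': "Im v = \<bar>\<tau>\<bar> / disp g w" using Imv by (simp add: field_simps)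
    have v1: "Im v \<ge> lo" unfolding Imv' lo_def using w dg e by (intro divide_left_mono) auto
    have v2: "Im v \<le> hi" unfolding Imv' hi_def using w dg e by (intro divide_left_mono) auto
    have v0: "Im v > 0" using v1 lo by linarith
    have wv: "w = p * (v - \<i>) / (v + \<i>)"
    proof -
      have p0: "p \<noteq> 0" "p - w \<noteq> 0" using p wp by auto
      have 1: "v - \<i> = \<i> * (2 * w) / (p - w)" using p0 by (simp add: v_def field_simps)
      have 2: "v + \<i> = \<i> * (2 * p) / (p - w)" using p0 by (simp add: v_def field_simps)
      show ?thesis unfolding 1 2 using p0 by simp
    qed
    define n where "n = - \<lfloor>Re v / (2 * \<tau>)\<rfloor>"
    obtain k where k: "k \<in> G" "k * g = g * k" and kv: "\<And>v. Im v > 0 \<Longrightarrow>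
      act k (p * (v - \<i>) / (v + \<i>)) = p * (v + of_real (2 * \<tau> * of_int n) - \<i>) / (v + of_real (2 * \<tau> * of_int n) + \<i>)"
      using parabolic_powers[OF g, of n] by (auto simp: p_def \<tau>_def)
    define v' where "v' = v + of_real (2 * \<tau> * of_int n)"
    have kw: "act k w = p * (v' - \<i>) / (v' + \<i>)" unfolding wv v'_def by (rule kv[OF v0])
    have Re': "\<bar>Re v'\<bar> \<le> 2 * \<bar>\<tau>\<bar>"
    proof -
      have "Re v' = 2 * \<tau> * frac (Re v / (2 * \<tau>))"
        using t0 by (simp add: v'_def n_def frac_def algebra_simps)
      then have "\<bar>Re v'\<bar> = 2 * \<bar>\<tau>\<bar> * frac (Re v / (2 * \<tau>))" by (simp add: abs_mult)
      also have "\<dots> \<le> 2 * \<bar>\<tau>\<bar> * 1"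
        using frac_lt_1[of "Re v / (2 * \<tau>)"] by (intro mult_left_mono) auto
      finally show ?thesis by simp
    qed
    have Im': "Im v' = Im v" by (simp add: v'_def)
    have "cmod (v' + \<i>) \<le> \<bar>Re (v' + \<i>)\<bar> + \<bar>Im (v' + \<i>)\<bar>" by (rule cmod_le)
    also have "\<dots> \<le> 2 * \<bar>\<tau>\<bar> + hi + 1" using Re' Im' v0 v2 by simp
    finally have c: "cmod (v' + \<i>) \<le> 2 * \<bar>\<tau>\<bar> + hi + 1" .
    have nz: "v' + \<i> \<noteq> 0" using Im' v0 by (auto simp: complex_eq_iff)
    have "(cmod (v' + \<i>))\<^sup>2 - (cmod (v' - \<i>))\<^sup>2 = 4 * Im v'"
      unfolding cmod_power2 by (simp add: power2_eq_square algebra_simps)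
    moreover have "(cmod (act k w))\<^sup>2 = (cmod (v' - \<i>))\<^sup>2 / (cmod (v' + \<i>))\<^sup>2"
      unfolding kw using p by (simp add: norm_divide norm_mult power_divide)
    moreover have "1 - Y / X = (X - Y) / X" if "X \<noteq> 0" for X Y :: real
      using that by (simp add: diff_divide_distrib)
    ultimately have "1 - (cmod (act k w))\<^sup>2 = 4 * Im v / (cmod (v' + \<i>))\<^sup>2"
      using nz Im' by simp
    also have "\<dots> \<ge> 4 * lo / (2 * \<bar>\<tau>\<bar> + hi + 1)\<^sup>2"
      using v1 lo c nz by (intro frac_le power_mono) auto
    finally have "(cmod (act k w))\<^sup>2 \<le> 1 - \<kappa>" by (simp add: \<kappa>_def)
    then have "cmod (act k w) \<le> R" unfolding R_def by (intro real_le_rsqrt) simp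
    then show "\<exists>k\<in>G. k * g = g * k \<and> cmod (act k w) \<le> R" using k by blast
  qed
qed

end

section \<open>Integrals over countable covers\<close>

lemma weight_integral_mono: "B \<subseteq> C \<Longrightarrow> weight_integral q f B \<le> weight_integral q f C"
  unfolding weight_integral_def
  by (intro nn_integral_mono mult_left_mono) (auto simp: indicator_def)

context univalent_map
begin

lemma weight_integral_cover:
  assumes J: "countable J" and B: "\<And>y. y \<in> J \<Longrightarrow> B y \<in> sets borel \<and> B y \<subseteq> ball 0 1"
    and cov: "C \<subseteq> (\<Union>y\<in>J. B y)"
  shows "weight_integral q f C \<le> (\<integral>\<^sup>+y. weight_integral q f (B y) \<partial>count_space J)"
proof -
  define \<phi> where "\<phi> = (\<lambda>z. ennreal (1 / cmod (deriv f z) powr q))"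
  have "weight_integral q f C \<le> (\<integral>\<^sup>+z. (\<integral>\<^sup>+y. \<phi> z * indicator (B y) z \<partial>count_space J) \<partial>lborel)"
    unfolding weight_integral_def
  proof (rule nn_integral_mono)
    fix z
    show "ennreal (1 / cmod (deriv f z) powr q) * indicator C z \<le>
        (\<integral>\<^sup>+y. \<phi> z * indicator (B y) z \<partial>count_space J)"
    proof (cases "z \<in> C")
      case True
      then obtain x where x: "x \<in> J" "z \<in> B x" using cov by auto
      have "\<phi> z = (\<integral>\<^sup>+y. \<phi> z * indicator {x} y \<partial>count_space J)"
        using x by (simp add: nn_integral_cmult_indicator emeasure_count_space)
      also have "\<dots> \<le> (\<integral>\<^sup>+y. \<phi> z * indicator (B y) z \<partial>count_space J)"
        using x by (intro nn_integral_mono mult_left_mono) (auto simp: indicator_def)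
      finally show ?thesis using True by (simp add: \<phi>_def)
    qed simp
  qed
  also have "\<dots> = (\<integral>\<^sup>+y. (\<integral>\<^sup>+z. \<phi> z * indicator (B y) z \<partial>lborel) \<partial>count_space J)"
    unfolding \<phi>_def
    by (rule nn_integral_count_space_nn_integral[OF J]) (use B borel_measurable_weight in blast)
  finally show ?thesis by (simp add: \<phi>_def weight_integral_def)
qed

lemma weight_integral_Un:
  assumes "B \<in> sets borel" "B \<subseteq> ball 0 1" "C \<in> sets borel" "C \<subseteq> ball 0 1"
  shows "weight_integral q f (B \<union> C) \<le> weight_integral q f B + weight_integral q f C"
proof -
  have "weight_integral q f (B \<union> C) \<le> (\<integral>\<^sup>+z. ennreal (1 / cmod (deriv f z) powr q) * indicator B z +
      ennreal (1 / cmod (deriv f z) powr q) * indicator C z \<partial>lborel)"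
    unfolding weight_integral_def by (rule nn_integral_mono) (auto simp: indicator_def)
  also have "\<dots> = weight_integral q f B + weight_integral q f C"
    unfolding weight_integral_def
    by (rule nn_integral_add; rule borel_measurable_weight; fact)
  finally show ?thesis .
qed

end

lemma borel_act_cball:
  assumes "sqdet x = 1" "R < 1"
  shows "act x ` cball 0 R \<in> sets borel" "act x ` cball 0 R \<subseteq> ball 0 1"
proof -
  have "cball (0::complex) R \<subseteq> ball 0 1" using assms(2) by auto
  then have "compact (act x ` cball 0 R)"
    by (intro compact_continuous_image continuous_on_subset[OF act_continuous_on[OF assms(1)]] compact_cball)
  then show "act x ` cball 0 R \<in> sets borel" by (intro borel_closed compact_imp_closed)
  show "act x ` cball 0 R \<subseteq> ball 0 1" using assms act_in_disk[OF assms(1)] by auto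
qed

text \<open>Applied with \<open>k\<close> sending \<open>y\<close> to the conjugate of a fixed
  \<open>g\<close> by \<open>y\<close>; the fibres are then the cosets of the centralizer of
  \<open>g\<close>.\<close>

lemma nn_integral_count_space_fibers:
  fixes u :: "'a \<Rightarrow> ennreal"
  assumes G: "countable G"
  shows "(\<integral>\<^sup>+h. (\<integral>\<^sup>+y. u y \<partial>count_space {y \<in> G. k y = h}) \<partial>count_space (k ` G)) = (\<integral>\<^sup>+y. u y \<partial>count_space G)"
proof -
  have "(\<integral>\<^sup>+y. u y \<partial>count_space {y \<in> G. k y = h}) = (\<integral>\<^sup>+y. u y * indicator {k y} h \<partial>count_space G)" for h
    by (subst (1 2) nn_integral_count_space_indicator)
      (auto intro!: nn_integral_cong simp: indicator_def)
  then have "(\<integral>\<^sup>+h. (\<integral>\<^sup>+y. u y \<partial>count_space {y \<in> G. k y = h}) \<partial>count_space (k ` G)) =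
      (\<integral>\<^sup>+h. (\<integral>\<^sup>+y. u y * indicator {k y} h \<partial>count_space G) \<partial>count_space (k ` G))" by simp
  also have "\<dots> = (\<integral>\<^sup>+y. (\<integral>\<^sup>+h. u y * indicator {k y} h \<partial>count_space (k ` G)) \<partial>count_space G)"
    by (rule nn_integral_count_space_nn_integral[OF G]) simp
  also have "\<dots> = (\<integral>\<^sup>+y. u y \<partial>count_space G)"
    by (intro nn_integral_cong) (simp add: nn_integral_cmult_indicator emeasure_count_space)
  finally show ?thesis .
qed

section \<open>The two inequalities for groups of matrices\<close>

locale koebe_disk_group = koebe_constant + discrete_disk_group
begin

text \<open>Of the conjugation to a Kleinian group only this remains: each \<open>act x\<close>
  corresponds under \<open>f\<close> to some Moebius map of determinant 1 without poles on the
  image.\<close>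

definition equivariant :: "(complex \<Rightarrow> complex) \<Rightarrow> bool" where
  "equivariant f \<longleftrightarrow> (\<forall>x\<in>G. \<exists>a b c d. a * d - b * c = 1 \<and>
     (\<forall>z. cmod z < 1 \<longrightarrow> c * f z + d \<noteq> 0 \<and> f (act x z) = (a * f z + b) / (c * f z + d)))"

text \<open>\<open>X\<close> may contain only one of \<open>x\<close> and \<open>- x\<close>,
  because the two have the same ball; the remaining balls are disjoint.\<close>

lemma sum_le_integral:
  assumes q: "q > 0"
  obtains C where "C > 0"
    "\<And>f X. \<lbrakk>univalent_map f; finite X; X \<subseteq> G; \<And>x. x \<in> X \<Longrightarrow> - x \<notin> X\<rbrakk> \<Longrightarrow>
      (\<Sum>x\<in>X. ennreal (orbit_term q f x)) \<le> ennreal C * weight_integral q f (ball 0 1)"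
proof -
  obtain e where e: "0 < e" "e \<le> 1/8" and disj:
    "\<And>x y. \<lbrakk>x \<in> G; y \<in> G; x \<noteq> y; x \<noteq> - y\<rbrakk> \<Longrightarrow>
      ball (act x 0) (e / (cmod (sa x))\<^sup>2) \<inter> ball (act y 0) (e / (cmod (sa y))\<^sup>2) = {}"
    using orbit_balls_disjoint by metis
  obtain K where K: "K > 0" "\<And>f x. \<lbrakk>univalent_map f; sqdet x = 1\<rbrakk> \<Longrightarrow>
      ennreal (K * orbit_term q f x) \<le> weight_integral q f (ball (act x 0) (e / (cmod (sa x))\<^sup>2))"
    using integral_small_ball[OF e q] by metis
  show thesis
  proof (rule that)
    show "1 / K > 0" using K by simp
    fix f X assume f: "univalent_map f" and X: "finite X" "X \<subseteq> G" "\<And>x. x \<in> X \<Longrightarrow> - x \<notin> X"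
    interpret univalent_map f by fact
    define B where "B = (\<lambda>x. ball (act x 0) (e / (cmod (sa x))\<^sup>2))"
    have Bs: "B x \<subseteq> ball 0 1" if "x \<in> G" for x
    proof
      fix w assume "w \<in> B x"
      then have "cmod (w - act x 0) < e * (1 - (cmod (act x 0))\<^sup>2)"
        using height_act_zero[OF det[OF that]] by (simp add: B_def dist_norm norm_minus_commute)
      then show "w \<in> ball 0 1"
        using near_pdist(1)[OF act_in_disk[OF det[OF that], of 0] e(2)] by simp
    qed
    have D: "B x \<inter> B y = {}" if "x \<in> X" "y \<in> X" "x \<noteq> y" for x y
      unfolding B_def using disj[of x y] that X by blast
    define \<phi> where "\<phi> = (\<lambda>z. ennreal (1 / cmod (deriv f z) powr q))"
    have "(\<Sum>x\<in>X. ennreal (K * orbit_term q f x)) \<le> (\<Sum>x\<in>X. weight_integral q f (B x))"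
      unfolding B_def by (intro sum_mono K(2)[OF f] det) (use X in auto)
    also have "\<dots> = (\<integral>\<^sup>+z. (\<Sum>x\<in>X. \<phi> z * indicator (B x) z) \<partial>lborel)"
      unfolding \<phi>_def weight_integral_def using X Bs
      by (intro nn_integral_sum[symmetric] borel_measurable_weight) (auto simp: B_def)
    also have "\<dots> \<le> weight_integral q f (ball 0 1)"
      unfolding weight_integral_def
    proof (rule nn_integral_mono)
      fix z
      show "(\<Sum>x\<in>X. \<phi> z * indicator (B x) z) \<le> ennreal (1 / cmod (deriv f z) powr q) * indicator (ball 0 1) z"
      proof (cases "\<exists>x\<in>X. z \<in> B x")
        case True
        then obtain x where x: "x \<in> X" "z \<in> B x" by blast
        have "(\<Sum>y\<in>X. \<phi> z * indicator (B y) z) = (\<Sum>y\<in>{x}. \<phi> z * indicator (B y) z)"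
        proof (rule sum.mono_neutral_right)
          show "\<forall>y\<in>X - {x}. \<phi> z * indicator (B y) z = 0"
            using D[OF x(1)] x(2) by (auto simp: indicator_def)
        qed (use x X(1) in auto)
        also have "\<dots> = \<phi> z * indicator (ball 0 1) z"
        proof -
          have "z \<in> ball 0 1" using x Bs X(2) by blast
          then show ?thesis using x by simp
        qed
        finally show ?thesis by (simp add: \<phi>_def)
      next
        case False
        then have "(\<Sum>x\<in>X. \<phi> z * indicator (B x) z) = 0" by (intro sum.neutral) auto
        then show ?thesis by simp
      qed
    qed
    finally have 1: "(\<Sum>x\<in>X. ennreal (K * orbit_term q f x)) \<le> weight_integral q f (ball 0 1)" .
    have "(\<Sum>x\<in>X. ennreal (orbit_term q f x)) = (\<Sum>x\<in>X. ennreal (1 / K) * ennreal (K * orbit_term q f x))"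
      using K(1) by (intro sum.cong refl) (simp add: ennreal_mult'[symmetric])
    also have "\<dots> = ennreal (1 / K) * (\<Sum>x\<in>X. ennreal (K * orbit_term q f x))"
      by (rule sum_distrib_left[symmetric])
    also have "\<dots> \<le> ennreal (1 / K) * weight_integral q f (ball 0 1)"
      using 1 by (rule mult_left_mono) simp
    finally show "(\<Sum>x\<in>X. ennreal (orbit_term q f x)) \<le> ennreal (1 / K) * weight_integral q f (ball 0 1)" .
  qed
qed

lemma parabolic_conjugate:
  assumes "g \<in> G" "is_parabolic g" "y \<in> G"
  shows "y * g * adj y \<in> G" "is_parabolic (y * g * adj y)"
proof -
  show "y * g * adj y \<in> G" using assms mult inv by simp
  have "y * g * adj y \<noteq> 1"
  proof
    assume 1: "y * g * adj y = 1"
    have "g = adj y * (y * g * adj y) * y"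
      using adj_cancel[OF assms(3)] by (metis mult.assoc mult.left_neutral mult.right_neutral)
    then have "g = 1" using 1 adj_cancel[OF assms(3)] by simp
    then show False using assms(2) by (simp add: is_parabolic_def)
  qed
  then show "is_parabolic (y * g * adj y)"
    using assms(2) det[OF assms(3)] Re_sa_conj[OF det[OF assms(3)], of g]
    by (simp add: is_parabolic_def sqdet_mult)
qed

text \<open>For a parabolic element \<open>sqn (g - 1)\<close> is twice \<open>|Im (sa g)|\<close>.
  The gap lets \<open>horodisk_integral_bound\<close> serve all conjugates with one
  constant.\<close>

lemma parabolic_translation_gap:
  obtains \<tau>0 where "\<tau>0 > 0" "\<And>g. \<lbrakk>g \<in> G; is_parabolic g\<rbrakk> \<Longrightarrow> \<bar>Im (sa g)\<bar> \<ge> \<tau>0"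
proof -
  obtain e where e: "e > 0" "\<And>x. x \<in> G \<Longrightarrow> sqn (x - 1) < e \<Longrightarrow> x = 1"
    using discrete by blast
  show thesis
  proof (rule that)
    show "e / 2 > 0" using e by simp
    fix g assume g: "g \<in> G" "is_parabolic g"
    have "sa g - 1 = \<i> * Im (sa g)" using parabolic_form(3)[OF g(2)] by (metis add_diff_cancel_left')
    then have "cmod (sa g - 1) = \<bar>Im (sa g)\<bar>" by (metis norm_ii norm_mult norm_of_real mult_1)
    moreover have "cmod (sb g) = \<bar>Im (sa g)\<bar>"
      using parabolic_form(2)[OF g(2)] by (subst parabolic_form(4)[OF g(2)]) (simp add: norm_mult)
    ultimately have "sqn (g - 1) = 2 * \<bar>Im (sa g)\<bar>" by (simp add: sqn_def)
    moreover have "sqn (g - 1) \<ge> e" using e(2)[OF g(1)] g(2) by (force simp: is_parabolic_def)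
    ultimately show "\<bar>Im (sa g)\<bar> \<ge> e / 2" by simp
  qed
qed

text \<open>Elements of one centralizer coset give the same horodisk, so summing over all
  \<open>y\<close> would count it infinitely often. The sum therefore runs over the distinct
  conjugates \<open>h\<close>, and the crescent of \<open>h\<close> is covered by images of
  \<open>cball 0 R\<close> under exactly those \<open>y\<close> that conjugate \<open>g\<close> to
  \<open>h\<close>. Altogether every \<open>y\<close> is used once.\<close>

lemma cusp_integral_le_sum:
  assumes q: "q > 0" and \<eta>: "\<eta> > 0" and g: "g \<in> G" "is_parabolic g"
  obtains C where "C > 0"
    "\<And>f. \<lbrakk>univalent_map f; equivariant f\<rbrakk> \<Longrightarrow>
      weight_integral q f (\<Union>y\<in>G. {z. cmod z < 1 \<and> disp (y * g * adj y) z < \<eta>}) \<le>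
        ennreal C * (\<integral>\<^sup>+x. ennreal (orbit_term q f x) \<partial>count_space G)"
proof -
  obtain \<tau>0 where \<tau>0: "\<tau>0 > 0" "\<And>g. \<lbrakk>g \<in> G; is_parabolic g\<rbrakk> \<Longrightarrow> \<bar>Im (sa g)\<bar> \<ge> \<tau>0"
    using parabolic_translation_gap by metis
  obtain M \<theta> where M: "M > 0" "\<theta> > 0" and H:
    "\<And>f \<tau> p A' B C D. \<lbrakk>f holomorphic_on ball 0 1; inj_on f (ball 0 1); \<bar>\<tau>\<bar> \<ge> \<tau>0; cmod p = 1;
       A' * D - B * C = 1;
       \<And>z. cmod z < 1 \<Longrightarrow> C * f z + D \<noteq> 0 \<and> f (parabolic \<tau> p z) = (A' * f z + B) / (C * f z + D)\<rbrakk>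
     \<Longrightarrow> weight_integral q f (horodisk \<tau> p \<eta>)
       \<le> ennreal M * weight_integral q f (horodisk \<tau> p \<eta> - horodisk \<tau> p (\<theta> * \<eta>))"
    using horodisk_integral_bound[OF \<eta> \<tau>0(1) q] by metis
  have te: "\<theta> * \<eta> > 0" using M \<eta> by simp
  obtain R where R: "0 \<le> R" "R < 1" and cr: "\<And>w. \<lbrakk>cmod w < 1; \<theta> * \<eta> \<le> disp g w; disp g w < \<eta>\<rbrakk> \<Longrightarrow>
      \<exists>k\<in>G. k * g = g * k \<and> cmod (act k w) \<le> R"
    using crescent_cover[OF g te \<eta>] by metis
  obtain K where K: "K > 0" "\<And>f x. \<lbrakk>univalent_map f; sqdet x = 1\<rbrakk> \<Longrightarrow>
      weight_integral q f (act x ` cball 0 R) \<le> ennreal (K * orbit_term q f x)"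
    using integral_compact_piece[OF R q] by metis
  show thesis
  proof (rule that)
    show "M * K > 0" using M K by simp
    fix f assume f: "univalent_map f" and eq: "equivariant f"
    interpret univalent_map f by fact
    define cj where "cj = (\<lambda>y. y * g * adj y)"
    define hd where "hd = (\<lambda>h. {z. cmod z < 1 \<and> disp h z < \<eta>})"
    define J where "J = (\<lambda>h. {y \<in> G. cj y = h})"
    define S where "S = (\<integral>\<^sup>+x. ennreal (orbit_term q f x) \<partial>count_space G)"
    have cG: "h \<in> G \<and> is_parabolic h" if "h \<in> cj ` G" for h
      using that parabolic_conjugate[OF g] by (auto simp: cj_def)
    have hdh: "hd h = horodisk (Im (sa h)) (fixpoint h) \<eta>" if "h \<in> cj ` G" for h
      unfolding hd_def using horodisk_disp[OF _ \<eta>] cG[OF that] by simp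
    have hb: "hd h \<in> sets borel \<and> hd h \<subseteq> ball 0 1" if "h \<in> cj ` G" for h
    proof -
      have "Im (sa h) \<noteq> 0" "cmod (fixpoint h) = 1" using cG[OF that] parabolic_form by auto
      then show ?thesis
        using hdh[OF that] horodisk_eq_ball[OF _ \<eta>] by (auto simp: hd_def)
    qed
    have piece: "weight_integral q f (hd h) \<le>
        ennreal (M * K) * (\<integral>\<^sup>+y. ennreal (orbit_term q f y) \<partial>count_space (J h))" if h: "h \<in> cj ` G" for h
    proof -
      have hG: "h \<in> G" "is_parabolic h" using cG[OF h] by auto
      obtain y0 where y0: "y0 \<in> G" "h = y0 * g * adj y0" using h by (auto simp: cj_def)
      obtain a b c d where abcd: "a * d - b * c = 1"
        "\<And>z. cmod z < 1 \<Longrightarrow> c * f z + d \<noteq> 0 \<and> f (act h z) = (a * f z + b) / (c * f z + d)"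
        using eq hG(1) unfolding equivariant_def by metis
      have "weight_integral q f (hd h) \<le> ennreal M *
          weight_integral q f (hd h - horodisk (Im (sa h)) (fixpoint h) (\<theta> * \<eta>))"
        unfolding hdh[OF h]
        by (rule H[OF holo inj \<tau>0(2)[OF hG] parabolic_form(2)[OF hG(2)] abcd(1)])
          (use abcd(2) parabolic_form(5)[OF hG(2)] in simp)
      also have "weight_integral q f (hd h - horodisk (Im (sa h)) (fixpoint h) (\<theta> * \<eta>)) \<le>
          (\<integral>\<^sup>+y. weight_integral q f (act y ` cball 0 R) \<partial>count_space (J h))"
      proof (rule weight_integral_cover)
        show "countable (J h)" unfolding J_def using countable_group by (rule countable_subset[rotated]) auto
        show "act y ` cball 0 R \<in> sets borel \<and> act y ` cball 0 R \<subseteq> ball 0 1" if "y \<in> J h" for y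
          using borel_act_cball[OF det R(2)] that by (auto simp: J_def)
        show "hd h - horodisk (Im (sa h)) (fixpoint h) (\<theta> * \<eta>) \<subseteq> (\<Union>y\<in>J h. act y ` cball 0 R)"
        proof
          fix w assume w0: "w \<in> hd h - horodisk (Im (sa h)) (fixpoint h) (\<theta> * \<eta>)"
          then have w: "cmod w < 1" "disp h w < \<eta>" by (auto simp: hd_def)
          have w3: "\<theta> * \<eta> \<le> disp h w"
            using w0 w unfolding horodisk_disp[OF hG(2) te] by simp
          define v where "v = act (adj y0) w"
          have v1: "cmod v < 1" unfolding v_def by (rule act_in_disk[OF det[OF inv[OF y0(1)]] w(1)])
          have yv: "act y0 v = w" unfolding v_def by (rule act_adj(2)[OF det[OF y0(1)] w(1)])
          have "disp h w = disp g v" using disp_conj[OF det[OF y0(1)] v1, of g] by (simp add: y0(2) yv)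
          then have "\<theta> * \<eta> \<le> disp g v" "disp g v < \<eta>" using w w3 by simp_all
          from cr[OF v1 this] obtain k where k: "k \<in> G" "k * g = g * k" "cmod (act k v) \<le> R"
            by blast
          \<comment> \<open>Since \<open>k\<close> commutes with \<open>g\<close>, this
            \<open>y\<close> still conjugates \<open>g\<close> to \<open>h\<close>.\<close>
          define y where "y = y0 * adj k"
          have yG: "y \<in> G" using y0 k mult inv by (simp add: y_def)
          have "adj k * g * k = g"
            using k(2) adj_cancel[OF k(1)] by (metis mult.assoc mult.left_neutral)
          then have "cj y = h" by (simp add: cj_def y_def y0(2) adj_mult) (metis mult.assoc)
          moreover have "act y (act k v) = w"
            unfolding y_def using act_mult(1)[OF det[OF inv[OF k(1)]] act_in_disk[OF det[OF k(1)] v1], of y0]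
              act_adj(1)[OF det[OF k(1)] v1] yv by simp
          ultimately have "y \<in> J h" "w \<in> act y ` cball 0 R"
            using yG k(3) by (auto simp: J_def image_iff intro!: bexI[of _ "act k v"])
          then show "w \<in> (\<Union>y\<in>J h. act y ` cball 0 R)" by blast
        qed
      qed
      also have "\<dots> \<le> (\<integral>\<^sup>+y. ennreal K * ennreal (orbit_term q f y) \<partial>count_space (J h))"
        by (intro nn_integral_mono order_trans[OF K(2)[OF f det]])
          (use K(1) in \<open>auto simp: J_def ennreal_mult'\<close>)
      also have "\<dots> = ennreal K * (\<integral>\<^sup>+y. ennreal (orbit_term q f y) \<partial>count_space (J h))"
        by (simp add: nn_integral_cmult)
      finally show ?thesis using M K by (simp add: mult_left_mono ennreal_mult' mult.assoc)
    qed
    have "(\<Union>y\<in>G. {z. cmod z < 1 \<and> disp (y * g * adj y) z < \<eta>}) = (\<Union>h\<in>cj ` G. hd h)"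
      by (auto simp: cj_def hd_def)
    then have "weight_integral q f (\<Union>y\<in>G. {z. cmod z < 1 \<and> disp (y * g * adj y) z < \<eta>}) \<le>
        (\<integral>\<^sup>+h. weight_integral q f (hd h) \<partial>count_space (cj ` G))"
      using hb countable_group by (intro weight_integral_cover) auto
    also have "\<dots> \<le> (\<integral>\<^sup>+h. ennreal (M * K) * (\<integral>\<^sup>+y. ennreal (orbit_term q f y) \<partial>count_space (J h)) \<partial>count_space (cj ` G))"
      by (intro nn_integral_mono piece) simp
    also have "\<dots> = ennreal (M * K) * (\<integral>\<^sup>+h. (\<integral>\<^sup>+y. ennreal (orbit_term q f y) \<partial>count_space (J h)) \<partial>count_space (cj ` G))"
      by (simp add: nn_integral_cmult)
    also have "\<dots> = ennreal (M * K) * (\<integral>\<^sup>+x. ennreal (orbit_term q f x) \<partial>count_space G)"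
      unfolding J_def by (simp only: nn_integral_count_space_fibers[OF countable_group])
    finally show "weight_integral q f (\<Union>y\<in>G. {z. cmod z < 1 \<and> disp (y * g * adj y) z < \<eta>}) \<le>
        ennreal (M * K) * (\<integral>\<^sup>+x. ennreal (orbit_term q f x) \<partial>count_space G)" .
  qed
qed

text \<open>A point of the Dirichlet domain lies in a fixed compact disk or in one of finitely many
  horodisks. Pulled back by the group these cover the disk, and the constants of the finitely many
  cusps are added to that of the compact disk.\<close>

lemma integral_le_sum:
  assumes q: "q > 0"
    and F: "F \<in> sets borel" "F \<subseteq> ball 0 1" "\<And>z. cmod z < 1 \<Longrightarrow> \<exists>x\<in>G. act x z \<in> F"
    and area: "hyperbolic_area F < \<infinity>"
  obtains C where "C > 0"
    "\<And>f. \<lbrakk>univalent_map f; equivariant f\<rbrakk> \<Longrightarrow> weight_integral q f (ball 0 1) \<le>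
        ennreal C * (\<integral>\<^sup>+x. ennreal (orbit_term q f x) \<partial>count_space G)"
proof -
  obtain R0 where R0: "0 \<le> R0" "R0 < 1" "\<And>z. z \<in> dirichlet \<Longrightarrow> cmod z \<ge> R0 \<Longrightarrow> small_elements z \<noteq> {}"
    using far_points_thin[OF F area] by metis
  obtain r0 P \<eta> where r0: "r0 < 1" and \<eta>: "\<eta> > 0" and P: "finite P" "\<And>g. g \<in> P \<Longrightarrow> g \<in> G \<and> is_parabolic g"
    and cov: "\<And>z. z \<in> dirichlet \<Longrightarrow> cmod z \<le> r0 \<or> (\<exists>g\<in>P. disp g z < \<eta>)"
  proof (rule dirichlet_cover[OF R0])
    fix r P \<eta>
    assume "r < 1" "0 < \<eta>" "finite P" "\<And>g. g \<in> P \<Longrightarrow> g \<in> G \<and> is_parabolic g"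
      "\<And>z. z \<in> dirichlet \<Longrightarrow> cmod z \<le> r \<or> (\<exists>g\<in>P. disp g z < \<eta>)"
    then show thesis by (rule that)
  qed
  define r where "r = max 0 r0"
  have r: "0 \<le> r" "r < 1" using r0 by (auto simp: r_def)
  obtain K where K: "K > 0" "\<And>f x. \<lbrakk>univalent_map f; sqdet x = 1\<rbrakk> \<Longrightarrow>
      weight_integral q f (act x ` cball 0 r) \<le> ennreal (K * orbit_term q f x)"
    using integral_compact_piece[OF r q] by metis
  define U where "U = (\<lambda>g. \<Union>y\<in>G. {z. cmod z < 1 \<and> disp (y * g * adj y) z < \<eta>})"
  have "\<forall>g\<in>P. \<exists>C>0. \<forall>f. univalent_map f \<longrightarrow> equivariant f \<longrightarrow> weight_integral q f (U g) \<le>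
      ennreal C * (\<integral>\<^sup>+x. ennreal (orbit_term q f x) \<partial>count_space G)"
  proof
    fix g assume "g \<in> P"
    then have g: "g \<in> G" "is_parabolic g" using P by auto
    show "\<exists>C>0. \<forall>f. univalent_map f \<longrightarrow> equivariant f \<longrightarrow> weight_integral q f (U g) \<le>
        ennreal C * (\<integral>\<^sup>+x. ennreal (orbit_term q f x) \<partial>count_space G)"
    proof (rule cusp_integral_le_sum[OF q \<eta> g])
      fix C :: real
      assume "C > 0" and "\<And>f. \<lbrakk>univalent_map f; equivariant f\<rbrakk> \<Longrightarrow>
        weight_integral q f (\<Union>y\<in>G. {z. cmod z < 1 \<and> disp (y * g * adj y) z < \<eta>}) \<le>
          ennreal C * (\<integral>\<^sup>+x. ennreal (orbit_term q f x) \<partial>count_space G)"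
      then show ?thesis unfolding U_def by (intro exI[of _ C]) simp
    qed
  qed
  then obtain c where c: "\<And>g. g \<in> P \<Longrightarrow> c g > 0"
    "\<And>g f. \<lbrakk>g \<in> P; univalent_map f; equivariant f\<rbrakk> \<Longrightarrow> weight_integral q f (U g) \<le>
        ennreal (c g) * (\<integral>\<^sup>+x. ennreal (orbit_term q f x) \<partial>count_space G)"
    by metis
  show thesis
  proof (rule that)
    show "K + (\<Sum>g\<in>P. c g) > 0" using K c P by (intro add_pos_nonneg sum_nonneg) (auto simp: less_imp_le)
    fix f assume f: "univalent_map f" and eq: "equivariant f"
    interpret univalent_map f by fact
    define S where "S = (\<integral>\<^sup>+x. ennreal (orbit_term q f x) \<partial>count_space G)"
    have Ub: "U g \<in> sets borel \<and> U g \<subseteq> ball 0 1" if "g \<in> P" for g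
    proof -
      have "{z. cmod z < 1 \<and> disp (y * g * adj y) z < \<eta>} \<in> sets borel" if y: "y \<in> G" for y
      proof -
        have h: "is_parabolic (y * g * adj y)" using parabolic_conjugate P \<open>g \<in> P\<close> y by simp
        then show ?thesis
          using horodisk_disp[OF h \<eta>, symmetric] horodisk_eq_ball[OF _ \<eta>] parabolic_form(1,2)[OF h] by simp
      qed
      then have "U g \<in> sets borel"
        unfolding U_def using countable_group by (intro sets.countable_UN'') auto
      then show ?thesis by (auto simp: U_def)
    qed
    define T where "T = (\<Union>y\<in>G. act y ` cball 0 r)"
    have Tb: "T \<in> sets borel" "T \<subseteq> ball 0 1"
      unfolding T_def using countable_group borel_act_cball[OF det r(2)]
      by (auto intro!: sets.countable_UN'')
    have cover: "ball 0 1 \<subseteq> T \<union> (\<Union>g\<in>P. U g)"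
    proof
      fix z :: complex assume z: "z \<in> ball 0 1"
      then obtain x where x: "x \<in> G" "act x z \<in> dirichlet" using exists_dirichlet[of z] by auto
      have zz: "act (adj x) (act x z) = z" using act_adj(1)[OF det[OF x(1)]] z by simp
      have a1: "cmod (act x z) < 1" using x(2) by (simp add: dirichlet_iff)
      from cov[OF x(2)] show "z \<in> T \<union> (\<Union>g\<in>P. U g)"
      proof
        assume "cmod (act x z) \<le> r0"
        then have "act x z \<in> cball 0 r" by (simp add: r_def)
        then have "z \<in> act (adj x) ` cball 0 r" using zz by (metis image_eqI)
        then show ?thesis using inv[OF x(1)] by (auto simp: T_def)
      next
        assume "\<exists>g\<in>P. disp g (act x z) < \<eta>"
        then obtain g where g: "g \<in> P" "disp g (act x z) < \<eta>" by blast
        have "disp (adj x * g * adj (adj x)) z < \<eta>"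
          using disp_conj[OF det[OF inv[OF x(1)]] a1, of g] zz g(2) by simp
        then have "z \<in> U g" unfolding U_def by (intro UN_I[OF inv[OF x(1)]]) (use z in simp)
        then show ?thesis using g by blast
      qed
    qed
    have "weight_integral q f (ball 0 1) \<le> weight_integral q f (T \<union> (\<Union>g\<in>P. U g))"
      by (rule weight_integral_mono[OF cover])
    also have "\<dots> \<le> weight_integral q f T + weight_integral q f (\<Union>g\<in>P. U g)"
      using Tb Ub P(1) by (intro weight_integral_Un) auto
    also have "\<dots> \<le> ennreal K * S + (\<Sum>g\<in>P. ennreal (c g)) * S"
    proof (rule add_mono)
      have "weight_integral q f T \<le> (\<integral>\<^sup>+y. weight_integral q f (act y ` cball 0 r) \<partial>count_space G)"
        unfolding T_def using borel_act_cball[OF det r(2)] by (intro weight_integral_cover countable_group) auto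
      also have "\<dots> \<le> (\<integral>\<^sup>+y. ennreal K * ennreal (orbit_term q f y) \<partial>count_space G)"
        by (intro nn_integral_mono order_trans[OF K(2)[OF f det]])
          (use K(1) in \<open>auto simp: ennreal_mult'\<close>)
      finally show "weight_integral q f T \<le> ennreal K * S" by (simp add: nn_integral_cmult S_def)
      have "weight_integral q f (\<Union>g\<in>P. U g) \<le> (\<integral>\<^sup>+g. weight_integral q f (U g) \<partial>count_space P)"
        using P(1) Ub by (intro weight_integral_cover countable_finite) auto
      also have "\<dots> = (\<Sum>g\<in>P. weight_integral q f (U g))"
        using P(1) by (simp add: nn_integral_count_space_finite)
      also have "\<dots> \<le> (\<Sum>g\<in>P. ennreal (c g) * S)"
        unfolding S_def by (intro sum_mono c(2)[OF _ f eq])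
      finally show "weight_integral q f (\<Union>g\<in>P. U g) \<le> (\<Sum>g\<in>P. ennreal (c g)) * S"
        by (simp add: sum_distrib_right)
    qed
    also have "\<dots> = (ennreal K + ennreal (\<Sum>g\<in>P. c g)) * S"
      using c(1) by (subst sum_ennreal[symmetric]) (auto simp: distrib_right less_imp_le)
    also have "ennreal K + ennreal (\<Sum>g\<in>P. c g) = ennreal (K + (\<Sum>g\<in>P. c g))"
      using K(1) c(1) by (subst ennreal_plus) (auto intro!: sum_nonneg simp: less_imp_le)
    finally show "weight_integral q f (ball 0 1) \<le> ennreal (K + (\<Sum>g\<in>P. c g)) *
        (\<integral>\<^sup>+x. ennreal (orbit_term q f x) \<partial>count_space G)" by (simp add: S_def)
  qed
qed

end

section \<open>Transfer to Moebius transformations\<close>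

definition mat_of :: "sq \<Rightarrow> complex^2^2" where
  "mat_of x = (\<chi> i j. if i = 1 then (if j = 1 then sa x else sb x)
                     else (if j = 1 then cnj (sb x) else cnj (sa x)))"

lemma mat_of_nth [simp]:
  "mat_of x $ 1 $ 1 = sa x" "mat_of x $ 1 $ 2 = sb x"
  "mat_of x $ 2 $ 1 = cnj (sb x)" "mat_of x $ 2 $ 2 = cnj (sa x)"
  by (simp_all add: mat_of_def)

lemma mat_of_eq_iff: "mat_of x = mat_of y \<longleftrightarrow> x = y"
  by (auto simp: vec_eq_iff forall_2 sq_eq_iff)

lemma mat_of_simps:
  "mat_of (x * y) = mat_of x ** mat_of y" "mat_of 1 = mat 1" "mat_of (- x) = - mat_of x"
  by (simp_all add: vec_eq_iff forall_2 matrix_matrix_mult_def sum_2 mat_def mult.commute add.commute)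

lemma det_mat_of: "det (mat_of x) = of_real (sqdet x)"
  by (simp add: det_2 sqdet_def complex_norm_square of_real_diff del: of_real_power)

lemma mat_of_carrier: "mat_of x \<in> carrier SL2C \<longleftrightarrow> sqdet x = 1"
  by (simp add: SL2C_def det_mat_of)

definition psl :: "sq \<Rightarrow> (complex^2^2) set" where
  "psl x = PSL2C_class (mat_of x)"

lemma moebius_psl: "moebius (psl x) = act x"
  by (rule ext) (simp add: psl_def moebius_PSL2C_class act_def autom_def)

lemma psl_mult:
  assumes "sqdet x = 1" "sqdet y = 1"
  shows "psl (x * y) = psl x \<otimes>\<^bsub>PSL2C\<^esub> psl y"
  unfolding psl_def mat_of_simps using assms by (simp add: mult_PSL2C_class mat_of_carrier)

lemma psl_uminus: "psl (- x) = psl x"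
  by (auto simp: psl_def PSL2C_class_eq mat_of_simps)

lemma one_PSL2C: "\<one>\<^bsub>PSL2C\<^esub> = pm_one"
  by (simp add: PSL2C_def FactGroup_def)

lemma psl_1: "psl 1 = \<one>\<^bsub>PSL2C\<^esub>"
  by (simp add: one_PSL2C psl_def PSL2C_class_eq pm_one_def mat_of_simps)

lemma psl_eq_one_iff: "psl x = \<one>\<^bsub>PSL2C\<^esub> \<longleftrightarrow> x = 1 \<or> x = - 1"
proof
  assume "psl x = \<one>\<^bsub>PSL2C\<^esub>"
  then have "mat_of x \<in> {mat_of 1, mat_of (- 1)}"
    by (auto simp: one_PSL2C psl_def PSL2C_class_eq pm_one_def mat_of_simps)
  then show "x = 1 \<or> x = - 1" by (auto simp: mat_of_eq_iff)
qed (auto simp: psl_1 psl_uminus)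

lemma psl_carrier: "sqdet x = 1 \<Longrightarrow> psl x \<in> carrier PSL2C"
  by (simp add: carrier_PSL2C psl_def mat_of_carrier)

lemma psl_adj:
  assumes "sqdet x = 1"
  shows "psl (adj x) = inv\<^bsub>PSL2C\<^esub> (psl x)"
proof -
  interpret group PSL2C by (rule group_PSL2C)
  have "psl (adj x) \<otimes>\<^bsub>PSL2C\<^esub> psl x = \<one>\<^bsub>PSL2C\<^esub>"
    using psl_mult[of "adj x" x] su_inverse(2)[OF assms] assms by (simp add: psl_1)
  then show ?thesis using psl_carrier assms by (metis inv_equality sqdet_simps(4))
qed

text \<open>A matrix of determinant \<open>1\<close> that maps the disk onto itself preserves the unit circle; the
  equality of moduli there determines the second row.\<close>

lemma disk_preserving_form:
  fixes a b c d :: complex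
  assumes det: "a * d - b * c = 1"
    and pole: "\<And>z. cmod z < 1 \<Longrightarrow> c * z + d \<noteq> 0"
    and onto: "(\<lambda>z. (a * z + b) / (c * z + d)) ` ball 0 1 = ball 0 1"
  shows "c = cnj b" "d = cnj a"
proof -
  have into: "cmod (a * z + b) < cmod (c * z + d)" if "cmod z < 1" for z
  proof -
    have "(a * z + b) / (c * z + d) \<in> (\<lambda>z. (a * z + b) / (c * z + d)) ` ball 0 1"
      using that by (intro imageI) simp
    then have "(a * z + b) / (c * z + d) \<in> ball 0 1" unfolding onto .
    then show ?thesis using pole[OF that] by (simp add: norm_divide field_simps)
  qed
  have "closed {z. cmod (a * z + b) \<le> cmod (c * z + d)}"
    by (intro closed_Collect_le continuous_intros)
  then have "closure (ball 0 1) \<subseteq> {z. cmod (a * z + b) \<le> cmod (c * z + d)}"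
    by (rule closure_minimal[rotated]) (auto intro!: less_imp_le[OF into])
  then have le: "cmod (a * z + b) \<le> cmod (c * z + d)" if "cmod z = 1" for z
    using that by (auto simp: subset_iff)
  \<comment> \<open>A boundary point mapped into the open disk would share its value with an
    interior point, by surjectivity, against injectivity.\<close>
  have eq: "cmod (a * z + b) = cmod (c * z + d)" if z: "cmod z = 1" for z
  proof (rule ccontr)
    assume "\<not> ?thesis"
    then have lt: "cmod (a * z + b) < cmod (c * z + d)" using le[OF z] by simp
    then have nz: "c * z + d \<noteq> 0" by auto
    then have "cmod ((a * z + b) / (c * z + d)) < 1" using lt by (simp add: norm_divide)
    then have "(a * z + b) / (c * z + d) \<in> (\<lambda>z. (a * z + b) / (c * z + d)) ` ball 0 1"
      unfolding onto by simp
    then obtain y where y: "cmod y < 1" "(a * z + b) / (c * z + d) = (a * y + b) / (c * y + d)" by auto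
    then have "(a * z + b) * (c * y + d) = (a * y + b) * (c * z + d)"
      using nz pole[OF y(1)] by (simp add: frac_eq_eq)
    then have "(a * d - b * c) * (z - y) = 0" by (simp add: algebra_simps)
    then show False using det y z by simp
  qed
  have ex: "(cmod (u * z + v))\<^sup>2 = (cmod u)\<^sup>2 * (cmod z)\<^sup>2 + (cmod v)\<^sup>2 + 2 * Re (u * cnj v * z)" for u v z
    unfolding cmod_power2 by (simp add: power2_eq_square algebra_simps)
  \<comment> \<open>On the unit circle both sides are real trigonometric polynomials of degree 1;
    the values at 1, -1 and \<i> determine their coefficients.\<close>
  have e: "(cmod a)\<^sup>2 + (cmod b)\<^sup>2 + 2 * Re (a * cnj b * z) = (cmod c)\<^sup>2 + (cmod d)\<^sup>2 + 2 * Re (c * cnj d * z)"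
    if "cmod z = 1" for z
    using arg_cong[OF eq[OF that], of "\<lambda>t. t\<^sup>2"] unfolding ex that by simp
  have s: "(cmod a)\<^sup>2 + (cmod b)\<^sup>2 = (cmod c)\<^sup>2 + (cmod d)\<^sup>2"
    and r: "Re (a * cnj b) = Re (c * cnj d)"
    using e[of 1] e[of "- 1"] by simp_all
  have i: "Im (a * cnj b) = Im (c * cnj d)"
    using e[of \<i>] s by simp
  have ab: "a * cnj b = c * cnj d" using r i by (simp add: complex_eq_iff)
  then have "cnj (a * cnj b) = cnj (c * cnj d)" by simp
  then have ab': "cnj a * b = cnj c * d" by simp
  \<comment> \<open>The second row turns out to be the conjugate of the first up to this factor,
    \<open>cnj a = k * d\<close> and \<open>cnj b = k * c\<close>; comparing moduli gives
    \<open>k^2 = 1\<close>.\<close>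
  define k where "k = (cmod d)\<^sup>2 - (cmod b)\<^sup>2"
  have k2: "k = (cmod a)\<^sup>2 - (cmod c)\<^sup>2" using s by (simp add: k_def)
  have "cmod b < cmod d" using into[of 0] by simp
  then have k0: "k > 0" by (simp add: k_def power_strict_mono)
  have sq: "of_real ((cmod u)\<^sup>2) = u * cnj u" for u
    by (simp add: complex_norm_square del: of_real_power)
  have "cnj a = cnj a * (a * d - b * c)" using det by simp
  also have "\<dots> = a * cnj a * d - (cnj a * b) * c" by (simp add: algebra_simps)
  also have "\<dots> = of_real k * d" unfolding ab' k2 of_real_diff sq by (simp add: algebra_simps)
  finally have a: "cnj a = of_real k * d" .
  have "cnj b = cnj b * (a * d - b * c)" using det by simp
  also have "\<dots> = (a * cnj b) * d - b * cnj b * c" by (simp add: algebra_simps)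
  also have "\<dots> = of_real k * c" unfolding ab k_def of_real_diff sq by (simp add: algebra_simps)
  finally have b: "cnj b = of_real k * c" .
  have nab: "cmod a = k * cmod d" "cmod b = k * cmod c"
    using arg_cong[OF a, of cmod] arg_cong[OF b, of cmod] k0 by (simp_all add: norm_mult)
  have "(cmod a)\<^sup>2 = k\<^sup>2 * (cmod d)\<^sup>2" "(cmod b)\<^sup>2 = k\<^sup>2 * (cmod c)\<^sup>2"
    unfolding nab by (simp_all add: power_mult_distrib)
  then have 1: "k = k\<^sup>2 * (cmod d)\<^sup>2 - (cmod c)\<^sup>2" and 2: "k = (cmod d)\<^sup>2 - k\<^sup>2 * (cmod c)\<^sup>2"
    using k2 k_def by linarith+
  have "(k\<^sup>2 - 1) * ((cmod d)\<^sup>2 + (cmod c)\<^sup>2) = 0" using 1 2 by (simp add: algebra_simps)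
  moreover have "(cmod d)\<^sup>2 + (cmod c)\<^sup>2 > 0"
    using \<open>cmod b < cmod d\<close> norm_ge_zero[of b] by (intro add_pos_nonneg) (auto simp del: norm_ge_zero)
  ultimately have "k\<^sup>2 = 1" by auto
  then have "k = 1" using k0 by (simp add: power2_eq_1_iff)
  then show "c = cnj b" "d = cnj a" using a b by simp_all
qed

lemma fuchsian_element_form:
  assumes G: "fuchsian_group \<Gamma>" and g: "\<gamma> \<in> \<Gamma>"
  obtains x where "sqdet x = 1" "psl x = \<gamma>"
proof -
  have "\<gamma> \<in> carrier PSL2C"
    using G g unfolding fuchsian_group_def kleinian_group_def by (meson subgroup.mem_carrier)
  then obtain M where M: "det M = 1" "\<gamma> = PSL2C_class M" by (auto simp: carrier_PSL2C SL2C_def)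
  define x where "x = Sq (M$1$1) (M$1$2)"
  have on: "\<And>z. cmod z < 1 \<Longrightarrow> \<not> moebius_pole \<gamma> z" "moebius \<gamma> ` ball 0 1 = ball 0 1"
    using G g by (auto simp: fuchsian_group_def)
  have "moebius \<gamma> = (\<lambda>z. (M$1$1 * z + M$1$2) / (M$2$1 * z + M$2$2))"
    by (rule ext) (simp add: M moebius_PSL2C_class)
  then have "M$2$1 = cnj (M$1$2)" "M$2$2 = cnj (M$1$1)"
    using disk_preserving_form[of "M$1$1" "M$2$2" "M$1$2" "M$2$1"] on M(1)
    by (auto simp: M(2) moebius_pole_PSL2C_class det_2)
  then have "M = mat_of x" by (simp add: vec_eq_iff forall_2 x_def)
  then have "sqdet x = 1 \<and> psl x = \<gamma>" using M det_mat_of[of x] by (simp add: psl_def)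
  then show ?thesis using that by blast
qed

lemma dist_mat_of: "dist (mat_of x) (mat_of y) \<le> 2 * sqn (x - y)"
proof -
  have "dist (mat_of x) (mat_of y) = L2_set (\<lambda>i. L2_set (\<lambda>j. cmod ((mat_of x - mat_of y) $ i $ j)) UNIV) UNIV"
    by (simp add: dist_norm norm_vec_def)
  also have "\<dots> \<le> (\<Sum>i\<in>UNIV. L2_set (\<lambda>j. cmod ((mat_of x - mat_of y) $ i $ j)) UNIV)"
    by (rule L2_set_le_sum) (rule L2_set_nonneg)
  also have "\<dots> \<le> (\<Sum>i\<in>UNIV. \<Sum>j\<in>UNIV. cmod ((mat_of x - mat_of y) $ i $ j))"
    by (intro sum_mono L2_set_le_sum) simp
  also have "\<dots> = 2 * sqn (x - y)"
    by (simp add: sum_2 sqn_def flip: complex_cnj_diff)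
  finally show ?thesis .
qed

lemma fuchsian_disk_group:
  assumes G: "fuchsian_group \<Gamma>" and fr: "acts_freely_on_disk \<Gamma>"
  shows "discrete_disk_group {x. sqdet x = 1 \<and> psl x \<in> \<Gamma>}"
proof
  interpret P: group PSL2C by (rule group_PSL2C)
  have sub: "subgroup \<Gamma> PSL2C" and disc: "subtopology PSL2C_topology \<Gamma> = discrete_topology \<Gamma>"
    using G by (auto simp: fuchsian_group_def kleinian_group_def)
  let ?G = "{x. sqdet x = 1 \<and> psl x \<in> \<Gamma>}"
  show "sqdet x = 1" if "x \<in> ?G" for x using that by simp
  show "1 \<in> ?G" using subgroup.one_closed[OF sub] by (simp add: psl_1)
  show "x * y \<in> ?G" if "x \<in> ?G" "y \<in> ?G" for x y
    using that subgroup.m_closed[OF sub] by (simp add: psl_mult sqdet_mult)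
  show "adj x \<in> ?G" if "x \<in> ?G" for x
    using that subgroup.m_inv_closed[OF sub] by (simp add: psl_adj)
  show "- x \<in> ?G" if "x \<in> ?G" for x using that by (simp add: psl_uminus)
  show "x = 1 \<or> x = - 1" if "x \<in> ?G" "cmod z < 1" "act x z = z" for x z
    using that fr unfolding acts_freely_on_disk_def psl_eq_one_iff[symmetric]
    by (auto simp: moebius_psl[symmetric])
  show "\<exists>e>0. \<forall>x\<in>?G. sqn (x - 1) < e \<longrightarrow> x = 1"
  proof -
    have "openin (subtopology PSL2C_topology \<Gamma>) {\<one>\<^bsub>PSL2C\<^esub>}"
      unfolding disc using subgroup.one_closed[OF sub] by simp
    then obtain U where U: "openin PSL2C_topology U" "{\<one>\<^bsub>PSL2C\<^esub>} = U \<inter> \<Gamma>"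
      by (auto simp: openin_subtopology)
    define V where "V = {A \<in> carrier SL2C. PSL2C_class A \<in> U}"
    have "openin (top_of_set (carrier SL2C)) V"
      using U(1) unfolding openin_PSL2C_topology SL2C_topology_def V_def by blast
    moreover have "mat_of 1 \<in> V"
      using U(2) psl_1 mat_of_carrier[of 1] by (auto simp: V_def psl_def)
    ultimately obtain e where e: "e > 0" "ball (mat_of 1) e \<inter> carrier SL2C \<subseteq> V"
      unfolding openin_contains_ball by blast
    \<comment> \<open>\<open>e / 2\<close> absorbs the factor 2 in \<open>dist_mat_of\<close>; the
      bound 1 excludes \<open>x = - 1\<close>, which lies at distance 2 from 1.\<close>
    show ?thesis
    proof (intro exI[of _ "min 1 (e / 2)"] conjI ballI impI)
      show "min 1 (e / 2) > 0" using e by simp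
      fix x assume x: "x \<in> ?G" "sqn (x - 1) < min 1 (e / 2)"
      have "dist (mat_of 1) (mat_of x) < e"
        using dist_mat_of[of x 1] x(2) by (simp add: dist_commute)
      then have "mat_of x \<in> V" using e(2) x(1) mat_of_carrier by auto
      then have "psl x \<in> U \<inter> \<Gamma>" using x(1) by (simp add: V_def psl_def)
      then have "psl x = \<one>\<^bsub>PSL2C\<^esub>" using U(2) by blast
      then have "x = 1 \<or> x = - 1" by (simp add: psl_eq_one_iff)
      moreover have "x \<noteq> - 1"
      proof
        assume "x = - 1"
        then have "x - 1 = sreal (- 2)" by (simp add: sq_eq_iff)
        then show False using x(2) by simp
      qed
      ultimately show "x = 1" by blast
    qed
  qed
qed

section \<open>From sums over matrices to the sum over the Fuchsian group\<close>

lemma nn_integral_count_space_le: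
  fixes u :: "'a \<Rightarrow> ennreal"
  assumes I: "countable I" and fin: "\<And>X. finite X \<Longrightarrow> X \<subseteq> I \<Longrightarrow> sum u X \<le> S"
  shows "(\<integral>\<^sup>+x. u x \<partial>count_space I) \<le> S"
proof (cases "finite I")
  case True
  then show ?thesis using fin[of I] by (simp add: nn_integral_count_space_finite)
next
  case False
  note b = bij_betw_from_nat_into[OF I False]
  have "(\<integral>\<^sup>+x. u x \<partial>count_space I) = (\<Sum>n. u (from_nat_into I n))"
    by (simp add: nn_integral_bij_count_space[symmetric, OF b] nn_integral_count_space_nat)
  also have "\<dots> = (SUP n. \<Sum>i<n. u (from_nat_into I i))" by (rule suminf_eq_SUP)
  also have "\<dots> \<le> S"
  proof (rule SUP_least)
    fix n
    have inj: "inj_on (from_nat_into I) {..<n}"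
      using b by (meson bij_betw_imp_inj_on inj_on_subset subset_UNIV)
    have "(\<Sum>i<n. u (from_nat_into I i)) = sum u (from_nat_into I ` {..<n})"
      by (simp add: sum.reindex[OF inj])
    also have "\<dots> \<le> S"
      using b by (intro fin) (auto dest: bij_betwE)
    finally show "(\<Sum>i<n. u (from_nat_into I i)) \<le> S" .
  qed
  finally show ?thesis .
qed

lemma psl_eq_imp:
  assumes "psl x = psl y"
  shows "x = y \<or> x = - y"
proof -
  have "mat_of x \<in> {mat_of y, mat_of (- y)}"
    using assms unfolding psl_def PSL2C_class_eq mat_of_simps by blast
  then show ?thesis by (auto simp: mat_of_eq_iff)
qed

lemma PSL2C_moebius_form:
  assumes "P \<in> carrier PSL2C"
  shows "\<exists>a b c d. a * d - b * c = 1 \<and> moebius P = (\<lambda>z. (a * z + b) / (c * z + d)) \<and>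
    (\<forall>z. moebius_pole P z \<longleftrightarrow> c * z + d = 0)"
proof -
  obtain M where M: "det M = 1" "P = PSL2C_class M"
    using assms by (auto simp: carrier_PSL2C SL2C_def)
  show ?thesis
    by (rule exI[of _ "M$1$1"], rule exI[of _ "M$1$2"], rule exI[of _ "M$2$1"], rule exI[of _ "M$2$2"])
      (use M in \<open>auto simp: det_2 moebius_PSL2C_class moebius_pole_PSL2C_class\<close>)
qed

lemma orbit_term_eq:
  assumes f: "univalent_map f" "f 0 = 0" "deriv f 0 = 1" and x: "sqdet x = 1"
    and P: "a' * d' - b' * c' = 1" "moebius P = (\<lambda>z. (a' * z + b') / (c' * z + d'))"
    and conj: "\<And>z. cmod z < 1 \<Longrightarrow> c' * f z + d' \<noteq> 0 \<and> f (act x z) = (a' * f z + b') / (c' * f z + d')"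
  shows "cmod (deriv (moebius (psl x)) 0) powr (q + 2) / cmod (deriv (moebius P) 0) powr q =
    orbit_term q f x"
proof -
  interpret univalent_map f by fact
  define a where "a = cmod (sa x)"
  have a: "a \<ge> 1" using su_norms(1)[OF x] by (simp add: a_def)
  define d where "d = cmod (deriv f (act x 0))"
  have d: "d > 0" using deriv_nonzero[OF act_in_disk[OF x]] by (simp add: d_def)
  \<comment> \<open>As \<open>f 0 = 0\<close>, the absence of a pole on the image says that the
    image transformation is finite at 0, so its derivative there is the true one.\<close>
  have nz: "d' \<noteq> 0" using conj[of 0] f(2) by simp
  have "deriv (act x) 0 = 1 / (cnj (sa x))\<^sup>2"
    using act_has_derivative[OF x, of 0] by (simp add: DERIV_imp_deriv act_zero(2))
  then have 1: "cmod (deriv (moebius (psl x)) 0) = 1 / a\<^sup>2"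
    by (simp add: moebius_psl norm_divide norm_power a_def)
  define m where "m = moebius P"
  have "(m has_field_derivative (a' * (c' * 0 + d') - (a' * 0 + b') * c') /
      ((c' * 0 + d') * (c' * 0 + d'))) (at 0)"
    unfolding m_def P(2) using nz by (auto intro!: derivative_eq_intros)
  then have dm: "(m has_field_derivative 1 / d'\<^sup>2) (at 0)"
    using P(1) by (simp add: power2_eq_square)
  have df: "(f has_field_derivative 1) (at 0)"
    using holomorphic_derivI[OF holo open_ball, of 0] f(3) by simp
  have "((\<lambda>z. m (f z)) has_field_derivative 1 / d'\<^sup>2 * 1) (at 0)"
    by (rule DERIV_chain'[OF df]) (use dm f(2) in simp)
  then have "deriv (\<lambda>z. m (f z)) 0 = 1 / d'\<^sup>2" by (simp add: DERIV_imp_deriv)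
  moreover have "deriv (\<lambda>z. m (f z)) 0 = deriv (\<lambda>z. f (act x z)) 0"
    by (rule deriv_cong_ev[OF eventually_mono[OF eventually_nhds_in_open[of "ball 0 1" 0]] refl])
      (use conj in \<open>auto simp: m_def P(2)\<close>)
  ultimately have "deriv m 0 = deriv f (act x 0) / (cnj (sa x))\<^sup>2"
    using dm deriv_comp_act[OF x, of 0] by (simp add: DERIV_imp_deriv act_zero(2))
  then have 2: "cmod (deriv (moebius P) 0) = d * (1 / a\<^sup>2)"
    by (simp add: m_def[symmetric] norm_divide norm_power d_def a_def)
  have p: "(1 / a\<^sup>2) powr q > 0" using a by simp
  have "(1 / a\<^sup>2) powr (q + 2) = (1 / a\<^sup>2) powr q * (1 / a\<^sup>2)\<^sup>2"
    using a by (simp add: powr_add powr_numeral)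
  moreover have "(d * (1 / a\<^sup>2)) powr q = d powr q * (1 / a\<^sup>2) powr q"
    by (rule powr_mult)
  ultimately have "(1 / a\<^sup>2) powr (q + 2) / (d * (1 / a\<^sup>2)) powr q = (1 / a\<^sup>2)\<^sup>2 / d powr q"
    using p by simp
  then show ?thesis
    unfolding 1 2 orbit_term_def a_def[symmetric] d_def[symmetric]
    by (simp add: power_divide flip: power_mult)
qed

theorem theorem2:
  fixes \<Gamma> :: "(complex^2^2) set set" and q :: real
  assumes "fuchsian_group \<Gamma>" and "finite_area_hyperbolic_surface \<Gamma>" and "q > 0"
  shows "\<exists>C>0. \<forall>(f :: complex \<Rightarrow> complex) \<Omega> \<rho>.
    open \<Omega> \<and> connected \<Omega> \<and> conformal_map f unit_disk \<Omega> \<and> f 0 = 0 \<and> deriv f 0 = 1 \<and>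
    conjugates_to_kleinian f \<Omega> \<Gamma> \<rho> \<longrightarrow>
    (let S = (\<Sum>\<^sub>\<infinity>\<gamma>\<in>\<Gamma>. ennreal (cmod (deriv (moebius \<gamma>) 0) powr (q + 2)
                                / cmod (deriv (moebius (\<rho> \<gamma>)) 0) powr q));
         I = (\<integral>\<^sup>+z\<in>unit_disk. ennreal (1 / cmod (deriv f z) powr q) \<partial>lborel)
     in ennreal (1 / C) * S \<le> I \<and> I \<le> ennreal C * S)"
proof -
  obtain F where free: "acts_freely_on_disk \<Gamma>" and F: "fundamental_set \<Gamma> F" "hyperbolic_area F < \<infinity>"
    using assms(2) by (auto simp: finite_area_hyperbolic_surface_def)
  obtain A where A: "koebe_constant A" using koebe_constant_exists by blast
  define G where "G = {x. sqdet x = 1 \<and> psl x \<in> \<Gamma>}"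
  interpret koebe_disk_group A G
    unfolding G_def koebe_disk_group_def using A fuchsian_disk_group[OF assms(1) free] by blast
  have Fc: "\<exists>x\<in>G. act x z \<in> F" if "cmod z < 1" for z
  proof -
    have "\<exists>w. w \<in> F \<and> (\<exists>g\<in>\<Gamma>. w = moebius g z)"
      using F(1) that unfolding fundamental_set_def by (metis mem_ball_0)
    then obtain g where g: "g \<in> \<Gamma>" "moebius g z \<in> F" by blast
    obtain x where "sqdet x = 1" "psl x = g" using fuchsian_element_form[OF assms(1) g(1)] .
    then show ?thesis using g by (intro bexI[of _ x]) (auto simp: G_def moebius_psl[symmetric])
  qed
  have Fb: "F \<in> sets borel" "F \<subseteq> ball 0 1" using F(1) by (auto simp: fundamental_set_def)
  obtain C1 where C1: "C1 > 0"
    "\<And>f X. \<lbrakk>univalent_map f; finite X; X \<subseteq> G; \<And>x. x \<in> X \<Longrightarrow> - x \<notin> X\<rbrakk> \<Longrightarrow>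
      (\<Sum>x\<in>X. ennreal (orbit_term q f x)) \<le> ennreal C1 * weight_integral q f (ball 0 1)"
    using sum_le_integral[OF assms(3)] by metis
  obtain C2 where C2: "C2 > 0"
    "\<And>f. \<lbrakk>univalent_map f; equivariant f\<rbrakk> \<Longrightarrow> weight_integral q f (ball 0 1) \<le>
        ennreal C2 * (\<integral>\<^sup>+x. ennreal (orbit_term q f x) \<partial>count_space G)"
    using integral_le_sum[OF assms(3) Fb Fc F(2)] by metis
  \<comment> \<open>The upper bound carries the factor 2 because two matrices represent each group
    element; the lower bound uses one representative per element.\<close>
  define C where "C = max C1 (2 * C2)"
  have C: "C > 0" "C1 \<le> C" "2 * C2 \<le> C" using C1(1) by (auto simp: C_def)
  show ?thesis
  proof (intro exI[of _ C] conjI allI impI)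
    show "C > 0" by (rule C)
    fix f :: "complex \<Rightarrow> complex" and \<Omega> \<rho>
    assume "open \<Omega> \<and> connected \<Omega> \<and> conformal_map f unit_disk \<Omega> \<and> f 0 = 0 \<and> deriv f 0 = 1 \<and>
      conjugates_to_kleinian f \<Omega> \<Gamma> \<rho>"
    then have cf: "conformal_map f unit_disk \<Omega>" and f0: "f 0 = 0" "deriv f 0 = 1"
      and cj: "conjugates_to_kleinian f \<Omega> \<Gamma> \<rho>" by auto
    have inj: "inj_on f (ball 0 1)" and im: "f ` ball 0 1 = \<Omega>"
      using cf by (auto simp: conformal_map_def bij_betw_def)
    have f: "univalent_map f"
      using cf inj by (simp add: univalent_map_def conformal_map_def)
    have form: "\<exists>a b c d. a * d - b * c = 1 \<and> moebius (\<rho> (psl x)) = (\<lambda>z. (a * z + b) / (c * z + d)) \<and>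
        (\<forall>z. cmod z < 1 \<longrightarrow> c * f z + d \<noteq> 0 \<and> f (act x z) = (a * f z + b) / (c * f z + d))"
      if x: "x \<in> G" for x
    proof -
      have g: "psl x \<in> \<Gamma>" using x by (simp add: G_def)
      then have "\<rho> (psl x) \<in> carrier PSL2C" using cj by (simp add: conjugates_to_kleinian_def)
      then obtain a b c d where abcd: "a * d - b * c = 1"
        "moebius (\<rho> (psl x)) = (\<lambda>z. (a * z + b) / (c * z + d))"
        "\<forall>z. moebius_pole (\<rho> (psl x)) z \<longleftrightarrow> c * z + d = 0"
        using PSL2C_moebius_form by blast
      have "c * f z + d \<noteq> 0 \<and> f (act x z) = (a * f z + b) / (c * f z + d)" if z: "cmod z < 1" for z
      proof -
        have "f z \<in> \<Omega>" using im z by auto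
        then have "\<not> moebius_pole (\<rho> (psl x)) (f z)"
          "f (moebius (psl x) (inv_into unit_disk f (f z))) = moebius (\<rho> (psl x)) (f z)"
          using cj g by (auto simp: conjugates_to_kleinian_def)
        moreover have "inv_into unit_disk f (f z) = z" using inj z by simp
        ultimately show ?thesis using abcd(3) by (simp add: abcd(2) moebius_psl)
      qed
      then show ?thesis using abcd(1,2) by blast
    qed
    have eqv: "equivariant f"
      unfolding equivariant_def using form by blast
    define u where "u = (\<lambda>\<gamma>. ennreal (cmod (deriv (moebius \<gamma>) 0) powr (q + 2)
        / cmod (deriv (moebius (\<rho> \<gamma>)) 0) powr q))"
    have ux: "u (psl x) = ennreal (orbit_term q f x)" if "x \<in> G" for x
    proof -
      obtain a b c d where "a * d - b * c = 1" "moebius (\<rho> (psl x)) = (\<lambda>z. (a * z + b) / (c * z + d))"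
        "\<And>z. cmod z < 1 \<Longrightarrow> c * f z + d \<noteq> 0 \<and> f (act x z) = (a * f z + b) / (c * f z + d)"
        using form[OF \<open>x \<in> G\<close>] by blast
      from orbit_term_eq[OF f f0 det[OF \<open>x \<in> G\<close>] this, of q]
      show ?thesis unfolding u_def by simp
    qed
    define S where "S = infsum u \<Gamma>"
    define I where "I = weight_integral q f (ball 0 1)"
    have S: "S = (SUP X\<in>{X. finite X \<and> X \<subseteq> \<Gamma>}. sum u X)"
      unfolding S_def by (rule nonneg_infsum_complete) simp
    have SX: "sum u X \<le> S" if "finite X" "X \<subseteq> \<Gamma>" for X
      unfolding S using that by (intro SUP_upper) auto
    have "\<forall>\<gamma>\<in>\<Gamma>. \<exists>x. x \<in> G \<and> psl x = \<gamma>"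
      using fuchsian_element_form[OF assms(1)] by (metis (mono_tags, lifting) G_def mem_Collect_eq)
    then obtain r where r: "\<And>\<gamma>. \<gamma> \<in> \<Gamma> \<Longrightarrow> r \<gamma> \<in> G" "\<And>\<gamma>. \<gamma> \<in> \<Gamma> \<Longrightarrow> psl (r \<gamma>) = \<gamma>" by metis
    have lower: "S \<le> ennreal C1 * I"
      unfolding S
    proof (rule SUP_least)
      fix Y assume "Y \<in> {X. finite X \<and> X \<subseteq> \<Gamma>}"
      then have Y: "finite Y" "Y \<subseteq> \<Gamma>" by auto
      have injr: "inj_on r Y" using r(2) Y(2) by (metis inj_on_inverseI subsetD)
      \<comment> \<open>A choice of representatives never contains both signs: \<open>x\<close> and
        \<open>- x\<close> represent the same group element, so both would be its one chosen matrix,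
        forcing \<open>x = 0\<close>.\<close>
      have neg: "- x \<notin> r ` Y" if x: "x \<in> r ` Y" for x
      proof
        assume "- x \<in> r ` Y"
        then obtain b c where bc: "b \<in> Y" "c \<in> Y" "x = r b" "- x = r c" using x by auto
        then have "psl (- x) = c" "psl x = b" using r(2) Y(2) by auto
        then have "b = c" by (simp add: psl_uminus)
        then have "x = - x" using bc by simp
        then have "x = 0" by (simp add: sq_eq_iff)
        moreover have "x \<in> G" using r(1) bc(1,3) Y(2) by auto
        ultimately show False using det[of x] by simp
      qed
      have "sum u Y = (\<Sum>\<gamma>\<in>Y. ennreal (orbit_term q f (r \<gamma>)))"
        using ux[OF r(1)] r(2) Y(2) by (intro sum.cong refl) (metis subsetD)
      also have "\<dots> = (\<Sum>x\<in>r ` Y. ennreal (orbit_term q f x))"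
        by (simp add: sum.reindex[OF injr])
      also have "\<dots> \<le> ennreal C1 * I"
        unfolding I_def by (rule C1(2)[OF f _ _ neg]) (use Y r in auto)
      finally show "sum u Y \<le> ennreal C1 * I" .
    qed
    have upper: "(\<integral>\<^sup>+x. ennreal (orbit_term q f x) \<partial>count_space G) \<le> 2 * S"
    proof (rule nn_integral_count_space_le[OF countable_group])
      fix X assume X: "finite X" "X \<subseteq> G"
      have "(\<Sum>x\<in>X. ennreal (orbit_term q f x)) = (\<Sum>x\<in>X. u (psl x))"
        using ux X(2) by (intro sum.cong refl) (metis subsetD)
      also have "\<dots> = (\<Sum>\<gamma>\<in>psl ` X. \<Sum>x\<in>{x \<in> X. psl x = \<gamma>}. u (psl x))"
        by (rule sum.image_gen[OF X(1)])
      also have "\<dots> \<le> (\<Sum>\<gamma>\<in>psl ` X. 2 * u \<gamma>)"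
      proof (rule sum_mono)
        fix \<gamma> assume "\<gamma> \<in> psl ` X"
        then obtain y where y: "psl y = \<gamma>" by auto
        \<comment> \<open>Only the two signs of a matrix have the same class, which is the origin of
          the factor 2.\<close>
        have "{x \<in> X. psl x = \<gamma>} \<subseteq> {y, - y}" using psl_eq_imp y by auto
        then have "card {x \<in> X. psl x = \<gamma>} \<le> card {y, - y}" by (intro card_mono) auto
        also have "\<dots> \<le> 2" by (simp add: card_insert_if)
        finally have c: "card {x \<in> X. psl x = \<gamma>} \<le> 2" .
        have "(\<Sum>x\<in>{x \<in> X. psl x = \<gamma>}. u (psl x)) = of_nat (card {x \<in> X. psl x = \<gamma>}) * u \<gamma>" by simp
        also have "\<dots> \<le> of_nat 2 * u \<gamma>" using c by (intro mult_right_mono) (auto simp del: of_nat_numeral)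
        finally show "(\<Sum>x\<in>{x \<in> X. psl x = \<gamma>}. u (psl x)) \<le> 2 * u \<gamma>" by simp
      qed
      also have "\<dots> = 2 * sum u (psl ` X)" by (rule sum_distrib_left[symmetric])
      also have "\<dots> \<le> 2 * S" using X by (intro mult_left_mono SX) (auto simp: G_def)
      finally show "(\<Sum>x\<in>X. ennreal (orbit_term q f x)) \<le> 2 * S" .
    qed
    have "ennreal (1 / C) * S \<le> ennreal (1 / C) * (ennreal C1 * I)"
      using lower by (rule mult_left_mono) simp
    also have "\<dots> = ennreal (C1 / C) * I"
      using C C1(1) by (simp add: ennreal_mult'[symmetric] mult.assoc[symmetric])
    also have "\<dots> \<le> ennreal 1 * I"
      using C by (intro mult_right_mono ennreal_leI) auto
    finally have 1: "ennreal (1 / C) * S \<le> I" by simp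
    have "I \<le> ennreal C2 * (2 * S)"
      unfolding I_def by (rule order_trans[OF C2(2)[OF f eqv] mult_left_mono[OF upper]]) simp
    also have "\<dots> = ennreal (2 * C2) * S"
      using C2(1) by (simp add: ennreal_mult' mult_ac)
    also have "\<dots> \<le> ennreal C * S"
      using C by (intro mult_right_mono ennreal_leI) auto
    finally have 2: "I \<le> ennreal C * S" .
    show "let S = (\<Sum>\<^sub>\<infinity>\<gamma>\<in>\<Gamma>. ennreal (cmod (deriv (moebius \<gamma>) 0) powr (q + 2)
                                / cmod (deriv (moebius (\<rho> \<gamma>)) 0) powr q));
         I = (\<integral>\<^sup>+z\<in>unit_disk. ennreal (1 / cmod (deriv f z) powr q) \<partial>lborel)
     in ennreal (1 / C) * S \<le> I \<and> I \<le> ennreal C * S"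
      using 1 2 unfolding S_def I_def u_def weight_integral_def Let_def by blast
  qed
qed

end
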